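(* Let $\Gamma=\operatorname{HNN}(G,H,\theta)$ be a non-ascending HNN extension with quasi-kernels $K_{-1}$ and $K_1$. If $\ker\Gamma$ is trivial, then $\Gamma$ is $C^*$-simple if and only if $K_{-1}$ and $K_1$ are each either trivial or non-amenable. If $K_{-1}$ and $K_1$ are amenable, then $\Gamma$ is $C^*$-simple if and only if $K_{-1}$ and $K_1$ are trivial.
   Context: Let $G$ be a group, $H\le G$, $\theta:H\to G$ injective homomorphism; $\Gamma=\operatorname{HNN}(G,H,\theta)=\langle G,\tau\mid \tau^{-1}h\tau=\theta(h)\ (h\in H)\rangle$; non-ascending means $H\neq G$ and $\theta(H)\neq G$. Set $H_{-1}=H$, $H_1=\theta(H)$; fix left coset representative sets $S_{-1},S_1$ of $H_{-1},H_1$ in $G$ containing $1$. Every $g\in\Gamma$ has a unique normal form $g=g_1\tau^{\varepsilon_1}\cdots g_n\tau^{\varepsilon_n}g_{n+1}$ ($n\ge0$, $g_i\in S_{-\varepsilon_i}$, $g_{n+1}\in G$, $g_i=1\Rightarrow\varepsilon_{i-1}=\varepsilon_i$); for $n\ge1$, $\varepsilon_1$ is the type and $g_1$ the initial letter. $T_\varepsilon$: elements of length $\ge1$ and type $\varepsilon$; $T_\varepsilon^\dagger$: those in $T_\varepsilon$ with initial letter $1$. Kernel $\ker\Gamma=\bigcap_{r\in\Gamma}rHr^{-1}$; quasi-kernels $K_\varepsilon=\bigcap_{r\in\Gamma\setminus T_\varepsilon^\dagger}rHr^{-1}$. $C^*$-simple: reduced group $C^*$-algebra simple. *)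

theory Defs
  imports "HOL-Analysis.Analysis" "HOL-Algebra.Coset" "HOL-Algebra.Generated_Groups"
begin

text \<open>Gm is an HNN extension of G relative to the subgroup H and the injective
  homomorphism theta, with canonical map iota from G and stable letter tau:
  Gm is generated by iota(G) and tau, the defining relations hold, and every
  assignment into a group satisfying the relations extends to a homomorphism.
  The test groups range over groups with elements of type ('a * int) list,
  which is large enough to contain a copy of the HNN extension.\<close>

definition is_HNN ::
  "'a monoid \<Rightarrow> 'a set \<Rightarrow> ('a \<Rightarrow> 'a) \<Rightarrow> 'b monoid \<Rightarrow> ('a \<Rightarrow> 'b) \<Rightarrow> 'b \<Rightarrow> bool" where
  "is_HNN G H \<theta> Gm \<iota> \<tau> \<longleftrightarrow>
     group Gm \<and> \<iota> \<in> hom G Gm \<and> \<tau> \<in> carrier Gm \<and>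
     (\<forall>h\<in>H. inv\<^bsub>Gm\<^esub> \<tau> \<otimes>\<^bsub>Gm\<^esub> \<iota> h \<otimes>\<^bsub>Gm\<^esub> \<tau> = \<iota> (\<theta> h)) \<and>
     carrier Gm = generate Gm (\<iota> ` carrier G \<union> {\<tau>}) \<and>
     (\<forall>(L :: ('a \<times> int) list monoid) \<phi> t.
        group L \<and> \<phi> \<in> hom G L \<and> t \<in> carrier L \<and>
        (\<forall>h\<in>H. inv\<^bsub>L\<^esub> t \<otimes>\<^bsub>L\<^esub> \<phi> h \<otimes>\<^bsub>L\<^esub> t = \<phi> (\<theta> h))
        \<longrightarrow> (\<exists>\<psi>\<in>hom Gm L. (\<forall>g\<in>carrier G. \<psi> (\<iota> g) = \<phi> g) \<and> \<psi> \<tau> = t))"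

definition left_coset_reps :: "'a monoid \<Rightarrow> 'a set \<Rightarrow> 'a set \<Rightarrow> bool" where
  "left_coset_reps G K S \<longleftrightarrow> S \<subseteq> carrier G \<and> \<one>\<^bsub>G\<^esub> \<in> S \<and>
     (\<forall>g\<in>carrier G. \<exists>!s. s \<in> S \<and> s \<in> g <#\<^bsub>G\<^esub> K)"

text \<open>A normal form g_1 tau^e_1 ... g_n tau^e_n g_(n+1) is encoded by the list
  w = [(g_1,e_1),...,(g_n,e_n)] together with g_(n+1).  Sm1 = S_(-1) are the
  representatives of H_(-1) = H, S1 = S_1 those of H_1 = theta(H).\<close>

definition nf_word :: "'a monoid \<Rightarrow> 'a set \<Rightarrow> 'a set \<Rightarrow> ('a \<times> int) list \<Rightarrow> bool" where
  "nf_word G Sm1 S1 w \<longleftrightarrow>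
     (\<forall>i<length w. (snd (w!i) = 1 \<or> snd (w!i) = -1) \<and>
        fst (w!i) \<in> (if snd (w!i) = 1 then Sm1 else S1)) \<and>
     (\<forall>i. 0 < i \<and> i < length w \<and> fst (w!i) = \<one>\<^bsub>G\<^esub> \<longrightarrow> snd (w!(i-1)) = snd (w!i))"

definition nf_eval :: "'b monoid \<Rightarrow> ('a \<Rightarrow> 'b) \<Rightarrow> 'b \<Rightarrow> ('a \<times> int) list \<Rightarrow> 'a \<Rightarrow> 'b" where
  "nf_eval Gm \<iota> \<tau> w g =
     foldr (\<lambda>(x, e) acc. \<iota> x \<otimes>\<^bsub>Gm\<^esub> (\<tau> [^]\<^bsub>Gm\<^esub> (e::int)) \<otimes>\<^bsub>Gm\<^esub> acc) w (\<iota> g)"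

definition T_dagger ::
  "'a monoid \<Rightarrow> 'a set \<Rightarrow> 'a set \<Rightarrow> 'b monoid \<Rightarrow> ('a \<Rightarrow> 'b) \<Rightarrow> 'b \<Rightarrow> int \<Rightarrow> 'b set" where
  "T_dagger G Sm1 S1 Gm \<iota> \<tau> \<epsilon> =
     {x \<in> carrier Gm. \<exists>w g. nf_word G Sm1 S1 w \<and> g \<in> carrier G \<and> w \<noteq> [] \<and>
        snd (hd w) = \<epsilon> \<and> fst (hd w) = \<one>\<^bsub>G\<^esub> \<and> x = nf_eval Gm \<iota> \<tau> w g}"

definition conj_set :: "'b monoid \<Rightarrow> 'b \<Rightarrow> 'b set \<Rightarrow> 'b set" where
  "conj_set Gm r X = r <#\<^bsub>Gm\<^esub> (X #>\<^bsub>Gm\<^esub> inv\<^bsub>Gm\<^esub> r)"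

definition HNN_kernel :: "'b monoid \<Rightarrow> ('a \<Rightarrow> 'b) \<Rightarrow> 'a set \<Rightarrow> 'b set" where
  "HNN_kernel Gm \<iota> H = (\<Inter>r\<in>carrier Gm. conj_set Gm r (\<iota> ` H))"

definition quasi_kernel ::
  "'a monoid \<Rightarrow> 'a set \<Rightarrow> 'a set \<Rightarrow> 'a set \<Rightarrow> 'b monoid \<Rightarrow> ('a \<Rightarrow> 'b) \<Rightarrow> 'b \<Rightarrow> int \<Rightarrow> 'b set" where
  "quasi_kernel G H Sm1 S1 Gm \<iota> \<tau> \<epsilon> =
     (\<Inter>r\<in>carrier Gm - T_dagger G Sm1 S1 Gm \<iota> \<tau> \<epsilon>. conj_set Gm r (\<iota> ` H))"

definition amenable :: "'b monoid \<Rightarrow> bool" where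
  "amenable L \<longleftrightarrow> (\<exists>\<mu> :: 'b set \<Rightarrow> real.
     \<mu> (carrier L) = 1 \<and> (\<forall>A\<subseteq>carrier L. 0 \<le> \<mu> A) \<and>
     (\<forall>A B. A \<subseteq> carrier L \<and> B \<subseteq> carrier L \<and> A \<inter> B = {} \<longrightarrow> \<mu> (A \<union> B) = \<mu> A + \<mu> B) \<and>
     (\<forall>g\<in>carrier L. \<forall>A\<subseteq>carrier L. \<mu> (g <#\<^bsub>L\<^esub> A) = \<mu> A))"

definition l2 :: "'b set \<Rightarrow> ('b \<Rightarrow> complex) set" where
  "l2 A = {f. (\<forall>x. x \<notin> A \<longrightarrow> f x = 0) \<and> (\<lambda>x. (cmod (f x))^2) summable_on A}"

definition l2norm :: "'b set \<Rightarrow> ('b \<Rightarrow> complex) \<Rightarrow> real" where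
  "l2norm A f = sqrt (\<Sum>\<^sub>\<infinity>x\<in>A. (cmod (f x))^2)"

type_synonym 'b op = "('b \<Rightarrow> complex) \<Rightarrow> ('b \<Rightarrow> complex)"

text \<open>Bounded operators on l2(A); an operator is normalised to be 0 outside l2(A).\<close>
definition bounded_op :: "'b set \<Rightarrow> 'b op \<Rightarrow> bool" where
  "bounded_op A T \<longleftrightarrow>
     (\<forall>f. f \<notin> l2 A \<longrightarrow> T f = (\<lambda>_. 0)) \<and> (\<forall>f\<in>l2 A. T f \<in> l2 A) \<and>
     (\<forall>f\<in>l2 A. \<forall>g\<in>l2 A. T (\<lambda>x. f x + g x) = (\<lambda>x. T f x + T g x)) \<and>
     (\<forall>f\<in>l2 A. \<forall>c. T (\<lambda>x. c * f x) = (\<lambda>x. c * T f x)) \<and>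
     (\<exists>K. \<forall>f\<in>l2 A. l2norm A (T f) \<le> K * l2norm A f)"

definition opnorm :: "'b set \<Rightarrow> 'b op \<Rightarrow> real" where
  "opnorm A T = Sup {l2norm A (T f) | f. f \<in> l2 A \<and> l2norm A f \<le> 1}"

definition op_diff :: "'b op \<Rightarrow> 'b op \<Rightarrow> 'b op" where
  "op_diff T S = (\<lambda>f x. T f x - S f x)"

definition lreg :: "'b monoid \<Rightarrow> 'b \<Rightarrow> 'b op" where
  "lreg Gm g = (\<lambda>f. if f \<in> l2 (carrier Gm)
      then (\<lambda>x. if x \<in> carrier Gm then f (inv\<^bsub>Gm\<^esub> g \<otimes>\<^bsub>Gm\<^esub> x) else 0)
      else (\<lambda>_. 0))"

definition group_alg :: "'b monoid \<Rightarrow> 'b op set" where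
  "group_alg Gm = {T. \<exists>F c. finite F \<and> F \<subseteq> carrier Gm \<and>
      T = (\<lambda>f x. \<Sum>g\<in>F. c g * lreg Gm g f x)}"

definition reduced_Cstar :: "'b monoid \<Rightarrow> 'b op set" where
  "reduced_Cstar Gm = {T. bounded_op (carrier Gm) T \<and>
      (\<forall>e>0. \<exists>S\<in>group_alg Gm. opnorm (carrier Gm) (op_diff T S) < e)}"

definition closed_ideal :: "'b set \<Rightarrow> 'b op set \<Rightarrow> 'b op set \<Rightarrow> bool" where
  "closed_ideal A Alg J \<longleftrightarrow> J \<subseteq> Alg \<and> (\<lambda>f x. 0) \<in> J \<and>
     (\<forall>S\<in>J. \<forall>T\<in>J. (\<lambda>f x. S f x + T f x) \<in> J) \<and>
     (\<forall>S\<in>J. \<forall>c. (\<lambda>f x. c * S f x) \<in> J) \<and>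
     (\<forall>S\<in>J. \<forall>a\<in>Alg. a \<circ> S \<in> J \<and> S \<circ> a \<in> J) \<and>
     (\<forall>T\<in>Alg. (\<forall>e>0. \<exists>S\<in>J. opnorm A (op_diff T S) < e) \<longrightarrow> T \<in> J)"

definition Cstar_simple :: "'b monoid \<Rightarrow> bool" where
  "Cstar_simple Gm \<longleftrightarrow> (\<forall>J. closed_ideal (carrier Gm) (reduced_Cstar Gm) J \<longrightarrow>
      J = {\<lambda>f x. 0} \<or> J = reduced_Cstar Gm)"

end

(* The sets T_dagger and their translates encode the half-trees of the Bass--Serre tree; the
   quasi-kernels are the pointwise fixators of the complements of two of them.

   If a quasi-kernel K is amenable and contains some a distinct from 1, let L be the increasing
   union of the conjugates of K by powers of the stable letter: the elements fixing a neighbourhood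
   of an end. A conjugate b of a has support disjoint from that of a, so (1 - a)(1 - b) is a nonzero
   element of the group algebra that vanishes on the square-summable functions on the cosets of L.
   Simplicity would put 1 in the closure of the kernel of this representation, hence give a
   finitely supported function of sum 1 on one of the conjugates of K that convolves with norm
   less than 1/2; then finite sets expand, and Hall's theorem makes the conjugate paradoxical.

   Conversely, C*-simplicity follows from Powers averaging. Given finitely many nontrivial elements
   there is a half-tree C that each of them either fixes pointwise or moves off itself. If the
   quasi-kernels are trivial, only the second case occurs and Powers' original estimate applies. If
   the fixator K of the complement of C is not amenable, averaging over K kills the elements of the
   second kind, by a spectral gap, and leaves those of the first kind unchanged, so that one
   concludes by induction on the number of elements. *)

theory Submission
  imports Defs "HOL-Algebra.Bij"
begin

section \<open>The universal property\<close>

text \<open>Uniqueness of normal forms is not assumed but proved, by letting \<open>Gm\<close>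
  permute them; for this the universal property, stated for groups on one particular type, has to be
  extended to groups of any type. The tree is never built: an edge is a coset, a half-tree is a set
  of group elements, and the geometry is read off the first letters of normal forms. The fixator of
  one half-tree would not do in the first half of the argument. The product (1 - a)(1 - b) has to
  vanish at every coset, and a translate of a fixed half-tree may meet the supports of both
  \<open>a\<close> and \<open>b\<close>, whereas a small enough neighbourhood of an end avoids one
  of them. In the second half, averaging over the fixator can leave the elements of the first kind
  alone because fixators of complementary sets commute modulo the kernel, which is trivial. Averages
  are taken over lists, since a product of two averages counts elements with multiplicity. All norm
  estimates are made on finite sets.\<close>

lemma (in group) generate_eq_foldr:
  assumes X: "X \<subseteq> carrier G" and inv: "\<And>x. x \<in> X \<Longrightarrow> inv x \<in> f ` L"
    and sub: "X \<subseteq> f ` L" and fL: "f ` L \<subseteq> carrier G" and q: "q \<in> generate G X"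
  shows "\<exists>v \<in> lists L. q = foldr (\<lambda>l y. f l \<otimes> y) v \<one>"
  using q
proof induction
  case one
  show ?case by (rule bexI[of _ "[]"]) auto
next
  case (incl h)
  then obtain l where "l \<in> L" "h = f l" using sub by blast
  then show ?case using fL by (intro bexI[of _ "[l]"]) auto
next
  case (inv h)
  then obtain l where "l \<in> L" "inv h = f l" using assms(2) by blast
  then show ?case using fL by (intro bexI[of _ "[l]"]) auto
next
  case (eng h1 h2)
  then obtain v1 v2 where v: "v1 \<in> lists L" "h1 = foldr (\<lambda>l y. f l \<otimes> y) v1 \<one>"
    "v2 \<in> lists L" "h2 = foldr (\<lambda>l y. f l \<otimes> y) v2 \<one>" by blast
  have cl: "foldr (\<lambda>l y. f l \<otimes> y) v z \<in> carrier G" if "v \<in> lists L" "z \<in> carrier G" for v z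
    using that fL by (induction v) auto
  have "foldr (\<lambda>l y. f l \<otimes> y) v \<one> \<otimes> z = foldr (\<lambda>l y. f l \<otimes> y) v z"
    if "v \<in> lists L" "z \<in> carrier G" for v z
    using that
  proof (induction v)
    case (Cons a v)
    then have "f a \<in> carrier G" using fL by auto
    with Cons cl[of v \<one>] show ?case by (auto simp: m_assoc)
  qed auto
  moreover have "h2 \<in> carrier G" using v cl by auto
  ultimately show ?case using v by (intro bexI[of _ "v1 @ v2"]) auto
qed

lemma group_transport:
  fixes Q :: "('d, 'm) monoid_scheme" and j :: "'d \<Rightarrow> 'c"
  assumes "group Q" and j: "inj_on j (carrier Q)"
  obtains L :: "'c monoid" where "group L" "carrier L = j ` carrier Q" "j \<in> hom Q L"
    "the_inv_into (carrier Q) j \<in> hom L Q"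
proof -
  interpret Q: group Q by fact
  let ?k = "the_inv_into (carrier Q) j"
  define L where "L = \<lparr>carrier = j ` carrier Q, mult = (\<lambda>x y. j (?k x \<otimes>\<^bsub>Q\<^esub> ?k y)), one = j \<one>\<^bsub>Q\<^esub>\<rparr>"
  have k: "?k (j x) = x" if "x \<in> carrier Q" for x using that j by (rule the_inv_into_f_f[rotated])
  have "group L"
    by (rule groupI) (auto simp: L_def k Q.m_assoc intro!: bexI[of _ "inv\<^bsub>Q\<^esub> _"])
  moreover have "j \<in> hom Q L" "?k \<in> hom L Q" by (auto simp: hom_def L_def k)
  ultimately show ?thesis by (intro that[of L]) (auto simp: L_def)
qed

locale hnn = G: group G + Gm: group Gm for G :: "'a monoid" and Gm :: "'b monoid" +
  fixes H :: "'a set" and \<theta> :: "'a \<Rightarrow> 'a"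
    and Sm1 S1 :: "'a set" and \<iota> :: "'a \<Rightarrow> 'b" and \<tau> :: 'b
  assumes subgroupH: "subgroup H G"
    and th_hom: "\<theta> \<in> hom (G\<lparr>carrier := H\<rparr>) G" and th_inj: "inj_on \<theta> H"
    and hnn: "is_HNN G H \<theta> Gm \<iota> \<tau>"
    and repsm1: "left_coset_reps G H Sm1" and reps1: "left_coset_reps G (\<theta> ` H) S1"
begin

lemma iota_hom: "\<iota> \<in> hom G Gm" and tau_carrier: "\<tau> \<in> carrier Gm"
  and tau_rel: "h \<in> H \<Longrightarrow> inv\<^bsub>Gm\<^esub> \<tau> \<otimes>\<^bsub>Gm\<^esub> \<iota> h \<otimes>\<^bsub>Gm\<^esub> \<tau> = \<iota> (\<theta> h)"
  and carrier_Gm: "carrier Gm = generate Gm (\<iota> ` carrier G \<union> {\<tau>})"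
  using hnn unfolding is_HNN_def by auto

sublocale iota: group_hom G Gm \<iota>
  by unfold_locales (rule iota_hom)

text \<open>The images of \<open>G\<close> and \<open>t\<close> generate a subgroup of
  \<open>P\<close> whose elements are products of letters, so choosing one word for each element
  embeds it into the type of the test groups in \<open>is_HNN\<close>. The homomorphism found there
  is carried back along the embedding.\<close>

lemma universal:
  assumes "group (P :: 'c monoid)" and \<phi>: "\<phi> \<in> hom G P" and t: "t \<in> carrier P"
    and rel: "\<And>h. h \<in> H \<Longrightarrow> inv\<^bsub>P\<^esub> t \<otimes>\<^bsub>P\<^esub> \<phi> h \<otimes>\<^bsub>P\<^esub> t = \<phi> (\<theta> h)"
  shows "\<exists>\<psi>\<in>hom Gm P. (\<forall>g\<in>carrier G. \<psi> (\<iota> g) = \<phi> g) \<and> \<psi> \<tau> = t"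
proof -
  interpret P: group P by fact
  define X where "X = \<phi> ` carrier G \<union> {t}"
  define Q where "Q = P\<lparr>carrier := generate P X\<rparr>"
  have XP: "X \<subseteq> carrier P" using \<phi> t by (auto simp: X_def hom_def)
  have sub: "subgroup (generate P X) P" using XP by (rule P.generate_is_subgroup)
  have Q: "group Q" unfolding Q_def using sub by (rule subgroup.subgroup_is_group) (rule assms)
  \<comment> \<open>The integer only tags the kind of letter: 0 for an element of \<open>G\<close>,
    1 for \<open>t\<close>, any other value for the inverse of \<open>t\<close>.\<close>
  define f :: "'a \<times> int \<Rightarrow> 'c" where
    "f = (\<lambda>(g, e). if e = 0 then \<phi> g else if e = 1 then t else inv\<^bsub>P\<^esub> t)"
  define F where "F = (\<lambda>v. foldr (\<lambda>l y. f l \<otimes>\<^bsub>P\<^esub> y) v \<one>\<^bsub>P\<^esub>)"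
  have "\<exists>v \<in> lists (carrier G \<times> UNIV). q = F v" if "q \<in> carrier Q" for q
    unfolding F_def
  proof (rule P.generate_eq_foldr[OF XP])
    fix x assume "x \<in> X"
    then consider g where "g \<in> carrier G" "x = \<phi> g" | "x = t" by (auto simp: X_def)
    then show "inv\<^bsub>P\<^esub> x \<in> f ` (carrier G \<times> UNIV)"
    proof cases
      case 1
      then have "inv\<^bsub>P\<^esub> x = f (inv\<^bsub>G\<^esub> g, 0)"
        using group_hom.hom_inv[of G P \<phi> g] \<phi> assms(1) G.group_axioms by (simp add: f_def group_hom_def group_hom_axioms_def)
      then show ?thesis using 1 by blast
    next
      case 2
      then have "inv\<^bsub>P\<^esub> x = f (\<one>\<^bsub>G\<^esub>, -1)" by (simp add: f_def)
      then show ?thesis by blast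
    qed
  next
    show "X \<subseteq> f ` (carrier G \<times> UNIV)"
    proof
      fix x assume "x \<in> X"
      then consider g where "g \<in> carrier G" "x = \<phi> g" | "x = t" by (auto simp: X_def)
      then show "x \<in> f ` (carrier G \<times> UNIV)"
      proof cases
        case 1
        then have "x = f (g, 0)" by (simp add: f_def)
        then show ?thesis using 1 by blast
      next
        case 2
        then have "x = f (\<one>\<^bsub>G\<^esub>, 1)" by (simp add: f_def)
        then show ?thesis by blast
      qed
    qed
    show "f ` (carrier G \<times> UNIV) \<subseteq> carrier P" using \<phi> t by (auto simp: f_def hom_def)
    show "q \<in> generate P X" using that by (simp add: Q_def)
  qed
  then obtain j where j: "\<And>q. q \<in> carrier Q \<Longrightarrow> F (j q) = q" by metis
  then have "inj_on j (carrier Q)" by (metis inj_onI)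
  then obtain L :: "('a \<times> int) list monoid" where L: "group L" "carrier L = j ` carrier Q" "j \<in> hom Q L"
    "the_inv_into (carrier Q) j \<in> hom L Q" using group_transport[OF Q] by blast
  let ?k = "the_inv_into (carrier Q) j"
  have k: "?k (j x) = x" if "x \<in> carrier Q" for x
    using that \<open>inj_on j (carrier Q)\<close> by (rule the_inv_into_f_f[rotated])
  have tQ: "t \<in> carrier Q" and phQ: "\<phi> g \<in> carrier Q" if "g \<in> carrier G" for g
    using that by (auto simp: Q_def X_def intro: generate.incl)
  have tQ: "t \<in> carrier Q" by (auto simp: Q_def X_def intro: generate.incl)
  have phi': "\<phi> \<in> hom G Q" using \<phi> phQ by (auto simp: hom_def Q_def)
  have jphi: "j \<circ> \<phi> \<in> hom G L" using phi' L(3) by (rule hom_compose)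
  have jt: "j t \<in> carrier L" using tQ L by auto
  interpret j: group_hom Q L j using Q L by (simp add: group_hom_def group_hom_axioms_def)
  have "inv\<^bsub>L\<^esub> (j t) \<otimes>\<^bsub>L\<^esub> (j \<circ> \<phi>) h \<otimes>\<^bsub>L\<^esub> j t = (j \<circ> \<phi>) (\<theta> h)" if h: "h \<in> H" for h
  proof -
    have hG: "h \<in> carrier G" using h subgroupH subgroup.subset by blast
    have "inv\<^bsub>Q\<^esub> t = inv\<^bsub>P\<^esub> t" using sub tQ unfolding Q_def by (simp add: P.m_inv_consistent)
    moreover have "x \<otimes>\<^bsub>Q\<^esub> y = x \<otimes>\<^bsub>P\<^esub> y" for x y by (simp add: Q_def)
    ultimately have "inv\<^bsub>P\<^esub> t \<otimes>\<^bsub>P\<^esub> \<phi> h \<otimes>\<^bsub>P\<^esub> t = inv\<^bsub>Q\<^esub> t \<otimes>\<^bsub>Q\<^esub> \<phi> h \<otimes>\<^bsub>Q\<^esub> t" by simp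
    also have "j \<dots> = inv\<^bsub>L\<^esub> (j t) \<otimes>\<^bsub>L\<^esub> j (\<phi> h) \<otimes>\<^bsub>L\<^esub> j t"
      using phQ[OF hG] tQ by simp
    finally have "inv\<^bsub>L\<^esub> (j t) \<otimes>\<^bsub>L\<^esub> j (\<phi> h) \<otimes>\<^bsub>L\<^esub> j t = j (inv\<^bsub>P\<^esub> t \<otimes>\<^bsub>P\<^esub> \<phi> h \<otimes>\<^bsub>P\<^esub> t)" by simp
    then show ?thesis using rel[OF h] by simp
  qed
  then have "\<exists>\<psi>\<in>hom Gm L. (\<forall>g\<in>carrier G. \<psi> (\<iota> g) = (j \<circ> \<phi>) g) \<and> \<psi> \<tau> = j t"
    using hnn jphi jt L(1) unfolding is_HNN_def by blast
  then obtain \<psi> where psi: "\<psi> \<in> hom Gm L" "\<forall>g\<in>carrier G. \<psi> (\<iota> g) = j (\<phi> g)" "\<psi> \<tau> = j t" by auto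
  have "?k \<circ> \<psi> \<in> hom Gm Q" using psi(1) L(4) by (rule hom_compose)
  then have "?k \<circ> \<psi> \<in> hom Gm P" using sub[THEN subgroup.subset] by (auto simp: hom_def Q_def)
  moreover have "(?k \<circ> \<psi>) (\<iota> g) = \<phi> g" if "g \<in> carrier G" for g using psi that k phQ by simp
  moreover have "(?k \<circ> \<psi>) \<tau> = t" using psi k tQ by simp
  ultimately show ?thesis by blast
qed

end

section \<open>The action on normal forms\<close>

context hnn begin

definition Hs :: "int \<Rightarrow> 'a set" where "Hs e = (if e = 1 then \<theta> ` H else H)"
definition S :: "int \<Rightarrow> 'a set" where "S e = (if e = 1 then S1 else Sm1)"
text \<open>For \<open>h\<close> in \<open>Hs (-e)\<close> one has h tau^e = tau^e (th e h) in the
  extension (\<open>td_comm\<close>). Hence a letter followed by tau^e matters only modulo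
  \<open>Hs (-e)\<close>, which is why its representatives come from \<open>S (-e)\<close>.\<close>

definition th :: "int \<Rightarrow> 'a \<Rightarrow> 'a" where "th e = (if e = 1 then \<theta> else the_inv_into H \<theta>)"
definition rep :: "int \<Rightarrow> 'a \<Rightarrow> 'a" where "rep e g = (THE s. s \<in> S e \<and> s \<in> g <#\<^bsub>G\<^esub> Hs e)"

lemma theta_group_hom: "group_hom (G\<lparr>carrier := H\<rparr>) G \<theta>"
  using subgroup.subgroup_is_group[OF subgroupH G.group_axioms] G.group_axioms th_hom
  by (simp add: group_hom_def group_hom_axioms_def)

lemma H_subset: "H \<subseteq> carrier G" using subgroupH by (rule subgroup.subset)

lemma theta_mult: "h \<in> H \<Longrightarrow> k \<in> H \<Longrightarrow> \<theta> (h \<otimes>\<^bsub>G\<^esub> k) = \<theta> h \<otimes>\<^bsub>G\<^esub> \<theta> k"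
  using th_hom by (auto simp: hom_def)

lemma theta_closed: "h \<in> H \<Longrightarrow> \<theta> h \<in> carrier G"
  using th_hom by (auto simp: hom_def)

lemma subgroup_Hs: "subgroup (Hs e) G"
  using group_hom.img_is_subgroup[OF theta_group_hom] subgroupH by (simp add: Hs_def)

lemma Hs_carrier: "h \<in> Hs e \<Longrightarrow> h \<in> carrier G"
  using subgroup_Hs subgroup.subset by blast

lemma Hs_mult: "h \<in> Hs e \<Longrightarrow> k \<in> Hs e \<Longrightarrow> h \<otimes>\<^bsub>G\<^esub> k \<in> Hs e"
  and Hs_one: "\<one>\<^bsub>G\<^esub> \<in> Hs e"
  and Hs_inv: "h \<in> Hs e \<Longrightarrow> inv\<^bsub>G\<^esub> h \<in> Hs e"
  using subgroup_Hs by (simp_all add: subgroup.m_closed subgroup.one_closed subgroup.m_inv_closed)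

lemma Hs_cancel_left:
  assumes "h \<in> Hs e" "g \<in> carrier G" shows "h \<otimes>\<^bsub>G\<^esub> g \<in> Hs e \<longleftrightarrow> g \<in> Hs e"
proof
  assume "h \<otimes>\<^bsub>G\<^esub> g \<in> Hs e"
  then have "inv\<^bsub>G\<^esub> h \<otimes>\<^bsub>G\<^esub> (h \<otimes>\<^bsub>G\<^esub> g) \<in> Hs e" using assms Hs_inv Hs_mult by blast
  then show "g \<in> Hs e" using assms Hs_carrier by (simp add: G.m_assoc[symmetric])
qed (use assms Hs_mult in auto)

lemma th_closed: "e = 1 \<or> e = -1 \<Longrightarrow> h \<in> Hs (-e) \<Longrightarrow> th e h \<in> Hs e"
  using th_inj by (auto simp: th_def Hs_def the_inv_into_f_f)

lemma th_inverse: "e = 1 \<or> e = -1 \<Longrightarrow> h \<in> Hs (-e) \<Longrightarrow> th (-e) (th e h) = h"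
  using th_inj by (auto simp: th_def Hs_def the_inv_into_f_f)

lemma th_mult:
  assumes e: "e = 1 \<or> e = -1" and "h \<in> Hs (-e)" "k \<in> Hs (-e)"
  shows "th e (h \<otimes>\<^bsub>G\<^esub> k) = th e h \<otimes>\<^bsub>G\<^esub> th e k"
  using e
proof
  assume "e = 1"
  then show ?thesis using assms by (simp add: th_def Hs_def theta_mult)
next
  assume e: "e = -1"
  then obtain a b where ab: "a \<in> H" "h = \<theta> a" "b \<in> H" "k = \<theta> b" using assms by (auto simp: Hs_def)
  then have "h \<otimes>\<^bsub>G\<^esub> k = \<theta> (a \<otimes>\<^bsub>G\<^esub> b)" "a \<otimes>\<^bsub>G\<^esub> b \<in> H"
    using theta_mult subgroupH by (auto simp: subgroup.m_closed)
  then show ?thesis using e ab th_inj by (simp add: th_def the_inv_into_f_f)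
qed

lemma th_one: assumes "e = 1 \<or> e = -1" shows "th e \<one>\<^bsub>G\<^esub> = \<one>\<^bsub>G\<^esub>"
proof -
  have "th e \<one>\<^bsub>G\<^esub> \<otimes>\<^bsub>G\<^esub> th e \<one>\<^bsub>G\<^esub> = th e \<one>\<^bsub>G\<^esub>" using th_mult[OF assms Hs_one Hs_one] by simp
  moreover have "th e \<one>\<^bsub>G\<^esub> \<in> carrier G" using th_closed[OF assms Hs_one] Hs_carrier by blast
  ultimately show ?thesis using G.l_cancel_one by blast
qed

lemma reps: "left_coset_reps G (Hs e) (S e)"
  using repsm1 reps1 by (simp add: Hs_def S_def)

lemma S_carrier: "s \<in> S e \<Longrightarrow> s \<in> carrier G" and S_one: "\<one>\<^bsub>G\<^esub> \<in> S e"
  using reps[of e] unfolding left_coset_reps_def by auto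

lemma rep_prop: assumes "g \<in> carrier G" shows "rep e g \<in> S e" "rep e g \<in> g <#\<^bsub>G\<^esub> Hs e"
proof -
  have "\<exists>!s. s \<in> S e \<and> s \<in> g <#\<^bsub>G\<^esub> Hs e" using reps assms unfolding left_coset_reps_def by auto
  from theI'[OF this] show "rep e g \<in> S e" "rep e g \<in> g <#\<^bsub>G\<^esub> Hs e" by (auto simp: rep_def)
qed

lemma rep_carrier: "g \<in> carrier G \<Longrightarrow> rep e g \<in> carrier G"
  using rep_prop S_carrier by blast

lemma l_coset_iff: assumes "g \<in> carrier G" "s \<in> carrier G"
  shows "s \<in> g <#\<^bsub>G\<^esub> Hs e \<longleftrightarrow> inv\<^bsub>G\<^esub> s \<otimes>\<^bsub>G\<^esub> g \<in> Hs e"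
proof
  assume "s \<in> g <#\<^bsub>G\<^esub> Hs e"
  then obtain h where h: "h \<in> Hs e" "s = g \<otimes>\<^bsub>G\<^esub> h" by (auto simp: l_coset_def)
  then have "inv\<^bsub>G\<^esub> s \<otimes>\<^bsub>G\<^esub> g = inv\<^bsub>G\<^esub> h" using assms Hs_carrier
    by (simp add: G.inv_mult_group G.m_assoc)
  then show "inv\<^bsub>G\<^esub> s \<otimes>\<^bsub>G\<^esub> g \<in> Hs e" using h Hs_inv by simp
next
  assume *: "inv\<^bsub>G\<^esub> s \<otimes>\<^bsub>G\<^esub> g \<in> Hs e"
  then have "inv\<^bsub>G\<^esub> (inv\<^bsub>G\<^esub> s \<otimes>\<^bsub>G\<^esub> g) \<in> Hs e" by (rule Hs_inv)
  moreover have "s = g \<otimes>\<^bsub>G\<^esub> inv\<^bsub>G\<^esub> (inv\<^bsub>G\<^esub> s \<otimes>\<^bsub>G\<^esub> g)" using assms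
    by (simp add: G.inv_mult_group G.m_assoc[symmetric])
  ultimately show "s \<in> g <#\<^bsub>G\<^esub> Hs e" by (auto simp: l_coset_def)
qed

lemma rep_Hs: "g \<in> carrier G \<Longrightarrow> inv\<^bsub>G\<^esub> (rep e g) \<otimes>\<^bsub>G\<^esub> g \<in> Hs e"
  by (simp add: rep_prop l_coset_iff[symmetric] rep_carrier)

lemma rep_unique:
  assumes "s \<in> S e" "g \<in> carrier G" "inv\<^bsub>G\<^esub> s \<otimes>\<^bsub>G\<^esub> g \<in> Hs e" shows "rep e g = s"
proof -
  have "\<exists>!s. s \<in> S e \<and> s \<in> g <#\<^bsub>G\<^esub> Hs e" using reps assms unfolding left_coset_reps_def by auto
  moreover have "s \<in> g <#\<^bsub>G\<^esub> Hs e" using assms l_coset_iff[of g s] S_carrier by simp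
  ultimately show ?thesis using assms rep_prop by blast
qed

lemma rep_S: "s \<in> S e \<Longrightarrow> rep e s = s"
  using rep_unique S_carrier Hs_one by simp

lemma rep_mult_rep:
  assumes "g \<in> carrier G" "k \<in> carrier G"
  shows "rep e (g \<otimes>\<^bsub>G\<^esub> rep e k) = rep e (g \<otimes>\<^bsub>G\<^esub> k)"
proof (rule sym, rule rep_unique)
  let ?r = "rep e (g \<otimes>\<^bsub>G\<^esub> rep e k)"
  note c = rep_carrier[OF assms(2), of e]
  show "?r \<in> S e" using rep_prop assms c by simp
  show "g \<otimes>\<^bsub>G\<^esub> k \<in> carrier G" using assms by simp
  have r: "?r \<in> carrier G" using rep_carrier assms c by simp
  have "inv\<^bsub>G\<^esub> ?r \<otimes>\<^bsub>G\<^esub> (g \<otimes>\<^bsub>G\<^esub> rep e k) \<otimes>\<^bsub>G\<^esub> (inv\<^bsub>G\<^esub> (rep e k) \<otimes>\<^bsub>G\<^esub> k) \<in> Hs e"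
    by (intro Hs_mult rep_Hs) (use assms c in auto)
  moreover have "inv\<^bsub>G\<^esub> ?r \<otimes>\<^bsub>G\<^esub> (g \<otimes>\<^bsub>G\<^esub> rep e k) \<otimes>\<^bsub>G\<^esub> (inv\<^bsub>G\<^esub> (rep e k) \<otimes>\<^bsub>G\<^esub> k)
      = inv\<^bsub>G\<^esub> ?r \<otimes>\<^bsub>G\<^esub> (g \<otimes>\<^bsub>G\<^esub> (rep e k \<otimes>\<^bsub>G\<^esub> (inv\<^bsub>G\<^esub> (rep e k) \<otimes>\<^bsub>G\<^esub> k)))"
    using assms c r by (simp add: G.m_assoc)
  moreover have "rep e k \<otimes>\<^bsub>G\<^esub> (inv\<^bsub>G\<^esub> (rep e k) \<otimes>\<^bsub>G\<^esub> k) = k"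
    using assms c by (simp add: G.m_assoc[symmetric])
  ultimately show "inv\<^bsub>G\<^esub> ?r \<otimes>\<^bsub>G\<^esub> (g \<otimes>\<^bsub>G\<^esub> k) \<in> Hs e" by simp
qed

lemma rep_eq_one_iff: assumes "g \<in> carrier G" shows "rep e g = \<one>\<^bsub>G\<^esub> \<longleftrightarrow> g \<in> Hs e"
  using rep_unique[OF S_one assms] rep_Hs[OF assms, of e] assms by auto

lemma S_Hs: "s \<in> S e \<Longrightarrow> s \<in> Hs e \<longleftrightarrow> s = \<one>\<^bsub>G\<^esub>"
  using rep_eq_one_iff rep_S S_carrier by metis

fun nfw :: "('a \<times> int) list \<Rightarrow> bool" where
  "nfw [] = True"
| "nfw ((s, e) # w) = ((e = 1 \<or> e = -1) \<and> s \<in> S (-e) \<and> nfw w \<and>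
     (w \<noteq> [] \<longrightarrow> fst (hd w) = \<one>\<^bsub>G\<^esub> \<longrightarrow> snd (hd w) = e))"

lemma nf_word_iff: "nf_word G Sm1 S1 w \<longleftrightarrow> nfw w"
proof (induction w rule: nfw.induct)
  case 1
  show ?case by (simp add: nf_word_def)
next
  case (2 s e w)
  have "nf_word G Sm1 S1 ((s, e) # w) \<longleftrightarrow> (e = 1 \<or> e = -1) \<and> s \<in> S (-e) \<and> nf_word G Sm1 S1 w \<and>
     (w \<noteq> [] \<longrightarrow> fst (hd w) = \<one>\<^bsub>G\<^esub> \<longrightarrow> snd (hd w) = e)" (is "?l \<longleftrightarrow> ?r")
  proof
    assume l: ?l
    have 1: "i < length w \<Longrightarrow> (snd (w!i) = 1 \<or> snd (w!i) = -1) \<and>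
        fst (w!i) \<in> (if snd (w!i) = 1 then Sm1 else S1)" for i
      using l unfolding nf_word_def by (metis Suc_less_eq length_Cons nth_Cons_Suc)
    have 2: "i < length w \<Longrightarrow> 0 < i \<Longrightarrow> fst (w!i) = \<one>\<^bsub>G\<^esub> \<Longrightarrow> snd (w!(i-1)) = snd (w!i)" for i
      using l[unfolded nf_word_def, THEN conjunct2, rule_format, of "Suc i"]
      by (cases i) auto
    have 3: "(e = 1 \<or> e = -1) \<and> s \<in> S (-e)"
      using l[unfolded nf_word_def, THEN conjunct1, rule_format, of 0] by (auto simp: S_def)
    have 4: "w \<noteq> [] \<longrightarrow> fst (hd w) = \<one>\<^bsub>G\<^esub> \<longrightarrow> snd (hd w) = e"
      using l[unfolded nf_word_def, THEN conjunct2, rule_format, of 1] by (cases w) auto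
    show ?r using 1 2 3 4 unfolding nf_word_def by blast
  next
    assume r: ?r
    have 1: "(snd (((s, e) # w)!i) = 1 \<or> snd (((s, e) # w)!i) = -1) \<and>
        fst (((s, e) # w)!i) \<in> (if snd (((s, e) # w)!i) = 1 then Sm1 else S1)"
      if "i < length ((s, e) # w)" for i
      using r that unfolding nf_word_def by (cases i) (auto simp: S_def)
    have 2: "snd (((s, e) # w)!(i-1)) = snd (((s, e) # w)!i)"
      if "0 < i \<and> i < length ((s, e) # w) \<and> fst (((s, e) # w)!i) = \<one>\<^bsub>G\<^esub>" for i
    proof (cases "i = 1")
      case True
      then show ?thesis using r that by (cases w) auto
    next
      case False
      then have "2 \<le> i" using that by linarith
      then obtain k where k: "i = Suc (Suc k)" by (metis add_2_eq_Suc le_Suc_ex)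
      then show ?thesis using r[THEN conjunct2, THEN conjunct2, THEN conjunct1, unfolded nf_word_def,
            THEN conjunct2, rule_format, of "Suc k"] that k by simp
    qed
    show ?l unfolding nf_word_def using 1 2 by blast
  qed
  then show ?case using 2 by simp
qed

text \<open>Left multiplication by \<open>g\<close>, in the manner of van der Waerden: g s = s' h
  with \<open>h\<close> in \<open>Hs (-e)\<close>, the carry \<open>h\<close> crosses tau^e, becomes
  \<open>th e h\<close> and acts on the rest. Exponents never change here; cancellation is left to
  \<open>tact\<close>.\<close>

fun gact :: "'a \<Rightarrow> ('a \<times> int) list \<times> 'a \<Rightarrow> ('a \<times> int) list \<times> 'a" where
  "gact g ([], x) = ([], g \<otimes>\<^bsub>G\<^esub> x)"
| "gact g ((s, e) # w, x) =
    (let s' = rep (-e) (g \<otimes>\<^bsub>G\<^esub> s); r = gact (th e (inv\<^bsub>G\<^esub> s' \<otimes>\<^bsub>G\<^esub> (g \<otimes>\<^bsub>G\<^esub> s))) (w, x)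
     in ((s', e) # fst r, snd r))"

fun tact :: "int \<Rightarrow> ('a \<times> int) list \<times> 'a \<Rightarrow> ('a \<times> int) list \<times> 'a" where
  "tact d ([], x) = ([(\<one>\<^bsub>G\<^esub>, d)], x)"
| "tact d ((s, e) # w, x) =
    (if s = \<one>\<^bsub>G\<^esub> \<and> e = -d then (w, x) else ((\<one>\<^bsub>G\<^esub>, d) # (s, e) # w, x))"

definition W :: "(('a \<times> int) list \<times> 'a) set" where
  "W = {(w, x). nfw w \<and> x \<in> carrier G}"

lemma gact_props:
  assumes "g \<in> carrier G" "nfw w" "x \<in> carrier G"
  shows "nfw (fst (gact g (w, x))) \<and> snd (gact g (w, x)) \<in> carrier G \<and>
    (w = [] \<longleftrightarrow> fst (gact g (w, x)) = []) \<and>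
    (w \<noteq> [] \<longrightarrow> hd (fst (gact g (w, x))) = (rep (- snd (hd w)) (g \<otimes>\<^bsub>G\<^esub> fst (hd w)), snd (hd w)))"
  using assms
proof (induction w arbitrary: g)
  case Nil
  then show ?case by simp
next
  case (Cons l w)
  obtain s e where l: "l = (s, e)" by (cases l)
  have e: "e = 1 \<or> e = -1" and s: "s \<in> S (-e)" and w: "nfw w"
    and hd: "w \<noteq> [] \<longrightarrow> fst (hd w) = \<one>\<^bsub>G\<^esub> \<longrightarrow> snd (hd w) = e" using Cons.prems l by auto
  have sc: "s \<in> carrier G" using s S_carrier by blast
  define s' where "s' = rep (-e) (g \<otimes>\<^bsub>G\<^esub> s)"
  define h where "h = th e (inv\<^bsub>G\<^esub> s' \<otimes>\<^bsub>G\<^esub> (g \<otimes>\<^bsub>G\<^esub> s))"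
  have s': "s' \<in> S (-e)" using rep_prop sc Cons.prems by (simp add: s'_def)
  have hH: "h \<in> Hs e" unfolding h_def s'_def using e sc Cons.prems by (intro th_closed rep_Hs) auto
  have hc: "h \<in> carrier G" using hH Hs_carrier by blast
  note IH = Cons.IH[OF hc w Cons.prems(3)]
  have "snd (hd (fst (gact h (w, x)))) = e"
    if "fst (gact h (w, x)) \<noteq> []" "fst (hd (fst (gact h (w, x)))) = \<one>\<^bsub>G\<^esub>"
  proof -
    have wne: "w \<noteq> []" using IH that by auto
    obtain s2 e2 w2 where w2: "w = (s2, e2) # w2" using wne by (cases w) auto
    then have e2: "e2 = 1 \<or> e2 = -1" and s2: "s2 \<in> S (-e2)" using w by auto
    have "rep (-e2) (h \<otimes>\<^bsub>G\<^esub> s2) = \<one>\<^bsub>G\<^esub>" using IH that w2 by simp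
    then have "h \<otimes>\<^bsub>G\<^esub> s2 \<in> Hs (-e2)" using rep_eq_one_iff hc s2 S_carrier by simp
    \<comment> \<open>For opposite exponents the carry \<open>h\<close> lies in
      \<open>Hs (-e2)\<close>, and multiplication by it cannot bring a nontrivial representative
      \<open>s2\<close> into that subgroup. So no factor tau^e 1 tau^-e arises.\<close>
    have "e2 = e"
    proof (rule ccontr)
      assume "e2 \<noteq> e"
      then have "-e2 = e" using e e2 by auto
      then have "s2 \<in> Hs (-e2)" using \<open>h \<otimes>\<^bsub>G\<^esub> s2 \<in> Hs (-e2)\<close> hH s2 S_carrier Hs_cancel_left by metis
      then have "s2 = \<one>\<^bsub>G\<^esub>" using S_Hs s2 by simp
      then show False using hd w2 \<open>e2 \<noteq> e\<close> by simp
    qed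
    then show ?thesis using IH wne w2 by simp
  qed
  then show ?case using IH e s' by (simp add: l Let_def flip: s'_def h_def)
qed

lemma gact_W: "g \<in> carrier G \<Longrightarrow> p \<in> W \<Longrightarrow> gact g p \<in> W"
  using gact_props[of g "fst p" "snd p"]
  by (cases p; cases "gact g p") (simp add: W_def)

lemma gact_one: "p \<in> W \<Longrightarrow> gact \<one>\<^bsub>G\<^esub> p = p"
proof (cases p)
  fix w x assume "p \<in> W" "p = (w, x)"
  then have "nfw w" "x \<in> carrier G" by (auto simp: W_def)
  then have "gact \<one>\<^bsub>G\<^esub> (w, x) = (w, x)"
    by (induction w) (auto simp: S_carrier rep_S th_one Let_def)
  then show ?thesis using \<open>p = (w, x)\<close> by simp
qed

lemma gact_mult:
  assumes "g \<in> carrier G" "k \<in> carrier G" "p \<in> W"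
  shows "gact (g \<otimes>\<^bsub>G\<^esub> k) p = gact g (gact k p)"
proof (cases p)
  case (Pair w x)
  then have "nfw w" "x \<in> carrier G" using assms by (auto simp: W_def)
  then have "gact (g \<otimes>\<^bsub>G\<^esub> k) (w, x) = gact g (gact k (w, x))"
    using assms(1,2)
  proof (induction w arbitrary: g k)
    case Nil
    then show ?case by (simp add: G.m_assoc)
  next
    case (Cons l w)
    obtain s e where l: "l = (s, e)" by (cases l)
    have e: "e = 1 \<or> e = -1" and s: "s \<in> S (-e)" and w: "nfw w" using Cons.prems l by auto
    have sc: "s \<in> carrier G" using s S_carrier by blast
    note c = Cons.prems(3,4) sc
    define a where "a = rep (-e) (k \<otimes>\<^bsub>G\<^esub> s)"
    define b where "b = rep (-e) (g \<otimes>\<^bsub>G\<^esub> a)"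
    have ac: "a \<in> carrier G" using rep_carrier c by (simp add: a_def)
    have bc: "b \<in> carrier G" using rep_carrier c ac by (simp add: b_def)
    have b: "rep (-e) (g \<otimes>\<^bsub>G\<^esub> k \<otimes>\<^bsub>G\<^esub> s) = b" unfolding a_def b_def using c
      by (simp add: rep_mult_rep G.m_assoc)
    define h1 where "h1 = inv\<^bsub>G\<^esub> a \<otimes>\<^bsub>G\<^esub> (k \<otimes>\<^bsub>G\<^esub> s)"
    define h2 where "h2 = inv\<^bsub>G\<^esub> b \<otimes>\<^bsub>G\<^esub> (g \<otimes>\<^bsub>G\<^esub> a)"
    have h1: "h1 \<in> Hs (-e)" unfolding h1_def a_def by (rule rep_Hs) (use c in simp)
    have h2: "h2 \<in> Hs (-e)" unfolding h2_def b_def by (rule rep_Hs) (use c ac in simp)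
    have "inv\<^bsub>G\<^esub> b \<otimes>\<^bsub>G\<^esub> (g \<otimes>\<^bsub>G\<^esub> k \<otimes>\<^bsub>G\<^esub> s) = inv\<^bsub>G\<^esub> b \<otimes>\<^bsub>G\<^esub> (g \<otimes>\<^bsub>G\<^esub> ((a \<otimes>\<^bsub>G\<^esub> inv\<^bsub>G\<^esub> a) \<otimes>\<^bsub>G\<^esub> (k \<otimes>\<^bsub>G\<^esub> s)))"
      using c ac by (simp add: G.m_assoc)
    also have "\<dots> = h2 \<otimes>\<^bsub>G\<^esub> h1" unfolding h1_def h2_def using c ac bc by (simp only: G.m_assoc G.m_closed G.inv_closed)
    finally have h: "inv\<^bsub>G\<^esub> b \<otimes>\<^bsub>G\<^esub> (g \<otimes>\<^bsub>G\<^esub> k \<otimes>\<^bsub>G\<^esub> s) = h2 \<otimes>\<^bsub>G\<^esub> h1" .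
    have "gact (th e (h2 \<otimes>\<^bsub>G\<^esub> h1)) (w, x) = gact (th e h2) (gact (th e h1) (w, x))"
      using Cons.IH[OF w Cons.prems(2), of "th e h2" "th e h1"] th_mult[OF e h2 h1]
        th_closed[OF e h1] th_closed[OF e h2] Hs_carrier by simp
    moreover have "gact k ((s, e) # w, x) = ((a, e) # fst (gact (th e h1) (w, x)), snd (gact (th e h1) (w, x)))"
      by (simp add: Let_def flip: a_def h1_def)
    moreover have "gact g ((a, e) # w', x') = ((b, e) # fst (gact (th e h2) (w', x')), snd (gact (th e h2) (w', x')))" for w' x'
      by (simp add: Let_def flip: b_def h2_def)
    ultimately show ?case unfolding l
      by (simp only: gact.simps Let_def b h) simp
  qed
  then show ?thesis using Pair by simp
qed

lemma tact_W: "d = 1 \<or> d = -1 \<Longrightarrow> p \<in> W \<Longrightarrow> tact d p \<in> W"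
  by (cases "(d, p)" rule: tact.cases) (auto simp: W_def S_one)

lemma tact_tact: "d = 1 \<or> d = -1 \<Longrightarrow> p \<in> W \<Longrightarrow> tact (-d) (tact d p) = p"
proof (cases "(d, p)" rule: tact.cases)
  case (2 d' s e w x)
  assume "d = 1 \<or> d = -1" "p \<in> W"
  with 2 show ?thesis by (cases w) (auto simp: W_def)
qed auto

text \<open>The defining relation of the extension, verified on normal forms, as
  \<open>universal\<close> asks for. The delicate point is that \<open>tact d\<close> cancels a
  letter of \<open>p\<close> exactly when it cancels one of \<open>gact (th d h) p\<close>.\<close>

lemma gact_tact:
  assumes d: "d = 1 \<or> d = -1" and p: "p \<in> W" and h: "h \<in> Hs (-d)"
  shows "gact h (tact d p) = tact d (gact (th d h) p)"
proof (cases "(d, p)" rule: tact.cases)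
  case (1 d' x)
  then show ?thesis using h Hs_carrier rep_eq_one_iff[of h "-d"] d by (auto simp: Let_def)
next
  case (2 d' s e w x)
  have hc: "h \<in> carrier G" "th d h \<in> carrier G" using h th_closed[OF d h] Hs_carrier by auto
  have w: "nfw w" "x \<in> carrier G" "s \<in> S (-e)" using p 2 by (auto simp: W_def)
  have rh: "rep (-d) h = \<one>\<^bsub>G\<^esub>" using rep_eq_one_iff hc h by simp
  show ?thesis
  proof (cases "s = \<one>\<^bsub>G\<^esub> \<and> e = -d")
    case True
    have "rep d (th d h) = \<one>\<^bsub>G\<^esub>" using rep_eq_one_iff hc th_closed[OF d h] by simp
    then show ?thesis using 2 True d h hc th_inverse[OF d h] by (auto simp: Let_def)
  next
    case False
    have "\<not> (rep (-e) (th d h \<otimes>\<^bsub>G\<^esub> s) = \<one>\<^bsub>G\<^esub> \<and> e = -d)"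
    proof
      assume a: "rep (-e) (th d h \<otimes>\<^bsub>G\<^esub> s) = \<one>\<^bsub>G\<^esub> \<and> e = -d"
      then have "th d h \<otimes>\<^bsub>G\<^esub> s \<in> Hs d" using rep_eq_one_iff hc w S_carrier by auto
      then have "s \<in> Hs d" using Hs_cancel_left th_closed[OF d h] w S_carrier by metis
      then show False using S_Hs w a False by auto
    qed
    then show ?thesis using 2 False hc rh by (auto simp: Let_def)
  qed
qed

abbreviation gm_mult (infixl "\<cdot>" 70) where "x \<cdot> y \<equiv> x \<otimes>\<^bsub>Gm\<^esub> y"

definition td :: "int \<Rightarrow> 'b" where "td d = \<tau> [^]\<^bsub>Gm\<^esub> d"

lemma td_carrier: "td d \<in> carrier Gm"
  using tau_carrier by (simp add: td_def)

lemma td_neg: "td (-d) = inv\<^bsub>Gm\<^esub> (td d)"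
  using tau_carrier by (simp add: td_def Gm.int_pow_neg)

lemma td_1: "td 1 = \<tau>" and td_m1: "td (-1) = inv\<^bsub>Gm\<^esub> \<tau>"
  using tau_carrier by (simp_all add: td_def Gm.int_pow_neg)

lemma td_cancel: "x \<in> carrier Gm \<Longrightarrow> td (-d) \<cdot> (td d \<cdot> x) = x"
  "x \<in> carrier Gm \<Longrightarrow> td d \<cdot> (td (-d) \<cdot> x) = x"
  using td_carrier[of d] by (simp_all add: td_neg Gm.m_assoc[symmetric])

lemma td_comm:
  assumes "e = 1 \<or> e = -1" "h \<in> Hs (-e)"
  shows "\<iota> h \<cdot> td e = td e \<cdot> \<iota> (th e h)"
proof -
  have main: "\<iota> h \<cdot> \<tau> = \<tau> \<cdot> \<iota> (\<theta> h)" if "h \<in> H" for h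
  proof -
    have "\<iota> h \<in> carrier Gm" using that H_subset by auto
    moreover have "\<tau> \<cdot> \<iota> (\<theta> h) = \<tau> \<cdot> (inv\<^bsub>Gm\<^esub> \<tau> \<cdot> \<iota> h \<cdot> \<tau>)" using tau_rel that by simp
    ultimately show ?thesis using tau_carrier by (simp add: Gm.m_assoc[symmetric])
  qed
  show ?thesis using assms(1)
  proof
    assume "e = 1"
    then show ?thesis using assms main by (simp add: Hs_def th_def td_1)
  next
    assume e: "e = -1"
    then obtain k where k: "k \<in> H" "h = \<theta> k" using assms by (auto simp: Hs_def)
    then have c: "\<iota> k \<in> carrier Gm" "\<iota> h \<in> carrier Gm" using H_subset theta_closed by auto
    have "\<iota> h = inv\<^bsub>Gm\<^esub> \<tau> \<cdot> \<iota> k \<cdot> \<tau>" using tau_rel k by simp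
    then have "\<iota> h \<cdot> inv\<^bsub>Gm\<^esub> \<tau> = inv\<^bsub>Gm\<^esub> \<tau> \<cdot> \<iota> k"
      using c tau_carrier by (simp add: Gm.m_assoc)
    then show ?thesis using e k th_inj by (simp add: th_def td_m1 the_inv_into_f_f)
  qed
qed

definition is_action :: "('b \<Rightarrow> ('a \<times> int) list \<times> 'a \<Rightarrow> ('a \<times> int) list \<times> 'a) \<Rightarrow> bool" where
  "is_action act \<longleftrightarrow>
    (\<forall>x\<in>carrier Gm. \<forall>y\<in>carrier Gm. \<forall>p\<in>W. act (x \<cdot> y) p = act x (act y p)) \<and>
    (\<forall>g\<in>carrier G. \<forall>p\<in>W. act (\<iota> g) p = gact g p) \<and>
    (\<forall>d. d = 1 \<or> d = -1 \<longrightarrow> (\<forall>p\<in>W. act (td d) p = tact d p))"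

text \<open>\<open>gact\<close> and \<open>tact\<close> permute \<open>W\<close> and respect the
  defining relation, so the universal property turns them into an action. The target is a group of
  functions on \<open>W\<close>, hence the need for \<open>universal\<close> at an arbitrary
  type.\<close>

lemma action_exists: "\<exists>act. is_action act"
proof -
  let ?P = "BijGroup W"
  interpret P: group ?P by (rule group_BijGroup)
  define \<phi> where "\<phi> = (\<lambda>g. restrict (gact g) W)"
  define T where "T = (\<lambda>d. restrict (tact d) W)"
  have phiB: "\<phi> g \<in> Bij W" if g: "g \<in> carrier G" for g
  proof -
    have "bij_betw (gact g) W W"
      by (rule bij_betw_byWitness[where f' = "gact (inv\<^bsub>G\<^esub> g)"])
        (use g gact_W in \<open>auto simp: gact_mult[symmetric] gact_one\<close>)
    then show ?thesis by (auto simp: Bij_def \<phi>_def)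
  qed
  have TB: "T d \<in> Bij W" if d: "d = 1 \<or> d = -1" for d
  proof -
    have "bij_betw (tact d) W W"
      by (rule bij_betw_byWitness[where f' = "tact (-d)"])
        (use d tact_W tact_tact[of d] tact_tact[of "-d"] tact_W[of "-d"] in auto)
    then show ?thesis by (auto simp: Bij_def T_def)
  qed
  have mult: "f \<otimes>\<^bsub>?P\<^esub> g = compose W f g" if "f \<in> Bij W" "g \<in> Bij W" for f g
    using that by (simp add: BijGroup_def)
  have car: "carrier ?P = Bij W" by (simp add: BijGroup_def)
  have phihom: "\<phi> \<in> hom G ?P"
  proof (rule homI)
    show "\<phi> x \<in> carrier ?P" if "x \<in> carrier G" for x using phiB that car by simp
    show "\<phi> (x \<otimes>\<^bsub>G\<^esub> y) = \<phi> x \<otimes>\<^bsub>?P\<^esub> \<phi> y" if "x \<in> carrier G" "y \<in> carrier G" for x y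
      using that phiB gact_W gact_mult by (simp add: mult) (auto simp: \<phi>_def compose_def)
  qed
  have Tinv: "inv\<^bsub>?P\<^esub> (T 1) = T (-1)"
  proof (rule P.inv_equality)
    show "T (-1) \<otimes>\<^bsub>?P\<^esub> T 1 = \<one>\<^bsub>?P\<^esub>"
      using TB[of 1] TB[of "-1"] tact_W[of 1] tact_tact[of 1]
      by (simp add: mult) (auto simp: T_def compose_def BijGroup_def restrict_def)
  qed (use TB car in auto)
  have rel: "inv\<^bsub>?P\<^esub> (T 1) \<otimes>\<^bsub>?P\<^esub> \<phi> h \<otimes>\<^bsub>?P\<^esub> T 1 = \<phi> (\<theta> h)" if h: "h \<in> H" for h
  proof -
    have c: "h \<in> carrier G" "\<theta> h \<in> carrier G" using h H_subset theta_closed by auto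
    have cP: "T 1 \<in> carrier ?P" "\<phi> h \<in> carrier ?P" "\<phi> (\<theta> h) \<in> carrier ?P"
      using TB phiB c car by auto
    have "\<phi> h \<otimes>\<^bsub>?P\<^esub> T 1 = T 1 \<otimes>\<^bsub>?P\<^esub> \<phi> (\<theta> h)"
    proof -
      have "gact h (tact 1 p) = tact 1 (gact (\<theta> h) p)" if "p \<in> W" for p
        using gact_tact[of 1 p h] that h by (simp add: Hs_def th_def)
      then show ?thesis using c TB[of 1] phiB tact_W[of 1] gact_W
        by (simp add: mult) (auto simp: T_def \<phi>_def compose_def restrict_def)
    qed
    then show ?thesis using cP by (metis P.inv_closed P.inv_solve_left P.m_assoc P.m_closed)
  qed
  have t: "T 1 \<in> carrier ?P" using TB car by simp
  obtain \<psi> where psi: "\<psi> \<in> hom Gm ?P" "\<forall>g\<in>carrier G. \<psi> (\<iota> g) = \<phi> g" "\<psi> \<tau> = T 1"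
    using universal[OF group_BijGroup phihom t rel] by blast
  interpret psi: group_hom Gm ?P \<psi>
    using psi(1) by (simp add: group_hom_def group_hom_axioms_def group_BijGroup Gm.group_axioms)
  have psiB: "\<psi> x \<in> Bij W" if "x \<in> carrier Gm" for x using psi.hom_closed[OF that] car by simp
  have "\<psi> (x \<cdot> y) p = \<psi> x (\<psi> y p)" if "x \<in> carrier Gm" "y \<in> carrier Gm" "p \<in> W" for x y p
    using psi.hom_mult[OF that(1,2)] mult psiB that by (simp add: compose_def)
  moreover have "\<psi> (\<iota> g) p = gact g p" if "g \<in> carrier G" "p \<in> W" for g p
    using psi(2) that by (simp add: \<phi>_def)
  moreover have "\<psi> (td d) p = tact d p" if "d = 1 \<or> d = -1" "p \<in> W" for d p
    using that psi(3) tau_carrier Tinv by (auto simp: td_1 td_m1 T_def)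
  ultimately have "is_action \<psi>" unfolding is_action_def by simp
  then show ?thesis by blast
qed

section \<open>Existence and uniqueness of normal forms\<close>

definition ev :: "('a \<times> int) list \<times> 'a \<Rightarrow> 'b" where "ev p = nf_eval Gm \<iota> \<tau> (fst p) (snd p)"

lemma ev_Nil: "ev ([], x) = \<iota> x"
  and ev_Cons: "ev ((s, e) # w, x) = \<iota> s \<cdot> td e \<cdot> ev (w, x)"
  by (simp_all add: ev_def nf_eval_def td_def)

lemma W_Cons: "((s, e) # w, x) \<in> W \<Longrightarrow> (w, x) \<in> W \<and> s \<in> carrier G \<and> (e = 1 \<or> e = -1)"
  using S_carrier by (auto simp: W_def)

lemma ev_carrier: "p \<in> W \<Longrightarrow> ev p \<in> carrier Gm"
proof (cases p)
  fix w x assume "p \<in> W" "p = (w, x)"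
  moreover have "(w, x) \<in> W \<Longrightarrow> ev (w, x) \<in> carrier Gm"
  proof (induction w)
    case Nil
    then show ?case by (simp add: ev_Nil W_def)
  next
    case (Cons l w)
    then show ?case using W_Cons td_carrier by (cases l) (auto simp: ev_Cons)
  qed
  ultimately show ?thesis by simp
qed

lemma ev_gact: "g \<in> carrier G \<Longrightarrow> (w, x) \<in> W \<Longrightarrow> ev (gact g (w, x)) = \<iota> g \<cdot> ev (w, x)"
proof (induction w arbitrary: g)
  case Nil
  then show ?case by (simp add: ev_Nil W_def)
next
  case (Cons l w)
  obtain s e where l: "l = (s, e)" by (cases l)
  have e: "e = 1 \<or> e = -1" and s: "s \<in> carrier G" and w: "(w, x) \<in> W"
    using Cons.prems W_Cons l by auto
  define s' where "s' = rep (-e) (g \<otimes>\<^bsub>G\<^esub> s)"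
  define h where "h = inv\<^bsub>G\<^esub> s' \<otimes>\<^bsub>G\<^esub> (g \<otimes>\<^bsub>G\<^esub> s)"
  have s': "s' \<in> carrier G" using rep_carrier s Cons.prems by (simp add: s'_def)
  have h: "h \<in> Hs (-e)" unfolding h_def s'_def using s Cons.prems by (intro rep_Hs) auto
  have hc: "h \<in> carrier G" "th e h \<in> carrier G" using h th_closed[OF e] Hs_carrier by auto
  have gs: "g \<otimes>\<^bsub>G\<^esub> s = s' \<otimes>\<^bsub>G\<^esub> h" using s s' Cons.prems by (simp add: h_def G.m_assoc[symmetric])
  have ew: "ev (w, x) \<in> carrier Gm" using ev_carrier w by simp
  have "gact g ((s, e) # w, x) = ((s', e) # fst (gact (th e h) (w, x)), snd (gact (th e h) (w, x)))"
    by (simp add: Let_def flip: s'_def h_def)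
  then have "ev (gact g (l # w, x)) = \<iota> s' \<cdot> td e \<cdot> (\<iota> (th e h) \<cdot> ev (w, x))"
    using Cons.IH[OF hc(2) w] l by (simp add: ev_Cons)
  also have "\<dots> = \<iota> s' \<cdot> (td e \<cdot> \<iota> (th e h)) \<cdot> ev (w, x)"
    using s' hc ew td_carrier by (simp add: Gm.m_assoc)
  also have "\<dots> = \<iota> s' \<cdot> (\<iota> h \<cdot> td e) \<cdot> ev (w, x)" using td_comm[OF e h] by simp
  also have "\<dots> = \<iota> (s' \<otimes>\<^bsub>G\<^esub> h) \<cdot> td e \<cdot> ev (w, x)"
    using s' hc ew td_carrier by (simp add: Gm.m_assoc)
  also have "\<dots> = \<iota> g \<cdot> ev (l # w, x)"
    using s Cons.prems ew td_carrier l by (simp add: gs[symmetric] ev_Cons Gm.m_assoc)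
  finally show ?case .
qed

lemma ev_tact:
  assumes "d = 1 \<or> d = -1" "(w, x) \<in> W"
  shows "ev (tact d (w, x)) = td d \<cdot> ev (w, x)"
proof (cases w)
  case Nil
  then show ?thesis using assms td_carrier by (simp add: ev_Nil ev_Cons W_def)
next
  case (Cons l w')
  obtain s e where l: "l = (s, e)" by (cases l)
  have c: "ev (w, x) \<in> carrier Gm" "ev (w', x) \<in> carrier Gm"
    using assms ev_carrier W_Cons Cons l by blast+
  show ?thesis
  proof (cases "s = \<one>\<^bsub>G\<^esub> \<and> e = -d")
    case True
    then show ?thesis using Cons l c td_carrier td_cancel by (simp add: ev_Cons)
  next
    case False
    then have "tact d (w, x) = ((\<one>\<^bsub>G\<^esub>, d) # w, x)" using Cons l by auto
    then show ?thesis using c td_carrier by (simp add: ev_Cons)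
  qed
qed

lemma one_W: "([], \<one>\<^bsub>G\<^esub>) \<in> W" by (simp add: W_def)

lemma ev_surj: assumes "x \<in> carrier Gm" obtains w g where "(w, g) \<in> W" "x = ev (w, g)"
proof -
  have g: "\<iota> g \<cdot> ev p \<in> ev ` W" if "g \<in> carrier G" "p \<in> W" for g p
    using that ev_gact[of g "fst p" "snd p"] gact_W[of g p] by (auto intro!: image_eqI[of _ _ "gact g p"])
  have t: "td d \<cdot> ev p \<in> ev ` W" if "d = 1 \<or> d = -1" "p \<in> W" for d p
    using that ev_tact[of d "fst p" "snd p"] tact_W[of d p] by (auto intro!: image_eqI[of _ _ "tact d p"])
  have "x \<in> generate Gm (\<iota> ` carrier G \<union> {\<tau>})" using assms carrier_Gm by simp
  \<comment> \<open>Generalised from \<open>x\<close> to the products \<open>x \<cdot> ev p\<close>: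
    the image of \<open>ev\<close> is stable under left multiplication, and the product case is a
    composition.\<close>
  then have "\<forall>p\<in>W. x \<cdot> ev p \<in> ev ` W"
  proof induction
    case one
    then show ?case using ev_carrier by auto
  next
    case (incl h)
    then show ?case using g t[of 1] td_1 by auto
  next
    case (inv h)
    then show ?case using g[of "inv\<^bsub>G\<^esub> _"] t[of "-1"] td_m1 by (auto simp flip: iota.hom_inv)
  next
    case (eng h1 h2)
    then have "h1 \<in> carrier Gm" "h2 \<in> carrier Gm" using carrier_Gm by auto
    then show ?case using eng.IH ev_carrier by (auto simp: Gm.m_assoc)
  qed
  then have "x \<cdot> ev ([], \<one>\<^bsub>G\<^esub>) \<in> ev ` W" using one_W by blast
  then have "x \<in> ev ` W" using assms by (simp add: ev_Nil)
  then show ?thesis using that by auto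
qed

text \<open>Acting on the empty normal form rebuilds the word letter by letter, so an element of
  \<open>Gm\<close> remembers its normal form. \<open>ev_inj\<close> extracts the uniqueness from
  this.\<close>

lemma act_ev:
  fixes act :: "'b \<Rightarrow> ('a \<times> int) list \<times> 'a \<Rightarrow> ('a \<times> int) list \<times> 'a"
  assumes "is_action act"
  shows "(w, x) \<in> W \<Longrightarrow> act (ev (w, x)) ([], \<one>\<^bsub>G\<^esub>) = (w, x)"
  proof (induction w)
  case Nil
  then show ?case using assms one_W by (simp add: ev_Nil W_def is_action_def)
next
  case (Cons l w)
  obtain s e where l: "l = (s, e)" by (cases l)
  have e: "e = 1 \<or> e = -1" and s: "s \<in> carrier G" and w: "(w, x) \<in> W"
    using Cons.prems W_Cons l by auto
  have sS: "s \<in> S (-e)" using Cons.prems l by (simp add: W_def)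
  have c: "ev (w, x) \<in> carrier Gm" "\<iota> s \<in> carrier Gm" using w ev_carrier s by auto
  have "act (ev (l # w, x)) ([], \<one>\<^bsub>G\<^esub>) = act (\<iota> s) (act (td e) (act (ev (w, x)) ([], \<one>\<^bsub>G\<^esub>)))"
    using l c td_carrier assms one_W Cons.IH[OF w] w by (simp add: ev_Cons Gm.m_assoc is_action_def)
  also have "\<dots> = gact s (tact e (w, x))"
    using Cons.IH[OF w] assms s e w tact_W by (auto simp: is_action_def)
  \<comment> \<open>Nothing cancels: \<open>w\<close> cannot begin with the letter 1 and exponent
    -e, because \<open>(s, e) # w\<close> is a normal form.\<close>
  also have "tact e (w, x) = ((\<one>\<^bsub>G\<^esub>, e) # w, x)"
    using Cons.prems l e by (cases w) (auto simp: W_def)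
  also have "gact s ((\<one>\<^bsub>G\<^esub>, e) # w, x) = (l # w, x)"
    using s sS rep_S th_one[OF e] gact_one[OF w] l by simp
  finally show ?case .
qed

lemma ev_inj: assumes "p \<in> W" "q \<in> W" "ev p = ev q" shows "p = q"
proof -
  obtain act where "is_action act" using action_exists by (rule exE)
  note e = act_ev[OF this]
  have "p = act (ev p) ([], \<one>\<^bsub>G\<^esub>)" by (cases p, simp only:, rule e[symmetric]) (use assms in simp)
  also have "\<dots> = act (ev q) ([], \<one>\<^bsub>G\<^esub>)" by (simp only: assms(3))
  also have "\<dots> = q" by (cases q, simp only:, rule e) (use assms in simp)
  finally show ?thesis .
qed

section \<open>Half-trees and edge groups in terms of normal forms\<close>

definition A :: "int \<Rightarrow> 'b set" where "A d = T_dagger G Sm1 S1 Gm \<iota> \<tau> d"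
definition V :: "'b set" where "V = \<iota> ` carrier G"
text \<open>The sign is reversed because the letter in front of tau^d is a representative modulo
  \<open>Hs (-d)\<close>: an element of \<open>V\<close> preserves \<open>A d\<close> exactly when
  it lies in \<open>E d\<close>.\<close>

definition E :: "int \<Rightarrow> 'b set" where "E d = \<iota> ` Hs (-d)"

lemma A_iff:
  assumes "(w, x) \<in> W" shows "ev (w, x) \<in> A d \<longleftrightarrow> w \<noteq> [] \<and> hd w = (\<one>\<^bsub>G\<^esub>, d)"
proof -
  have "ev (w, x) \<in> A d \<longleftrightarrow> (\<exists>w' g. (w', g) \<in> W \<and> w' \<noteq> [] \<and> hd w' = (\<one>\<^bsub>G\<^esub>, d) \<and> ev (w, x) = ev (w', g))"
    using ev_carrier[OF assms] by (auto simp: A_def T_dagger_def nf_word_iff W_def ev_def prod_eq_iff)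
  also have "\<dots> \<longleftrightarrow> w \<noteq> [] \<and> hd w = (\<one>\<^bsub>G\<^esub>, d)" using ev_inj[OF assms] assms by auto
  finally show ?thesis .
qed

lemma A_carrier: "A d \<subseteq> carrier Gm" by (auto simp: A_def T_dagger_def)

lemma V_iff: assumes "(w, x) \<in> W" shows "ev (w, x) \<in> V \<longleftrightarrow> w = []"
proof
  assume "ev (w, x) \<in> V"
  then obtain g where "g \<in> carrier G" "ev (w, x) = ev ([], g)" by (auto simp: V_def ev_Nil)
  then show "w = []" using ev_inj[OF assms, of "([], g)"] by (simp add: W_def)
qed (use assms in \<open>auto simp: V_def ev_Nil W_def\<close>)

lemma iota_inj: assumes "g \<in> carrier G" "h \<in> carrier G" "\<iota> g = \<iota> h" shows "g = h"
  using ev_inj[of "([], g)" "([], h)"] assms by (simp add: ev_Nil W_def)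

lemma V_subgroup: "subgroup V Gm"
  unfolding V_def by (rule iota.subgroup_img_is_subgroup[OF G.subgroup_self])

lemma V_carrier: "v \<in> V \<Longrightarrow> v \<in> carrier Gm"
  using V_subgroup subgroup.subset by blast

lemma E_subgroup: "subgroup (E d) Gm"
  unfolding E_def by (rule iota.subgroup_img_is_subgroup[OF subgroup_Hs])

lemma E_V: "E d \<subseteq> V" by (auto simp: E_def V_def Hs_carrier)

lemma E_iff: "g \<in> carrier G \<Longrightarrow> \<iota> g \<in> E d \<longleftrightarrow> g \<in> Hs (-d)"
  using iota_inj Hs_carrier by (auto simp: E_def)

lemma A_not_V: "x \<in> A d \<Longrightarrow> x \<notin> V"
proof
  assume x: "x \<in> A d" "x \<in> V"
  then obtain w g where w: "(w, g) \<in> W" "x = ev (w, g)" using A_carrier ev_surj by blast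
  then show False using x A_iff[OF w(1)] V_iff[OF w(1)] by simp
qed

lemma A_mult_V: assumes "x \<in> A d" "v \<in> V" shows "x \<cdot> v \<in> A d"
proof -
  obtain w g where w: "(w, g) \<in> W" "x = ev (w, g)" using assms A_carrier ev_surj by blast
  obtain k where k: "k \<in> carrier G" "v = \<iota> k" using assms by (auto simp: V_def)
  have "(w, g \<otimes>\<^bsub>G\<^esub> k) \<in> W" using w k by (auto simp: W_def)
  moreover have "ev (w, g) \<cdot> \<iota> k = ev (w, g \<otimes>\<^bsub>G\<^esub> k)" using w(1)
  proof (induction w)
    case Nil
    then show ?case using k by (simp add: ev_Nil W_def)
  next
    case (Cons l w)
    obtain s e where l: "l = (s, e)" by (cases l)
    have "(w, g) \<in> W" "s \<in> carrier G" using Cons.prems W_Cons l by auto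
    moreover have "ev (w, g) \<in> carrier Gm" using calculation ev_carrier by blast
    ultimately have "ev (l # w, g) \<cdot> \<iota> k = \<iota> s \<cdot> td e \<cdot> (ev (w, g) \<cdot> \<iota> k)"
      using k td_carrier l by (simp add: ev_Cons Gm.m_assoc)
    then show ?case using Cons.IH \<open>(w, g) \<in> W\<close> l by (simp add: ev_Cons)
  qed
  ultimately show ?thesis using assms(1) w k A_iff[OF w(1)] A_iff[of w "g \<otimes>\<^bsub>G\<^esub> k"] by simp
qed

text \<open>Multiplying by \<open>g\<close> replaces the first letter 1 by \<open>rep (-d) g\<close>
  and keeps the exponent \<open>d\<close>; the new letter is 1 exactly for \<open>g\<close> in
  \<open>Hs (-d)\<close>.\<close>

lemma V_act_A:
  assumes "d = 1 \<or> d = -1" "x \<in> A d" "g \<in> carrier G"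
  shows "\<iota> g \<cdot> x \<in> A d \<longleftrightarrow> g \<in> Hs (-d)" "\<iota> g \<cdot> x \<notin> A (-d)"
proof -
  obtain w y where w: "(w, y) \<in> W" "x = ev (w, y)" using assms A_carrier ev_surj by blast
  then have w': "w \<noteq> []" "hd w = (\<one>\<^bsub>G\<^esub>, d)" using assms A_iff by auto
  obtain v z where vz: "gact g (w, y) = (v, z)" by fastforce
  have "(v, z) \<in> W" using gact_W[OF assms(3) w(1)] vz by simp
  moreover have "\<iota> g \<cdot> x = ev (v, z)" using ev_gact[OF assms(3) w(1)] vz w by simp
  moreover have "v \<noteq> []" "hd v = (rep (-d) g, d)"
    using gact_props[of g w y] w w' vz assms by (auto simp: W_def)
  ultimately show "\<iota> g \<cdot> x \<in> A d \<longleftrightarrow> g \<in> Hs (-d)" "\<iota> g \<cdot> x \<notin> A (-d)"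
    using A_iff rep_eq_one_iff assms by auto
qed

lemma E_act_A: "d = 1 \<or> d = -1 \<Longrightarrow> h \<in> E d \<Longrightarrow> x \<in> A d \<Longrightarrow> h \<cdot> x \<in> A d"
  using V_act_A Hs_carrier by (auto simp: E_def)

lemma V_disj_A: "d = 1 \<or> d = -1 \<Longrightarrow> v \<in> V \<Longrightarrow> v \<notin> E d \<Longrightarrow> x \<in> A d \<Longrightarrow> v \<cdot> x \<notin> A d"
  using V_act_A E_iff by (auto simp: V_def)

lemma V_disj_A': "d = 1 \<or> d = -1 \<Longrightarrow> v \<in> V \<Longrightarrow> x \<in> A d \<Longrightarrow> v \<cdot> x \<notin> A (-d)"
  unfolding V_def using V_act_A(2)[of d x] by blast

text \<open>So \<open>td d\<close> maps the complement of \<open>A (-d)\<close> onto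
  \<open>A d\<close>. A leading tau^d survives unless the word begins with tau^-d, and what remains
  after that cancellation cannot begin with tau^d.\<close>

lemma td_A:
  assumes d: "d = 1 \<or> d = -1" and "x \<in> carrier Gm"
  shows "td d \<cdot> x \<in> A d \<longleftrightarrow> x \<notin> A (-d)"
proof -
  obtain w y where w: "(w, y) \<in> W" "x = ev (w, y)" using assms ev_surj by blast
  have "td d \<cdot> x = ev (tact d (w, y))" using ev_tact d w by simp
  moreover obtain v z where vz: "tact d (w, y) = (v, z)" by fastforce
  moreover have "(v, z) \<in> W" using tact_W[OF d w(1)] vz by simp
  moreover have "(v \<noteq> [] \<and> hd v = (\<one>\<^bsub>G\<^esub>, d)) \<longleftrightarrow> \<not> (w \<noteq> [] \<and> hd w = (\<one>\<^bsub>G\<^esub>, -d))"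
  proof (cases w)
    case Nil
    then show ?thesis using vz by auto
  next
    case (Cons l w')
    obtain s e where l: "l = (s, e)" by (cases l)
    have "w' \<noteq> [] \<Longrightarrow> hd w' = (\<one>\<^bsub>G\<^esub>, d) \<Longrightarrow> e = d" using w Cons l by (auto simp: W_def)
    then show ?thesis using vz Cons l d by (auto split: if_splits)
  qed
  ultimately show ?thesis using A_iff w by simp
qed

text \<open>Each factor \<open>td (-d)\<close> strips one leading tau^d, and words are finite.
  Geometrically, the translates of \<open>A d\<close> by the powers of \<open>td d\<close> have
  empty intersection.\<close>

lemma td_pow_leaves_A:
  assumes d: "d = 1 \<or> d = -1" and "z \<in> carrier Gm"
  shows "\<exists>n. td (-d) [^]\<^bsub>Gm\<^esub> (n::nat) \<cdot> z \<notin> A d"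
proof -
  have "\<exists>n. td (-d) [^]\<^bsub>Gm\<^esub> (n::nat) \<cdot> ev (w, y) \<notin> A d" if "(w, y) \<in> W" for w y
    using that
  proof (induction w)
    case Nil
    then show ?case using A_iff[OF Nil] ev_carrier[OF Nil] by (intro exI[of _ 0]) simp
  next
    case (Cons l w)
    show ?case
    proof (cases "l = (\<one>\<^bsub>G\<^esub>, d)")
      case False
      then show ?thesis using A_iff[OF Cons.prems] ev_carrier[OF Cons.prems] by (intro exI[of _ 0]) simp
    next
      case True
      have w: "(w, y) \<in> W" using Cons.prems W_Cons True by blast
      then obtain n where n: "td (-d) [^]\<^bsub>Gm\<^esub> (n::nat) \<cdot> ev (w, y) \<notin> A d" using Cons.IH by blast
      have "td (-d) \<cdot> ev (l # w, y) = ev (w, y)"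
        using True w ev_carrier td_carrier td_cancel by (simp add: ev_Cons)
      then have "td (-d) [^]\<^bsub>Gm\<^esub> (Suc n) \<cdot> ev (l # w, y) = td (-d) [^]\<^bsub>Gm\<^esub> n \<cdot> ev (w, y)"
        using td_carrier ev_carrier[OF Cons.prems] by (simp add: Gm.m_assoc)
      then show ?thesis using n by (intro exI[of _ "Suc n"]) simp
    qed
  qed
  moreover obtain w y where "(w, y) \<in> W" "z = ev (w, y)" using assms ev_surj by blast
  ultimately show ?thesis by blast
qed

lemma nfw_append:
  "nfw (u @ v) \<longleftrightarrow> nfw u \<and> nfw v \<and>
    (u \<noteq> [] \<and> v \<noteq> [] \<and> fst (hd v) = \<one>\<^bsub>G\<^esub> \<longrightarrow> snd (hd v) = snd (last u))"
  by (induction u rule: nfw.induct) (auto simp: hd_append)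

lemma ev_append:
  assumes "(w, x) \<in> W" "y \<in> carrier Gm" "\<iota> x \<cdot> y = ev (v, z)"
  shows "ev (w, x) \<cdot> y = ev (w @ v, z)"
  using assms(1)
proof (induction w)
  case Nil
  then show ?case using assms by (simp add: ev_Nil)
next
  case (Cons l w)
  obtain s e where l: "l = (s, e)" by (cases l)
  have "e = 1 \<or> e = -1" "s \<in> carrier G" "(w, x) \<in> W" using Cons.prems l W_Cons by auto
  moreover have "ev (w, x) \<in> carrier Gm" using calculation ev_carrier by blast
  ultimately have "ev (l # w, x) \<cdot> y = \<iota> s \<cdot> td e \<cdot> (ev (w, x) \<cdot> y)"
    using assms(2) td_carrier l by (simp add: ev_Cons Gm.m_assoc)
  then show ?case using Cons.IH \<open>(w, x) \<in> W\<close> l by (simp add: ev_Cons)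
qed

lemma ev_snoc:
  assumes "nfw (w @ [(s, e)])" "x \<in> carrier G"
  shows "ev (w @ [(s, e)], x) = ev (w, s) \<cdot> (td e \<cdot> \<iota> x)"
proof (rule ev_append[symmetric])
  have "s \<in> carrier G" using assms S_carrier by (auto simp: nfw_append)
  then show "(w, s) \<in> W" "td e \<cdot> \<iota> x \<in> carrier Gm" "\<iota> s \<cdot> (td e \<cdot> \<iota> x) = ev ([(s, e)], x)"
    using assms td_carrier by (auto simp: W_def nfw_append ev_Cons ev_Nil Gm.m_assoc)
qed

text \<open>Seen from the vertex reached by the prefix, the base edge does not lie in the direction
  of the next step tau^e, because a reduced path does not backtrack. The induction removes the last
  letter, since it comes first in the inverse.\<close>

lemma inv_prefix_not_A:
  "nfw (w @ [(s, e)]) \<Longrightarrow> inv\<^bsub>Gm\<^esub> (ev (w, s)) \<notin> A e"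
proof (induction w arbitrary: s e rule: rev_induct)
  case Nil
  then have "s \<in> carrier G" using S_carrier by auto
  then have "inv\<^bsub>Gm\<^esub> (ev ([], s)) \<in> V" by (auto simp: ev_Nil V_def simp flip: iota.hom_inv)
  then show ?case using A_not_V by blast
next
  case (snoc l w)
  obtain s1 e1 where l: "l = (s1, e1)" by (cases l)
  have n: "nfw (w @ [(s1, e1)])" "e1 = 1 \<or> e1 = -1" "e = 1 \<or> e = -1" "s \<in> S (-e)" "s = \<one>\<^bsub>G\<^esub> \<longrightarrow> e = e1"
    using snoc.prems l by (auto simp: nfw_append)
  have c: "s \<in> carrier G" "s1 \<in> carrier G" using n S_carrier by (auto simp: nfw_append)
  then have c1: "ev (w, s1) \<in> carrier Gm" using n ev_carrier by (auto simp: W_def nfw_append)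
  define y where "y = td (-e1) \<cdot> inv\<^bsub>Gm\<^esub> (ev (w, s1))"
  have "inv\<^bsub>Gm\<^esub> (ev (w, s1)) \<notin> A e1" using snoc.IH n by blast
  then have y: "y \<in> A (-e1)" using td_A[of "-e1" "inv\<^bsub>Gm\<^esub> (ev (w, s1))"] n c1 by (auto simp: y_def)
  have yc: "y \<in> carrier Gm" using td_carrier c1 by (simp add: y_def)
  have "inv\<^bsub>Gm\<^esub> (ev (w @ [l], s)) = \<iota> (inv\<^bsub>G\<^esub> s) \<cdot> y"
    using ev_snoc[OF n(1) c(1)] l c c1 td_carrier
    by (simp add: y_def td_neg Gm.inv_mult_group Gm.m_assoc)
  moreover have "\<iota> (inv\<^bsub>G\<^esub> s) \<cdot> y \<notin> A e"
  proof (cases "e = e1")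
    case True
    then show ?thesis using V_act_A(2)[of "-e1" y "inv\<^bsub>G\<^esub> s"] n y c by auto
  next
    case False
    then have e: "e = -e1" using n by auto
    then have "s \<noteq> \<one>\<^bsub>G\<^esub>" using n by auto
    then have "s \<notin> Hs (-e)" using S_Hs n by simp
    then have "inv\<^bsub>G\<^esub> s \<notin> Hs (-e)" using Hs_inv[of "inv\<^bsub>G\<^esub> s"] c by auto
    then show ?thesis using V_act_A(1)[of "-e1" y "inv\<^bsub>G\<^esub> s"] n y c e by auto
  qed
  ultimately show ?case by simp
qed

text \<open>That the inverse of \<open>q\<close> avoids \<open>A d\<close> says that the translate
  of \<open>A d\<close> by \<open>q\<close> omits the base edge. The normal forms of
  \<open>q\<close> and \<open>y\<close> then concatenate, up to the group element in between, and as
  \<open>q\<close> is outside \<open>V\<close> the first letter is that of \<open>q\<close>.\<close>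

lemma mult_A_iff:
  assumes d: "d = 1 \<or> d = -1" and q: "q \<in> carrier Gm" "q \<notin> V" "inv\<^bsub>Gm\<^esub> q \<notin> A d" and y: "y \<in> A d"
  shows "q \<cdot> y \<in> A e \<longleftrightarrow> q \<in> A e"
proof -
  obtain w x where w: "(w, x) \<in> W" "q = ev (w, x)" using q ev_surj by blast
  then have "w \<noteq> []" using V_iff q by auto
  then obtain w0 s e0 where w0: "w = w0 @ [(s, e0)]" by (cases w rule: rev_cases) auto
  have n: "nfw (w0 @ [(s, e0)])" "x \<in> carrier G" using w w0 by (auto simp: W_def)
  then have e0: "e0 = 1 \<or> e0 = -1" "s \<in> carrier G" "nfw w0" using S_carrier by (auto simp: nfw_append)
  have c0: "ev (w0, s) \<in> carrier Gm" using e0 ev_carrier by (auto simp: W_def)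
  obtain v z where v: "(v, z) \<in> W" "y = ev (v, z)" using y A_carrier ev_surj by blast
  have yc: "y \<in> carrier Gm" using v ev_carrier by simp
  obtain v2 z2 where v2: "gact x (v, z) = (v2, z2)" by fastforce
  have v2W: "(v2, z2) \<in> W" using gact_W[OF n(2) v(1)] v2 by simp
  have xy: "\<iota> x \<cdot> y = ev (v2, z2)" using ev_gact[OF n(2) v(1)] v2 v by simp
  have hd2: "v2 \<noteq> []" "hd v2 = (rep (-d) x, d)"
    using gact_props[of x v z] v n y A_iff[OF v(1)] v2 by (auto simp: W_def)
  \<comment> \<open>The junction is reduced: otherwise \<open>q\<close> would end in tau^-d followed
    by an element of \<open>Hs (-d)\<close>, and its inverse would begin with tau^d.\<close>
  have "e0 = d" if "rep (-d) x = \<one>\<^bsub>G\<^esub>"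
  proof (rule ccontr)
    assume "e0 \<noteq> d"
    then have e: "e0 = -d" using e0 d by auto
    have "inv\<^bsub>G\<^esub> x \<in> Hs (-d)" using that n rep_eq_one_iff Hs_inv by auto
    moreover have "td d \<cdot> inv\<^bsub>Gm\<^esub> (ev (w0, s)) \<in> A d"
      using td_A[OF d, of "inv\<^bsub>Gm\<^esub> (ev (w0, s))"] inv_prefix_not_A[OF n(1)] c0 e by simp
    ultimately have "\<iota> (inv\<^bsub>G\<^esub> x) \<cdot> (td d \<cdot> inv\<^bsub>Gm\<^esub> (ev (w0, s))) \<in> A d"
      using V_act_A[OF d] n by blast
    moreover have "inv\<^bsub>Gm\<^esub> q = \<iota> (inv\<^bsub>G\<^esub> x) \<cdot> (td d \<cdot> inv\<^bsub>Gm\<^esub> (ev (w0, s)))"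
      using ev_snoc[OF n] w w0 e n c0 td_carrier
      by (simp add: td_neg Gm.inv_mult_group Gm.m_assoc)
    ultimately show False using q by simp
  qed
  then have "(w @ v2, z2) \<in> W" using hd2 v2W w w0 by (auto simp: W_def nfw_append)
  moreover have "q \<cdot> y = ev (w @ v2, z2)" using ev_append[OF w(1) yc xy] w by simp
  ultimately show ?thesis using A_iff w \<open>w \<noteq> []\<close> by simp
qed

end

section \<open>Half-trees and fixators\<close>

context hnn begin

text \<open>The element \<open>r\<close> stands for the edge \<open>rH\<close> of the Bass--Serre tree, \<open>A d\<close> for the half-tree entered
  along the edge from the base vertex \<open>V\<close> to \<open>\<tau>\<^sup>d V\<close>, and \<open>E d\<close> is the stabilizer of that edge.\<close>

definition Fix :: "'b set \<Rightarrow> 'b set" where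
  "Fix X = {x \<in> carrier Gm. \<forall>r\<in>X. inv\<^bsub>Gm\<^esub> r \<cdot> x \<cdot> r \<in> E 1}"

definition saturated :: "'b set \<Rightarrow> bool" where
  "saturated X \<longleftrightarrow> X \<subseteq> carrier Gm \<and> (\<forall>r\<in>X. \<forall>h\<in>E 1. r \<cdot> h \<in> X)"

lemma mult_inv_cancel [simp]:
  assumes "x \<in> carrier Gm" "y \<in> carrier Gm"
  shows "x \<cdot> (inv\<^bsub>Gm\<^esub> x \<cdot> y) = y" "inv\<^bsub>Gm\<^esub> x \<cdot> (x \<cdot> y) = y"
  using assms by (simp_all add: Gm.m_assoc[symmetric])

lemma E_carrier: "h \<in> E d \<Longrightarrow> h \<in> carrier Gm"
  using E_V V_carrier by blast

lemma E_mult: "h \<in> E d \<Longrightarrow> k \<in> E d \<Longrightarrow> h \<cdot> k \<in> E d"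
  and E_inv: "h \<in> E d \<Longrightarrow> inv\<^bsub>Gm\<^esub> h \<in> E d" and E_one: "\<one>\<^bsub>Gm\<^esub> \<in> E d"
  using E_subgroup by (simp_all add: subgroup.m_closed subgroup.m_inv_closed subgroup.one_closed)

lemma Fix_carrier: "x \<in> Fix X \<Longrightarrow> x \<in> carrier Gm" by (simp add: Fix_def)

lemma conj_set_iff:
  assumes "r \<in> carrier Gm" "X \<subseteq> carrier Gm"
  shows "x \<in> conj_set Gm r X \<longleftrightarrow> x \<in> carrier Gm \<and> inv\<^bsub>Gm\<^esub> r \<cdot> x \<cdot> r \<in> X"
proof
  assume "x \<in> conj_set Gm r X"
  then obtain h where h: "h \<in> X" "x = r \<cdot> (h \<cdot> inv\<^bsub>Gm\<^esub> r)"
    by (auto simp: conj_set_def l_coset_def r_coset_def)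
  then have "h \<in> carrier Gm" using assms by auto
  moreover from this have "inv\<^bsub>Gm\<^esub> r \<cdot> x \<cdot> r = h" using h assms(1)
    by (simp add: Gm.m_assoc)
  ultimately show "x \<in> carrier Gm \<and> inv\<^bsub>Gm\<^esub> r \<cdot> x \<cdot> r \<in> X" using h assms by simp
next
  assume x: "x \<in> carrier Gm \<and> inv\<^bsub>Gm\<^esub> r \<cdot> x \<cdot> r \<in> X"
  then have "x = r \<cdot> (inv\<^bsub>Gm\<^esub> r \<cdot> x \<cdot> r \<cdot> inv\<^bsub>Gm\<^esub> r)" using assms(1)
    by (simp add: Gm.m_assoc)
  then show "x \<in> conj_set Gm r X" using x by (auto simp: conj_set_def l_coset_def r_coset_def)
qed

lemma E_1: "E 1 = \<iota> ` H" by (simp add: E_def Hs_def)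

lemma Inter_conj_set:
  assumes "X \<subseteq> carrier Gm" "X \<noteq> {}"
  shows "(\<Inter>r\<in>X. conj_set Gm r (\<iota> ` H)) = Fix X"
proof -
  have "\<iota> ` H \<subseteq> carrier Gm" using E_1 E_carrier by blast
  then have "x \<in> conj_set Gm r (\<iota> ` H) \<longleftrightarrow> x \<in> carrier Gm \<and> inv\<^bsub>Gm\<^esub> r \<cdot> x \<cdot> r \<in> E 1"
    if "r \<in> X" for x r using conj_set_iff that assms by (auto simp: E_1)
  then show ?thesis using assms by (auto simp: Fix_def)
qed

lemma one_not_A: "\<one>\<^bsub>Gm\<^esub> \<notin> A d"
  using A_not_V V_subgroup subgroup.one_closed by blast

lemma HNN_kernel_Fix: "HNN_kernel Gm \<iota> H = Fix (carrier Gm)"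
  unfolding HNN_kernel_def using Inter_conj_set[of "carrier Gm"] Gm.one_closed by blast

lemma quasi_kernel_Fix: "quasi_kernel G H Sm1 S1 Gm \<iota> \<tau> e = Fix (carrier Gm - A e)"
  unfolding quasi_kernel_def A_def[symmetric]
  using Inter_conj_set[of "carrier Gm - A e"] one_not_A Gm.one_closed by blast

lemma conj_mult:
  assumes "x \<in> carrier Gm" "y \<in> carrier Gm" "r \<in> carrier Gm"
  shows "inv\<^bsub>Gm\<^esub> r \<cdot> (x \<cdot> y) \<cdot> r = (inv\<^bsub>Gm\<^esub> r \<cdot> x \<cdot> r) \<cdot> (inv\<^bsub>Gm\<^esub> r \<cdot> y \<cdot> r)"
proof -
  have "(inv\<^bsub>Gm\<^esub> r \<cdot> x \<cdot> r) \<cdot> (inv\<^bsub>Gm\<^esub> r \<cdot> y \<cdot> r) = inv\<^bsub>Gm\<^esub> r \<cdot> (x \<cdot> ((r \<cdot> inv\<^bsub>Gm\<^esub> r) \<cdot> (y \<cdot> r)))"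
    using assms by (simp only: Gm.m_assoc Gm.m_closed Gm.inv_closed)
  then show ?thesis using assms by (simp add: Gm.m_assoc)
qed

lemma conj_inv:
  assumes "x \<in> carrier Gm" "r \<in> carrier Gm"
  shows "inv\<^bsub>Gm\<^esub> r \<cdot> inv\<^bsub>Gm\<^esub> x \<cdot> r = inv\<^bsub>Gm\<^esub> (inv\<^bsub>Gm\<^esub> r \<cdot> x \<cdot> r)"
  using assms by (simp add: Gm.inv_mult_group Gm.m_assoc)

lemma conj_conj:
  assumes "x \<in> carrier Gm" "g \<in> carrier Gm" "r \<in> carrier Gm"
  shows "inv\<^bsub>Gm\<^esub> (g \<cdot> r) \<cdot> x \<cdot> (g \<cdot> r) = inv\<^bsub>Gm\<^esub> r \<cdot> (inv\<^bsub>Gm\<^esub> g \<cdot> x \<cdot> g) \<cdot> r"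
  using assms by (simp add: Gm.inv_mult_group Gm.m_assoc)

lemma Fix_subgroup: assumes "X \<subseteq> carrier Gm" shows "subgroup (Fix X) Gm"
proof (rule Gm.subgroupI)
  show "Fix X \<subseteq> carrier Gm" by (auto simp: Fix_def)
  have "\<one>\<^bsub>Gm\<^esub> \<in> Fix X" using assms E_one by (auto simp: Fix_def subset_iff)
  then show "Fix X \<noteq> {}" by blast
  show "inv\<^bsub>Gm\<^esub> a \<in> Fix X" if "a \<in> Fix X" for a
    using that assms E_inv by (auto simp: Fix_def subset_iff conj_inv)
  show "a \<cdot> b \<in> Fix X" if "a \<in> Fix X" "b \<in> Fix X" for a b
    using that assms E_mult by (auto simp: Fix_def subset_iff conj_mult)
qed

lemma Fix_anti: "X \<subseteq> Y \<Longrightarrow> Fix Y \<subseteq> Fix X" by (auto simp: Fix_def)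

lemma Fix_mult_set:
  assumes "g \<in> carrier Gm" "x \<in> carrier Gm" "X \<subseteq> carrier Gm" "\<And>r. r \<in> X \<Longrightarrow> g \<cdot> r \<in> Y" "x \<in> Fix Y"
  shows "inv\<^bsub>Gm\<^esub> g \<cdot> x \<cdot> g \<in> Fix X"
  using assms by (auto simp: Fix_def conj_conj[symmetric] subset_iff)

text \<open>\<open>x\<close> fixes the coset of \<open>r\<close> modulo \<open>E 1\<close>, so it
  moves \<open>r\<close> only within it, and \<open>X\<close> is a union of such cosets.\<close>

lemma Fix_mult_mem:
  assumes X: "saturated X" and x: "x \<in> Fix X" and r: "r \<in> X"
  shows "x \<cdot> r \<in> X"
proof -
  have c: "r \<in> carrier Gm" "x \<in> carrier Gm" using assms by (auto simp: saturated_def Fix_def)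
  have "r \<cdot> (inv\<^bsub>Gm\<^esub> r \<cdot> x \<cdot> r) \<in> X" using assms by (auto simp: saturated_def Fix_def)
  moreover have "r \<cdot> (inv\<^bsub>Gm\<^esub> r \<cdot> x \<cdot> r) = x \<cdot> r" using c by (simp add: Gm.m_assoc)
  ultimately show ?thesis by simp
qed

lemma Fix_mult_mem_compl:
  assumes X: "saturated X" and x: "x \<in> Fix X" and r: "r \<in> carrier Gm" "r \<notin> X"
  shows "x \<cdot> r \<notin> X"
proof
  assume "x \<cdot> r \<in> X"
  have c: "x \<in> carrier Gm" using x by (simp add: Fix_def)
  have "inv\<^bsub>Gm\<^esub> x \<in> Fix X" using x Fix_subgroup X saturated_def subgroup.m_inv_closed by metis
  then have "inv\<^bsub>Gm\<^esub> x \<cdot> (x \<cdot> r) \<in> X" using Fix_mult_mem X \<open>x \<cdot> r \<in> X\<close> by blast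
  then show False using c r by simp
qed

lemma saturated_compl: assumes "saturated X" shows "saturated (carrier Gm - X)"
proof -
  have "r \<cdot> h \<notin> X" if "r \<in> carrier Gm" "r \<notin> X" "h \<in> E 1" for r h
  proof
    assume "r \<cdot> h \<in> X"
    then have "r \<cdot> h \<cdot> inv\<^bsub>Gm\<^esub> h \<in> X" using assms that E_inv by (auto simp: saturated_def)
    then show False using that E_carrier by (simp add: Gm.m_assoc)
  qed
  then show ?thesis using E_carrier by (auto simp: saturated_def)
qed

lemma saturated_A: "saturated (A d)"
  unfolding saturated_def using A_mult_V subsetD[OF E_V] A_carrier by blast

text \<open>An element that fixes the complement of \<open>X\<close> preserves \<open>X\<close>, so
  \<open>t\<close> and its conjugate by \<open>k\<close> both fix all of \<open>X\<close>, and so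
  does the commutator. By symmetry it fixes the complement too, hence it lies in the kernel, which
  is trivial.\<close>

lemma Fix_commute:
  assumes triv: "Fix (carrier Gm) = {\<one>\<^bsub>Gm\<^esub>}" and X: "saturated X"
    and k: "k \<in> Fix (carrier Gm - X)" and t: "t \<in> Fix X"
  shows "k \<cdot> t = t \<cdot> k"
proof -
  have c: "k \<in> carrier Gm" "t \<in> carrier Gm" using assms by (auto simp: Fix_def)
  have main: "inv\<^bsub>Gm\<^esub> r \<cdot> (inv\<^bsub>Gm\<^esub> (t \<cdot> k) \<cdot> (k \<cdot> t)) \<cdot> r \<in> E 1"
    if "saturated X" "k \<in> Fix (carrier Gm - X)" "t \<in> Fix X" "r \<in> X" for k t r X
  proof -
    have c: "k \<in> carrier Gm" "t \<in> carrier Gm" "r \<in> carrier Gm" using that by (auto simp: Fix_def saturated_def)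
    have "carrier Gm - (carrier Gm - X) = X" using that by (auto simp: saturated_def)
    then have "k \<cdot> r \<in> X"
      using Fix_mult_mem_compl[OF saturated_compl[OF that(1)] that(2) c(3)] that c by auto
    then have 1: "inv\<^bsub>Gm\<^esub> (k \<cdot> r) \<cdot> t \<cdot> (k \<cdot> r) \<in> E 1" using that by (auto simp: Fix_def)
    have 2: "inv\<^bsub>Gm\<^esub> r \<cdot> t \<cdot> r \<in> E 1" using that by (auto simp: Fix_def)
    have "inv\<^bsub>Gm\<^esub> (inv\<^bsub>Gm\<^esub> (k \<cdot> r) \<cdot> t \<cdot> (k \<cdot> r)) \<cdot> (inv\<^bsub>Gm\<^esub> r \<cdot> t \<cdot> r) \<in> E 1"
      using E_mult E_inv 1 2 by blast
    also have "inv\<^bsub>Gm\<^esub> (inv\<^bsub>Gm\<^esub> (k \<cdot> r) \<cdot> t \<cdot> (k \<cdot> r)) \<cdot> (inv\<^bsub>Gm\<^esub> r \<cdot> t \<cdot> r)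
        = inv\<^bsub>Gm\<^esub> r \<cdot> (inv\<^bsub>Gm\<^esub> k \<cdot> (inv\<^bsub>Gm\<^esub> t \<cdot> (k \<cdot> ((r \<cdot> inv\<^bsub>Gm\<^esub> r) \<cdot> (t \<cdot> r)))))"
      using c by (simp add: Gm.inv_mult_group Gm.m_assoc)
    also have "\<dots> = inv\<^bsub>Gm\<^esub> r \<cdot> (inv\<^bsub>Gm\<^esub> (t \<cdot> k) \<cdot> (k \<cdot> t)) \<cdot> r"
      using c by (simp add: Gm.inv_mult_group Gm.m_assoc)
    finally show ?thesis .
  qed
  let ?z = "inv\<^bsub>Gm\<^esub> (t \<cdot> k) \<cdot> (k \<cdot> t)"
  have "inv\<^bsub>Gm\<^esub> r \<cdot> ?z \<cdot> r \<in> E 1" if r: "r \<in> carrier Gm" for r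
  proof (cases "r \<in> X")
    case True
    then show ?thesis using main assms by blast
  next
    case False
    have "carrier Gm - (carrier Gm - X) = X" using X by (auto simp: saturated_def)
    then have "inv\<^bsub>Gm\<^esub> r \<cdot> (inv\<^bsub>Gm\<^esub> (k \<cdot> t) \<cdot> (t \<cdot> k)) \<cdot> r \<in> E 1"
      using main[OF saturated_compl[OF X], of t k r] False r k t by simp
    then have "inv\<^bsub>Gm\<^esub> (inv\<^bsub>Gm\<^esub> r \<cdot> (inv\<^bsub>Gm\<^esub> (k \<cdot> t) \<cdot> (t \<cdot> k)) \<cdot> r) \<in> E 1" by (rule E_inv)
    then show ?thesis using c r by (simp add: Gm.inv_mult_group Gm.m_assoc)
  qed
  then have "?z \<in> Fix (carrier Gm)" using c by (simp add: Fix_def)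
  then have "(t \<cdot> k) \<cdot> ?z = t \<cdot> k" using triv c by simp
  then show ?thesis using c by (simp add: Gm.inv_mult_group Gm.m_assoc)
qed

lemma disjoint_translate:
  assumes d: "d = 1 \<or> d = -1" and u: "u \<in> carrier Gm" "u \<notin> A d" "inv\<^bsub>Gm\<^esub> u \<notin> A d" "u \<notin> E d"
    and y: "y \<in> A d"
  shows "u \<cdot> y \<notin> A d"
  using assms V_disj_A mult_A_iff[OF d, of u y d] by (cases "u \<in> V") auto

lemma A_mult_subset:
  assumes d: "d = 1 \<or> d = -1" and "q \<in> A e" "inv\<^bsub>Gm\<^esub> q \<notin> A d" "y \<in> A d"
  shows "q \<cdot> y \<in> A e"
  using assms A_carrier A_not_V mult_A_iff[OF d, of q y e] by auto

end

section \<open>Room for disjoint translates in the non-ascending case\<close>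

locale non_ascending_hnn = hnn +
  assumes H_proper: "H \<noteq> carrier G" and thH_proper: "\<theta> ` H \<noteq> carrier G"
begin

lemma ex_V_not_E: obtains v where "v \<in> V" "v \<notin> E d"
proof -
  have "Hs (-d) \<noteq> carrier G" using H_proper thH_proper by (simp add: Hs_def)
  then obtain g where "g \<in> carrier G" "g \<notin> Hs (-d)" using Hs_carrier by blast
  then show ?thesis using that E_iff by (auto simp: V_def)
qed

text \<open>For opposite types, an element \<open>v\<close> of the vertex group outside
  \<open>E e\<close> moves \<open>A e\<close> off itself, and \<open>td d\<close> carries everything
  off \<open>A e\<close> into \<open>A d\<close>. Such a \<open>v\<close> exists because the
  extension is non-ascending.\<close>

lemma A_contains_translate:
  assumes d: "d = 1 \<or> d = -1" and e: "e = 1 \<or> e = -1"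
  shows "\<exists>x\<in>carrier Gm. \<forall>y\<in>A e. x \<cdot> y \<in> A d"
proof (cases "d = e")
  case True
  then show ?thesis using subsetD[OF A_carrier] by (intro bexI[of _ "\<one>\<^bsub>Gm\<^esub>"]) auto
next
  case False
  then have e': "e = -d" using assms by auto
  obtain v where v: "v \<in> V" "v \<notin> E e" by (rule ex_V_not_E)
  have "td d \<cdot> v \<cdot> y \<in> A d" if "y \<in> A e" for y
  proof -
    have c: "y \<in> carrier Gm" using that A_carrier by blast
    have "v \<cdot> y \<notin> A e" using V_disj_A e v that by blast
    then show ?thesis using td_A[OF d, of "v \<cdot> y"] v V_carrier c e' td_carrier by (simp add: Gm.m_assoc)
  qed
  then show ?thesis using v V_carrier td_carrier by (intro bexI[of _ "td d \<cdot> v"]) auto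
qed

lemma A_nonempty: assumes d: "d = 1 \<or> d = -1" shows "td d \<in> A d"
  using td_A[OF d, of "\<one>\<^bsub>Gm\<^esub>"] one_not_A td_carrier by simp

lemma mult_inv_mult_cancel:
  assumes "c \<in> carrier Gm" "x \<in> carrier Gm" "c' \<in> carrier Gm"
  shows "(inv\<^bsub>Gm\<^esub> c' \<cdot> c) \<cdot> (inv\<^bsub>Gm\<^esub> c \<cdot> x) = inv\<^bsub>Gm\<^esub> c' \<cdot> x"
proof -
  have "(inv\<^bsub>Gm\<^esub> c' \<cdot> c) \<cdot> (inv\<^bsub>Gm\<^esub> c \<cdot> x) = inv\<^bsub>Gm\<^esub> c' \<cdot> ((c \<cdot> inv\<^bsub>Gm\<^esub> c) \<cdot> x)"
    using assms by (simp only: Gm.m_assoc Gm.m_closed Gm.inv_closed)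
  then show ?thesis using assms by simp
qed

text \<open>At every vertex of the Bass--Serre tree at least four half-trees are rooted, and they are
  pairwise disjoint, so three points cannot meet all of them.\<close>

lemma ex_direction_avoiding:
  assumes "a \<in> carrier Gm" "b \<in> carrier Gm" "c \<in> carrier Gm"
  shows "\<exists>v\<in>V. \<exists>d. (d = 1 \<or> d = -1) \<and> inv\<^bsub>Gm\<^esub> v \<cdot> a \<notin> A d \<and> inv\<^bsub>Gm\<^esub> v \<cdot> b \<notin> A d \<and> inv\<^bsub>Gm\<^esub> v \<cdot> c \<notin> A d"
proof -
  obtain v where v: "v \<in> V" "v \<notin> E 1" by (rule ex_V_not_E)
  obtain w where w: "w \<in> V" "w \<notin> E (-1)" by (rule ex_V_not_E)
  have vi: "inv\<^bsub>Gm\<^esub> v \<in> V" "inv\<^bsub>Gm\<^esub> v \<notin> E 1" and wi: "inv\<^bsub>Gm\<^esub> w \<in> V" "inv\<^bsub>Gm\<^esub> w \<notin> E (-1)"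
    using v w V_subgroup subgroup.m_inv_closed E_inv[of "inv\<^bsub>Gm\<^esub> v"] E_inv[of "inv\<^bsub>Gm\<^esub> w"] V_carrier by auto
  have vc: "v \<in> carrier Gm" "w \<in> carrier Gm" using v w V_carrier by auto
  have *: "\<not> (x \<in> A 1 \<and> x \<in> A (-1)) \<and> \<not> (x \<in> A 1 \<and> inv\<^bsub>Gm\<^esub> v \<cdot> x \<in> A 1)
      \<and> \<not> (x \<in> A 1 \<and> inv\<^bsub>Gm\<^esub> w \<cdot> x \<in> A (-1)) \<and> \<not> (x \<in> A (-1) \<and> inv\<^bsub>Gm\<^esub> v \<cdot> x \<in> A 1)
      \<and> \<not> (x \<in> A (-1) \<and> inv\<^bsub>Gm\<^esub> w \<cdot> x \<in> A (-1))
      \<and> \<not> (inv\<^bsub>Gm\<^esub> v \<cdot> x \<in> A 1 \<and> inv\<^bsub>Gm\<^esub> w \<cdot> x \<in> A (-1))" if x: "x \<in> carrier Gm" for x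
  proof (intro conjI notI; elim conjE)
    assume "x \<in> A 1" "x \<in> A (-1)"
    then show False using V_disj_A'[of 1 "\<one>\<^bsub>Gm\<^esub>" x] V_subgroup subgroup.one_closed x by fastforce
  next
    assume "x \<in> A 1" "inv\<^bsub>Gm\<^esub> v \<cdot> x \<in> A 1"
    then show False using V_disj_A[of 1] vi by blast
  next
    assume "x \<in> A 1" "inv\<^bsub>Gm\<^esub> w \<cdot> x \<in> A (-1)"
    then show False using V_disj_A'[of 1] wi by blast
  next
    assume "x \<in> A (-1)" "inv\<^bsub>Gm\<^esub> v \<cdot> x \<in> A 1"
    then show False using V_disj_A'[of "-1"] vi by fastforce
  next
    assume "x \<in> A (-1)" "inv\<^bsub>Gm\<^esub> w \<cdot> x \<in> A (-1)"
    then show False using V_disj_A[of "-1"] wi by fastforce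
  next
    assume a: "inv\<^bsub>Gm\<^esub> v \<cdot> x \<in> A 1" "inv\<^bsub>Gm\<^esub> w \<cdot> x \<in> A (-1)"
    have "inv\<^bsub>Gm\<^esub> w \<cdot> v \<in> V" using wi v V_subgroup subgroup.m_closed by metis
    then have "(inv\<^bsub>Gm\<^esub> w \<cdot> v) \<cdot> (inv\<^bsub>Gm\<^esub> v \<cdot> x) \<notin> A (-1)" using V_disj_A'[of 1] a by blast
    then show False using a mult_inv_mult_cancel vc x by simp
  qed
  have one: "\<one>\<^bsub>Gm\<^esub> \<in> V" using V_subgroup subgroup.one_closed by blast
  have "(a \<notin> A 1 \<and> b \<notin> A 1 \<and> c \<notin> A 1) \<or> (a \<notin> A (-1) \<and> b \<notin> A (-1) \<and> c \<notin> A (-1)) \<or>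
    (inv\<^bsub>Gm\<^esub> v \<cdot> a \<notin> A 1 \<and> inv\<^bsub>Gm\<^esub> v \<cdot> b \<notin> A 1 \<and> inv\<^bsub>Gm\<^esub> v \<cdot> c \<notin> A 1) \<or>
    (inv\<^bsub>Gm\<^esub> w \<cdot> a \<notin> A (-1) \<and> inv\<^bsub>Gm\<^esub> w \<cdot> b \<notin> A (-1) \<and> inv\<^bsub>Gm\<^esub> w \<cdot> c \<notin> A (-1))"
    using *[OF assms(1)] *[OF assms(2)] *[OF assms(3)] by argo
  then show ?thesis
  proof (elim disjE)
    assume "a \<notin> A 1 \<and> b \<notin> A 1 \<and> c \<notin> A 1"
    then show ?thesis using one assms by (intro bexI[OF _ one] exI[of _ 1]) simp
  next
    assume "a \<notin> A (-1) \<and> b \<notin> A (-1) \<and> c \<notin> A (-1)"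
    then show ?thesis using one assms by (intro bexI[OF _ one] exI[of _ "-1"]) simp
  qed (use v w in blast)+
qed

text \<open>View \<open>t\<close> from an edge \<open>r\<close> that it moves, as \<open>u\<close>.
  If \<open>u\<close> moves the base vertex, some direction there avoids \<open>u\<close> and its
  inverse; if it fixes the vertex, it moves \<open>A 1\<close> off itself. The direction must avoid
  the inverse of \<open>r\<close> as well: only then does the half-tree, carried back by
  \<open>r\<close>, stay inside \<open>A e\<close>.\<close>

lemma ex_disjoint_translate:
  assumes e: "e = 1 \<or> e = -1" and t: "t \<in> carrier Gm" "t \<notin> Fix (A e)"
  shows "\<exists>q\<in>carrier Gm. \<forall>y\<in>A e. q \<cdot> y \<in> A e \<and> inv\<^bsub>Gm\<^esub> q \<cdot> t \<cdot> q \<cdot> y \<notin> A e"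
proof -
  obtain r where r: "r \<in> A e" "inv\<^bsub>Gm\<^esub> r \<cdot> t \<cdot> r \<notin> E 1" using t by (auto simp: Fix_def)
  define u where "u = inv\<^bsub>Gm\<^esub> r \<cdot> t \<cdot> r"
  have rc: "r \<in> carrier Gm" using r A_carrier by blast
  have uc: "u \<in> carrier Gm" using rc t by (simp add: u_def)
  have "\<exists>c\<in>V. \<exists>d. (d = 1 \<or> d = -1) \<and> inv\<^bsub>Gm\<^esub> c \<cdot> inv\<^bsub>Gm\<^esub> r \<notin> A d \<and>
      (\<forall>y\<in>A d. inv\<^bsub>Gm\<^esub> c \<cdot> u \<cdot> c \<cdot> y \<notin> A d)"
  proof (cases "u \<in> V")
    case False
    obtain c d where cd: "c \<in> V" "d = 1 \<or> d = -1" "inv\<^bsub>Gm\<^esub> c \<cdot> u \<notin> A d" "inv\<^bsub>Gm\<^esub> c \<cdot> inv\<^bsub>Gm\<^esub> u \<notin> A d"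
      "inv\<^bsub>Gm\<^esub> c \<cdot> inv\<^bsub>Gm\<^esub> r \<notin> A d"
      using ex_direction_avoiding[of u "inv\<^bsub>Gm\<^esub> u" "inv\<^bsub>Gm\<^esub> r"] uc rc by auto
    have cc: "c \<in> carrier Gm" and ci: "inv\<^bsub>Gm\<^esub> c \<in> V"
      using cd V_carrier V_subgroup subgroup.m_inv_closed by auto
    have sub: "x \<cdot> c \<in> A d \<longleftrightarrow> x \<in> A d" if "x \<in> carrier Gm" for x
      using A_mult_V[of x d c] A_mult_V[of "x \<cdot> c" d "inv\<^bsub>Gm\<^esub> c"] cd(1) ci cc that by (auto simp: Gm.m_assoc)
    have 1: "inv\<^bsub>Gm\<^esub> c \<cdot> u \<cdot> c \<notin> A d" "inv\<^bsub>Gm\<^esub> (inv\<^bsub>Gm\<^esub> c \<cdot> u \<cdot> c) \<notin> A d"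
      using sub[of "inv\<^bsub>Gm\<^esub> c \<cdot> u"] sub[of "inv\<^bsub>Gm\<^esub> c \<cdot> inv\<^bsub>Gm\<^esub> u"] cd cc uc conj_inv[of u c] by auto
    have nE: "inv\<^bsub>Gm\<^esub> c \<cdot> u \<cdot> c \<notin> E d"
    proof
      assume a: "inv\<^bsub>Gm\<^esub> c \<cdot> u \<cdot> c \<in> E d"
      then have "c \<cdot> (inv\<^bsub>Gm\<^esub> c \<cdot> u \<cdot> c) \<cdot> inv\<^bsub>Gm\<^esub> c \<in> V"
        by (intro subgroup.m_closed[OF V_subgroup subgroup.m_closed[OF V_subgroup cd(1)]] subsetD[OF E_V a] ci)
      moreover have "c \<cdot> (inv\<^bsub>Gm\<^esub> c \<cdot> u \<cdot> c) \<cdot> inv\<^bsub>Gm\<^esub> c = u" using cc uc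
        by (simp add: Gm.m_assoc)
      ultimately show False using False by simp
    qed
    have "inv\<^bsub>Gm\<^esub> c \<cdot> u \<cdot> c \<cdot> y \<notin> A d" if "y \<in> A d" for y
      by (rule disjoint_translate[OF cd(2) _ 1 nE that]) (use cc uc in simp)
    then show ?thesis using cd(2,5) by (intro bexI[OF _ cd(1)] exI[of _ d]) blast
  next
    case True
    have uE: "u \<notin> E 1" using r by (simp add: u_def)
    have dis: "u \<cdot> y \<notin> A 1" if "y \<in> A 1" for y using V_disj_A[of 1] True uE that by blast
    have one: "\<one>\<^bsub>Gm\<^esub> \<in> V" using V_subgroup subgroup.one_closed by blast
    show ?thesis
    proof (cases "inv\<^bsub>Gm\<^esub> r \<in> A 1")
      case False
      then show ?thesis using dis uc rc by (intro bexI[OF _ one] exI[of _ 1] conjI) simp_all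
    next
      \<comment> \<open>Here the translate of \<open>A 1\<close> by \<open>r\<close> contains the
        base edge. The half-tree \<open>u\<close> times \<open>A 1\<close> is disjoint from
        \<open>A 1\<close> and serves instead; conjugating \<open>u\<close> by itself changes
        nothing.\<close>
      case r1: True
      have ui: "inv\<^bsub>Gm\<^esub> u \<in> V" "inv\<^bsub>Gm\<^esub> u \<notin> E 1"
        using subgroup.m_inv_closed[OF V_subgroup True] uE E_inv[of "inv\<^bsub>Gm\<^esub> u" 1] uc by auto
      then have "inv\<^bsub>Gm\<^esub> u \<cdot> inv\<^bsub>Gm\<^esub> r \<notin> A 1" using V_disj_A[of 1] r1 by blast
      moreover have "inv\<^bsub>Gm\<^esub> u \<cdot> u \<cdot> u = u" using uc by simp
      ultimately show ?thesis using dis by (intro bexI[OF _ True] exI[of _ 1] conjI) simp_all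
    qed
  qed
  then obtain c d where cd: "c \<in> V" "d = 1 \<or> d = -1" "inv\<^bsub>Gm\<^esub> c \<cdot> inv\<^bsub>Gm\<^esub> r \<notin> A d"
    "\<And>y. y \<in> A d \<Longrightarrow> inv\<^bsub>Gm\<^esub> c \<cdot> u \<cdot> c \<cdot> y \<notin> A d" by blast
  have cc: "c \<in> carrier Gm" using cd V_carrier by blast
  have "inv\<^bsub>Gm\<^esub> (r \<cdot> c) \<notin> A d" using cd cc rc by (simp add: Gm.inv_mult_group)
  then have sub: "r \<cdot> c \<cdot> y \<in> A e" if "y \<in> A d" for y
    using A_mult_subset[OF cd(2), of "r \<cdot> c" e y] A_mult_V[OF r(1) cd(1)] that by blast
  obtain x where x: "x \<in> carrier Gm" "\<And>y. y \<in> A e \<Longrightarrow> x \<cdot> y \<in> A d"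
    using A_contains_translate[OF cd(2) e] by blast
  let ?q = "r \<cdot> c \<cdot> x"
  have qc: "?q \<in> carrier Gm" using rc cc x by simp
  have "?q \<cdot> y \<in> A e \<and> inv\<^bsub>Gm\<^esub> ?q \<cdot> t \<cdot> ?q \<cdot> y \<notin> A e" if y: "y \<in> A e" for y
  proof
    have yc: "y \<in> carrier Gm" using y A_carrier by blast
    show "?q \<cdot> y \<in> A e" using sub[OF x(2)[OF y]] x(1) rc cc yc by (simp add: Gm.m_assoc)
    show "inv\<^bsub>Gm\<^esub> ?q \<cdot> t \<cdot> ?q \<cdot> y \<notin> A e"
    proof
      assume "inv\<^bsub>Gm\<^esub> ?q \<cdot> t \<cdot> ?q \<cdot> y \<in> A e"
      then have "x \<cdot> (inv\<^bsub>Gm\<^esub> ?q \<cdot> t \<cdot> ?q \<cdot> y) \<in> A d" using x by blast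
      moreover have "x \<cdot> (inv\<^bsub>Gm\<^esub> ?q \<cdot> t \<cdot> ?q \<cdot> y) = (x \<cdot> inv\<^bsub>Gm\<^esub> x) \<cdot> (inv\<^bsub>Gm\<^esub> c \<cdot> u \<cdot> c \<cdot> (x \<cdot> y))"
        using rc cc x(1) yc t(1) by (simp add: u_def Gm.inv_mult_group Gm.m_assoc)
      ultimately show False using cd(4)[of "x \<cdot> y"] x y rc cc yc uc by simp
    qed
  qed
  then show ?thesis using qc by blast
qed

definition thin :: "int \<Rightarrow> 'b \<Rightarrow> bool" where
  "thin e t \<longleftrightarrow> (\<forall>y\<in>A e. t \<cdot> y \<notin> A e)"

lemma thin_conj:
  assumes "t \<in> carrier Gm" "q \<in> carrier Gm" "\<And>y. y \<in> A e \<Longrightarrow> q \<cdot> y \<in> A e" "thin e t"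
  shows "thin e (inv\<^bsub>Gm\<^esub> q \<cdot> t \<cdot> q)"
  unfolding thin_def
proof (intro ballI notI)
  fix y assume y: "y \<in> A e" "inv\<^bsub>Gm\<^esub> q \<cdot> t \<cdot> q \<cdot> y \<in> A e"
  have yc: "y \<in> carrier Gm" using y A_carrier by blast
  have "q \<cdot> (inv\<^bsub>Gm\<^esub> q \<cdot> t \<cdot> q \<cdot> y) \<in> A e" using y assms by blast
  moreover have "q \<cdot> (inv\<^bsub>Gm\<^esub> q \<cdot> t \<cdot> q \<cdot> y) = (q \<cdot> inv\<^bsub>Gm\<^esub> q) \<cdot> (t \<cdot> (q \<cdot> y))"
    using assms(1,2) yc by (simp only: Gm.m_assoc Gm.m_closed Gm.inv_closed)
  ultimately show False using assms yc y by (auto simp: thin_def)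
qed

text \<open>The half-tree is shrunk for one element after another. Conjugating by a \<open>q\<close>
  that maps \<open>A e\<close> into itself amounts to passing to a smaller half-tree, and both
  alternatives are inherited by it.\<close>

lemma ex_Fix_or_thin:
  assumes e: "e = 1 \<or> e = -1" and "finite F" "F \<subseteq> carrier Gm"
  shows "\<exists>q\<in>carrier Gm. (\<forall>y\<in>A e. q \<cdot> y \<in> A e) \<and>
    (\<forall>t\<in>F. inv\<^bsub>Gm\<^esub> q \<cdot> t \<cdot> q \<in> Fix (A e) \<or> thin e (inv\<^bsub>Gm\<^esub> q \<cdot> t \<cdot> q))"
  using assms(2,3)
proof induction
  case empty
  then show ?case using subsetD[OF A_carrier] by (intro bexI[of _ "\<one>\<^bsub>Gm\<^esub>"]) auto
next
  case (insert s F)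
  obtain q where q: "q \<in> carrier Gm" "\<And>y. y \<in> A e \<Longrightarrow> q \<cdot> y \<in> A e"
    "\<And>t. t \<in> F \<Longrightarrow> inv\<^bsub>Gm\<^esub> q \<cdot> t \<cdot> q \<in> Fix (A e) \<or> thin e (inv\<^bsub>Gm\<^esub> q \<cdot> t \<cdot> q)"
    using insert by blast
  define s' where "s' = inv\<^bsub>Gm\<^esub> q \<cdot> s \<cdot> q"
  have sc: "s \<in> carrier Gm" "s' \<in> carrier Gm" using insert q by (auto simp: s'_def)
  show ?case
  proof (cases "s' \<in> Fix (A e)")
    case True
    then show ?thesis using q by (intro bexI[OF _ q(1)]) (auto simp: s'_def)
  next
    case False
    obtain p where p: "p \<in> carrier Gm" "\<And>y. y \<in> A e \<Longrightarrow> p \<cdot> y \<in> A e \<and> inv\<^bsub>Gm\<^esub> p \<cdot> s' \<cdot> p \<cdot> y \<notin> A e"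
      using ex_disjoint_translate[OF e sc(2) False] by blast
    have 1: "inv\<^bsub>Gm\<^esub> (q \<cdot> p) \<cdot> t \<cdot> (q \<cdot> p) = inv\<^bsub>Gm\<^esub> p \<cdot> (inv\<^bsub>Gm\<^esub> q \<cdot> t \<cdot> q) \<cdot> p" if "t \<in> carrier Gm" for t
      using that p q by (simp add: conj_conj)
    have "inv\<^bsub>Gm\<^esub> (q \<cdot> p) \<cdot> t \<cdot> (q \<cdot> p) \<in> Fix (A e) \<or> thin e (inv\<^bsub>Gm\<^esub> (q \<cdot> p) \<cdot> t \<cdot> (q \<cdot> p))"
      if t: "t \<in> insert s F" for t
    proof (cases "t = s")
      case True
      then show ?thesis using 1[OF sc(1)] p by (auto simp: thin_def s'_def)
    next
      case False
      then have tF: "t \<in> F" "t \<in> carrier Gm" using t insert by auto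
      then have tc: "inv\<^bsub>Gm\<^esub> q \<cdot> t \<cdot> q \<in> carrier Gm" using q by simp
      have A: "A e \<subseteq> carrier Gm" by (rule A_carrier)
      show ?thesis unfolding 1[OF tF(2)]
        using q(3)[OF tF(1)] thin_conj[OF tc p(1)] Fix_mult_set[OF p(1) tc A] p(2) by blast
    qed
    moreover have "q \<cdot> p \<cdot> y \<in> A e" if "y \<in> A e" for y
    proof -
      have "y \<in> carrier Gm" using that A_carrier by blast
      then have "q \<cdot> p \<cdot> y = q \<cdot> (p \<cdot> y)" using p q by (simp add: Gm.m_assoc)
      then show ?thesis using p q that by simp
    qed
    ultimately show ?thesis using p q by (intro bexI[of _ "q \<cdot> p"]) auto
  qed
qed

text \<open>Guarantees that a prescribed \<open>s\<close> becomes thin, so that the induction in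
  \<open>powers_nonamenable\<close> gets rid of at least one element.\<close>

lemma ex_Fix_or_thin_nontrivial:
  assumes triv: "Fix (carrier Gm) = {\<one>\<^bsub>Gm\<^esub>}" and e: "e = 1 \<or> e = -1"
    and F: "finite F" "F \<subseteq> carrier Gm" and s: "s \<in> F" "s \<noteq> \<one>\<^bsub>Gm\<^esub>"
  shows "\<exists>q\<in>carrier Gm. thin e (inv\<^bsub>Gm\<^esub> q \<cdot> s \<cdot> q) \<and>
    (\<forall>t\<in>F. inv\<^bsub>Gm\<^esub> q \<cdot> t \<cdot> q \<in> Fix (A e) \<or> thin e (inv\<^bsub>Gm\<^esub> q \<cdot> t \<cdot> q))"
proof -
  have sc: "s \<in> carrier Gm" using F s by blast
  have "s \<notin> Fix (carrier Gm)" using triv s by simp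
  then obtain r where r: "r \<in> carrier Gm" "inv\<^bsub>Gm\<^esub> r \<cdot> s \<cdot> r \<notin> E 1" using sc by (auto simp: Fix_def)
  \<comment> \<open>\<open>g\<close> takes the edge \<open>td e\<close> of \<open>A e\<close> to the
    edge \<open>r\<close> moved by \<open>s\<close>, so that the conjugate \<open>s1\<close> moves
    an edge inside \<open>A e\<close>.\<close>
  define g where "g = r \<cdot> inv\<^bsub>Gm\<^esub> (td e)"
  have g: "g \<in> carrier Gm" using r td_carrier by (simp add: g_def)
  have gr: "g \<cdot> td e = r" using r td_carrier by (simp add: g_def Gm.m_assoc)
  define s1 where "s1 = inv\<^bsub>Gm\<^esub> g \<cdot> s \<cdot> g"
  have s1: "s1 \<in> carrier Gm" using g sc by (simp add: s1_def)
  have "inv\<^bsub>Gm\<^esub> (td e) \<cdot> s1 \<cdot> td e = inv\<^bsub>Gm\<^esub> r \<cdot> s \<cdot> r"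
    unfolding s1_def using conj_conj[OF sc g td_carrier[of e]] gr by simp
  then have "inv\<^bsub>Gm\<^esub> (td e) \<cdot> s1 \<cdot> td e \<notin> E 1" using r by simp
  then have "s1 \<notin> Fix (A e)" using A_nonempty[OF e] unfolding Fix_def by blast
  then obtain p where p: "p \<in> carrier Gm" "\<forall>y\<in>A e. p \<cdot> y \<in> A e \<and> inv\<^bsub>Gm\<^esub> p \<cdot> s1 \<cdot> p \<cdot> y \<notin> A e"
    using ex_disjoint_translate[OF e s1] by blast
  let ?k = "g \<cdot> p"
  have k: "?k \<in> carrier Gm" using g p by simp
  let ?F = "(\<lambda>t. inv\<^bsub>Gm\<^esub> ?k \<cdot> t \<cdot> ?k) ` F"
  have thin1: "thin e (inv\<^bsub>Gm\<^esub> ?k \<cdot> s \<cdot> ?k)" using p conj_conj[OF sc g p(1)] by (simp add: thin_def s1_def)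
  have "?F \<subseteq> carrier Gm" using k F by auto
  then obtain q where q: "q \<in> carrier Gm" "\<forall>y\<in>A e. q \<cdot> y \<in> A e"
    "\<forall>t\<in>?F. inv\<^bsub>Gm\<^esub> q \<cdot> t \<cdot> q \<in> Fix (A e) \<or> thin e (inv\<^bsub>Gm\<^esub> q \<cdot> t \<cdot> q)"
    using ex_Fix_or_thin[OF e, of ?F] F by blast
  have 1: "inv\<^bsub>Gm\<^esub> (?k \<cdot> q) \<cdot> t \<cdot> (?k \<cdot> q) = inv\<^bsub>Gm\<^esub> q \<cdot> (inv\<^bsub>Gm\<^esub> ?k \<cdot> t \<cdot> ?k) \<cdot> q"
    if "t \<in> carrier Gm" for t
    using that k q(1) by (rule conj_conj)
  have "thin e (inv\<^bsub>Gm\<^esub> (?k \<cdot> q) \<cdot> s \<cdot> (?k \<cdot> q))"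
    unfolding 1[OF sc] by (rule thin_conj[OF _ q(1) _ thin1]) (use q(2) sc k in auto)
  moreover have "\<forall>t\<in>F. inv\<^bsub>Gm\<^esub> (?k \<cdot> q) \<cdot> t \<cdot> (?k \<cdot> q) \<in> Fix (A e) \<or> thin e (inv\<^bsub>Gm\<^esub> (?k \<cdot> q) \<cdot> t \<cdot> (?k \<cdot> q))"
  proof
    fix t assume t: "t \<in> F"
    then have "t \<in> carrier Gm" using F by blast
    from 1[OF this] show "inv\<^bsub>Gm\<^esub> (?k \<cdot> q) \<cdot> t \<cdot> (?k \<cdot> q) \<in> Fix (A e) \<or> thin e (inv\<^bsub>Gm\<^esub> (?k \<cdot> q) \<cdot> t \<cdot> (?k \<cdot> q))"
      using q(3) t by simp
  qed
  ultimately show ?thesis using k q by (intro bexI[of _ "?k \<cdot> q"]) auto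
qed

end

section \<open>Fixators of the neighbourhoods of an end\<close>

context hnn begin

lemma A_disjoint: assumes d: "d = 1 \<or> d = -1" and "x \<in> A d" shows "x \<notin> A (-d)"
  using V_disj_A'[OF d subgroup.one_closed[OF V_subgroup] assms(2)] subsetD[OF A_carrier assms(2)] by simp

lemma td_mult_A: assumes d: "d = 1 \<or> d = -1" and "x \<in> A d" shows "td d \<cdot> x \<in> A d"
  using td_A[OF d] A_disjoint[OF assms] subsetD[OF A_carrier assms(2)] by simp

lemma td_pow_A:
  assumes d: "d = 1 \<or> d = -1" and x: "x \<in> A d" shows "td d [^]\<^bsub>Gm\<^esub> (n::nat) \<cdot> x \<in> A d"
  using x
proof (induction n arbitrary: x)
  case 0
  then show ?case using subsetD[OF A_carrier] by simp
next
  case (Suc n)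
  have "x \<in> carrier Gm" using Suc.prems A_carrier by blast
  then have "td d [^]\<^bsub>Gm\<^esub> (Suc n) \<cdot> x = td d [^]\<^bsub>Gm\<^esub> n \<cdot> (td d \<cdot> x)"
    using td_carrier by (simp add: Gm.m_assoc)
  then show ?case using Suc.IH td_mult_A[OF d Suc.prems] by simp
qed

text \<open>\<open>td d\<close> maps the complement of \<open>A (-d)\<close> onto
  \<open>A d\<close>; so the fixator of the half-tree \<open>A d\<close> is a conjugate of the
  quasi-kernel of type \<open>-d\<close>.\<close>

lemma Fix_A_conj:
  assumes d: "d = 1 \<or> d = -1" and x: "x \<in> carrier Gm"
  shows "x \<in> Fix (A d) \<longleftrightarrow> inv\<^bsub>Gm\<^esub> (td d) \<cdot> x \<cdot> td d \<in> Fix (carrier Gm - A (-d))"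
proof
  assume 1: "x \<in> Fix (A d)"
  show "inv\<^bsub>Gm\<^esub> (td d) \<cdot> x \<cdot> td d \<in> Fix (carrier Gm - A (-d))"
    by (rule Fix_mult_set[OF _ x _ _ 1]) (use td_carrier td_A[OF d] in auto)
next
  assume 1: "inv\<^bsub>Gm\<^esub> (td d) \<cdot> x \<cdot> td d \<in> Fix (carrier Gm - A (-d))"
  have "inv\<^bsub>Gm\<^esub> (td (-d)) \<cdot> (inv\<^bsub>Gm\<^esub> (td d) \<cdot> x \<cdot> td d) \<cdot> td (-d) \<in> Fix (A d)"
  proof (rule Fix_mult_set[OF _ _ A_carrier _ 1])
    fix r assume r: "r \<in> A d"
    then have rc: "r \<in> carrier Gm" using A_carrier by blast
    then have "td (-d) \<cdot> r \<notin> A (-d)" using td_A[of "-d" r] d r by auto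
    then show "td (-d) \<cdot> r \<in> carrier Gm - A (-d)" using rc td_carrier by simp
  qed (use td_carrier x in auto)
  then show "x \<in> Fix (A d)" using x td_carrier by (simp add: td_neg Gm.m_assoc)
qed

text \<open>The image of an end under \<open>g\<close> lies on a definite side of the edge bounding
  \<open>A e\<close>. Once the neighbourhood of the end is so small that its image omits the base
  edge, \<open>mult_A_iff\<close> decides membership in \<open>A e\<close> for all its points alike;
  for \<open>q\<close> in \<open>V\<close> the action on the half-trees at the base vertex
  does.\<close>

lemma ex_eventually_in_or_out:
  assumes d: "d = 1 \<or> d = -1" and e: "e = 1 \<or> e = -1" and g: "g \<in> carrier Gm"
  shows "\<exists>N. \<forall>n\<ge>N. (\<forall>y\<in>A d. g \<cdot> (td d [^]\<^bsub>Gm\<^esub> (n::nat) \<cdot> y) \<in> A e) \<or>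
    (\<forall>y\<in>A d. g \<cdot> (td d [^]\<^bsub>Gm\<^esub> n \<cdot> y) \<notin> A e)"
proof -
  obtain N where N: "td (-d) [^]\<^bsub>Gm\<^esub> (N::nat) \<cdot> inv\<^bsub>Gm\<^esub> g \<notin> A d"
    using td_pow_leaves_A[OF d, of "inv\<^bsub>Gm\<^esub> g"] g by auto
  define q where "q = g \<cdot> td d [^]\<^bsub>Gm\<^esub> N"
  have tc: "td d [^]\<^bsub>Gm\<^esub> n \<in> carrier Gm" for n :: nat using td_carrier by simp
  have q: "q \<in> carrier Gm" using g tc by (simp add: q_def)
  have "inv\<^bsub>Gm\<^esub> (td d [^]\<^bsub>Gm\<^esub> N) = td (-d) [^]\<^bsub>Gm\<^esub> N"
    using td_carrier Gm.nat_pow_inv[of "td d" N] by (simp add: td_neg)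
  then have qi: "inv\<^bsub>Gm\<^esub> q \<notin> A d" using N g tc by (simp add: q_def Gm.inv_mult_group)
  have main: "(\<forall>y\<in>A d. q \<cdot> y \<in> A e) \<or> (\<forall>y\<in>A d. q \<cdot> y \<notin> A e)"
  proof (cases "q \<in> V")
    case False
    then show ?thesis using mult_A_iff[OF d q False qi] by blast
  next
    case True
    show ?thesis
    proof (cases "e = d")
      case e: True
      show ?thesis
      proof (cases "q \<in> E d")
        case True
        then show ?thesis using E_act_A[OF d] e by blast
      next
        case False
        then show ?thesis using V_disj_A[OF d \<open>q \<in> V\<close>] e by blast
      qed
    next
      case False
      then have "e = -d" using d e by auto
      then show ?thesis using V_disj_A'[OF d True] by blast
    qed
  qed
  have "(\<forall>y\<in>A d. g \<cdot> (td d [^]\<^bsub>Gm\<^esub> n \<cdot> y) \<in> A e) \<or>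
    (\<forall>y\<in>A d. g \<cdot> (td d [^]\<^bsub>Gm\<^esub> n \<cdot> y) \<notin> A e)" if "N \<le> n" for n
  proof -
    have "td d [^]\<^bsub>Gm\<^esub> n = td d [^]\<^bsub>Gm\<^esub> N \<cdot> td d [^]\<^bsub>Gm\<^esub> (n - N)"
      using that td_carrier Gm.nat_pow_mult[of "td d" N "n - N"] by simp
    then have "g \<cdot> (td d [^]\<^bsub>Gm\<^esub> n \<cdot> y) = q \<cdot> (td d [^]\<^bsub>Gm\<^esub> (n - N) \<cdot> y)" if "y \<in> A d" for y
      using subsetD[OF A_carrier that] g tc by (simp add: q_def Gm.m_assoc)
    then show ?thesis using main td_pow_A[OF d] by auto
  qed
  then show ?thesis by blast
qed

text \<open>Fixator of the n-th neighbourhood of the end of the axis of the stable letter in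
  direction \<open>d\<close>. The neighbourhoods decrease, so these groups increase with
  \<open>n\<close>; each is a conjugate of a quasi-kernel (\<open>end_fix_conj\<close>).\<close>

definition end_fix :: "int \<Rightarrow> nat \<Rightarrow> 'b set" where
  "end_fix d n = {x \<in> carrier Gm. inv\<^bsub>Gm\<^esub> (td d [^]\<^bsub>Gm\<^esub> n) \<cdot> x \<cdot> td d [^]\<^bsub>Gm\<^esub> n \<in> Fix (A d)}"

lemma end_fixI:
  assumes "x \<in> carrier Gm"
    "\<And>y. y \<in> A d \<Longrightarrow> inv\<^bsub>Gm\<^esub> (td d [^]\<^bsub>Gm\<^esub> n \<cdot> y) \<cdot> x \<cdot> (td d [^]\<^bsub>Gm\<^esub> n \<cdot> y) \<in> E 1"
  shows "x \<in> end_fix d n"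
proof -
  have "inv\<^bsub>Gm\<^esub> y \<cdot> (inv\<^bsub>Gm\<^esub> (td d [^]\<^bsub>Gm\<^esub> n) \<cdot> x \<cdot> td d [^]\<^bsub>Gm\<^esub> n) \<cdot> y \<in> E 1" if "y \<in> A d" for y
    using assms(2)[OF that] conj_conj[of x "td d [^]\<^bsub>Gm\<^esub> n" y] assms(1) td_carrier
      subsetD[OF A_carrier that] by simp
  then show ?thesis using assms(1) td_carrier by (simp add: end_fix_def Fix_def)
qed

lemma end_fix_mono:
  assumes d: "d = 1 \<or> d = -1" and "n \<le> m" shows "end_fix d n \<subseteq> end_fix d m"
proof
  fix x assume x: "x \<in> end_fix d n"
  let ?p = "\<lambda>n::nat. td d [^]\<^bsub>Gm\<^esub> n"
  have xc: "x \<in> carrier Gm" using x by (simp add: end_fix_def)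
  have pc: "?p k \<in> carrier Gm" for k using td_carrier by simp
  have "?p m = ?p n \<cdot> ?p (m - n)"
    using assms td_carrier Gm.nat_pow_mult[of "td d" n "m - n"] by simp
  moreover have "inv\<^bsub>Gm\<^esub> (?p (m - n)) \<cdot> (inv\<^bsub>Gm\<^esub> (?p n) \<cdot> x \<cdot> ?p n) \<cdot> ?p (m - n) \<in> Fix (A d)"
    by (rule Fix_mult_set[OF _ _ A_carrier td_pow_A[OF d]]) (use x pc in \<open>auto simp: end_fix_def\<close>)
  ultimately have "inv\<^bsub>Gm\<^esub> (?p m) \<cdot> x \<cdot> ?p m \<in> Fix (A d)"
    using conj_conj[OF xc pc pc, of n "m - n"] by simp
  then show "x \<in> end_fix d m" using xc by (simp add: end_fix_def)
qed

lemma end_fix_subgroup: "subgroup (end_fix d n) Gm"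
proof (rule Gm.subgroupI)
  let ?p = "td d [^]\<^bsub>Gm\<^esub> n"
  have pc: "?p \<in> carrier Gm" using td_carrier by simp
  note F = Fix_subgroup[OF A_carrier[of d]]
  show "end_fix d n \<subseteq> carrier Gm" by (auto simp: end_fix_def)
  have "\<one>\<^bsub>Gm\<^esub> \<in> end_fix d n" using pc subgroup.one_closed[OF F] by (simp add: end_fix_def)
  then show "end_fix d n \<noteq> {}" by blast
  show "inv\<^bsub>Gm\<^esub> a \<in> end_fix d n" if "a \<in> end_fix d n" for a
    using that subgroup.m_inv_closed[OF F] pc by (auto simp: end_fix_def conj_inv)
  show "a \<cdot> b \<in> end_fix d n" if "a \<in> end_fix d n" "b \<in> end_fix d n" for a b
    using that subgroup.m_closed[OF F] pc by (auto simp: end_fix_def conj_mult)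
qed

lemma end_fix_conj:
  assumes d: "d = 1 \<or> d = -1" and x: "x \<in> carrier Gm"
  shows "x \<in> end_fix d n \<longleftrightarrow>
    inv\<^bsub>Gm\<^esub> (td d [^]\<^bsub>Gm\<^esub> Suc n) \<cdot> x \<cdot> td d [^]\<^bsub>Gm\<^esub> Suc n \<in> Fix (carrier Gm - A (-d))"
  using x td_carrier Fix_A_conj[OF d, of "inv\<^bsub>Gm\<^esub> (td d [^]\<^bsub>Gm\<^esub> n) \<cdot> x \<cdot> td d [^]\<^bsub>Gm\<^esub> n"]
    conj_conj[OF x, of "td d [^]\<^bsub>Gm\<^esub> n" "td d"] by (simp add: end_fix_def)

end

context non_ascending_hnn begin

text \<open>The translates are branches leaving the axis of the stable letter at successive
  vertices: \<open>v\<close> turns \<open>A d\<close> away from the axis, and the powers of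
  \<open>td d\<close> move the branching point along it.\<close>

lemma ex_disjoint_translates:
  assumes d: "d = 1 \<or> d = -1"
  shows "\<exists>Y::nat \<Rightarrow> 'b. range Y \<subseteq> carrier Gm \<and>
    (\<forall>i j y. i \<noteq> j \<longrightarrow> y \<in> A d \<longrightarrow> inv\<^bsub>Gm\<^esub> (Y i) \<cdot> (Y j \<cdot> y) \<notin> A d)"
proof -
  obtain v where v: "v \<in> V" "v \<notin> E d" by (rule ex_V_not_E)
  have vc: "v \<in> carrier Gm" using v V_carrier by blast
  define Y where "Y = (\<lambda>j::nat. td d [^]\<^bsub>Gm\<^esub> j \<cdot> v)"
  have Yc: "Y j \<in> carrier Gm" for j using vc td_carrier by (simp add: Y_def)
  have less: "inv\<^bsub>Gm\<^esub> (Y i) \<cdot> (Y j \<cdot> y) \<notin> A d" if "i < j" "y \<in> A d" for i j y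
  proof -
    have yc: "y \<in> carrier Gm" using that A_carrier by blast
    \<comment> \<open>One factor \<open>td d\<close> is set apart: it brings
      \<open>v \<cdot> y\<close>, which is outside \<open>A (-d)\<close>, into \<open>A d\<close>,
      and the other \<open>m\<close> factors keep it there.\<close>
    define m where "m = j - Suc i"
    have "td d [^]\<^bsub>Gm\<^esub> j = td d [^]\<^bsub>Gm\<^esub> i \<cdot> td d [^]\<^bsub>Gm\<^esub> Suc m"
      using that Gm.nat_pow_mult[OF td_carrier, of d i "Suc m"] by (simp add: m_def)
    then have *: "inv\<^bsub>Gm\<^esub> (Y i) \<cdot> (Y j \<cdot> y) = inv\<^bsub>Gm\<^esub> v \<cdot> (td d [^]\<^bsub>Gm\<^esub> m \<cdot> (td d \<cdot> (v \<cdot> y)))"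
      using vc yc td_carrier by (simp add: Y_def Gm.inv_mult_group Gm.m_assoc)
    have "v \<cdot> y \<notin> A (-d)" using V_disj_A' d v that by blast
    then have "td d \<cdot> (v \<cdot> y) \<in> A d" using td_A[OF d] vc yc by simp
    then have "td d [^]\<^bsub>Gm\<^esub> m \<cdot> (td d \<cdot> (v \<cdot> y)) \<in> A d" by (rule td_pow_A[OF d])
    moreover have "inv\<^bsub>Gm\<^esub> v \<in> V" "inv\<^bsub>Gm\<^esub> v \<notin> E d"
      using v subgroup.m_inv_closed[OF V_subgroup] E_inv[of "inv\<^bsub>Gm\<^esub> v" d] vc by auto
    ultimately show ?thesis using V_disj_A[OF d] * by simp
  qed
  have "inv\<^bsub>Gm\<^esub> (Y i) \<cdot> (Y j \<cdot> y) \<notin> A d" if "i \<noteq> j" "y \<in> A d" for i j y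
  proof (cases "i < j")
    case False
    have yc: "y \<in> carrier Gm" using that A_carrier by blast
    show ?thesis
    proof
      assume "inv\<^bsub>Gm\<^esub> (Y i) \<cdot> (Y j \<cdot> y) \<in> A d"
      then have "inv\<^bsub>Gm\<^esub> (Y j) \<cdot> (Y i \<cdot> (inv\<^bsub>Gm\<^esub> (Y i) \<cdot> (Y j \<cdot> y))) \<notin> A d"
        using less[of j i] False that by simp
      then show False using Yc yc that by simp
    qed
  qed (use less that in auto)
  then show ?thesis using Yc by (intro exI[of _ Y]) auto
qed

text \<open>Every conjugate of the stabilizer of the germ of the end \<open>\<tau>\<^sup>d\<^sup>\<infinity>\<close> contains \<open>a\<close> or \<open>b\<close>,
  because the supports of \<open>a\<close> and \<open>b\<close> are disjoint half-trees.\<close>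

lemma ex_disjoint_support_pair:
  assumes d: "d = 1 \<or> d = -1" and a: "a \<in> Fix (carrier Gm - A (-d))" "a \<noteq> \<one>\<^bsub>Gm\<^esub>"
  defines "\<Lambda> \<equiv> \<Union>n. end_fix d n"
  shows "\<exists>b\<in>carrier Gm. b \<noteq> \<one>\<^bsub>Gm\<^esub> \<and> (\<forall>g\<in>carrier Gm. inv\<^bsub>Gm\<^esub> g \<cdot> b \<cdot> g \<in> \<Lambda> \<or>
    (inv\<^bsub>Gm\<^esub> g \<cdot> a \<cdot> g \<in> \<Lambda> \<and> inv\<^bsub>Gm\<^esub> (b \<cdot> g) \<cdot> a \<cdot> (b \<cdot> g) \<in> \<Lambda>))"
proof -
  define e where "e = -d"
  have e: "e = 1 \<or> e = -1" using d by (auto simp: e_def)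
  have ac: "a \<in> carrier Gm" using a by (simp add: Fix_def)
  obtain h where h: "h \<in> V" "h \<notin> E e" by (rule ex_V_not_E)
  have hc: "h \<in> carrier Gm" using h V_carrier by blast
  \<comment> \<open>The support of \<open>b\<close> is the translate of \<open>A e\<close> by
    \<open>h\<close>, and it is disjoint from \<open>A e\<close> because \<open>h\<close> is outside
    \<open>E e\<close>.\<close>
  define b where "b = h \<cdot> a \<cdot> inv\<^bsub>Gm\<^esub> h"
  have bc: "b \<in> carrier Gm" using hc ac by (simp add: b_def)
  have "inv\<^bsub>Gm\<^esub> h \<cdot> b \<cdot> h = a" using hc ac by (simp add: b_def Gm.m_assoc)
  then have b1: "b \<noteq> \<one>\<^bsub>Gm\<^esub>" using a hc by auto
  have fix_a: "inv\<^bsub>Gm\<^esub> r \<cdot> a \<cdot> r \<in> E 1" if "r \<in> carrier Gm" "r \<notin> A e" for r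
    using a that by (simp add: Fix_def e_def)
  have fix_b: "inv\<^bsub>Gm\<^esub> r \<cdot> b \<cdot> r \<in> E 1" if "r \<in> carrier Gm" "inv\<^bsub>Gm\<^esub> h \<cdot> r \<notin> A e" for r
    using fix_a[of "inv\<^bsub>Gm\<^esub> h \<cdot> r"] that hc ac by (simp add: b_def Gm.inv_mult_group Gm.m_assoc)
  have disj: "r \<notin> A e" if "r \<in> carrier Gm" "inv\<^bsub>Gm\<^esub> h \<cdot> r \<in> A e" for r
    using V_disj_A[OF e h that(2)] that hc by simp
  have pres_b: "inv\<^bsub>Gm\<^esub> h \<cdot> (b \<cdot> r) \<in> A e" if "r \<in> carrier Gm" "inv\<^bsub>Gm\<^esub> h \<cdot> r \<in> A e" for r
  proof -
    have "a \<cdot> (inv\<^bsub>Gm\<^esub> h \<cdot> r) \<notin> carrier Gm - A e"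
      using Fix_mult_mem_compl[OF saturated_compl[OF saturated_A], of a e "inv\<^bsub>Gm\<^esub> h \<cdot> r"] a that hc
      by (simp add: e_def)
    then show ?thesis using that hc ac by (simp add: b_def Gm.m_assoc)
  qed
  have "inv\<^bsub>Gm\<^esub> g \<cdot> b \<cdot> g \<in> \<Lambda> \<or>
    (inv\<^bsub>Gm\<^esub> g \<cdot> a \<cdot> g \<in> \<Lambda> \<and> inv\<^bsub>Gm\<^esub> (b \<cdot> g) \<cdot> a \<cdot> (b \<cdot> g) \<in> \<Lambda>)" if g: "g \<in> carrier Gm" for g
  proof -
    let ?p = "\<lambda>n::nat. td d [^]\<^bsub>Gm\<^esub> n"
    have pc: "?p n \<in> carrier Gm" for n using td_carrier by simp
    \<comment> \<open>The image under \<open>g\<close> of a small neighbourhood of the end lies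
      outside the support of \<open>b\<close> or inside it. In the second case it misses the support
      of \<open>a\<close>, and since \<open>b\<close> preserves its own support it still does so
      after applying \<open>b\<close>.\<close>
    obtain n where n: "(\<forall>y\<in>A d. inv\<^bsub>Gm\<^esub> h \<cdot> g \<cdot> (?p n \<cdot> y) \<in> A e) \<or>
        (\<forall>y\<in>A d. inv\<^bsub>Gm\<^esub> h \<cdot> g \<cdot> (?p n \<cdot> y) \<notin> A e)"
      using ex_eventually_in_or_out[OF d e, of "inv\<^bsub>Gm\<^esub> h \<cdot> g"] hc g by auto
    have inv: "inv\<^bsub>Gm\<^esub> g \<cdot> x \<cdot> g \<in> \<Lambda>"
      if x: "x \<in> carrier Gm" and g: "g \<in> carrier Gm"
        and r: "\<And>y. y \<in> A d \<Longrightarrow> inv\<^bsub>Gm\<^esub> (g \<cdot> (?p n \<cdot> y)) \<cdot> x \<cdot> (g \<cdot> (?p n \<cdot> y)) \<in> E 1" for x g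
    proof -
      have "inv\<^bsub>Gm\<^esub> g \<cdot> x \<cdot> g \<in> end_fix d n"
      proof (rule end_fixI)
        fix y assume y: "y \<in> A d"
        then have "y \<in> carrier Gm" using A_carrier by blast
        then show "inv\<^bsub>Gm\<^esub> (?p n \<cdot> y) \<cdot> (inv\<^bsub>Gm\<^esub> g \<cdot> x \<cdot> g) \<cdot> (?p n \<cdot> y) \<in> E 1"
          using r[OF y] conj_conj[OF x g, of "?p n \<cdot> y"] pc by simp
      qed (use x g in simp)
      then show ?thesis by (auto simp: \<Lambda>_def)
    qed
    have yc: "y \<in> carrier Gm" if "y \<in> A d" for y using that A_carrier by blast
    from n show ?thesis
    proof
      assume out: "\<forall>y\<in>A d. inv\<^bsub>Gm\<^esub> h \<cdot> g \<cdot> (?p n \<cdot> y) \<notin> A e"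
      have "inv\<^bsub>Gm\<^esub> g \<cdot> b \<cdot> g \<in> \<Lambda>"
      proof (rule inv[OF bc g])
        fix y assume y: "y \<in> A d"
        then show "inv\<^bsub>Gm\<^esub> (g \<cdot> (?p n \<cdot> y)) \<cdot> b \<cdot> (g \<cdot> (?p n \<cdot> y)) \<in> E 1"
          using fix_b[of "g \<cdot> (?p n \<cdot> y)"] bspec[OF out y] yc[OF y] pc g hc by (simp add: Gm.m_assoc)
      qed
      then show ?thesis ..
    next
      assume inn': "\<forall>y\<in>A d. inv\<^bsub>Gm\<^esub> h \<cdot> g \<cdot> (?p n \<cdot> y) \<in> A e"
      have inn: "inv\<^bsub>Gm\<^esub> h \<cdot> (g \<cdot> (?p n \<cdot> y)) \<in> A e" if "y \<in> A d" for y
        using bspec[OF inn' that] yc[OF that] pc g hc by (simp add: Gm.m_assoc)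
      have "inv\<^bsub>Gm\<^esub> g \<cdot> a \<cdot> g \<in> \<Lambda>"
        by (rule inv[OF ac g], rule fix_a) (use disj inn yc pc g in auto)
      moreover have "inv\<^bsub>Gm\<^esub> (b \<cdot> g) \<cdot> a \<cdot> (b \<cdot> g) \<in> \<Lambda>"
      proof (rule inv[OF ac])
        fix y assume y: "y \<in> A d"
        have r: "g \<cdot> (?p n \<cdot> y) \<in> carrier Gm" using yc[OF y] pc g by simp
        have "b \<cdot> (g \<cdot> (?p n \<cdot> y)) \<notin> A e" using disj pres_b[OF r inn[OF y]] r bc by simp
        then have "inv\<^bsub>Gm\<^esub> (b \<cdot> (g \<cdot> (?p n \<cdot> y))) \<cdot> a \<cdot> (b \<cdot> (g \<cdot> (?p n \<cdot> y))) \<in> E 1"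
          using fix_a r bc by simp
        moreover have "b \<cdot> g \<cdot> (?p n \<cdot> y) = b \<cdot> (g \<cdot> (?p n \<cdot> y))"
          using yc[OF y] pc g bc by (simp add: Gm.m_assoc)
        ultimately show "inv\<^bsub>Gm\<^esub> (b \<cdot> g \<cdot> (?p n \<cdot> y)) \<cdot> a \<cdot> (b \<cdot> g \<cdot> (?p n \<cdot> y)) \<in> E 1" by simp
      qed (use bc g in simp)
      ultimately show ?thesis by blast
    qed
  qed
  then show ?thesis using bc b1 by blast
qed

end

section \<open>Operators on square-summable functions\<close>

lemma L2_set_cmod_cong: "(\<And>x. x \<in> F \<Longrightarrow> f x = g x) \<Longrightarrow> L2_set (\<lambda>x. cmod (f x)) F = L2_set (\<lambda>x. cmod (g x)) F"
  by (simp cong: L2_set_cong)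

lemma l2norm_nonneg [simp]: "0 \<le> l2norm A f"
  by (simp add: l2norm_def infsum_nonneg)

lemma L2_set_le_l2norm:
  assumes "f \<in> l2 A" "finite F" "F \<subseteq> A" shows "L2_set (\<lambda>x. cmod (f x)) F \<le> l2norm A f"
  unfolding L2_set_def l2norm_def
  by (intro real_sqrt_le_mono finite_sum_le_infsum) (use assms in \<open>auto simp: l2_def\<close>)

text \<open>Reduces norm estimates to finite partial sums. Together with
  \<open>L2_set_le_l2norm\<close> it keeps infinite sums out of nearly all later arguments.\<close>

lemma l2I:
  assumes "\<And>x. x \<notin> A \<Longrightarrow> f x = 0" and c: "\<And>F. finite F \<Longrightarrow> F \<subseteq> A \<Longrightarrow> L2_set (\<lambda>x. cmod (f x)) F \<le> c"
  shows "f \<in> l2 A" "l2norm A f \<le> c"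
proof -
  have c0: "0 \<le> c" using c[of "{}"] by simp
  have le: "(\<Sum>x\<in>F. (cmod (f x))\<^sup>2) \<le> c\<^sup>2" if "finite F" "F \<subseteq> A" for F
  proof -
    have "(L2_set (\<lambda>x. cmod (f x)) F)\<^sup>2 \<le> c\<^sup>2" using c[OF that] by (intro power_mono) auto
    then show ?thesis by (simp add: L2_set_def sum_nonneg)
  qed
  have s: "(\<lambda>x. (cmod (f x))\<^sup>2) summable_on A"
    by (rule nonneg_bdd_above_summable_on) (use le in \<open>auto intro!: bdd_aboveI[of _ "c\<^sup>2"]\<close>)
  then show "f \<in> l2 A" using assms(1) by (simp add: l2_def)
  have "(\<Sum>\<^sub>\<infinity>x\<in>A. (cmod (f x))\<^sup>2) \<le> c\<^sup>2" using s le by (rule infsum_le_finite_sums)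
  then show "l2norm A f \<le> c" unfolding l2norm_def using c0 by (rule real_le_lsqrt[rotated])
qed

lemma l2_outside: "f \<in> l2 A \<Longrightarrow> x \<notin> A \<Longrightarrow> f x = 0"
  by (simp add: l2_def)

lemma l2_zero [simp]: "(\<lambda>_. 0) \<in> l2 A" "l2norm A (\<lambda>_. 0) = 0"
  by (simp_all add: l2_def l2norm_def)

lemma l2_add:
  assumes "f \<in> l2 A" "g \<in> l2 A"
  shows "(\<lambda>x. f x + g x) \<in> l2 A" "l2norm A (\<lambda>x. f x + g x) \<le> l2norm A f + l2norm A g"
proof -
  have 1: "L2_set (\<lambda>x. cmod (f x + g x)) F \<le> l2norm A f + l2norm A g" if F: "finite F" "F \<subseteq> A" for F
  proof -
    have "L2_set (\<lambda>x. cmod (f x + g x)) F \<le> L2_set (\<lambda>x. cmod (f x) + cmod (g x)) F"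
      by (rule L2_set_mono) (auto intro: norm_triangle_ineq)
    also have "\<dots> \<le> L2_set (\<lambda>x. cmod (f x)) F + L2_set (\<lambda>x. cmod (g x)) F" by (rule L2_set_triangle_ineq)
    also have "\<dots> \<le> l2norm A f + l2norm A g" using assms F by (intro add_mono L2_set_le_l2norm)
    finally show ?thesis .
  qed
  have 0: "f x + g x = 0" if "x \<notin> A" for x using assms that by (simp add: l2_outside)
  from l2I[of A "\<lambda>x. f x + g x", OF 0 1] show "(\<lambda>x. f x + g x) \<in> l2 A" "l2norm A (\<lambda>x. f x + g x) \<le> l2norm A f + l2norm A g"
    by blast+
qed

lemma l2_scale_le:
  assumes "f \<in> l2 A"
  shows "(\<lambda>x. c * f x) \<in> l2 A" "l2norm A (\<lambda>x. c * f x) \<le> cmod c * l2norm A f"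
proof -
  have 1: "L2_set (\<lambda>x. cmod (c * f x)) F \<le> cmod c * l2norm A f" if F: "finite F" "F \<subseteq> A" for F
    using L2_set_le_l2norm[OF assms F]
    by (simp add: norm_mult L2_set_right_distrib[symmetric] mult_left_mono)
  have 0: "c * f x = 0" if "x \<notin> A" for x using assms that by (simp add: l2_outside)
  from l2I[of A "\<lambda>x. c * f x", OF 0 1] show "(\<lambda>x. c * f x) \<in> l2 A" "l2norm A (\<lambda>x. c * f x) \<le> cmod c * l2norm A f"
    by blast+
qed

lemma l2_scale:
  assumes "f \<in> l2 A" shows "l2norm A (\<lambda>x. c * f x) = cmod c * l2norm A f"
proof (cases "c = 0")
  case False
  have "l2norm A (\<lambda>x. inverse c * (c * f x)) \<le> cmod (inverse c) * l2norm A (\<lambda>x. c * f x)"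
    by (rule l2_scale_le(2)[OF l2_scale_le(1)[OF assms]])
  moreover have "(\<lambda>x. inverse c * (c * f x)) = f" using False by (auto simp: field_simps)
  ultimately have "cmod c * l2norm A f \<le> l2norm A (\<lambda>x. c * f x)"
    using False by (simp add: norm_inverse norm_divide field_simps)
  then show ?thesis using l2_scale_le(2)[OF assms, of c] by simp
qed simp

lemma l2_diff:
  assumes "f \<in> l2 A" "g \<in> l2 A"
  shows "(\<lambda>x. f x - g x) \<in> l2 A" "l2norm A (\<lambda>x. f x - g x) \<le> l2norm A f + l2norm A g"
  using l2_add[OF assms(1) l2_scale_le(1)[OF assms(2), of "-1"]] l2_scale[OF assms(2), of "-1"] by simp_all

lemma l2norm_ge: assumes "f \<in> l2 A" "x \<in> A" shows "cmod (f x) \<le> l2norm A f"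
  using L2_set_le_l2norm[OF assms(1), of "{x}"] assms by simp

lemma l2norm_eq_0: assumes "f \<in> l2 A" "l2norm A f = 0" shows "f = (\<lambda>_. 0)"
proof
  fix x show "f x = 0" using l2norm_ge[OF assms(1), of x] assms l2_outside[OF assms(1), of x] by (cases "x \<in> A") auto
qed

definition ind :: "'b set \<Rightarrow> 'b \<Rightarrow> complex" where "ind F x = (if x \<in> F then 1 else 0)"

lemma l2_finite_support:
  assumes "finite F" "F \<subseteq> A" "\<And>x. x \<notin> F \<Longrightarrow> f x = 0"
  shows "f \<in> l2 A" "l2norm A f = L2_set (\<lambda>x. cmod (f x)) F"
proof -
  have 1: "L2_set (\<lambda>x. cmod (f x)) X \<le> L2_set (\<lambda>x. cmod (f x)) F" if X: "finite X" "X \<subseteq> A" for X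
  proof -
    have "(\<Sum>x\<in>X. (cmod (f x))\<^sup>2) = (\<Sum>x\<in>X \<inter> F. (cmod (f x))\<^sup>2)"
      using X assms by (intro sum.mono_neutral_right) auto
    also have "\<dots> \<le> (\<Sum>x\<in>F. (cmod (f x))\<^sup>2)" using assms by (intro sum_mono2) auto
    finally show ?thesis by (simp add: L2_set_def)
  qed
  have 0: "f x = 0" if "x \<notin> A" for x using that assms by auto
  from l2I[of A f, OF 0 1] show f: "f \<in> l2 A" and "l2norm A f = L2_set (\<lambda>x. cmod (f x)) F"
    using L2_set_le_l2norm[of f A F] assms by (auto intro: antisym)
qed

lemma l2_ind: assumes "finite F" "F \<subseteq> A" shows "ind F \<in> l2 A" "l2norm A (ind F) = sqrt (card F)"
proof -
  show "ind F \<in> l2 A" by (rule l2_finite_support[OF assms]) (simp add: ind_def)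
  have "l2norm A (ind F) = L2_set (\<lambda>x. cmod (ind F x)) F"
    by (rule l2_finite_support[OF assms]) (simp add: ind_def)
  also have "\<dots> = sqrt (card F)" by (simp add: L2_set_def ind_def)
  finally show "l2norm A (ind F) = sqrt (card F)" .
qed

lemma l2_tail:
  assumes "f \<in> l2 A" "0 < e"
  shows "\<exists>F. finite F \<and> F \<subseteq> A \<and> l2norm A (\<lambda>x. if x \<in> F then 0 else f x) \<le> e"
proof -
  let ?q = "\<lambda>x. (cmod (f x))\<^sup>2"
  have s: "?q summable_on A" using assms by (simp add: l2_def)
  have "(sum ?q \<longlongrightarrow> infsum ?q A) (finite_subsets_at_top A)" using s by (rule infsum_tendsto)
  then have "\<forall>\<^sub>F F in finite_subsets_at_top A. infsum ?q A - e\<^sup>2 < sum ?q F"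
    by (rule order_tendstoD) (use assms in simp)
  then obtain F where F: "finite F" "F \<subseteq> A" "infsum ?q A - e\<^sup>2 < sum ?q F"
    unfolding eventually_finite_subsets_at_top by blast
  have 1: "L2_set (\<lambda>x. cmod (if x \<in> F then 0 else f x)) X \<le> e" if X: "finite X" "X \<subseteq> A" for X
  proof -
    have "(\<Sum>x\<in>X. (cmod (if x \<in> F then 0 else f x))\<^sup>2) = (\<Sum>x\<in>X - F. ?q x)"
      using X by (intro sum.mono_neutral_cong_right) auto
    also have "\<dots> = sum ?q (F \<union> (X - F)) - sum ?q F" using F X by (subst sum.union_disjoint) auto
    also have "\<dots> \<le> infsum ?q A - sum ?q F"
      using F X s by (intro diff_right_mono finite_sum_le_infsum) auto
    also have "\<dots> \<le> e\<^sup>2" using F by simp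
    finally show ?thesis unfolding L2_set_def using assms(2) by (intro real_le_lsqrt) auto
  qed
  have 0: "(if x \<in> F then 0 else f x) = 0" if "x \<notin> A" for x using assms(1) that by (simp add: l2_outside)
  have "l2norm A (\<lambda>x. if x \<in> F then 0 else f x) \<le> e"
    by (rule l2I(2)[of A "\<lambda>x. if x \<in> F then 0 else f x", OF 0 1])
  then show ?thesis using F by blast
qed

section \<open>Bounded operators and the operator norm\<close>

lemma bounded_opD:
  assumes "bounded_op A T"
  shows "f \<notin> l2 A \<Longrightarrow> T f = (\<lambda>_. 0)" "f \<in> l2 A \<Longrightarrow> T f \<in> l2 A"
    "f \<in> l2 A \<Longrightarrow> g \<in> l2 A \<Longrightarrow> T (\<lambda>x. f x + g x) = (\<lambda>x. T f x + T g x)"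
    "f \<in> l2 A \<Longrightarrow> T (\<lambda>x. c * f x) = (\<lambda>x. c * T f x)"
  using assms by (auto simp: bounded_op_def)

lemma bounded_op_zero: "bounded_op A T \<Longrightarrow> T (\<lambda>_. 0) = (\<lambda>_. 0)"
  using bounded_opD(4)[of A T "\<lambda>_. 0" 0] by simp

lemma bounded_op_bound:
  assumes "bounded_op A T" obtains K where "0 \<le> K" "\<And>f. f \<in> l2 A \<Longrightarrow> l2norm A (T f) \<le> K * l2norm A f"
proof -
  obtain K where "\<forall>f\<in>l2 A. l2norm A (T f) \<le> K * l2norm A f" using assms by (auto simp: bounded_op_def)
  then have "l2norm A (T f) \<le> \<bar>K\<bar> * l2norm A f" if "f \<in> l2 A" for f
    using that mult_right_mono[of K "\<bar>K\<bar>" "l2norm A f"] by force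
  then show ?thesis using that[of "\<bar>K\<bar>"] by simp
qed

lemma opnorm_le:
  assumes "0 \<le> c" "\<And>f. f \<in> l2 A \<Longrightarrow> l2norm A (T f) \<le> c * l2norm A f"
  shows "opnorm A T \<le> c"
  unfolding opnorm_def
proof (rule cSup_least)
  show "{l2norm A (T f) |f. f \<in> l2 A \<and> l2norm A f \<le> 1} \<noteq> {}"
    using l2_zero[where A = A] by (metis (mono_tags, lifting) Collect_empty_eq zero_le_one)
next
  fix x assume "x \<in> {l2norm A (T f) |f. f \<in> l2 A \<and> l2norm A f \<le> 1}"
  then obtain f where f: "f \<in> l2 A" "l2norm A f \<le> 1" "x = l2norm A (T f)" by blast
  have "x \<le> c * l2norm A f" using assms f by simp
  also have "\<dots> \<le> c" using f assms(1) by (simp add: mult_left_le)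
  finally show "x \<le> c" .
qed

lemma le_opnorm:
  assumes T: "bounded_op A T" and f: "f \<in> l2 A"
  shows "l2norm A (T f) \<le> opnorm A T * l2norm A f"
proof (cases "l2norm A f = 0")
  case True
  then have "f = (\<lambda>_. 0)" using l2norm_eq_0 f by blast
  then show ?thesis using bounded_op_zero[OF T] by simp
next
  case False
  then have pos: "0 < l2norm A f" using l2norm_nonneg[of A f] by linarith
  obtain K where K: "0 \<le> K" "\<And>f. f \<in> l2 A \<Longrightarrow> l2norm A (T f) \<le> K * l2norm A f"
    using bounded_op_bound[OF T] by blast
  let ?c = "complex_of_real (1 / l2norm A f)"
  let ?g = "\<lambda>x. ?c * f x"
  have g: "?g \<in> l2 A" "l2norm A ?g \<le> 1"
    using l2_scale_le(1)[OF f, of ?c] l2_scale[OF f, of ?c] pos by (simp_all add: norm_divide)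
  have "l2norm A (T ?g) \<le> opnorm A T"
    unfolding opnorm_def
  proof (rule cSup_upper)
    show "bdd_above {l2norm A (T f) |f. f \<in> l2 A \<and> l2norm A f \<le> 1}"
    proof (rule bdd_aboveI)
      fix x assume "x \<in> {l2norm A (T f) |f. f \<in> l2 A \<and> l2norm A f \<le> 1}"
      then obtain h where h: "h \<in> l2 A" "l2norm A h \<le> 1" "x = l2norm A (T h)" by blast
      have "x \<le> K * l2norm A h" using K h by simp
      also have "\<dots> \<le> K" using h K by (simp add: mult_left_le)
      finally show "x \<le> K" .
    qed
  qed (use g in blast)
  moreover have "l2norm A (T ?g) = l2norm A (T f) / l2norm A f"
    using bounded_opD(4)[OF T f, of ?c] l2_scale[OF bounded_opD(2)[OF T f], of ?c] pos
    by (simp add: norm_divide)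
  ultimately have "l2norm A (T f) / l2norm A f \<le> opnorm A T" by (simp only:)
  then show ?thesis using pos by (simp only: pos_divide_le_eq)
qed

lemma opnorm_nonneg: assumes "bounded_op A T" "A \<noteq> {}" shows "0 \<le> opnorm A T"
proof -
  obtain a where a: "a \<in> A" using assms by blast
  have "0 \<le> opnorm A T * l2norm A (ind {a})"
    by (rule order_trans[OF l2norm_nonneg le_opnorm[OF assms(1) l2_ind(1)]]) (use a in auto)
  then show ?thesis using l2_ind(2)[of "{a}" A] a by simp
qed

lemma bounded_opI:
  assumes "\<And>f. f \<notin> l2 A \<Longrightarrow> T f = (\<lambda>_. 0)" "\<And>f. f \<in> l2 A \<Longrightarrow> T f \<in> l2 A"
    "\<And>f g. f \<in> l2 A \<Longrightarrow> g \<in> l2 A \<Longrightarrow> T (\<lambda>x. f x + g x) = (\<lambda>x. T f x + T g x)"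
    "\<And>f c. f \<in> l2 A \<Longrightarrow> T (\<lambda>x. c * f x) = (\<lambda>x. c * T f x)"
    "\<And>f. f \<in> l2 A \<Longrightarrow> l2norm A (T f) \<le> K * l2norm A f"
  shows "bounded_op A T"
  using assms unfolding bounded_op_def by blast

lemma bounded_op_null: "bounded_op A (\<lambda>f x. 0)"
  by (rule bounded_opI[where K = 0]) auto

lemma bounded_op_add:
  assumes T: "bounded_op A T" and S: "bounded_op A S"
  shows "bounded_op A (\<lambda>f x. T f x + S f x)"
proof -
  obtain K L where K: "\<And>f. f \<in> l2 A \<Longrightarrow> l2norm A (T f) \<le> K * l2norm A f"
    and L: "\<And>f. f \<in> l2 A \<Longrightarrow> l2norm A (S f) \<le> L * l2norm A f"
    using bounded_op_bound[OF T] bounded_op_bound[OF S] by metis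
  show ?thesis
  proof (rule bounded_opI[where K = "K + L"])
    fix f assume f: "f \<in> l2 A"
    have "l2norm A (\<lambda>x. T f x + S f x) \<le> l2norm A (T f) + l2norm A (S f)"
      by (intro l2_add bounded_opD(2)[OF T] bounded_opD(2)[OF S] f)
    then show "l2norm A (\<lambda>x. T f x + S f x) \<le> (K + L) * l2norm A f"
      using K[OF f] L[OF f] by (simp add: algebra_simps)
  qed (simp_all add: bounded_opD[OF T] bounded_opD[OF S] l2_add algebra_simps)
qed

lemma bounded_op_scale:
  assumes T: "bounded_op A T" shows "bounded_op A (\<lambda>f x. c * T f x)"
proof -
  obtain K where K: "\<And>f. f \<in> l2 A \<Longrightarrow> l2norm A (T f) \<le> K * l2norm A f"
    using bounded_op_bound[OF T] by metis
  show ?thesis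
  proof (rule bounded_opI[where K = "cmod c * K"])
    fix f assume f: "f \<in> l2 A"
    show "l2norm A (\<lambda>x. c * T f x) \<le> cmod c * K * l2norm A f"
      using K[OF f] l2_scale[OF bounded_opD(2)[OF T f], of c] by (simp add: mult.assoc mult_left_mono)
  qed (simp_all add: bounded_opD[OF T] l2_scale_le(1) algebra_simps)
qed

lemma bounded_op_diff:
  assumes T: "bounded_op A T" and S: "bounded_op A S" shows "bounded_op A (op_diff T S)"
  using bounded_op_add[OF T bounded_op_scale[OF S, of "-1"]] by (simp add: op_diff_def)

lemma bounded_op_comp:
  assumes T: "bounded_op A T" and S: "bounded_op A S" shows "bounded_op A (T \<circ> S)"
proof -
  obtain K L where K: "0 \<le> K" "\<And>f. f \<in> l2 A \<Longrightarrow> l2norm A (T f) \<le> K * l2norm A f"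
    and L: "\<And>f. f \<in> l2 A \<Longrightarrow> l2norm A (S f) \<le> L * l2norm A f"
    using bounded_op_bound[OF T] bounded_op_bound[OF S] by metis
  show ?thesis
  proof (rule bounded_opI[where K = "K * L"])
    fix f assume f: "f \<in> l2 A"
    have "l2norm A (T (S f)) \<le> K * l2norm A (S f)" by (rule K) (rule bounded_opD(2)[OF S f])
    also have "\<dots> \<le> K * (L * l2norm A f)" using L[OF f] K by (intro mult_left_mono)
    finally show "l2norm A ((T \<circ> S) f) \<le> K * L * l2norm A f" by (simp add: mult.assoc)
  qed (simp_all add: bounded_opD[OF T] bounded_opD[OF S] bounded_op_zero[OF T])
qed

text \<open>Linearity holds as an identity on all arguments: outside l2 the normalisation makes both
  sides zero, as \<open>R\<close> sends 0 to 0.\<close>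

lemma bounded_comp_linear:
  assumes "bounded_op A R" "bounded_op A T" "bounded_op A S"
  shows "R \<circ> (\<lambda>f x. c * S f x + T f x) = (\<lambda>f x. c * (R \<circ> S) f x + (R \<circ> T) f x)"
proof
  fix f
  show "(R \<circ> (\<lambda>f x. c * S f x + T f x)) f = (\<lambda>x. c * (R \<circ> S) f x + (R \<circ> T) f x)"
  proof (cases "f \<in> l2 A")
    case True
    then have "S f \<in> l2 A" "T f \<in> l2 A" using assms bounded_opD(2) by blast+
    then show ?thesis using bounded_opD(3,4)[OF assms(1)] by (simp add: l2_scale_le(1))
  next
    case False
    then show ?thesis using bounded_opD(1)[OF assms(2)] bounded_opD(1)[OF assms(3)]
        bounded_op_zero[OF assms(1)] by simp
  qed
qed

lemma opnorm_triangle: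
  assumes "bounded_op A T" "bounded_op A S" "A \<noteq> {}"
  shows "opnorm A (\<lambda>f x. T f x + S f x) \<le> opnorm A T + opnorm A S"
proof (rule opnorm_le)
  show "0 \<le> opnorm A T + opnorm A S" using assms by (intro add_nonneg_nonneg opnorm_nonneg)
  fix f assume f: "f \<in> l2 A"
  have "l2norm A (\<lambda>x. T f x + S f x) \<le> l2norm A (T f) + l2norm A (S f)"
    by (intro l2_add bounded_opD(2)[OF assms(1)] bounded_opD(2)[OF assms(2)] f)
  also have "\<dots> \<le> (opnorm A T + opnorm A S) * l2norm A f"
    using le_opnorm[OF assms(1) f] le_opnorm[OF assms(2) f] by (simp add: algebra_simps)
  finally show "l2norm A (\<lambda>x. T f x + S f x) \<le> (opnorm A T + opnorm A S) * l2norm A f" .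
qed

lemma opnorm_comp:
  assumes "bounded_op A T" "bounded_op A S" "A \<noteq> {}"
  shows "opnorm A (T \<circ> S) \<le> opnorm A T * opnorm A S"
proof (rule opnorm_le)
  show "0 \<le> opnorm A T * opnorm A S" using assms by (simp add: opnorm_nonneg)
  fix f assume f: "f \<in> l2 A"
  have "l2norm A (T (S f)) \<le> opnorm A T * l2norm A (S f)"
    by (rule le_opnorm[OF assms(1) bounded_opD(2)[OF assms(2) f]])
  also have "\<dots> \<le> opnorm A T * (opnorm A S * l2norm A f)"
    using le_opnorm[OF assms(2) f] assms by (intro mult_left_mono opnorm_nonneg) auto
  finally show "l2norm A ((T \<circ> S) f) \<le> opnorm A T * opnorm A S * l2norm A f" by (simp add: mult.assoc)
qed

lemma opnorm_scale_le:
  assumes "bounded_op A T" "A \<noteq> {}"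
  shows "opnorm A (\<lambda>f x. c * T f x) \<le> cmod c * opnorm A T"
proof (rule opnorm_le)
  show "0 \<le> cmod c * opnorm A T" using assms by (simp add: opnorm_nonneg)
  fix f assume f: "f \<in> l2 A"
  show "l2norm A (\<lambda>x. c * T f x) \<le> cmod c * opnorm A T * l2norm A f"
    using le_opnorm[OF assms(1) f] l2_scale[OF bounded_opD(2)[OF assms(1) f], of c]
    by (simp add: mult.assoc mult_left_mono)
qed

section \<open>The regular representation and the group algebra\<close>

locale plain_group = group G for G :: "'a monoid" (structure)
begin

abbreviation "cA \<equiv> carrier G"

lemma lreg_in:
  assumes "g \<in> carrier G" "f \<in> l2 cA"
  shows "lreg G g f \<in> l2 cA" "l2norm cA (lreg G g f) \<le> l2norm cA f"
proof -
  have 1: "L2_set (\<lambda>x. cmod (lreg G g f x)) F \<le> l2norm cA f" if F: "finite F" "F \<subseteq> cA" for F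
  proof -
    have inj: "inj_on (\<lambda>x. inv g \<otimes> x) F" using F assms(1) by (auto simp: inj_on_def subset_iff)
    have "L2_set (\<lambda>x. cmod (lreg G g f x)) F = L2_set (\<lambda>x. cmod (f (inv g \<otimes> x))) F"
      using F assms(2) by (intro L2_set_cmod_cong) (auto simp: lreg_def)
    also have "\<dots> = L2_set (\<lambda>x. cmod (f x)) ((\<lambda>x. inv g \<otimes> x) ` F)"
      by (simp add: L2_set_def sum.reindex[OF inj])
    also have "\<dots> \<le> l2norm cA f" using F assms by (intro L2_set_le_l2norm) auto
    finally show ?thesis .
  qed
  have 0: "lreg G g f x = 0" if "x \<notin> cA" for x using that by (simp add: lreg_def)
  from l2I[of cA "lreg G g f", OF 0 1] show "lreg G g f \<in> l2 cA" "l2norm cA (lreg G g f) \<le> l2norm cA f" by auto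
qed

lemma lreg_apply: "f \<in> l2 cA \<Longrightarrow> x \<in> cA \<Longrightarrow> lreg G g f x = f (inv g \<otimes> x)"
  by (simp add: lreg_def)

lemma lreg_bounded: assumes "g \<in> carrier G" shows "bounded_op cA (lreg G g)"
proof (rule bounded_opI[where K = 1])
  show "lreg G g f = (\<lambda>_. 0)" if "f \<notin> l2 cA" for f using that by (simp add: lreg_def)
  show "lreg G g (\<lambda>x. f x + h x) = (\<lambda>x. lreg G g f x + lreg G g h x)" if "f \<in> l2 cA" "h \<in> l2 cA" for f h
    using that by (auto simp: lreg_def l2_add)
  show "lreg G g (\<lambda>x. c * f x) = (\<lambda>x. c * lreg G g f x)" if "f \<in> l2 cA" for f c
    using that by (auto simp: lreg_def l2_scale_le)
qed (use lreg_in assms in auto)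

lemma lreg_mult: assumes "g \<in> carrier G" "h \<in> carrier G" shows "lreg G g \<circ> lreg G h = lreg G (g \<otimes> h)"
proof
  fix f show "(lreg G g \<circ> lreg G h) f = lreg G (g \<otimes> h) f"
  proof (cases "f \<in> l2 cA")
    case True
    have "lreg G g (lreg G h f) x = lreg G (g \<otimes> h) f x" for x
      using True assms lreg_in[OF assms(2) True]
      by (cases "x \<in> carrier G") (auto simp: lreg_def[of G g] lreg_apply inv_mult_group m_assoc, auto simp: lreg_def)
    then show ?thesis by auto
  next
    case False
    then have "lreg G h f = (\<lambda>_. 0)" "lreg G (g \<otimes> h) f = (\<lambda>_. 0)" by (simp_all add: lreg_def)
    then show ?thesis using bounded_op_zero[OF lreg_bounded[OF assms(1)]] by simp
  qed
qed

lemma lreg_one_l2: assumes "f \<in> l2 cA" shows "lreg G \<one> f = f"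
  using assms l2_outside[OF assms] by (auto simp: lreg_def)

text \<open>The unit of the reduced algebra is \<open>lreg G \<one>\<close> and not the identity
  map, since operators are normalised to vanish outside l2.\<close>

lemma comp_lreg_one: assumes T: "bounded_op cA T" shows "T \<circ> lreg G \<one> = T"
proof
  fix f show "(T \<circ> lreg G \<one>) f = T f"
    using lreg_one_l2 bounded_opD(1)[OF T, of f] bounded_op_zero[OF T]
    by (cases "f \<in> l2 cA") (auto simp: lreg_def)
qed

lemma group_alg_add:
  assumes "T \<in> group_alg G" "S \<in> group_alg G" shows "(\<lambda>f x. T f x + S f x) \<in> group_alg G"
proof -
  obtain F c where T: "finite F" "F \<subseteq> carrier G" "T = (\<lambda>f x. \<Sum>g\<in>F. c g * lreg G g f x)"
    using assms(1) by (auto simp: group_alg_def)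
  obtain F' c' where S: "finite F'" "F' \<subseteq> carrier G" "S = (\<lambda>f x. \<Sum>g\<in>F'. c' g * lreg G g f x)"
    using assms(2) by (auto simp: group_alg_def)
  let ?c = "\<lambda>g. (if g \<in> F then c g else 0) + (if g \<in> F' then c' g else 0)"
  have "T f x + S f x = (\<Sum>g\<in>F \<union> F'. ?c g * lreg G g f x)" for f x
  proof -
    have "T f x = (\<Sum>g\<in>F \<union> F'. (if g \<in> F then c g else 0) * lreg G g f x)"
      unfolding T(3) using T S by (intro sum.mono_neutral_cong_left) auto
    moreover have "S f x = (\<Sum>g\<in>F \<union> F'. (if g \<in> F' then c' g else 0) * lreg G g f x)"
      unfolding S(3) using T S by (intro sum.mono_neutral_cong_left) auto
    ultimately show ?thesis by (simp add: sum.distrib[symmetric] distrib_right)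
  qed
  then have "(\<lambda>f x. T f x + S f x) = (\<lambda>f x. \<Sum>g\<in>F \<union> F'. ?c g * lreg G g f x)" by (intro ext)
  then show ?thesis using T(1,2) S(1,2) unfolding group_alg_def
    by (intro CollectI exI[of _ "F \<union> F'"] exI[of _ ?c] conjI) simp_all
qed

lemma group_alg_scale: assumes "T \<in> group_alg G" shows "(\<lambda>f x. k * T f x) \<in> group_alg G"
proof -
  obtain F c where T: "finite F" "F \<subseteq> carrier G" "T = (\<lambda>f x. \<Sum>g\<in>F. c g * lreg G g f x)"
    using assms by (auto simp: group_alg_def)
  have "(\<lambda>f x. k * T f x) = (\<lambda>f x. \<Sum>g\<in>F. (k * c g) * lreg G g f x)"
    unfolding T(3) by (simp add: sum_distrib_left mult.assoc)
  then show ?thesis using T unfolding group_alg_def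
    by (intro CollectI exI[of _ F] exI[of _ "\<lambda>g. k * c g"]) simp
qed

lemma group_alg_lreg: assumes "g \<in> carrier G" shows "lreg G g \<in> group_alg G"
  unfolding group_alg_def using assms by (intro CollectI exI[of _ "{g}"] exI[of _ "\<lambda>_. 1"]) simp

lemma group_alg_zero: "(\<lambda>f x. 0) \<in> group_alg G"
  unfolding group_alg_def by (intro CollectI exI[of _ "{}"]) simp

lemma group_alg_induct [consumes 1, case_names zero add]:
  assumes "T \<in> group_alg G" and "P (\<lambda>f x. 0)"
    and "\<And>T g c. T \<in> group_alg G \<Longrightarrow> P T \<Longrightarrow> g \<in> carrier G \<Longrightarrow> P (\<lambda>f x. c * lreg G g f x + T f x)"
  shows "P T"
proof -
  obtain F c where T: "finite F" "F \<subseteq> carrier G" "T = (\<lambda>f x. \<Sum>g\<in>F. c g * lreg G g f x)"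
    using assms(1) by (auto simp: group_alg_def)
  have "P (\<lambda>f x. \<Sum>g\<in>F. c g * lreg G g f x)" using T(1,2)
  proof (induction)
    case empty
    then show ?case using assms(2) by simp
  next
    case (insert g F)
    have "(\<lambda>f x. \<Sum>g\<in>F. c g * lreg G g f x) \<in> group_alg G"
      unfolding group_alg_def using insert(1,4) by (intro CollectI exI[of _ F] exI[of _ c]) simp
    then show ?case using assms(3)[of "\<lambda>f x. \<Sum>g\<in>F. c g * lreg G g f x" g "c g"] insert by simp
  qed
  then show ?thesis using T by simp
qed

lemma group_alg_bounded: "T \<in> group_alg G \<Longrightarrow> bounded_op cA T"
  by (induction rule: group_alg_induct) (auto intro!: bounded_op_null bounded_op_add bounded_op_scale lreg_bounded)

lemma group_alg_lreg_comp:
  assumes g: "g \<in> carrier G" and T: "T \<in> group_alg G"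
  shows "lreg G g \<circ> T \<in> group_alg G" "T \<circ> lreg G g \<in> group_alg G"
  using T
proof (induction rule: group_alg_induct)
  case zero
  {
    case 1
    have "lreg G g \<circ> (\<lambda>(f :: 'a \<Rightarrow> complex) x. 0) = (\<lambda>f x. 0)" using bounded_op_zero[OF lreg_bounded[OF g]] by (auto simp: fun_eq_iff)
    then show ?case using group_alg_zero by (simp only:)
  next
    case 2
    have "(\<lambda>(f :: 'a \<Rightarrow> complex) (x :: 'a). 0 :: complex) \<circ> lreg G g = (\<lambda>f x. 0)" by (auto simp: fun_eq_iff)
    then show ?case using group_alg_zero by (simp only:)
  }
next
  case (add T h c)
  {
    case 1
    show ?case unfolding bounded_comp_linear[OF lreg_bounded[OF g] group_alg_bounded[OF \<open>T \<in> group_alg G\<close>] lreg_bounded[OF \<open>h \<in> carrier G\<close>]]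
      using add g by (simp add: lreg_mult group_alg_add group_alg_scale group_alg_lreg del: o_apply)
  next
    case 2
    have "(\<lambda>f x. c * lreg G h f x + T f x) \<circ> lreg G g = (\<lambda>f x. c * (lreg G h \<circ> lreg G g) f x + (T \<circ> lreg G g) f x)"
      by auto
    also have "\<dots> \<in> group_alg G"
      using add g by (simp add: lreg_mult group_alg_add group_alg_scale group_alg_lreg del: o_apply)
    finally show ?case .
  }
qed

lemma reduced_CstarD:
  assumes "T \<in> reduced_Cstar G"
  shows "bounded_op cA T" "0 < e \<Longrightarrow> \<exists>S\<in>group_alg G. opnorm cA (op_diff T S) < e"
  using assms by (auto simp: reduced_Cstar_def)

lemma group_alg_reduced: assumes "T \<in> group_alg G" shows "T \<in> reduced_Cstar G"
proof -
  have "opnorm cA (op_diff T T) \<le> 0" by (rule opnorm_le) (auto simp: op_diff_def)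
  then show ?thesis using assms group_alg_bounded by (force simp: reduced_Cstar_def)
qed

end

section \<open>Amenability\<close>

definition hall :: "'i set \<Rightarrow> ('i \<Rightarrow> 'x set) \<Rightarrow> bool" where
  "hall I B \<longleftrightarrow> (\<forall>J. finite J \<longrightarrow> J \<subseteq> I \<longrightarrow> card J \<le> card (\<Union>i\<in>J. B i))"

lemma hallD: "hall I B \<Longrightarrow> finite J \<Longrightarrow> J \<subseteq> I \<Longrightarrow> card J \<le> card (\<Union>i\<in>J. B i)"
  by (simp add: hall_def)

text \<open>Rado's argument: in a minimal family satisfying Hall's condition every set is a singleton.\<close>

lemma hall_minimal_singleton:
  assumes B: "hall I B" and fin: "\<And>i. i \<in> I \<Longrightarrow> finite (B i)" and i: "i \<in> I"
    and min: "\<And>x. x \<in> B i \<Longrightarrow> \<not> hall I (B(i := B i - {x}))"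
    and x: "x \<in> B i" and y: "y \<in> B i"
  shows "x = y"
proof (rule ccontr)
  assume "x \<noteq> y"
  \<comment> \<open>A violation caused by deleting \<open>z\<close> from \<open>B i\<close> must
    involve \<open>i\<close>; taking \<open>i\<close> out of the violating set turns the strict
    inequality into a weak one for the rest.\<close>
  have ex: "\<exists>J. finite J \<and> J \<subseteq> I \<and> i \<notin> J \<and> card ((\<Union>j\<in>J. B j) \<union> (B i - {z})) \<le> card J"
    if z: "z \<in> B i" for z
  proof -
    obtain J where J: "finite J" "J \<subseteq> I" "card (\<Union>j\<in>J. (B(i := B i - {z})) j) < card J"
      using min[OF z] by (auto simp: hall_def not_le)
    have "i \<in> J"
    proof (rule ccontr)
      assume "i \<notin> J"
      then have "(\<Union>j\<in>J. (B(i := B i - {z})) j) = (\<Union>j\<in>J. B j)" by auto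
      then show False using hallD[OF B J(1,2)] J(3) by simp
    qed
    have "(\<Union>j\<in>J. (B(i := B i - {z})) j) = (\<Union>j\<in>J - {i}. B j) \<union> (B i - {z})"
      using \<open>i \<in> J\<close> by auto
    moreover have "card J = Suc (card (J - {i}))" using J \<open>i \<in> J\<close> by (simp add: card_Suc_Diff1)
    ultimately have "card ((\<Union>j\<in>J - {i}. B j) \<union> (B i - {z})) \<le> card (J - {i})" using J(3) by simp
    then show ?thesis using J(1,2) by (intro exI[of _ "J - {i}"] conjI) auto
  qed
  obtain J where J: "finite J" "J \<subseteq> I" "i \<notin> J" "card ((\<Union>j\<in>J. B j) \<union> (B i - {x})) \<le> card J"
    using ex[OF x] by blast
  obtain K where K: "finite K" "K \<subseteq> I" "i \<notin> K" "card ((\<Union>j\<in>K. B j) \<union> (B i - {y})) \<le> card K"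
    using ex[OF y] by blast
  let ?P = "(\<Union>j\<in>J. B j) \<union> (B i - {x})" and ?Q = "(\<Union>j\<in>K. B j) \<union> (B i - {y})"
  have finP: "finite ?P" "finite ?Q" using J K fin i by auto
  have "?P \<union> ?Q = (\<Union>j\<in>insert i (J \<union> K). B j)" using \<open>x \<noteq> y\<close> x y by auto
  then have "card (insert i (J \<union> K)) \<le> card (?P \<union> ?Q)"
    using hallD[OF B, of "insert i (J \<union> K)"] J(1,2) K(1,2) i by simp
  then have 1: "Suc (card (J \<union> K)) \<le> card (?P \<union> ?Q)" using J K by simp
  have "card (J \<inter> K) \<le> card (\<Union>j\<in>J \<inter> K. B j)"
    by (rule hallD[OF B]) (use J K in auto)
  also have "\<dots> \<le> card (?P \<inter> ?Q)" using finP by (intro card_mono) auto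
  finally have 2: "card (J \<inter> K) \<le> card (?P \<inter> ?Q)" .
  \<comment> \<open>Submodular counting: since \<open>x\<close> and \<open>y\<close> differ, the
    union contains all of \<open>B i\<close>, and Hall's condition with \<open>i\<close> included
    makes it one element too large for the bounds on \<open>card ?P\<close> and
    \<open>card ?Q\<close>.\<close>
  have "card ?P + card ?Q = card (?P \<union> ?Q) + card (?P \<inter> ?Q)" using finP by (rule card_Un_Int)
  moreover have "card J + card K = card (J \<union> K) + card (J \<inter> K)" using J K by (intro card_Un_Int)
  ultimately show False using 1 2 J K by linarith
qed

text \<open>Zorn's lemma for the subfamilies satisfying Hall's condition, ordered by reverse
  inclusion. The intersection of a chain still satisfies it, because over finitely many indices the
  finite sets become stationary, so that some member of the chain equals the intersection there. A
  minimal family consists of singletons and is the matching.\<close>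

theorem hall_marriage:
  assumes A: "hall I A" and fin: "\<And>i. i \<in> I \<Longrightarrow> finite (A i)"
  shows "\<exists>f. inj_on f I \<and> (\<forall>i\<in>I. f i \<in> A i)"
proof -
  define P where "P = {B. hall I B \<and> (\<forall>i. B i \<subseteq> A i)}"
  define r where "r = {(B, C). B \<in> P \<and> C \<in> P \<and> (\<forall>i. C i \<subseteq> B i)}"
  have po: "Partial_order r"
    unfolding partial_order_on_def preorder_on_def refl_on_def trans_def antisym_def Field_def
    by (auto simp: r_def) (metis subset_antisym ext)+
  have field: "Field r = P" by (auto simp: Field_def r_def)
  have "\<exists>B\<in>Field r. \<forall>C\<in>Field r. (B, C) \<in> r \<longrightarrow> C = B"
  proof (rule Zorns_po_lemma[OF po])
    fix C assume C: "C \<in> Chains r"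
    show "\<exists>u\<in>Field r. \<forall>a\<in>C. (a, u) \<in> r"
    proof (cases "C = {}")
      case True
      then show ?thesis using A field by (auto simp: P_def)
    next
      case False
      have CP: "B \<in> P" if "B \<in> C" for B using C that by (auto simp: Chains_def r_def)
      have chain: "(\<forall>i. B i \<subseteq> B' i) \<or> (\<forall>i. B' i \<subseteq> B i)" if "B \<in> C" "B' \<in> C" for B B'
        using C that by (auto simp: Chains_def r_def)
      define M where "M = (\<lambda>i. \<Inter>B\<in>C. B i)"
      have stab: "\<exists>B\<in>C. \<forall>i\<in>J. B i = M i" if "finite J" "J \<subseteq> I" for J
        using that
      proof induction
        case empty
        then show ?case using False by auto
      next
        case (insert i J)
        obtain B where B: "B \<in> C" "\<forall>j\<in>J. B j = M j" using insert by auto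
        obtain B' where B': "B' \<in> C" "\<And>B. B \<in> C \<Longrightarrow> card (B' i) \<le> card (B i)"
          using ex_has_least_nat[of "\<lambda>B. B \<in> C" B "\<lambda>B. card (B i)"] B by blast
        have fi: "finite (B i)" if "B \<in> C" for B
          using CP[OF that] fin[of i] finite_subset[of "B i" "A i"] insert by (auto simp: P_def)
        have "B' i \<subseteq> D i" if "D \<in> C" for D
          using chain[OF B'(1) that] B'(2)[OF that] fi[OF B'(1)]
          by (metis card_seteq subset_refl)
        then have B'i: "B' i = M i" using B'(1) by (auto simp: M_def)
        have MD: "M j \<subseteq> D j" if "D \<in> C" for D j using that by (auto simp: M_def)
        from chain[OF B(1) B'(1)] show ?case
        proof
          assume "\<forall>i. B i \<subseteq> B' i"
          then have "B i = M i" using MD[OF B(1)] B'i by blast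
          then show ?thesis using B by blast
        next
          assume "\<forall>i. B' i \<subseteq> B i"
          then have "B' j = M j" if "j \<in> J" for j using MD[OF B'(1)] B(2) that by blast
          then show ?thesis using B'(1) B'i by blast
        qed
      qed
      have "hall I M"
        unfolding hall_def
      proof (intro allI impI)
        fix J assume J: "finite J" "J \<subseteq> I"
        then obtain B where B: "B \<in> C" "\<forall>i\<in>J. B i = M i" using stab by blast
        then have "(\<Union>i\<in>J. M i) = (\<Union>i\<in>J. B i)" by auto
        then show "card J \<le> card (\<Union>i\<in>J. M i)" using CP[OF B(1)] J by (auto simp: P_def hall_def)
      qed
      moreover have "M i \<subseteq> A i" for i using False CP by (auto simp: M_def P_def)
      ultimately have "M \<in> P" by (simp add: P_def)
      moreover have "(B, M) \<in> r" if "B \<in> C" for B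
        using that CP \<open>M \<in> P\<close> by (auto simp: r_def M_def)
      ultimately show ?thesis using field by blast
    qed
  qed
  then obtain B where B': "B \<in> P" "\<forall>C\<in>P. (B, C) \<in> r \<longrightarrow> C = B" unfolding field by blast
  have B: "B \<in> P" "\<And>C. C \<in> P \<Longrightarrow> (\<forall>i. C i \<subseteq> B i) \<Longrightarrow> C = B"
    using B' by (auto simp: r_def)
  have hB: "hall I B" "\<And>i. B i \<subseteq> A i" using B(1) by (auto simp: P_def)
  have finB: "finite (B i)" if "i \<in> I" for i using hB(2) fin[OF that] finite_subset by blast
  have min: "\<not> hall I (B(i := B i - {x}))" if "x \<in> B i" for i x
  proof
    assume "hall I (B(i := B i - {x}))"
    then have "B(i := B i - {x}) \<in> P" using hB(2) by (auto simp: P_def)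
    then have "B(i := B i - {x}) = B" using B(2)[of "B(i := B i - {x})"] by auto
    then have "B i - {x} = B i" by (metis fun_upd_same)
    then show False using that by blast
  qed
  have "\<exists>x. B i = {x}" if i: "i \<in> I" for i
  proof -
    have "card {i} \<le> card (\<Union>j\<in>{i}. B j)" by (rule hallD[OF hB(1)]) (use i in auto)
    then obtain x where "x \<in> B i" by fastforce
    then show ?thesis using hall_minimal_singleton[OF hB(1) finB i min] by blast
  qed
  then obtain f where f: "\<And>i. i \<in> I \<Longrightarrow> B i = {f i}" by metis
  have "inj_on f I"
  proof (rule inj_onI, rule ccontr)
    fix i j assume ij: "i \<in> I" "j \<in> I" "f i = f j" "i \<noteq> j"
    have "card {i, j} \<le> card (\<Union>k\<in>{i, j}. B k)" by (rule hallD[OF hB(1)]) (use ij in auto)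
    moreover have "(\<Union>k\<in>{i, j}. B k) = {f i}" using f ij by auto
    ultimately show False using ij by simp
  qed
  moreover have "f i \<in> A i" if "i \<in> I" for i using f[OF that] hB(2) by blast
  ultimately show ?thesis by blast
qed

text \<open>Hall's theorem turns the doubling into two injections of the group with disjoint ranges that are
  piecewise left translations by elements of \<open>E\<close>.\<close>

lemma (in group) doubling_not_amenable:
  assumes E: "finite E" "E \<subseteq> carrier G"
    and dbl: "\<And>F. finite F \<Longrightarrow> F \<subseteq> carrier G \<Longrightarrow> 2 * card F \<le> card (\<Union>s\<in>E. (\<lambda>x. s \<otimes> x) ` F)"
    and \<mu>1: "\<mu> (carrier G) = 1" and pos: "\<And>A. A \<subseteq> carrier G \<Longrightarrow> 0 \<le> \<mu> A"
    and add: "\<And>A B. A \<subseteq> carrier G \<Longrightarrow> B \<subseteq> carrier G \<Longrightarrow> A \<inter> B = {} \<Longrightarrow> \<mu> (A \<union> B) = \<mu> A + (\<mu> B :: real)"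
    and inv: "\<And>g A. g \<in> carrier G \<Longrightarrow> A \<subseteq> carrier G \<Longrightarrow> \<mu> ((\<lambda>x. g \<otimes> x) ` A) = \<mu> A"
  shows False
proof -
  define N where "N = (\<lambda>(x, b::bool). (\<lambda>s. s \<otimes> x) ` E)"
  have Np: "N p = (\<lambda>s. s \<otimes> fst p) ` E" for p by (simp add: N_def split: prod.splits)
  have "hall (carrier G \<times> UNIV) N"
    unfolding hall_def
  proof (intro allI impI)
    fix J :: "('a \<times> bool) set" assume J: "finite J" "J \<subseteq> carrier G \<times> UNIV"
    have "card J \<le> card (fst ` J \<times> (UNIV :: bool set))"
      using J by (intro card_mono) (auto intro: rev_image_eqI)
    also have "\<dots> = 2 * card (fst ` J)" by (simp add: card_cartesian_product)
    also have "\<dots> \<le> card (\<Union>s\<in>E. (\<lambda>x. s \<otimes> x) ` fst ` J)" using J by (intro dbl) auto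
    also have "(\<Union>s\<in>E. (\<lambda>x. s \<otimes> x) ` fst ` J) = (\<Union>p\<in>J. N p)"
      unfolding Np by blast
    finally show "card J \<le> card (\<Union>p\<in>J. N p)" .
  qed
  moreover have "finite (N p)" for p using E by (auto simp: N_def split: prod.splits)
  ultimately obtain f where f: "inj_on f (carrier G \<times> UNIV)" "\<And>p. p \<in> carrier G \<times> UNIV \<Longrightarrow> f p \<in> N p"
    using hall_marriage by blast
  define P where "P = (\<lambda>b s. {x \<in> carrier G. f (x, b) = s \<otimes> x})"
  have P: "P b s \<subseteq> carrier G" for b s by (auto simp: P_def)
  have \<mu>0: "\<mu> {} = 0" using add[of "{}" "{}"] by simp
  have fadd: "\<mu> (\<Union>i\<in>I. Q i) = (\<Sum>i\<in>I. \<mu> (Q i))"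
    if "finite I" "\<And>i. i \<in> I \<Longrightarrow> Q i \<subseteq> carrier G" "\<And>i j. i \<in> I \<Longrightarrow> j \<in> I \<Longrightarrow> i \<noteq> j \<Longrightarrow> Q i \<inter> Q j = {}"
    for I :: "'i set" and Q
    using that
  proof induction
    case empty
    then show ?case by (simp add: \<mu>0)
  next
    case (insert i I)
    have "\<mu> (Q i \<union> (\<Union>i\<in>I. Q i)) = \<mu> (Q i) + \<mu> (\<Union>i\<in>I. Q i)"
    proof (rule add)
      show "Q i \<inter> (\<Union>i\<in>I. Q i) = {}" using insert.prems(2)[of i] insert.hyps by auto
    qed (use insert in auto)
    then show ?case using insert by simp
  qed
  have PU: "(\<Union>s\<in>E. P b s) = carrier G" for b
    using f(2) by (fastforce simp: P_def N_def)
  have Pd: "P b s \<inter> P b t = {}" if "s \<noteq> t" "s \<in> E" "t \<in> E" for b s t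
    using that E by (auto simp: P_def subset_iff)
  have sum1: "(\<Sum>s\<in>E. \<mu> (P b s)) = 1" for b
    using fadd[OF E(1), of "P b"] P Pd PU \<mu>1 by simp
  \<comment> \<open>The ranges of the two injections, cut into translates of the pieces. By
    invariance each injection has a range of measure 1, and together they would have measure
    2.\<close>
  define R where "R = (\<lambda>(b, s). (\<lambda>x. s \<otimes> x) ` P b s)"
  have Rf: "R (b, s) = (\<lambda>x. f (x, b)) ` P b s" for b s by (force simp: R_def P_def)
  have Rc: "R p \<subseteq> carrier G" if "p \<in> UNIV \<times> E" for p using that E(2) by (auto simp: R_def P_def)
  have Rd: "R p \<inter> R q = {}" if "p \<noteq> q" "p \<in> UNIV \<times> E" "q \<in> UNIV \<times> E" for p q
  proof (rule ccontr)
    obtain b s c t where pq: "p = (b, s)" "q = (c, t)" by (cases p; cases q)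
    assume "R p \<inter> R q \<noteq> {}"
    then obtain x y where xy: "x \<in> P b s" "y \<in> P c t" "f (x, b) = f (y, c)" unfolding pq Rf by auto
    then have "(x, b) = (y, c)" using inj_onD[OF f(1) xy(3)] subsetD[OF P] by blast
    then show False using xy Pd[of s t b] that pq by auto
  qed
  have "\<mu> (\<Union>p\<in>UNIV \<times> E. R p) = (\<Sum>p\<in>UNIV \<times> E. \<mu> (R p))"
    using E Rc Rd by (intro fadd) auto
  also have "\<dots> = (\<Sum>b\<in>UNIV. \<Sum>s\<in>E. \<mu> (R (b, s)))" by (simp add: sum.cartesian_product)
  also have "\<dots> = (\<Sum>b\<in>(UNIV::bool set). \<Sum>s\<in>E. \<mu> (P b s))"
    unfolding R_def using E(2) P by (intro sum.cong refl) (simp add: inv subsetD)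
  also have "\<dots> = 2" by (simp add: sum1)
  finally have two: "\<mu> (\<Union>p\<in>UNIV \<times> E. R p) = 2" .
  let ?U = "\<Union>p\<in>UNIV \<times> E. R p"
  have U: "?U \<subseteq> carrier G" using Rc by blast
  then have "\<mu> (?U \<union> (carrier G - ?U)) = \<mu> ?U + \<mu> (carrier G - ?U)" by (intro add) auto
  moreover have "?U \<union> (carrier G - ?U) = carrier G" using U by blast
  ultimately show False using two \<mu>1 pos[of "carrier G - ?U"] by auto
qed

section \<open>From a contracting convolution to paradoxical doubling\<close>

lemma L2_set_sum_le:
  assumes "finite I" shows "L2_set (\<lambda>x. cmod (\<Sum>i\<in>I. f i x)) X \<le> (\<Sum>i\<in>I. L2_set (\<lambda>x. cmod (f i x)) X)"
  using assms
proof induction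
  case empty
  then show ?case by (simp add: L2_set_def)
next
  case (insert i I)
  have "L2_set (\<lambda>x. cmod (\<Sum>i\<in>insert i I. f i x)) X \<le> L2_set (\<lambda>x. cmod (f i x) + cmod (\<Sum>i\<in>I. f i x)) X"
    using insert by (intro L2_set_mono) (auto intro: norm_triangle_ineq)
  also have "\<dots> \<le> L2_set (\<lambda>x. cmod (f i x)) X + L2_set (\<lambda>x. cmod (\<Sum>i\<in>I. f i x)) X"
    by (rule L2_set_triangle_ineq)
  finally show ?case using insert by simp
qed

text \<open>If every translate of \<open>F\<close> by \<open>E\<close> nearly agreed with
  \<open>F\<close>, then, the coefficients having sum 1, the convolution of \<open>v\<close> with
  the indicator of \<open>F\<close> would be close to that indicator, and its norm could not drop to
  half.\<close>

lemma (in group) contraction_expands: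
  fixes v :: "'a \<Rightarrow> complex"
  assumes E: "finite E" "E \<subseteq> carrier G" and sum1: "(\<Sum>s\<in>E. v s) = 1"
    and contr: "\<And>F X. finite F \<Longrightarrow> F \<subseteq> carrier G \<Longrightarrow> finite X \<Longrightarrow> X \<subseteq> carrier G \<Longrightarrow>
      L2_set (\<lambda>x. cmod (\<Sum>s\<in>E. if inv s \<otimes> x \<in> F then v s else 0)) X \<le> sqrt (card F) / 2"
  shows "\<exists>\<delta>>0::real. \<forall>F. finite F \<longrightarrow> F \<subseteq> carrier G \<longrightarrow>
    (1 + \<delta>) * card F \<le> card (F \<union> (\<Union>s\<in>E. (\<lambda>x. s \<otimes> x) ` F))"
proof -
  define V where "V = (\<Sum>s\<in>E. cmod (v s))"
  have "1 = cmod (\<Sum>s\<in>E. v s)" using sum1 by simp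
  also have "\<dots> \<le> V" unfolding V_def by (rule norm_sum)
  finally have V: "1 \<le> V" .
  \<comment> \<open>With 16 the accumulated error \<open>V * sqrt (2 * (\<delta> * card F))\<close>
    equals \<open>sqrt (card F) / sqrt 8\<close>, which stays below the
    \<open>sqrt (card F) / 2\<close> forced by the contraction.\<close>
  define \<delta> where "\<delta> = 1 / (16 * V\<^sup>2)"
  have \<delta>: "0 < \<delta>" using V by (simp add: \<delta>_def)
  have "(1 + \<delta>) * card F \<le> card (F \<union> (\<Union>s\<in>E. (\<lambda>x. s \<otimes> x) ` F))"
    if F: "finite F" "F \<subseteq> carrier G" for F
  proof (cases "F = {}")
    case False
    define tr where "tr = (\<lambda>s. (\<lambda>x. s \<otimes> x) ` F)"
    define X where "X = F \<union> (\<Union>s\<in>E. tr s)"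
    have X: "finite X" "X \<subseteq> carrier G" using F E by (auto simp: X_def tr_def subset_iff)
    have trc: "finite (tr s)" "card (tr s) = card F" if "s \<in> E" for s
      using F E that by (auto simp: tr_def card_image inj_on_def subset_iff)
    have tr_iff: "inv s \<otimes> x \<in> F \<longleftrightarrow> x \<in> tr s" if "s \<in> E" "x \<in> X" for s x
    proof
      have c: "s \<in> carrier G" "x \<in> carrier G" using that E X by auto
      assume "inv s \<otimes> x \<in> F"
      then have "s \<otimes> (inv s \<otimes> x) \<in> tr s" by (simp add: tr_def)
      then show "x \<in> tr s" using c by (simp add: m_assoc[symmetric])
    next
      have c: "s \<in> carrier G" using that E by auto
      assume "x \<in> tr s"
      then show "inv s \<otimes> x \<in> F" using c F by (auto simp: tr_def m_assoc[symmetric] subset_iff)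
    qed
    define h where "h = (\<lambda>x. \<Sum>s\<in>E. if inv s \<otimes> x \<in> F then v s else 0)"
    define i where "i = (\<lambda>x. if x \<in> F then 1 else 0 :: complex)"
    define D where "D = (\<lambda>s x. v s * ((if x \<in> tr s then 1 else 0) - i x))"
    \<comment> \<open>As the coefficients sum to 1, \<open>i x\<close> can be spread over the same
      sum and compared with \<open>h x\<close> term by term.\<close>
    have hD: "h x - i x = (\<Sum>s\<in>E. D s x)" if "x \<in> X" for x
    proof -
      have "h x = (\<Sum>s\<in>E. v s * (if x \<in> tr s then 1 else 0))"
        unfolding h_def using tr_iff that by (intro sum.cong) auto
      moreover have "i x = (\<Sum>s\<in>E. v s * i x)" using sum1 by (simp add: sum_distrib_right[symmetric])
      ultimately show ?thesis by (simp add: D_def right_diff_distrib sum_subtractf)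
    qed
    have "(\<Sum>x\<in>X. (cmod (i x))\<^sup>2) = (\<Sum>x\<in>F. (1::real))"
      using X by (intro sum.mono_neutral_cong_right) (auto simp: i_def X_def)
    then have ni: "L2_set (\<lambda>x. cmod (i x)) X = sqrt (card F)" by (simp add: L2_set_def)
    have "L2_set (\<lambda>x. cmod (i x)) X \<le> L2_set (\<lambda>x. cmod (h x) + cmod (h x - i x)) X"
    proof (rule L2_set_mono)
      fix x show "cmod (i x) \<le> cmod (h x) + cmod (h x - i x)"
        using norm_triangle_ineq4[of "h x" "h x - i x"] by simp
    qed simp
    also have "\<dots> \<le> L2_set (\<lambda>x. cmod (h x)) X + L2_set (\<lambda>x. cmod (h x - i x)) X"
      by (rule L2_set_triangle_ineq)
    also have "L2_set (\<lambda>x. cmod (h x)) X \<le> sqrt (card F) / 2" unfolding h_def by (rule contr[OF F X])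
    finally have 1: "sqrt (card F) / 2 \<le> L2_set (\<lambda>x. cmod (h x - i x)) X" using ni by linarith
    have "L2_set (\<lambda>x. cmod (h x - i x)) X = L2_set (\<lambda>x. cmod (\<Sum>s\<in>E. D s x)) X"
      using hD by (simp cong: L2_set_cong)
    also have "\<dots> \<le> (\<Sum>s\<in>E. L2_set (\<lambda>x. cmod (D s x)) X)" by (rule L2_set_sum_le[OF E(1)])
    finally have 2: "sqrt (card F) / 2 \<le> (\<Sum>s\<in>E. L2_set (\<lambda>x. cmod (D s x)) X)" using 1 by linarith
    \<comment> \<open>\<open>tr s\<close> and \<open>F\<close> have the same size, so their
      symmetric difference has twice the size of \<open>tr s - F\<close>.\<close>
    have nD: "L2_set (\<lambda>x. cmod (D s x)) X = cmod (v s) * sqrt (2 * card (tr s - F))" if s: "s \<in> E" for s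
    proof -
      have "(\<Sum>x\<in>X. (cmod ((if x \<in> tr s then 1 else 0) - i x))\<^sup>2) = (\<Sum>x\<in>(tr s - F) \<union> (F - tr s). (1::real))"
        using X s by (intro sum.mono_neutral_cong_right) (auto simp: i_def X_def)
      also have "\<dots> = card (tr s - F) + card (F - tr s)"
        using F trc[OF s] by (simp, subst card_Un_disjoint) auto
      also have "card (F - tr s) = card (tr s - F)"
        using F trc[OF s] card_Diff_subset_Int[of F "tr s"] card_Diff_subset_Int[of "tr s" F]
        by (simp add: Int_commute)
      finally have "L2_set (\<lambda>x. cmod ((if x \<in> tr s then 1 else 0) - i x)) X = sqrt (2 * card (tr s - F))"
        by (simp add: L2_set_def)
      then show ?thesis by (simp add: D_def norm_mult L2_set_right_distrib[symmetric])
    qed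
    have "\<exists>s\<in>E. \<delta> * card F < card (tr s - F)"
    proof (rule ccontr)
      assume "\<not> (\<exists>s\<in>E. \<delta> * card F < card (tr s - F))"
      then have "L2_set (\<lambda>x. cmod (D s x)) X \<le> cmod (v s) * sqrt (2 * (\<delta> * card F))" if "s \<in> E" for s
        unfolding nD[OF that] using that by (intro mult_left_mono real_sqrt_le_mono) auto
      then have "(\<Sum>s\<in>E. L2_set (\<lambda>x. cmod (D s x)) X) \<le> V * sqrt (2 * (\<delta> * card F))"
        unfolding V_def sum_distrib_right by (rule sum_mono)
      also have "2 * (\<delta> * card F) = card F / (8 * V\<^sup>2)" by (simp add: \<delta>_def)
      also have "V * sqrt (card F / (8 * V\<^sup>2)) = sqrt (card F) / sqrt 8"
        using V by (simp add: real_sqrt_divide real_sqrt_mult)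
      also have "\<dots> < sqrt (card F) / 2"
      proof -
        have "2 < sqrt 8" by (rule real_less_rsqrt) simp
        moreover have "0 < sqrt (card F)" using F False by (simp add: card_gt_0_iff)
        ultimately show ?thesis by (intro divide_strict_left_mono) auto
      qed
      finally show False using 2 by linarith
    qed
    then obtain s where s: "s \<in> E" "\<delta> * card F < card (tr s - F)" by blast
    have "card F + card (tr s - F) = card (F \<union> (tr s - F))"
      using F trc[OF s(1)] by (subst card_Un_disjoint) auto
    also have "\<dots> \<le> card X" using X s by (intro card_mono) (auto simp: X_def)
    finally have "real (card F) + real (card (tr s - F)) \<le> card X" by linarith
    then show ?thesis using s unfolding X_def tr_def by (simp add: algebra_simps)
  qed simp
  then show ?thesis using \<delta> by (intro exI[of _ \<delta>]) simp
qed

text \<open>The expansion factor 1 + \<delta> is amplified to 2 by iteration: \<open>P n\<close>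
  consists of the products of at most \<open>n\<close> elements of \<open>E\<close>, and its
  translates enlarge every finite set by at least the n-th power of the factor.\<close>

lemma (in group) contraction_not_amenable:
  fixes v :: "'a \<Rightarrow> complex"
  assumes E: "finite E" "E \<subseteq> carrier G" and sum1: "(\<Sum>s\<in>E. v s) = 1"
    and contr: "\<And>F X. finite F \<Longrightarrow> F \<subseteq> carrier G \<Longrightarrow> finite X \<Longrightarrow> X \<subseteq> carrier G \<Longrightarrow>
      L2_set (\<lambda>x. cmod (\<Sum>s\<in>E. if inv s \<otimes> x \<in> F then v s else 0)) X \<le> sqrt (card F) / 2"
    and \<mu>1: "\<mu> (carrier G) = 1" and pos: "\<And>A. A \<subseteq> carrier G \<Longrightarrow> 0 \<le> \<mu> A"
    and add: "\<And>A B. A \<subseteq> carrier G \<Longrightarrow> B \<subseteq> carrier G \<Longrightarrow> A \<inter> B = {} \<Longrightarrow> \<mu> (A \<union> B) = \<mu> A + (\<mu> B :: real)"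
    and inv: "\<And>g A. g \<in> carrier G \<Longrightarrow> A \<subseteq> carrier G \<Longrightarrow> \<mu> ((\<lambda>x. g \<otimes> x) ` A) = \<mu> A"
  shows False
proof -
  obtain \<delta> :: real where \<delta>: "0 < \<delta>" "\<And>F. finite F \<Longrightarrow> F \<subseteq> carrier G \<Longrightarrow>
    (1 + \<delta>) * card F \<le> card (F \<union> (\<Union>s\<in>E. (\<lambda>x. s \<otimes> x) ` F))"
    using contraction_expands[OF E sum1 contr] by auto
  define P where "P = rec_nat {\<one>} (\<lambda>_ Q. Q \<union> (\<Union>s\<in>E. (\<lambda>x. s \<otimes> x) ` Q))"
  have P0: "P 0 = {\<one>}" and PS: "P (Suc n) = P n \<union> (\<Union>s\<in>E. (\<lambda>x. s \<otimes> x) ` P n)" for n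
    by (simp_all add: P_def)
  have P: "finite (P n) \<and> P n \<subseteq> carrier G" for n
    by (induction n) (use E in \<open>auto simp: P0 PS subset_iff\<close>)
  have grow: "(1 + \<delta>) ^ n * card F \<le> card (\<Union>s\<in>P n. (\<lambda>x. s \<otimes> x) ` F)"
    if F: "finite F" "F \<subseteq> carrier G" for n F
  proof (induction n)
    case 0
    have "(\<lambda>x. \<one> \<otimes> x) ` F = F" using F by (force simp: subset_iff)
    then show ?case by (simp add: P0)
  next
    case (Suc n)
    let ?Q = "\<Union>s\<in>P n. (\<lambda>x. s \<otimes> x) ` F"
    have Q: "finite ?Q" "?Q \<subseteq> carrier G" using F P[of n] by (auto simp: subset_iff)
    have as: "(s \<otimes> t) \<otimes> x = s \<otimes> (t \<otimes> x)" if "s \<in> E" "t \<in> P n" "x \<in> F" for s t x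
      using that E P[of n] F by (intro m_assoc) auto
    have "(1 + \<delta>) ^ Suc n * card F \<le> (1 + \<delta>) * card ?Q"
      using Suc \<delta>(1) by (simp add: mult.assoc)
    also have "\<dots> \<le> card (?Q \<union> (\<Union>s\<in>E. (\<lambda>x. s \<otimes> x) ` ?Q))" by (rule \<delta>(2)[OF Q])
    also have "?Q \<union> (\<Union>s\<in>E. (\<lambda>x. s \<otimes> x) ` ?Q) = (\<Union>s\<in>P (Suc n). (\<lambda>x. s \<otimes> x) ` F)"
    proof -
      have e: "z \<in> (\<Union>s\<in>E. (\<lambda>x. s \<otimes> x) ` ?Q) \<longleftrightarrow> z \<in> (\<Union>s\<in>(\<Union>s\<in>E. (\<lambda>x. s \<otimes> x) ` P n). (\<lambda>x. s \<otimes> x) ` F)" for z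
      proof -
        have "z \<in> (\<Union>s\<in>E. (\<lambda>x. s \<otimes> x) ` ?Q) \<longleftrightarrow> (\<exists>s\<in>E. \<exists>t\<in>P n. \<exists>x\<in>F. z = s \<otimes> (t \<otimes> x))" by blast
        also have "\<dots> \<longleftrightarrow> (\<exists>s\<in>E. \<exists>t\<in>P n. \<exists>x\<in>F. z = (s \<otimes> t) \<otimes> x)"
          by (intro bex_cong refl) (simp add: as)
        finally show ?thesis by blast
      qed
      have "(\<Union>s\<in>E. (\<lambda>x. s \<otimes> x) ` ?Q) = (\<Union>s\<in>(\<Union>s\<in>E. (\<lambda>x. s \<otimes> x) ` P n). (\<lambda>x. s \<otimes> x) ` F)"
        by (rule Set.set_eqI[OF e])
      then show ?thesis unfolding PS UN_Un by (simp only:)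
    qed
    finally show ?case .
  qed
  obtain n where n: "2 < (1 + \<delta>) ^ n" using real_arch_pow[of "1 + \<delta>" 2] \<delta>(1) by auto
  show False
  proof (rule doubling_not_amenable[OF _ _ _ \<mu>1 pos add inv])
    show "finite (P n)" "P n \<subseteq> carrier G" using P by auto
    fix F assume F: "finite F" "F \<subseteq> carrier G"
    have "2 * real (card F) \<le> (1 + \<delta>) ^ n * card F" using n by (intro mult_right_mono) auto
    also have "\<dots> \<le> card (\<Union>s\<in>P n. (\<lambda>x. s \<otimes> x) ` F)" by (rule grow[OF F])
    finally show "2 * card F \<le> card (\<Union>s\<in>P n. (\<lambda>x. s \<otimes> x) ` F)" by linarith
  qed auto
qed

text \<open>Compactness of a product of unit intervals, one for each set. Normalisation, finite
  additivity and invariance under \<open>s\<close> up to a tolerance are closed conditions; any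
  finitely many of them can be met, hence all of them together, for every tolerance.\<close>

lemma (in group) amenable_if_almost_invariant:
  assumes approx: "\<And>S \<epsilon>. finite S \<Longrightarrow> S \<subseteq> carrier G \<Longrightarrow> 0 < \<epsilon> \<Longrightarrow>
    \<exists>m :: 'a set \<Rightarrow> real. (\<forall>A. 0 \<le> m A \<and> m A \<le> 1) \<and> m (carrier G) = 1 \<and>
      (\<forall>A B. A \<inter> B = {} \<longrightarrow> m (A \<union> B) = m A + m B) \<and>
      (\<forall>s\<in>S. \<forall>A\<subseteq>carrier G. \<bar>m ((\<lambda>x. s \<otimes> x) ` A) - m A\<bar> \<le> \<epsilon>)"
  shows "\<exists>m :: 'a set \<Rightarrow> real. (\<forall>A. 0 \<le> m A) \<and> m (carrier G) = 1 \<and>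
      (\<forall>A B. A \<inter> B = {} \<longrightarrow> m (A \<union> B) = m A + m B) \<and>
      (\<forall>s\<in>carrier G. \<forall>A\<subseteq>carrier G. m ((\<lambda>x. s \<otimes> x) ` A) = m A)"
proof -
  have cont [continuous_intros]: "continuous_on UNIV (\<lambda>m :: 'a set \<Rightarrow> real. m A)" for A
    by (rule continuous_on_product_coordinates)
  define K where "K = PiE (UNIV :: 'a set set) (\<lambda>_. {0..1::real})"
  have "compactin (product_topology (\<lambda>_. euclidean) UNIV) K"
    unfolding K_def by (simp add: compactin_PiE)
  then have K: "compact K" by (simp add: euclidean_product_topology)
  define M where "M = {m :: 'a set \<Rightarrow> real. m (carrier G) = 1 \<and> (\<forall>A B. A \<inter> B = {} \<longrightarrow> m (A \<union> B) = m A + m B)}"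
  have "closed M" unfolding M_def
    by (intro closed_Collect_conj closed_Collect_all closed_Collect_imp closed_Collect_eq open_Collect_const continuous_intros)
  define C where "C = (\<lambda>(s, n). {m :: 'a set \<Rightarrow> real. \<forall>A. A \<subseteq> carrier G \<longrightarrow> \<bar>m ((\<lambda>x. s \<otimes> x) ` A) - m A\<bar> \<le> 1 / real (Suc n)})"
  have closedC: "closed (C p)" for p
    unfolding C_def case_prod_beta
    by (intro closed_Collect_all closed_Collect_imp closed_Collect_le open_Collect_const continuous_intros)
  have "K \<inter> \<Inter> (insert M (C ` (carrier G \<times> UNIV))) \<noteq> {}"
  proof (rule compact_imp_fip[OF K])
    show "closed T" if "T \<in> insert M (C ` (carrier G \<times> UNIV))" for T
      using that \<open>closed M\<close> closedC by auto
    fix \<F> assume F: "finite \<F>" "\<F> \<subseteq> insert M (C ` (carrier G \<times> UNIV))"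
    then have "finite (\<F> - {M})" "\<F> - {M} \<subseteq> C ` (carrier G \<times> UNIV)" by auto
    then obtain J where J: "J \<subseteq> carrier G \<times> UNIV" "finite J" "\<F> - {M} = C ` J"
      by (meson finite_subset_image)
    \<comment> \<open>The inserted 0 keeps the maximum defined when \<open>J\<close> is
      empty.\<close>
    define N where "N = Max (insert 0 (snd ` J))"
    have N: "n \<le> N" if "(s, n) \<in> J" for s n
      unfolding N_def using J(2) that by (intro Max_ge) force+
    have "finite (fst ` J)" "fst ` J \<subseteq> carrier G" "0 < 1 / real (Suc N)" using J by auto
    from approx[OF this] obtain m where m: "\<forall>A. 0 \<le> m A \<and> m A \<le> (1::real)" "m (carrier G) = 1"
      "\<forall>A B. A \<inter> B = {} \<longrightarrow> m (A \<union> B) = m A + m B"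
      "\<forall>s\<in>fst ` J. \<forall>A\<subseteq>carrier G. \<bar>m ((\<lambda>x. s \<otimes> x) ` A) - m A\<bar> \<le> 1 / real (Suc N)" by blast
    have "m \<in> C p" if p: "p \<in> J" for p
    proof -
      obtain s n where sn: "p = (s, n)" by (cases p)
      have "1 / real (Suc N) \<le> 1 / real (Suc n)" using N p sn by (intro divide_left_mono) auto
      moreover have "s \<in> fst ` J" using p sn by force
      ultimately have "\<bar>m ((\<lambda>x. s \<otimes> x) ` A) - m A\<bar> \<le> 1 / real (Suc n)" if "A \<subseteq> carrier G" for A
        using m(4)[rule_format, OF _ that] by (meson order_trans)
      then show ?thesis unfolding C_def sn by simp
    qed
    moreover have "m \<in> M" using m by (simp add: M_def)
    moreover have "m \<in> K" using m(1) by (simp add: K_def PiE_iff)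
    ultimately have "m \<in> K \<inter> \<Inter> \<F>" using J(3) by blast
    then show "K \<inter> \<Inter> \<F> \<noteq> {}" by blast
  qed
  then obtain m where "m \<in> K \<inter> \<Inter> (insert M (C ` (carrier G \<times> UNIV)))" by (meson all_not_in_conv)
  then have m: "m \<in> K" "m \<in> M" "\<And>s n. s \<in> carrier G \<Longrightarrow> m \<in> C (s, n)" by simp_all
  have "m ((\<lambda>x. s \<otimes> x) ` A) = m A" if "s \<in> carrier G" "A \<subseteq> carrier G" for s A
  proof (rule ccontr)
    assume "m ((\<lambda>x. s \<otimes> x) ` A) \<noteq> m A"
    then have "0 < \<bar>m ((\<lambda>x. s \<otimes> x) ` A) - m A\<bar>" by simp
    then obtain n where "1 / real (Suc n) < \<bar>m ((\<lambda>x. s \<otimes> x) ` A) - m A\<bar>"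
      using nat_approx_posE by blast
    moreover have "\<bar>m ((\<lambda>x. s \<otimes> x) ` A) - m A\<bar> \<le> 1 / real (Suc n)"
      using m(3)[OF that(1), of n] that(2) by (simp add: C_def)
    ultimately show False by linarith
  qed
  moreover have "0 \<le> m A" for A using m(1) by (simp add: K_def PiE_iff)
  ultimately show ?thesis using m(2) by (intro exI[of _ m]) (simp add: M_def)
qed

text \<open>For vectors of equal norm the pairwise distances are controlled by how far their sum
  falls short of maximal norm. If the sum is nearly maximal, all the \<open>v s\<close> are close to
  each other.\<close>

lemma sum_pair_differences:
  fixes v :: "'s \<Rightarrow> 'y \<Rightarrow> real"
  assumes N: "\<And>s. s \<in> E \<Longrightarrow> (\<Sum>y\<in>R. (v s y)\<^sup>2) = N"
  shows "(\<Sum>s\<in>E. \<Sum>t\<in>E. \<Sum>y\<in>R. (v s y - v t y)\<^sup>2) =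
    2 * (real (card E))\<^sup>2 * N - 2 * (\<Sum>y\<in>R. (\<Sum>s\<in>E. v s y)\<^sup>2)"
proof -
  have "(\<Sum>s\<in>E. \<Sum>t\<in>E. \<Sum>y\<in>R. (v s y - v t y)\<^sup>2) =
      (\<Sum>s\<in>E. \<Sum>t\<in>E. N + N - 2 * (\<Sum>y\<in>R. v s y * v t y))"
  proof (intro sum.cong refl)
    fix s t assume "s \<in> E" "t \<in> E"
    then have "(\<Sum>y\<in>R. (v s y)\<^sup>2 + (v t y)\<^sup>2 - 2 * (v s y * v t y)) = N + N - 2 * (\<Sum>y\<in>R. v s y * v t y)"
      using N by (simp add: sum.distrib sum_subtractf sum_distrib_left)
    then show "(\<Sum>y\<in>R. (v s y - v t y)\<^sup>2) = N + N - 2 * (\<Sum>y\<in>R. v s y * v t y)"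
      by (simp add: power2_diff mult.assoc)
  qed
  also have "\<dots> = 2 * (real (card E))\<^sup>2 * N - 2 * (\<Sum>s\<in>E. \<Sum>t\<in>E. \<Sum>y\<in>R. v s y * v t y)"
    by (simp add: sum_subtractf sum_distrib_left power2_eq_square)
  also have "(\<Sum>s\<in>E. \<Sum>t\<in>E. \<Sum>y\<in>R. v s y * v t y) = (\<Sum>s\<in>E. \<Sum>y\<in>R. \<Sum>t\<in>E. v s y * v t y)"
    by (intro sum.cong refl sum.swap)
  also have "\<dots> = (\<Sum>y\<in>R. \<Sum>s\<in>E. \<Sum>t\<in>E. v s y * v t y)" by (rule sum.swap)
  also have "\<dots> = (\<Sum>y\<in>R. (\<Sum>s\<in>E. v s y)\<^sup>2)"
    by (simp add: power2_eq_square sum_product)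
  finally show ?thesis .
qed

section \<open>Spectral gap for free actions of non-amenable groups\<close>

locale free_action = group G for G (structure) +
  fixes act :: "'a \<Rightarrow> 'y \<Rightarrow> 'y" and Y :: "'y set"
  assumes act_closed: "s \<in> carrier G \<Longrightarrow> y \<in> Y \<Longrightarrow> act s y \<in> Y"
    and act_one: "y \<in> Y \<Longrightarrow> act \<one> y = y"
    and act_mult: "s \<in> carrier G \<Longrightarrow> t \<in> carrier G \<Longrightarrow> y \<in> Y \<Longrightarrow> act (s \<otimes> t) y = act s (act t y)"
    and act_free: "s \<in> carrier G \<Longrightarrow> y \<in> Y \<Longrightarrow> act s y = y \<Longrightarrow> s = \<one>"
begin

lemma act_inv: "s \<in> carrier G \<Longrightarrow> y \<in> Y \<Longrightarrow> act (inv s) (act s y) = y"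
  "s \<in> carrier G \<Longrightarrow> y \<in> Y \<Longrightarrow> act s (act (inv s) y) = y"
  by (simp_all add: act_mult[symmetric] act_one)

lemma act_inj: "s \<in> carrier G \<Longrightarrow> inj_on (act s) Y"
  by (rule inj_on_inverseI[of _ "act (inv s)"]) (rule act_inv)

text \<open>Freeness identifies each orbit with the group once a base point is chosen. The resulting
  coordinate \<open>\<phi>\<close> lets measures on \<open>Y\<close> be pushed to the group
  equivariantly.\<close>

lemma ex_equivariant:
  "\<exists>\<phi>. \<forall>y\<in>Y. \<phi> y \<in> carrier G \<and> (\<forall>s\<in>carrier G. \<phi> (act s y) = s \<otimes> \<phi> y)"
proof -
  define orb where "orb = (\<lambda>y. (\<lambda>s. act s y) ` carrier G)"
  define r where "r = (\<lambda>y. SOME z. z \<in> orb y)"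
  define \<phi> where "\<phi> = (\<lambda>y. SOME s. s \<in> carrier G \<and> act s (r y) = y)"
  have orb_act: "orb (act s y) = orb y" if "s \<in> carrier G" "y \<in> Y" for s y
  proof
    show "orb (act s y) \<subseteq> orb y" using that by (auto simp: orb_def act_mult[symmetric])
    show "orb y \<subseteq> orb (act s y)"
    proof
      fix z assume "z \<in> orb y"
      then obtain t where t: "t \<in> carrier G" "z = act t y" by (auto simp: orb_def)
      have "z = act (t \<otimes> inv s) (act s y)" using that t act_closed by (simp add: act_mult act_inv)
      then show "z \<in> orb (act s y)" using that t by (auto simp: orb_def)
    qed
  qed
  have r: "r y \<in> orb y" "r y \<in> Y" if "y \<in> Y" for y
  proof -
    have "y \<in> orb y" using act_one[OF that] by (force simp: orb_def)
    then show "r y \<in> orb y" unfolding r_def by (rule someI)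
    then show "r y \<in> Y" using that act_closed by (auto simp: orb_def)
  qed
  have \<phi>: "\<phi> y \<in> carrier G" "act (\<phi> y) (r y) = y" if y: "y \<in> Y" for y
  proof -
    obtain t where t: "t \<in> carrier G" "r y = act t y" using r[OF y] by (auto simp: orb_def)
    then have "inv t \<in> carrier G \<and> act (inv t) (r y) = y" using y by (simp add: act_inv)
    then show "\<phi> y \<in> carrier G" "act (\<phi> y) (r y) = y"
      unfolding \<phi>_def by (metis (mono_tags, lifting) someI_ex)+
  qed
  have "\<phi> (act s y) = s \<otimes> \<phi> y" if s: "s \<in> carrier G" and y: "y \<in> Y" for s y
  proof -
    have sy: "act s y \<in> Y" using s y by (rule act_closed)
    have rr: "r (act s y) = r y" using orb_act[OF s y] by (simp add: r_def)
    let ?a = "\<phi> (act s y)" and ?b = "s \<otimes> \<phi> y"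
    have c: "?a \<in> carrier G" "?b \<in> carrier G" using \<phi> sy s y by auto
    have "act ?a (r y) = act s y" using \<phi>(2)[OF sy] rr by simp
    also have "\<dots> = act ?b (r y)" using s y \<phi> r by (simp add: act_mult)
    finally have "act (inv ?b \<otimes> ?a) (r y) = r y" using c r[OF y] by (simp add: act_mult act_inv)
    then have "inv ?b \<otimes> ?a = \<one>" using act_free c r[OF y] by simp
    then show ?thesis using c by (metis inv_closed inv_comm inv_inv inv_equality)
  qed
  then show ?thesis using \<phi> by blast
qed

text \<open>For \<open>c \<ge> 0\<close>: the average over \<open>S\<close> has operator norm at
  most \<open>c\<close> on l2 of \<open>Y\<close>, tested on finitely supported real functions and
  finite windows \<open>P\<close>. \<open>S\<close> is a list because products of averages count
  elements with multiplicity.\<close>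

definition contracts :: "'a list \<Rightarrow> real \<Rightarrow> bool" where
  "contracts S c \<longleftrightarrow> (\<forall>\<eta> :: 'y \<Rightarrow> real. \<forall>Q P. finite Q \<longrightarrow> Q \<subseteq> Y \<longrightarrow> finite P \<longrightarrow> P \<subseteq> Y \<longrightarrow>
    (\<forall>y\<in>Y - Q. \<eta> y = 0) \<longrightarrow>
    (\<Sum>y\<in>P. (\<Sum>s\<leftarrow>S. \<eta> (act (inv s) y))\<^sup>2) \<le> (c * length S)\<^sup>2 * (\<Sum>y\<in>Q. (\<eta> y)\<^sup>2))"

lemma sum_translate:
  fixes \<eta> :: "'y \<Rightarrow> real"
  assumes "finite Q" "Q \<subseteq> Y" "\<forall>y\<in>Y - Q. \<eta> y = 0" "s \<in> carrier G" "finite R" "R \<subseteq> Y" "act s ` Q \<subseteq> R"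
  shows "(\<Sum>y\<in>R. (\<eta> (act (inv s) y))\<^sup>2) = (\<Sum>y\<in>Q. (\<eta> y)\<^sup>2)"
proof -
  have "(\<Sum>y\<in>R. (\<eta> (act (inv s) y))\<^sup>2) = (\<Sum>y\<in>act s ` Q. (\<eta> (act (inv s) y))\<^sup>2)"
  proof (rule sum.mono_neutral_right[OF assms(5,7)], intro ballI)
    fix y assume y: "y \<in> R - act s ` Q"
    then have yY: "y \<in> Y" using assms by auto
    have "act (inv s) y \<notin> Q"
    proof
      assume "act (inv s) y \<in> Q"
      then have "act s (act (inv s) y) \<in> act s ` Q" by (rule imageI)
      then show False using y yY assms(4) by (simp add: act_inv)
    qed
    then show "(\<eta> (act (inv s) y))\<^sup>2 = 0" using assms(3) act_closed yY assms(4) by simp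
  qed
  also have "\<dots> = (\<Sum>y\<in>Q. (\<eta> (act (inv s) (act s y)))\<^sup>2)"
    using inj_on_subset[OF act_inj[OF assms(4)] assms(2)] by (simp add: sum.reindex)
  also have "\<dots> = (\<Sum>y\<in>Q. (\<eta> y)\<^sup>2)" using assms(2,4) by (intro sum.cong refl) (simp add: act_inv subset_iff)
  finally show ?thesis .
qed

text \<open>The density \<eta>^2 / N is a probability on \<open>Y\<close>, pushed to the group by
  the coordinate map. A difference of squares is a product, so by Cauchy--Schwarz it changes under
  \<open>s\<close> by at most (\<epsilon> / 2) times 2; the 2 comes from \<eta> and its translate
  having the same norm.\<close>

lemma almost_invariant_mean:
  fixes \<eta> :: "'y \<Rightarrow> real"
  assumes Q: "finite Q" "Q \<subseteq> Y" "\<forall>y\<in>Y - Q. \<eta> y = 0" and N: "(\<Sum>y\<in>Q. (\<eta> y)\<^sup>2) = N" "0 < N"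
    and S: "finite S" "S \<subseteq> carrier G"
    and R: "finite R" "R \<subseteq> Y" "Q \<subseteq> R" "\<And>s. s \<in> S \<Longrightarrow> act s ` Q \<subseteq> R"
    and small: "\<And>s. s \<in> S \<Longrightarrow> (\<Sum>y\<in>R. (\<eta> (act (inv s) y) - \<eta> y)\<^sup>2) \<le> (\<epsilon> / 2)\<^sup>2 * N" and \<epsilon>: "0 < \<epsilon>"
  shows "\<exists>m :: 'a set \<Rightarrow> real. (\<forall>A. 0 \<le> m A \<and> m A \<le> 1) \<and> m (carrier G) = 1 \<and>
      (\<forall>A B. A \<inter> B = {} \<longrightarrow> m (A \<union> B) = m A + m B) \<and>
      (\<forall>s\<in>S. \<forall>A\<subseteq>carrier G. \<bar>m ((\<lambda>x. s \<otimes> x) ` A) - m A\<bar> \<le> \<epsilon>)"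
proof -
  obtain \<phi> where \<phi>: "\<And>y. y \<in> Y \<Longrightarrow> \<phi> y \<in> carrier G"
    "\<And>y s. y \<in> Y \<Longrightarrow> s \<in> carrier G \<Longrightarrow> \<phi> (act s y) = s \<otimes> \<phi> y" using ex_equivariant by blast
  define w where "w = (\<lambda>y. (\<eta> y)\<^sup>2 / N)"
  define m where "m = (\<lambda>A. \<Sum>y\<in>R. if \<phi> y \<in> A then w y else 0)"
  have w0: "0 \<le> w y" for y using N by (simp add: w_def)
  have sR: "(\<Sum>y\<in>R. (\<eta> y)\<^sup>2) = N"
    using sum_translate[OF Q one_closed R(1,2)] R(3) N act_one Q(2) R(2)
    by (simp add: image_subset_iff subset_iff)
  have w1: "(\<Sum>y\<in>R. w y) = 1" using sR N by (simp add: w_def sum_divide_distrib[symmetric])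
  have "0 \<le> m A" for A unfolding m_def by (intro sum_nonneg) (simp add: w0)
  moreover have "m A \<le> 1" for A unfolding m_def w1[symmetric] by (intro sum_mono) (simp add: w0)
  moreover have "m (carrier G) = 1" unfolding m_def w1[symmetric] using \<phi>(1) R(2) by (intro sum.cong) auto
  moreover have "m (A \<union> B) = m A + m B" if "A \<inter> B = {}" for A B
    unfolding m_def sum.distrib[symmetric] using that by (intro sum.cong) auto
  moreover have "\<bar>m ((\<lambda>x. s \<otimes> x) ` A) - m A\<bar> \<le> \<epsilon>" if s: "s \<in> S" and A: "A \<subseteq> carrier G" for s A
  proof -
    have sc: "s \<in> carrier G" using s S by blast
    define \<zeta> where "\<zeta> = (\<lambda>y. \<eta> (act (inv s) y))"
    have iff: "\<phi> y \<in> (\<lambda>x. s \<otimes> x) ` A \<longleftrightarrow> \<phi> (act (inv s) y) \<in> A" if "y \<in> Y" for y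
    proof -
      have "\<phi> (act (inv s) y) = inv s \<otimes> \<phi> y" using \<phi> that sc by simp
      moreover have "inv s \<otimes> \<phi> y \<in> A \<longleftrightarrow> \<phi> y \<in> (\<lambda>x. s \<otimes> x) ` A"
      proof
        assume "inv s \<otimes> \<phi> y \<in> A"
        then have "s \<otimes> (inv s \<otimes> \<phi> y) \<in> (\<lambda>x. s \<otimes> x) ` A" by (rule imageI)
        then show "\<phi> y \<in> (\<lambda>x. s \<otimes> x) ` A" using sc \<phi>(1)[OF that] by (simp add: m_assoc[symmetric])
      next
        assume "\<phi> y \<in> (\<lambda>x. s \<otimes> x) ` A"
        then show "inv s \<otimes> \<phi> y \<in> A" using sc A by (auto simp: m_assoc[symmetric] subset_iff)
      qed
      ultimately show ?thesis by simp
    qed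
    have mA: "m A = (\<Sum>y\<in>Q. (if \<phi> y \<in> A then \<eta> y / sqrt N else 0)\<^sup>2)"
      unfolding m_def w_def using R Q N by (intro sum.mono_neutral_cong_right) (auto simp: power_divide)
    have "m A = (\<Sum>y\<in>R. (if \<phi> (act (inv s) y) \<in> A then \<zeta> y / sqrt N else 0)\<^sup>2)"
      unfolding mA \<zeta>_def
      by (rule sum_translate[OF Q(1,2) _ sc R(1,2) R(4)[OF s], of "\<lambda>y. if \<phi> y \<in> A then \<eta> y / sqrt N else 0", symmetric])
        (use Q(3) in auto)
    also have "\<dots> = (\<Sum>y\<in>R. if \<phi> y \<in> (\<lambda>x. s \<otimes> x) ` A then (\<zeta> y)\<^sup>2 / N else 0)"
      using iff R(2) N by (intro sum.cong) (auto simp: power_divide)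
    finally have "m ((\<lambda>x. s \<otimes> x) ` A) - m A =
        (\<Sum>y\<in>R. if \<phi> y \<in> (\<lambda>x. s \<otimes> x) ` A then ((\<eta> y)\<^sup>2 - (\<zeta> y)\<^sup>2) / N else 0)"
      unfolding m_def w_def
      by (simp add: sum_subtractf[symmetric]) (intro sum.cong, auto simp: diff_divide_distrib)
    also have "\<bar>\<dots>\<bar> \<le> (\<Sum>y\<in>R. \<bar>if \<phi> y \<in> (\<lambda>x. s \<otimes> x) ` A then ((\<eta> y)\<^sup>2 - (\<zeta> y)\<^sup>2) / N else 0\<bar>)"
      by (rule sum_abs)
    also have "\<dots> \<le> (\<Sum>y\<in>R. \<bar>(\<zeta> y - \<eta> y)\<bar> * \<bar>\<zeta> y + \<eta> y\<bar> / N)"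
    proof (rule sum_mono)
      fix y
      have "\<bar>(\<eta> y)\<^sup>2 - (\<zeta> y)\<^sup>2\<bar> = \<bar>\<zeta> y - \<eta> y\<bar> * \<bar>\<zeta> y + \<eta> y\<bar>"
        by (simp add: abs_mult[symmetric] power2_eq_square algebra_simps abs_minus_commute)
      then show "\<bar>if \<phi> y \<in> (\<lambda>x. s \<otimes> x) ` A then ((\<eta> y)\<^sup>2 - (\<zeta> y)\<^sup>2) / N else 0\<bar> \<le> \<bar>\<zeta> y - \<eta> y\<bar> * \<bar>\<zeta> y + \<eta> y\<bar> / N"
        using N by simp
    qed
    also have "\<dots> = (\<Sum>y\<in>R. \<bar>\<zeta> y - \<eta> y\<bar> * \<bar>\<zeta> y + \<eta> y\<bar>) / N" by (simp add: sum_divide_distrib)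
    also have "\<dots> \<le> (L2_set (\<lambda>y. \<zeta> y - \<eta> y) R * L2_set (\<lambda>y. \<zeta> y + \<eta> y) R) / N"
      using N by (intro divide_right_mono L2_set_mult_ineq) auto
    also have "\<dots> \<le> ((\<epsilon> / 2 * sqrt N) * (2 * sqrt N)) / N"
    proof (intro divide_right_mono mult_mono)
      have "L2_set (\<lambda>y. \<zeta> y - \<eta> y) R \<le> sqrt ((\<epsilon> / 2)\<^sup>2 * N)"
        unfolding L2_set_def \<zeta>_def using small[OF s] by simp
      also have "\<dots> = \<epsilon> / 2 * sqrt N" using \<epsilon> by (simp add: real_sqrt_mult real_sqrt_divide power_divide)
      finally show "L2_set (\<lambda>y. \<zeta> y - \<eta> y) R \<le> \<epsilon> / 2 * sqrt N" .
      have "L2_set (\<lambda>y. \<zeta> y + \<eta> y) R \<le> L2_set \<zeta> R + L2_set \<eta> R" by (rule L2_set_triangle_ineq)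
      also have "L2_set \<zeta> R = sqrt N"
        unfolding L2_set_def \<zeta>_def using sum_translate[OF Q sc R(1,2) R(4)[OF s]] N by simp
      also have "L2_set \<eta> R = sqrt N" unfolding L2_set_def using sR by simp
      finally show "L2_set (\<lambda>y. \<zeta> y + \<eta> y) R \<le> 2 * sqrt N" by simp
    qed (use N \<epsilon> in auto)
    also have "\<dots> = \<epsilon>" using N by (simp add: real_sqrt_mult_self mult.assoc)
    finally show ?thesis .
  qed
  ultimately show ?thesis by (intro exI[of _ m]) blast
qed

text \<open>If no list contracts, then for every finite set there is a function whose translates
  have a sum of nearly maximal norm. By \<open>sum_pair_differences\<close> it is almost invariant,
  its square gives an almost invariant mean, and compactness produces an invariant one.\<close>

lemma spectral_gap:
  assumes na: "\<nexists>m :: 'a set \<Rightarrow> real. (\<forall>A. 0 \<le> m A) \<and> m (carrier G) = 1 \<and>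
      (\<forall>A B. A \<inter> B = {} \<longrightarrow> m (A \<union> B) = m A + m B) \<and>
      (\<forall>s\<in>carrier G. \<forall>A\<subseteq>carrier G. m ((\<lambda>x. s \<otimes> x) ` A) = m A)"
  shows "\<exists>S c. S \<noteq> [] \<and> set S \<subseteq> carrier G \<and> 0 \<le> c \<and> c < 1 \<and> contracts S c"
proof (rule ccontr)
  assume none: "\<not> ?thesis"
  have "\<exists>m :: 'a set \<Rightarrow> real. (\<forall>A. 0 \<le> m A \<and> m A \<le> 1) \<and> m (carrier G) = 1 \<and>
      (\<forall>A B. A \<inter> B = {} \<longrightarrow> m (A \<union> B) = m A + m B) \<and>
      (\<forall>s\<in>S0. \<forall>A\<subseteq>carrier G. \<bar>m ((\<lambda>x. s \<otimes> x) ` A) - m A\<bar> \<le> \<epsilon>)"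
    if S0: "finite S0" "S0 \<subseteq> carrier G" and \<epsilon>0: "0 < \<epsilon>" for S0 \<epsilon>
  proof -
    define \<delta> where "\<delta> = min \<epsilon> 1"
    have \<delta>: "0 < \<delta>" "\<delta> \<le> 1" "\<delta> \<le> \<epsilon>" using \<epsilon>0 by (auto simp: \<delta>_def)
    \<comment> \<open>The unit is included so that the pairwise differences contain the comparison
      of each translate with \<eta> itself.\<close>
    define E where "E = insert \<one> S0"
    have E: "finite E" "E \<subseteq> carrier G" using S0 by (auto simp: E_def)
    obtain S where S: "set S = E" "distinct S" using finite_distinct_list[OF E(1)] by blast
    define n where "n = card E"
    have lS: "length S = n" using S distinct_card n_def by metis
    have n1: "1 \<le> n" using E by (simp add: n_def E_def Suc_le_eq card_gt_0_iff)
    \<comment> \<open>Chosen so that 2 n^2 N (1 - c^2) equals (\<delta> / 2)^2 N, which is within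
      the tolerance of \<open>almost_invariant_mean\<close>; capping \<delta> at 1 keeps the
      radicand nonnegative.\<close>
    define c where "c = sqrt (1 - \<delta>\<^sup>2 / (8 * (real n)\<^sup>2))"
    have "\<delta>\<^sup>2 \<le> 1" using \<delta> by (simp add: power_le_one)
    moreover have "1 \<le> (real n)\<^sup>2" using n1 by simp
    ultimately have q: "\<delta>\<^sup>2 / (8 * (real n)\<^sup>2) \<le> 1" by (simp add: divide_le_eq)
    have q': "0 < \<delta>\<^sup>2 / (8 * (real n)\<^sup>2)" using \<delta>(1) n1 by simp
    have c: "0 \<le> c" "c < 1" "c\<^sup>2 = 1 - \<delta>\<^sup>2 / (8 * (real n)\<^sup>2)"
      using q q' by (auto simp: c_def real_sqrt_lt_1_iff)
    have "S \<noteq> []" using lS n1 by auto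
    then have "\<not> contracts S c" using none S E c by blast
    then obtain \<eta> Q P where Q: "finite Q" "Q \<subseteq> Y" "\<forall>y\<in>Y - Q. \<eta> y = (0::real)" and P: "finite P" "P \<subseteq> Y"
      and big: "(c * length S)\<^sup>2 * (\<Sum>y\<in>Q. (\<eta> y)\<^sup>2) < (\<Sum>y\<in>P. (\<Sum>s\<leftarrow>S. \<eta> (act (inv s) y))\<^sup>2)"
      unfolding contracts_def by (auto simp: not_le)
    define N where "N = (\<Sum>y\<in>Q. (\<eta> y)\<^sup>2)"
    define R where "R = P \<union> Q \<union> (\<Union>s\<in>E. act s ` Q)"
    have R: "finite R" "R \<subseteq> Y" "Q \<subseteq> R" "\<And>s. s \<in> E \<Longrightarrow> act s ` Q \<subseteq> R"
      using P Q E act_closed by (auto simp: R_def subset_iff)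
    have sumS: "(\<Sum>s\<leftarrow>S. h s) = (\<Sum>s\<in>E. h s)" for h :: "'a \<Rightarrow> real"
      using S by (simp add: sum_list_distinct_conv_sum_set)
    have vN: "(\<Sum>y\<in>R. (\<eta> (act (inv s) y))\<^sup>2) = N" if "s \<in> E" for s
      unfolding N_def using that E R(4) by (intro sum_translate[OF Q _ R(1,2)]) auto
    have "(\<Sum>y\<in>P. (\<Sum>s\<leftarrow>S. \<eta> (act (inv s) y))\<^sup>2) \<le> (\<Sum>y\<in>R. (\<Sum>s\<in>E. \<eta> (act (inv s) y))\<^sup>2)"
      unfolding sumS using R by (intro sum_mono2) (auto simp: R_def)
    then have big': "c\<^sup>2 * (real n)\<^sup>2 * N < (\<Sum>y\<in>R. (\<Sum>s\<in>E. \<eta> (act (inv s) y))\<^sup>2)"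
      using big by (simp add: lS N_def power_mult_distrib)
    have tot: "(\<Sum>s\<in>E. \<Sum>t\<in>E. \<Sum>y\<in>R. (\<eta> (act (inv s) y) - \<eta> (act (inv t) y))\<^sup>2)
        < 2 * (real n)\<^sup>2 * N - 2 * (c\<^sup>2 * (real n)\<^sup>2 * N)"
      using sum_pair_differences[where E = E and R = R and N = N and v = "\<lambda>s y. \<eta> (act (inv s) y)"] vN big' by (simp add: n_def)
    also have "\<dots> = (\<delta> / 2)\<^sup>2 * N"
    proof -
      have "2 * (real n)\<^sup>2 * N - 2 * (c\<^sup>2 * (real n)\<^sup>2 * N) = 2 * (real n)\<^sup>2 * N * (1 - c\<^sup>2)"
        by (simp add: algebra_simps)
      also have "1 - c\<^sup>2 = \<delta>\<^sup>2 / (8 * (real n)\<^sup>2)" using c(3) by simp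
      also have "2 * (real n)\<^sup>2 * N * (\<delta>\<^sup>2 / (8 * (real n)\<^sup>2)) = (\<delta> / 2)\<^sup>2 * N"
        using n1 by (simp add: power_divide)
      finally show ?thesis .
    qed
    finally have tot: "(\<Sum>s\<in>E. \<Sum>t\<in>E. \<Sum>y\<in>R. (\<eta> (act (inv s) y) - \<eta> (act (inv t) y))\<^sup>2) < (\<delta> / 2)\<^sup>2 * N" .
    have "0 \<le> (\<Sum>s\<in>E. \<Sum>t\<in>E. \<Sum>y\<in>R. (\<eta> (act (inv s) y) - \<eta> (act (inv t) y))\<^sup>2)"
      by (intro sum_nonneg) simp
    \<comment> \<open>A violation of the contraction is strict, which forces \<eta> to be nonzero
      and allows its square to be normalised.\<close>
    then have "0 < (\<delta> / 2)\<^sup>2 * N" using tot by linarith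
    then have N0: "0 < N" using \<delta>(1) by (simp add: zero_less_mult_iff)
    have small: "(\<Sum>y\<in>R. (\<eta> (act (inv s) y) - \<eta> y)\<^sup>2) \<le> (\<epsilon> / 2)\<^sup>2 * N" if s: "s \<in> S0" for s
    proof -
      have "(\<Sum>y\<in>R. (\<eta> (act (inv s) y) - \<eta> y)\<^sup>2) = (\<Sum>y\<in>R. (\<eta> (act (inv s) y) - \<eta> (act (inv \<one>) y))\<^sup>2)"
        using R(2) act_one by (intro sum.cong) (auto simp: subset_iff)
      also have "\<dots> \<le> (\<Sum>t\<in>E. \<Sum>y\<in>R. (\<eta> (act (inv s) y) - \<eta> (act (inv t) y))\<^sup>2)"
        by (rule member_le_sum) (use E in \<open>auto simp: E_def intro!: sum_nonneg\<close>)
      also have "\<dots> \<le> (\<Sum>s\<in>E. \<Sum>t\<in>E. \<Sum>y\<in>R. (\<eta> (act (inv s) y) - \<eta> (act (inv t) y))\<^sup>2)"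
        using s E by (intro member_le_sum[of s]) (auto simp: E_def intro!: sum_nonneg)
      also have "\<dots> \<le> (\<delta> / 2)\<^sup>2 * N" using tot by simp
      also have "\<dots> \<le> (\<epsilon> / 2)\<^sup>2 * N" using \<delta> N0 by (intro mult_right_mono power_mono) auto
      finally show ?thesis .
    qed
    show ?thesis
      by (rule almost_invariant_mean[OF Q N_def[symmetric] N0 S0 R(1,2,3) _ small \<epsilon>0]) (use R(4) E_def in auto)
  qed
  from amenable_if_almost_invariant[OF this] na show False by blast
qed

text \<open>The list of all products realises the composition of the two averages. The average over
  \<open>T\<close>, called \<zeta>, is again finitely supported, so the estimate for
  \<open>S\<close> applies to it.\<close>

lemma contracts_mult:
  assumes S: "contracts S c" "set S \<subseteq> carrier G" and T: "contracts T d" "set T \<subseteq> carrier G"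
  shows "contracts (concat (map (\<lambda>s. map (\<lambda>t. s \<otimes> t) T) S)) (c * d)"
  unfolding contracts_def
proof (intro allI impI)
  fix \<eta> :: "'y \<Rightarrow> real" and Q P
  assume Q: "finite Q" "Q \<subseteq> Y" and P: "finite P" "P \<subseteq> Y" and \<eta>: "\<forall>y\<in>Y - Q. \<eta> y = 0"
  define \<zeta> where "\<zeta> = (\<lambda>y. \<Sum>t\<leftarrow>T. \<eta> (act (inv t) y))"
  define Z where "Z = (\<Union>t\<in>set T. act t ` Q)"
  have Z: "finite Z" "Z \<subseteq> Y" using Q T act_closed by (auto simp: Z_def subset_iff)
  have \<zeta>: "\<forall>y\<in>Y - Z. \<zeta> y = 0"
  proof
    fix y assume y: "y \<in> Y - Z"
    have "\<eta> (act (inv t) y) = 0" if t: "t \<in> set T" for t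
    proof -
      have tc: "t \<in> carrier G" using t T by blast
      have "act (inv t) y \<notin> Q"
      proof
        assume "act (inv t) y \<in> Q"
        then have "act t (act (inv t) y) \<in> Z" using t by (auto simp: Z_def)
        then show False using y tc by (simp add: act_inv)
      qed
      then show ?thesis using \<eta> act_closed y tc by simp
    qed
    then have "map (\<lambda>t. \<eta> (act (inv t) y)) T = map (\<lambda>_. 0) T" by simp
    then show "\<zeta> y = 0" unfolding \<zeta>_def by (simp only: sum_list_0)
  qed
  have eq: "(\<Sum>s\<leftarrow>concat (map (\<lambda>s. map (\<lambda>t. s \<otimes> t) T) S). \<eta> (act (inv s) y)) = (\<Sum>s\<leftarrow>S. \<zeta> (act (inv s) y))"
    if y: "y \<in> Y" for y
    using S(2)
  proof (induction S)
    case (Cons s S)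
    have m: "map (\<lambda>t. \<eta> (act (inv (s \<otimes> t)) y)) T = map (\<lambda>t. \<eta> (act (inv t) (act (inv s) y))) T"
      using Cons.prems T y by (auto simp: inv_mult_group act_mult subset_iff)
    show ?case using Cons by (simp add: \<zeta>_def comp_def m)
  qed simp
  have len: "length (concat (map (\<lambda>s. map (\<lambda>t. s \<otimes> t) T) S)) = length S * length T"
    by (induction S) auto
  have "(\<Sum>y\<in>P. (\<Sum>s\<leftarrow>concat (map (\<lambda>s. map (\<lambda>t. s \<otimes> t) T) S). \<eta> (act (inv s) y))\<^sup>2)
      = (\<Sum>y\<in>P. (\<Sum>s\<leftarrow>S. \<zeta> (act (inv s) y))\<^sup>2)"
    using eq P by (intro sum.cong) auto
  also have "\<dots> \<le> (c * length S)\<^sup>2 * (\<Sum>y\<in>Z. (\<zeta> y)\<^sup>2)"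
    using S(1) Z P \<zeta> unfolding contracts_def by blast
  also have "\<dots> \<le> (c * length S)\<^sup>2 * ((d * length T)\<^sup>2 * (\<Sum>y\<in>Q. (\<eta> y)\<^sup>2))"
    using T(1) Z Q \<eta> unfolding contracts_def \<zeta>_def by (intro mult_left_mono) auto
  finally show "(\<Sum>y\<in>P. (\<Sum>s\<leftarrow>concat (map (\<lambda>s. map (\<lambda>t. s \<otimes> t) T) S). \<eta> (act (inv s) y))\<^sup>2)
     \<le> (c * d * length (concat (map (\<lambda>s. map (\<lambda>t. s \<otimes> t) T) S)))\<^sup>2 * (\<Sum>y\<in>Q. (\<eta> y)\<^sup>2)"
    unfolding len by (simp add: power_mult_distrib mult.assoc mult.left_commute)
qed

lemma arbitrarily_contracting:
  assumes na: "\<nexists>m :: 'a set \<Rightarrow> real. (\<forall>A. 0 \<le> m A) \<and> m (carrier G) = 1 \<and>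
      (\<forall>A B. A \<inter> B = {} \<longrightarrow> m (A \<union> B) = m A + m B) \<and>
      (\<forall>s\<in>carrier G. \<forall>A\<subseteq>carrier G. m ((\<lambda>x. s \<otimes> x) ` A) = m A)" and e: "0 < e"
  shows "\<exists>S c. S \<noteq> [] \<and> set S \<subseteq> carrier G \<and> 0 \<le> c \<and> c < e \<and> contracts S c"
proof -
  obtain S c where S: "S \<noteq> []" "set S \<subseteq> carrier G" "0 \<le> c" "c < 1" "contracts S c"
    using spectral_gap[OF na] by blast
  have "\<exists>T. T \<noteq> [] \<and> set T \<subseteq> carrier G \<and> contracts T (c ^ Suc n)" for n
  proof (induction n)
    case 0
    then show ?case using S by auto
  next
    case (Suc n)
    then obtain T where T: "T \<noteq> []" "set T \<subseteq> carrier G" "contracts T (c ^ Suc n)" by blast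
    let ?U = "concat (map (\<lambda>s. map (\<lambda>t. s \<otimes> t) T) S)"
    have "?U \<noteq> []" using S(1) T(1) by (cases S) auto
    moreover have "set ?U \<subseteq> carrier G" using S(2) T(2) by auto
    ultimately show ?case using contracts_mult[OF S(5,2) T(3,2)] by (intro exI[of _ ?U]) simp
  qed
  moreover obtain n where "c ^ n < e" using real_arch_pow_inv[OF e S(4)] by blast
  moreover have "c ^ Suc n \<le> c ^ n" using S(3,4) by (intro power_decreasing) auto
  ultimately show ?thesis using S(3) by (meson le_less_trans zero_le_power)
qed

end

section \<open>A non-simplicity criterion\<close>

definition approx :: "'b set \<Rightarrow> 'b op set \<Rightarrow> 'b op \<Rightarrow> bool" where
  "approx A X T \<longleftrightarrow> (\<forall>e>0. \<exists>S\<in>X. opnorm A (op_diff T S) < e)"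

lemma approx_self: assumes "T \<in> X" shows "approx A X T"
proof -
  have "opnorm A (op_diff T T) \<le> 0" by (rule opnorm_le) (auto simp: op_diff_def)
  then show ?thesis using assms unfolding approx_def by force
qed

lemma approx_add:
  assumes T: "approx A X T" "bounded_op A T" and S: "approx A X S" "bounded_op A S"
    and X: "\<And>R. R \<in> X \<Longrightarrow> bounded_op A R" "\<And>R R'. R \<in> X \<Longrightarrow> R' \<in> X \<Longrightarrow> (\<lambda>f x. R f x + R' f x) \<in> X" and ne: "A \<noteq> {}"
  shows "approx A X (\<lambda>f x. T f x + S f x)"
  unfolding approx_def
proof (intro allI impI)
  fix e :: real assume "0 < e"
  then have "0 < e / 2" by simp
  then obtain T' S' where T': "T' \<in> X" "opnorm A (op_diff T T') < e / 2" and S': "S' \<in> X" "opnorm A (op_diff S S') < e / 2"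
    using T(1) S(1) unfolding approx_def by meson
  have eq: "op_diff (\<lambda>f x. T f x + S f x) (\<lambda>f x. T' f x + S' f x) = (\<lambda>f x. op_diff T T' f x + op_diff S S' f x)"
    by (simp add: op_diff_def algebra_simps)
  have "opnorm A (\<lambda>f x. op_diff T T' f x + op_diff S S' f x) \<le> opnorm A (op_diff T T') + opnorm A (op_diff S S')"
    by (intro opnorm_triangle bounded_op_diff T S X(1) T' S' ne)
  then show "\<exists>R\<in>X. opnorm A (op_diff (\<lambda>f x. T f x + S f x) R) < e"
    using T' S' by (intro bexI[OF _ X(2)[OF T'(1) S'(1)]]) (simp add: eq)
qed

lemma approx_scale:
  assumes T: "approx A X T" "bounded_op A T"
    and X: "\<And>R. R \<in> X \<Longrightarrow> bounded_op A R" "\<And>R. R \<in> X \<Longrightarrow> (\<lambda>f x. c * R f x) \<in> X" and ne: "A \<noteq> {}"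
  shows "approx A X (\<lambda>f x. c * T f x)"
  unfolding approx_def
proof (intro allI impI)
  fix e :: real assume e: "0 < e"
  have pos: "0 < cmod c + 1" by (simp add: add_nonneg_pos)
  then have "0 < e / (cmod c + 1)" using e by simp
  then obtain T' where T': "T' \<in> X" "opnorm A (op_diff T T') < e / (cmod c + 1)"
    using T(1) unfolding approx_def by meson
  have b: "bounded_op A (op_diff T T')" by (intro bounded_op_diff T X T')
  have eq: "op_diff (\<lambda>f x. c * T f x) (\<lambda>f x. c * T' f x) = (\<lambda>f x. c * op_diff T T' f x)"
    by (simp add: op_diff_def algebra_simps)
  have "opnorm A (\<lambda>f x. c * op_diff T T' f x) \<le> cmod c * opnorm A (op_diff T T')"
    by (rule opnorm_scale_le[OF b ne])
  also have "\<dots> \<le> (cmod c + 1) * opnorm A (op_diff T T')"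
    by (intro mult_right_mono opnorm_nonneg[OF b ne]) simp
  also have "\<dots> < e" using T'(2) pos by (simp add: field_simps)
  finally show "\<exists>R\<in>X. opnorm A (op_diff (\<lambda>f x. c * T f x) R) < e"
    by (intro bexI[OF _ X(2)[OF T'(1)]]) (simp only: eq)
qed

lemma approx_comp:
  assumes T: "approx A X T" "bounded_op A T" and S: "approx A Y S" "bounded_op A S"
    and X: "\<And>R. R \<in> X \<Longrightarrow> bounded_op A R" and Y: "\<And>R. R \<in> Y \<Longrightarrow> bounded_op A R"
    and Z: "\<And>R R'. R \<in> X \<Longrightarrow> R' \<in> Y \<Longrightarrow> R \<circ> R' \<in> Z" and ne: "A \<noteq> {}"
  shows "approx A Z (T \<circ> S)"
  unfolding approx_def
proof (intro allI impI)
  fix e :: real assume e: "0 < e"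
  have pos: "0 < opnorm A T + 1" using opnorm_nonneg[OF T(2) ne] by simp
  then have "0 < e / 2 / (opnorm A T + 1)" using e by simp
  then obtain S' where S': "S' \<in> Y" "opnorm A (op_diff S S') < e / 2 / (opnorm A T + 1)"
    using S(1) unfolding approx_def by meson
  \<comment> \<open>\<open>T'\<close> is chosen after \<open>S'\<close>, since its tolerance depends
    on the norm of \<open>S'\<close>; the added 1 avoids a division by zero.\<close>
  have pos': "0 < opnorm A S' + 1" using opnorm_nonneg[OF Y[OF S'(1)] ne] by simp
  then have "0 < e / 2 / (opnorm A S' + 1)" using e by simp
  then obtain T' where T': "T' \<in> X" "opnorm A (op_diff T T') < e / 2 / (opnorm A S' + 1)"
    using T(1) unfolding approx_def by meson
  have bS: "bounded_op A (op_diff S S')" by (intro bounded_op_diff S Y S')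
  have bT: "bounded_op A (op_diff T T')" by (intro bounded_op_diff T X T')
  have eq: "op_diff (T \<circ> S) (T' \<circ> S') = (\<lambda>f x. (T \<circ> op_diff S S') f x + (op_diff T T' \<circ> S') f x)"
  proof -
    have d: "op_diff S S' = (\<lambda>f x. (-1) * S' f x + S f x)" by (simp add: op_diff_def)
    show ?thesis unfolding d bounded_comp_linear[OF T(2) S(2) Y[OF S'(1)]] by (simp add: op_diff_def)
  qed
  have "opnorm A (\<lambda>f x. (T \<circ> op_diff S S') f x + (op_diff T T' \<circ> S') f x)
      \<le> opnorm A (T \<circ> op_diff S S') + opnorm A (op_diff T T' \<circ> S')"
    by (intro opnorm_triangle bounded_op_comp bS bT T Y S' ne)
  also have "\<dots> \<le> opnorm A T * opnorm A (op_diff S S') + opnorm A (op_diff T T') * opnorm A S'"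
    by (intro add_mono opnorm_comp bS bT T Y S' ne)
  also have "\<dots> \<le> (opnorm A T + 1) * opnorm A (op_diff S S') + opnorm A (op_diff T T') * (opnorm A S' + 1)"
    by (intro add_mono mult_right_mono mult_left_mono opnorm_nonneg bS bT ne) auto
  also have "\<dots> < e / 2 + e / 2"
    using S'(2) T'(2) pos pos' by (intro add_strict_mono) (simp_all add: field_simps)
  finally have "opnorm A (op_diff (T \<circ> S) (T' \<circ> S')) < e" unfolding eq by simp
  then show "\<exists>R\<in>Z. opnorm A (op_diff (T \<circ> S) R) < e" using Z[OF T'(1) S'(1)] by blast
qed

lemma approx_approx:
  assumes T: "bounded_op A T" "\<And>e. 0 < e \<Longrightarrow> \<exists>S. approx A X S \<and> bounded_op A S \<and> opnorm A (op_diff T S) < e"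
    and X: "\<And>R. R \<in> X \<Longrightarrow> bounded_op A R" and ne: "A \<noteq> {}"
  shows "approx A X T"
  unfolding approx_def
proof (intro allI impI)
  fix e :: real assume "0 < e"
  then have e: "0 < e / 2" by simp
  obtain S where S: "approx A X S" "bounded_op A S" "opnorm A (op_diff T S) < e / 2" using T(2)[OF e] by blast
  then obtain R where R: "R \<in> X" "opnorm A (op_diff S R) < e / 2" using e unfolding approx_def by meson
  have eq: "op_diff T R = (\<lambda>f x. op_diff T S f x + op_diff S R f x)" by (simp add: op_diff_def)
  have "opnorm A (\<lambda>f x. op_diff T S f x + op_diff S R f x) \<le> opnorm A (op_diff T S) + opnorm A (op_diff S R)"
    by (intro opnorm_triangle bounded_op_diff T S X R ne)
  then show "\<exists>R\<in>X. opnorm A (op_diff T R) < e" using S R by (intro bexI[OF _ R(1)]) (simp add: eq)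
qed

section \<open>The quasi-regular representation and its kernel\<close>

context plain_group begin

lemma cA_ne: "cA \<noteq> {}" using one_closed by blast

lemma reduced_Cstar_approx: "T \<in> reduced_Cstar G \<longleftrightarrow> bounded_op cA T \<and> approx cA (group_alg G) T"
  by (simp add: reduced_Cstar_def approx_def)

text \<open>The coefficients in \<open>group_alg\<close> are existentially quantified; here they are
  recovered from the operator, as its value at the indicator of the unit.\<close>

definition cf :: "'a op \<Rightarrow> 'a \<Rightarrow> complex" where "cf T = T (ind {\<one>})"

lemma ind_l2: "y \<in> carrier G \<Longrightarrow> ind {y} \<in> l2 cA" by (rule l2_ind) auto

lemma lreg_ind: assumes "g \<in> carrier G" "y \<in> carrier G" shows "lreg G g (ind {y}) = ind {g \<otimes> y}"
proof
  fix x show "lreg G g (ind {y}) x = ind {g \<otimes> y} x"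
  proof (cases "x \<in> carrier G")
    case True
    have "inv g \<otimes> x = y \<longleftrightarrow> x = g \<otimes> y" using assms True by (metis inv_solve_left)
    then show ?thesis using True assms ind_l2 by (simp add: lreg_apply ind_def)
  next
    case False
    then show ?thesis using assms ind_l2 by (auto simp: lreg_def ind_def)
  qed
qed

lemma cf_lreg: "g \<in> carrier G \<Longrightarrow> cf (lreg G g) = ind {g}"
  by (simp add: cf_def lreg_ind)

text \<open>Elements of the group algebra commute with right translations, so a matrix entry depends
  only on \<open>x \<otimes> inv y\<close>.\<close>

lemma group_alg_ind:
  assumes "T \<in> group_alg G" "y \<in> carrier G" "x \<in> carrier G" shows "T (ind {y}) x = cf T (x \<otimes> inv y)"
  using assms(1)
proof (induction rule: group_alg_induct)
  case (add T g c)
  have "x \<otimes> inv y = g \<longleftrightarrow> x = g \<otimes> y" using assms \<open>g \<in> carrier G\<close> by (metis inv_solve_right)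
  then have "ind {g \<otimes> y} x = ind {g} (x \<otimes> inv y)" by (simp add: ind_def)
  then show ?case using add assms lreg_ind[OF \<open>g \<in> carrier G\<close> assms(2)] cf_lreg[OF \<open>g \<in> carrier G\<close>]
    by (simp add: cf_def)
qed (simp add: cf_def)

lemma cf_finite: assumes "T \<in> group_alg G" shows "finite {x. cf T x \<noteq> 0}" "cf T x \<noteq> 0 \<Longrightarrow> x \<in> carrier G"
proof -
  have "finite {x. cf T x \<noteq> 0} \<and> {x. cf T x \<noteq> 0} \<subseteq> carrier G" using assms
  proof (induction rule: group_alg_induct)
    case (add T g c)
    have "cf (\<lambda>f x. c * lreg G g f x + T f x) = (\<lambda>x. c * ind {g} x + cf T x)"
      using cf_lreg[OF \<open>g \<in> carrier G\<close>] by (simp add: cf_def)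
    then have "{x. cf (\<lambda>f x. c * lreg G g f x + T f x) x \<noteq> 0} \<subseteq> insert g {x. cf T x \<noteq> 0}"
      by (auto simp: ind_def)
    then show ?case using add finite_subset by blast
  qed (simp add: cf_def)
  then show "finite {x. cf T x \<noteq> 0}" "cf T x \<noteq> 0 \<Longrightarrow> x \<in> carrier G" by auto
qed

definition ks :: "'a set \<Rightarrow> 'a op \<Rightarrow> 'a \<Rightarrow> 'a \<Rightarrow> complex" where
  "ks L T k y = (\<Sum>x | cf T x \<noteq> 0. if inv k \<otimes> x \<otimes> y \<in> L then cf T x else 0)"

lemma ks_eq:
  assumes "finite F" "{x. cf T x \<noteq> 0} \<subseteq> F"
  shows "ks L T k y = (\<Sum>x\<in>F. if inv k \<otimes> x \<otimes> y \<in> L then cf T x else 0)"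
  unfolding ks_def using assms by (intro sum.mono_neutral_left) auto

lemma ks_add:
  assumes "T \<in> group_alg G" "S \<in> group_alg G"
  shows "ks L (\<lambda>f x. T f x + S f x) k y = ks L T k y + ks L S k y"
proof -
  let ?F = "{x. cf T x \<noteq> 0} \<union> {x. cf S x \<noteq> 0}"
  have F: "finite ?F" using cf_finite assms by simp
  have c: "cf (\<lambda>f x. T f x + S f x) = (\<lambda>x. cf T x + cf S x)" by (simp add: cf_def)
  have "ks L (\<lambda>f x. T f x + S f x) k y = (\<Sum>x\<in>?F. if inv k \<otimes> x \<otimes> y \<in> L then cf (\<lambda>f x. T f x + S f x) x else 0)"
    by (rule ks_eq[OF F]) (auto simp: c)
  also have "\<dots> = (\<Sum>x\<in>?F. if inv k \<otimes> x \<otimes> y \<in> L then cf T x else 0) + (\<Sum>x\<in>?F. if inv k \<otimes> x \<otimes> y \<in> L then cf S x else 0)"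
    unfolding sum.distrib[symmetric] c by (intro sum.cong) auto
  also have "\<dots> = ks L T k y + ks L S k y"
    using ks_eq[OF F, of T] ks_eq[OF F, of S] by simp
  finally show ?thesis .
qed

lemma ks_scale:
  assumes "T \<in> group_alg G" shows "ks L (\<lambda>f x. c * T f x) k y = c * ks L T k y"
proof -
  have cc: "cf (\<lambda>f x. c * T f x) = (\<lambda>x. c * cf T x)" by (simp add: cf_def)
  have "ks L (\<lambda>f x. c * T f x) k y = (\<Sum>x | cf T x \<noteq> 0. if inv k \<otimes> x \<otimes> y \<in> L then cf (\<lambda>f x. c * T f x) x else 0)"
    by (rule ks_eq) (auto simp: cc cf_finite assms)
  also have "\<dots> = c * ks L T k y" unfolding ks_def sum_distrib_left cc by (intro sum.cong) auto
  finally show ?thesis .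
qed

lemma ks_lreg: assumes "g \<in> carrier G" shows "ks L (lreg G g) k y = (if inv k \<otimes> g \<otimes> y \<in> L then 1 else 0)"
proof -
  have "ks L (lreg G g) k y = (\<Sum>x\<in>{g}. if inv k \<otimes> x \<otimes> y \<in> L then cf (lreg G g) x else 0)"
    by (rule ks_eq) (auto simp: cf_lreg assms ind_def)
  then show ?thesis by (simp add: cf_lreg assms ind_def)
qed

text \<open>Multiplication by a group element on the left moves the row coset, on the right the
  column coset. Hence the operators all of whose entries vanish form a two-sided ideal.\<close>

lemma ks_lreg_comp:
  assumes g: "g \<in> carrier G" and T: "T \<in> group_alg G" and k: "k \<in> carrier G" "y \<in> carrier G"
  shows "ks L (lreg G g \<circ> T) k y = ks L T (inv g \<otimes> k) y" "ks L (T \<circ> lreg G g) k y = ks L T k (g \<otimes> y)"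
proof -
  let ?F = "{x. cf T x \<noteq> 0}"
  note fin = cf_finite[OF T]
  have Tl: "cf T \<in> l2 cA" unfolding cf_def by (rule bounded_opD(2)[OF group_alg_bounded[OF T] ind_l2]) simp
  have c1: "cf (lreg G g \<circ> T) x = (if x \<in> carrier G then cf T (inv g \<otimes> x) else 0)" for x
    using Tl by (simp add: cf_def lreg_def)
  have "lreg G g \<circ> T \<in> group_alg G" using group_alg_lreg_comp[OF g T] by simp
  have inj1: "inj_on (\<lambda>x. g \<otimes> x) ?F" using g fin by (auto simp: inj_on_def)
  have "ks L (lreg G g \<circ> T) k y = (\<Sum>x\<in>(\<lambda>x. g \<otimes> x) ` ?F. if inv k \<otimes> x \<otimes> y \<in> L then cf (lreg G g \<circ> T) x else 0)"
  proof (rule ks_eq)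
    show "{x. cf (lreg G g \<circ> T) x \<noteq> 0} \<subseteq> (\<lambda>x. g \<otimes> x) ` ?F"
    proof
      fix x assume "x \<in> {x. cf (lreg G g \<circ> T) x \<noteq> 0}"
      then have "x \<in> carrier G" "cf T (inv g \<otimes> x) \<noteq> 0" by (auto simp: c1 split: if_splits)
      then show "x \<in> (\<lambda>x. g \<otimes> x) ` ?F" using g
        by (intro image_eqI[of _ _ "inv g \<otimes> x"]) (auto simp: m_assoc[symmetric])
    qed
  qed (use fin in simp)
  also have "\<dots> = (\<Sum>x\<in>?F. if inv k \<otimes> (g \<otimes> x) \<otimes> y \<in> L then cf (lreg G g \<circ> T) (g \<otimes> x) else 0)"
    by (simp add: sum.reindex[OF inj1])
  also have "\<dots> = ks L T (inv g \<otimes> k) y"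
    unfolding ks_def
  proof (rule sum.cong[OF refl])
    fix x assume "x \<in> ?F"
    then have x: "x \<in> carrier G" using fin by blast
    have "inv g \<otimes> (g \<otimes> x) = x" using x g by (simp add: m_assoc[symmetric])
    moreover have "inv k \<otimes> (g \<otimes> x) \<otimes> y = inv (inv g \<otimes> k) \<otimes> x \<otimes> y" using x g k
      by (simp add: inv_mult_group m_assoc)
    ultimately show "(if inv k \<otimes> (g \<otimes> x) \<otimes> y \<in> L then cf (lreg G g \<circ> T) (g \<otimes> x) else 0)
        = (if inv (inv g \<otimes> k) \<otimes> x \<otimes> y \<in> L then cf T x else 0)" using x g by (simp add: c1)
  qed
  finally show "ks L (lreg G g \<circ> T) k y = ks L T (inv g \<otimes> k) y" .
  have Tg: "T (ind {g}) \<in> l2 cA" by (rule bounded_opD(2)[OF group_alg_bounded[OF T] ind_l2[OF g]])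
  have c2: "cf (T \<circ> lreg G g) x = (if x \<in> carrier G then cf T (x \<otimes> inv g) else 0)" for x
    using group_alg_ind[OF T g, of x] lreg_ind[OF g one_closed] g l2_outside[OF Tg, of x] by (simp add: cf_def)
  have inj2: "inj_on (\<lambda>x. x \<otimes> g) ?F" using g fin by (auto simp: inj_on_def)
  have "ks L (T \<circ> lreg G g) k y = (\<Sum>x\<in>(\<lambda>x. x \<otimes> g) ` ?F. if inv k \<otimes> x \<otimes> y \<in> L then cf (T \<circ> lreg G g) x else 0)"
  proof (rule ks_eq)
    show "{x. cf (T \<circ> lreg G g) x \<noteq> 0} \<subseteq> (\<lambda>x. x \<otimes> g) ` ?F"
    proof
      fix x assume "x \<in> {x. cf (T \<circ> lreg G g) x \<noteq> 0}"
      then have "x \<in> carrier G" "cf T (x \<otimes> inv g) \<noteq> 0" by (auto simp: c2 split: if_splits)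
      then show "x \<in> (\<lambda>x. x \<otimes> g) ` ?F" using g
        by (intro image_eqI[of _ _ "x \<otimes> inv g"]) (auto simp: m_assoc)
    qed
  qed (use fin in simp)
  also have "\<dots> = (\<Sum>x\<in>?F. if inv k \<otimes> (x \<otimes> g) \<otimes> y \<in> L then cf (T \<circ> lreg G g) (x \<otimes> g) else 0)"
    by (simp add: sum.reindex[OF inj2])
  also have "\<dots> = ks L T k (g \<otimes> y)"
    unfolding ks_def
  proof (rule sum.cong[OF refl])
    fix x assume "x \<in> ?F"
    then have x: "x \<in> carrier G" using fin by blast
    then show "(if inv k \<otimes> (x \<otimes> g) \<otimes> y \<in> L then cf (T \<circ> lreg G g) (x \<otimes> g) else 0)
        = (if inv k \<otimes> x \<otimes> (g \<otimes> y) \<in> L then cf T x else 0)" using x g k by (simp add: c2 m_assoc)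
  qed
  finally show "ks L (T \<circ> lreg G g) k y = ks L T k (g \<otimes> y)" .
qed

text \<open>The kernel of the representation of the group algebra on \<open>\<complex>[G/L]\<close>: \<open>ks L T k y\<close> is the
  matrix entry of the operator \<open>T\<close> at the cosets \<open>kL\<close> and \<open>yL\<close>.\<close>

definition ker_quasi_regular :: "'a set \<Rightarrow> 'a op set" where
  "ker_quasi_regular L = {T \<in> group_alg G. \<forall>k\<in>carrier G. \<forall>y\<in>carrier G. ks L T k y = 0}"

lemma kqr_add: "T \<in> ker_quasi_regular L \<Longrightarrow> S \<in> ker_quasi_regular L \<Longrightarrow> (\<lambda>f x. T f x + S f x) \<in> ker_quasi_regular L"
  by (simp add: ker_quasi_regular_def group_alg_add ks_add)

lemma kqr_scale: "T \<in> ker_quasi_regular L \<Longrightarrow> (\<lambda>f x. c * T f x) \<in> ker_quasi_regular L"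
  by (simp add: ker_quasi_regular_def group_alg_scale ks_scale)

lemma kqr_lreg:
  "T \<in> ker_quasi_regular L \<Longrightarrow> g \<in> carrier G \<Longrightarrow> lreg G g \<circ> T \<in> ker_quasi_regular L"
  "T \<in> ker_quasi_regular L \<Longrightarrow> g \<in> carrier G \<Longrightarrow> T \<circ> lreg G g \<in> ker_quasi_regular L"
  by (simp_all add: ker_quasi_regular_def group_alg_lreg_comp ks_lreg_comp del: o_apply)

lemma kqr_zero: "(\<lambda>f x. 0) \<in> ker_quasi_regular L"
  by (simp add: ker_quasi_regular_def group_alg_zero ks_def cf_def)

lemma kqr_group_alg: "T \<in> ker_quasi_regular L \<Longrightarrow> T \<in> group_alg G"
  by (simp add: ker_quasi_regular_def)

lemma kqr_bounded: "T \<in> ker_quasi_regular L \<Longrightarrow> bounded_op cA T"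
  using kqr_group_alg group_alg_bounded by blast

lemma kqr_comp:
  assumes T: "T \<in> ker_quasi_regular L" and S: "S \<in> group_alg G"
  shows "S \<circ> T \<in> ker_quasi_regular L \<and> T \<circ> S \<in> ker_quasi_regular L"
  using S
proof (induction rule: group_alg_induct)
  case zero
  have "(\<lambda>(f :: 'a \<Rightarrow> complex) (x :: 'a). 0 :: complex) \<circ> T = (\<lambda>f x. 0)" by auto
  moreover have "T \<circ> (\<lambda>(f :: 'a \<Rightarrow> complex) (x :: 'a). 0 :: complex) = (\<lambda>f x. 0)"
    using bounded_op_zero[OF kqr_bounded[OF T]] by auto
  ultimately show ?case using kqr_zero by (simp only:)
next
  case (add S g c)
  have IH: "S \<circ> T \<in> ker_quasi_regular L \<and> T \<circ> S \<in> ker_quasi_regular L" using add by blast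
  have "(\<lambda>f x. c * lreg G g f x + S f x) \<circ> T = (\<lambda>f x. c * (lreg G g \<circ> T) f x + (S \<circ> T) f x)" by auto
  moreover have "(\<lambda>f x. c * (lreg G g \<circ> T) f x + (S \<circ> T) f x) \<in> ker_quasi_regular L"
    by (rule kqr_add[OF kqr_scale[OF kqr_lreg(1)[OF T \<open>g \<in> carrier G\<close>]] conjunct1[OF IH]])
  moreover have "T \<circ> (\<lambda>f x. c * lreg G g f x + S f x) = (\<lambda>f x. c * (T \<circ> lreg G g) f x + (T \<circ> S) f x)"
    by (rule bounded_comp_linear[OF kqr_bounded[OF T] group_alg_bounded[OF \<open>S \<in> group_alg G\<close>] lreg_bounded[OF \<open>g \<in> carrier G\<close>]])
  moreover have "(\<lambda>f x. c * (T \<circ> lreg G g) f x + (T \<circ> S) f x) \<in> ker_quasi_regular L"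
    by (rule kqr_add[OF kqr_scale[OF kqr_lreg(2)[OF T \<open>g \<in> carrier G\<close>]] conjunct2[OF IH]])
  ultimately show ?case by (simp only:)
qed

text \<open>The closure of a two-sided ideal of a dense subalgebra is a closed ideal.
  \<open>opnorm\<close> does not see values outside l2, so boundedness is demanded alongside
  approximability.\<close>

lemma closed_ideal_closure_kqr:
  "closed_ideal cA (reduced_Cstar G) {T. bounded_op cA T \<and> approx cA (ker_quasi_regular L) T}"
proof -
  let ?I = "ker_quasi_regular L" and ?J = "{T. bounded_op cA T \<and> approx cA (ker_quasi_regular L) T}"
  have sub: "approx cA (group_alg G) T" if "approx cA ?I T" for T
    using that kqr_group_alg unfolding approx_def by blast
  have 1: "?J \<subseteq> reduced_Cstar G" using sub by (auto simp: reduced_Cstar_approx)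
  have 2: "(\<lambda>f x. 0) \<in> ?J" using approx_self[OF kqr_zero] bounded_op_null by simp
  have 3: "\<forall>S\<in>?J. \<forall>T\<in>?J. (\<lambda>f x. S f x + T f x) \<in> ?J"
  proof (intro ballI)
    fix S T assume "S \<in> ?J" "T \<in> ?J"
    then have b: "approx cA ?I S" "bounded_op cA S" "approx cA ?I T" "bounded_op cA T" by auto
    have "approx cA ?I (\<lambda>f x. S f x + T f x)"
      by (rule approx_add[OF b _ _ cA_ne]) (erule kqr_bounded, erule (1) kqr_add)
    then show "(\<lambda>f x. S f x + T f x) \<in> ?J" using bounded_op_add[OF b(2,4)] by blast
  qed
  have 4: "\<forall>S\<in>?J. \<forall>c. (\<lambda>f x. c * S f x) \<in> ?J"
  proof (intro ballI allI)
    fix S c assume "S \<in> ?J"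
    then have b: "approx cA ?I S" "bounded_op cA S" by auto
    have "approx cA ?I (\<lambda>f x. c * S f x)"
      by (rule approx_scale[OF b _ _ cA_ne]) (erule kqr_bounded, erule kqr_scale)
    then show "(\<lambda>f x. c * S f x) \<in> ?J" using bounded_op_scale[OF b(2), of c] by blast
  qed
  have 5: "\<forall>S\<in>?J. \<forall>a\<in>reduced_Cstar G. a \<circ> S \<in> ?J \<and> S \<circ> a \<in> ?J"
  proof (intro ballI conjI)
    fix S a assume S: "S \<in> ?J" and a: "a \<in> reduced_Cstar G"
    then have b: "approx cA ?I S" "bounded_op cA S" "approx cA (group_alg G) a" "bounded_op cA a"
      by (auto simp: reduced_Cstar_approx)
    have "approx cA ?I (a \<circ> S)"
      by (rule approx_comp[OF b(3,4,1,2) _ _ _ cA_ne])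
        (erule group_alg_bounded, erule kqr_bounded, rule conjunct1[OF kqr_comp])
    then show "a \<circ> S \<in> ?J" using bounded_op_comp[OF b(4,2)] by blast
    have "approx cA ?I (S \<circ> a)"
      by (rule approx_comp[OF b _ _ _ cA_ne])
        (erule kqr_bounded, erule group_alg_bounded, rule conjunct2[OF kqr_comp])
    then show "S \<circ> a \<in> ?J" using bounded_op_comp[OF b(2,4)] by blast
  qed
  have 6: "\<forall>T\<in>reduced_Cstar G. (\<forall>e>0. \<exists>S\<in>?J. opnorm cA (op_diff T S) < e) \<longrightarrow> T \<in> ?J"
  proof (intro ballI impI)
    fix T assume T: "T \<in> reduced_Cstar G" and ap: "\<forall>e>0. \<exists>S\<in>?J. opnorm cA (op_diff T S) < e"
    have b: "bounded_op cA T" using T by (simp add: reduced_Cstar_approx)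
    have "approx cA ?I T"
    proof (rule approx_approx[OF b _ _ cA_ne])
      show "\<exists>S. approx cA ?I S \<and> bounded_op cA S \<and> opnorm cA (op_diff T S) < e" if "0 < e" for e
        using ap that by blast
    qed (erule kqr_bounded)
    then show "T \<in> ?J" using b by simp
  qed
  show ?thesis unfolding closed_ideal_def using 1 2 3 4 5 6 by (intro conjI)
qed

text \<open>By simplicity the closure of the kernel is everything and contains the unit. The
  distance 1/2 is the contraction from which \<open>contraction_expands\<close> starts.\<close>

lemma Cstar_simple_near_one:
  assumes simple: "Cstar_simple G" and z: "z \<in> ker_quasi_regular L" "z \<noteq> (\<lambda>f x. 0)"
  shows "\<exists>S\<in>ker_quasi_regular L. opnorm cA (op_diff (lreg G \<one>) S) < 1 / 2"
proof -
  let ?J = "{T. bounded_op cA T \<and> approx cA (ker_quasi_regular L) T}"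
  have "z \<in> ?J" using approx_self[OF z(1)] kqr_bounded[OF z(1)] by simp
  then have "?J \<noteq> {\<lambda>f x. 0}" using z(2) by auto
  then have "?J = reduced_Cstar G"
    using simple closed_ideal_closure_kqr[of L] unfolding Cstar_simple_def by blast
  moreover have "lreg G \<one> \<in> reduced_Cstar G" by (intro group_alg_reduced group_alg_lreg) simp
  ultimately have "approx cA (ker_quasi_regular L) (lreg G \<one>)" by blast
  then show ?thesis unfolding approx_def by (meson half_gt_zero zero_less_one)
qed

lemma group_alg_ind_finite:
  assumes T: "T \<in> group_alg G" and F: "finite F" "F \<subseteq> carrier G" and x: "x \<in> carrier G"
  shows "T (ind F) x = (\<Sum>y\<in>F. cf T (x \<otimes> inv y))"
  using F
proof (induction)
  case empty
  have "ind {} = (\<lambda>_::'a. 0)" by (auto simp: ind_def)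
  then show ?case using bounded_op_zero[OF group_alg_bounded[OF T]] by simp
next
  case (insert y F)
  have "ind (insert y F) = (\<lambda>x. ind {y} x + ind F x)" using insert by (auto simp: ind_def)
  then have "T (ind (insert y F)) = (\<lambda>x. T (ind {y}) x + T (ind F) x)"
    using bounded_opD(3)[OF group_alg_bounded[OF T], of "ind {y}" "ind F"] ind_l2 l2_ind(1)[of F cA] insert by simp
  then show ?case using insert group_alg_ind[OF T _ x, of y] by simp
qed

text \<open>For \<open>S\<close> in the kernel and close to the unit, T = 1 - S has norm below 1/2,
  yet its coefficients over \<open>?L\<close> sum to 1, because the entry of \<open>S\<close> at the
  trivial coset is 0. Only finitely many coefficients are nonzero, so those in \<open>?L\<close> lie
  in a single \<open>L n\<close>, where they form a contracting convolution.\<close>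

theorem Cstar_simple_not_amenable:
  fixes L :: "nat \<Rightarrow> 'a set"
  assumes simple: "Cstar_simple G"
    and L: "\<And>n. subgroup (L n) G" "\<And>n m. n \<le> m \<Longrightarrow> L n \<subseteq> L m"
    and z: "z \<in> ker_quasi_regular (\<Union>n. L n)" "z \<noteq> (\<lambda>f x. 0)"
  shows "\<exists>n. \<not> amenable (G\<lparr>carrier := L n\<rparr>)"
proof -
  let ?L = "\<Union>n. L n"
  obtain S where S: "S \<in> ker_quasi_regular ?L" "opnorm cA (op_diff (lreg G \<one>) S) < 1 / 2"
    using Cstar_simple_near_one[OF simple z] by blast
  have SG: "S \<in> group_alg G" using S kqr_group_alg by blast
  define T where "T = (\<lambda>f x. lreg G \<one> f x + (-1) * S f x)"
  have TG: "T \<in> group_alg G" unfolding T_def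
    by (intro group_alg_add group_alg_scale SG group_alg_lreg one_closed)
  have Tn: "opnorm cA T < 1 / 2" using S by (simp add: T_def op_diff_def)
  define E where "E = {x. cf T x \<noteq> 0} \<inter> ?L"
  have finE: "finite E" using cf_finite[OF TG] by (simp add: E_def)
  have "\<exists>n. E \<subseteq> L n" using finE
  proof -
    have "\<exists>n. X \<subseteq> L n" if "finite X" "X \<subseteq> ?L" for X using that
    proof induction
      case (insert x X)
      then obtain n m where "X \<subseteq> L n" "x \<in> L m" by auto
      then have "insert x X \<subseteq> L (max n m)" using L(2)[of n "max n m"] L(2)[of m "max n m"] by auto
      then show ?case by blast
    qed simp
    then show ?thesis using finE by (simp add: E_def)
  qed
  then obtain n where n: "E \<subseteq> L n" by blast
  interpret M: group "G\<lparr>carrier := L n\<rparr>" using L(1) by (rule subgroup.subgroup_is_group) (rule group_axioms)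
  have invM: "inv\<^bsub>G\<lparr>carrier := L n\<rparr>\<^esub> x = inv x" if "x \<in> L n" for x using m_inv_consistent[OF L(1)] that by simp
  have Lc: "L n \<subseteq> carrier G" using subgroup.subset[OF L(1)] .
  have "ks ?L T \<one> \<one> = 1"
  proof -
    have "ks ?L T \<one> \<one> = ks ?L (lreg G \<one>) \<one> \<one> + (-1) * ks ?L S \<one> \<one>"
      unfolding T_def ks_add[OF group_alg_lreg[OF one_closed] group_alg_scale[OF SG]] ks_scale[OF SG] ..
    moreover have "ks ?L S \<one> \<one> = 0" using S by (simp add: ker_quasi_regular_def)
    moreover have "\<one> \<in> ?L" using subgroup.one_closed[OF L(1)] by blast
    ultimately show ?thesis by (simp add: ks_lreg)
  qed
  moreover have "ks ?L T \<one> \<one> = (\<Sum>s\<in>E. cf T s)"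
    unfolding ks_def E_def using cf_finite[OF TG]
    by (intro sum.mono_neutral_cong_right) (auto split: if_splits)
  ultimately have sum1: "(\<Sum>s\<in>E. cf T s) = 1" by simp
  have contr: "L2_set (\<lambda>x. cmod (\<Sum>s\<in>E. if inv s \<otimes> x \<in> F then cf T s else 0)) X \<le> sqrt (card F) / 2"
    if F: "finite F" "F \<subseteq> L n" and X: "finite X" "X \<subseteq> L n" for F X
  proof -
    have Fc: "F \<subseteq> carrier G" and Xc: "X \<subseteq> carrier G" using F X Lc by auto
    \<comment> \<open>For \<open>x\<close> and \<open>F\<close> in \<open>L n\<close> only quotients
      in \<open>L n\<close> occur, so the coefficients of \<open>T\<close> outside this subgroup
      never enter.\<close>
    have eq: "(\<Sum>s\<in>E. if inv s \<otimes> x \<in> F then cf T s else 0) = T (ind F) x" if x: "x \<in> X" for x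
    proof -
      have xc: "x \<in> carrier G" "x \<in> L n" using x Xc X by auto
      have inj: "inj_on (\<lambda>y. x \<otimes> inv y) F"
      proof (rule inj_onI)
        fix a b assume ab: "a \<in> F" "b \<in> F" "x \<otimes> inv a = x \<otimes> inv b"
        then have c: "a \<in> carrier G" "b \<in> carrier G" using Fc by auto
        have "inv (x \<otimes> inv a) \<otimes> x = inv (x \<otimes> inv b) \<otimes> x" using ab(3) by simp
        then show "a = b" using c xc by (simp add: inv_mult_group m_assoc)
      qed
      have "T (ind F) x = (\<Sum>y\<in>F. cf T (x \<otimes> inv y))" by (rule group_alg_ind_finite[OF TG F(1) Fc xc(1)])
      also have "\<dots> = (\<Sum>s\<in>(\<lambda>y. x \<otimes> inv y) ` F. cf T s)" by (simp add: sum.reindex[OF inj])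
      also have "\<dots> = (\<Sum>s\<in>E \<inter> {s. inv s \<otimes> x \<in> F}. cf T s)"
      proof (rule sum.mono_neutral_right)
        show "finite ((\<lambda>y. x \<otimes> inv y) ` F)" using F by simp
        show "E \<inter> {s. inv s \<otimes> x \<in> F} \<subseteq> (\<lambda>y. x \<otimes> inv y) ` F"
        proof
          fix s assume s: "s \<in> E \<inter> {s. inv s \<otimes> x \<in> F}"
          then have "s \<in> carrier G" using n Lc by blast
          then have "s = x \<otimes> inv (inv s \<otimes> x)" using xc by (simp add: inv_mult_group m_assoc[symmetric])
          then show "s \<in> (\<lambda>y. x \<otimes> inv y) ` F" using s by blast
        qed
        show "\<forall>s\<in>(\<lambda>y. x \<otimes> inv y) ` F - E \<inter> {s. inv s \<otimes> x \<in> F}. cf T s = 0"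
        proof
          fix s assume s: "s \<in> (\<lambda>y. x \<otimes> inv y) ` F - E \<inter> {s. inv s \<otimes> x \<in> F}"
          then obtain y where y: "y \<in> F" "s = x \<otimes> inv y" by blast
          have "y \<in> L n" "y \<in> carrier G" using y F Fc by auto
          then have "s \<in> L n" "inv s \<otimes> x = y"
            using y xc subgroup.m_closed[OF L(1)] subgroup.m_inv_closed[OF L(1)]
            by (auto simp: inv_mult_group m_assoc)
          then show "cf T s = 0" using s y by (auto simp: E_def)
        qed
      qed
      also have "\<dots> = (\<Sum>s\<in>E. if inv s \<otimes> x \<in> F then cf T s else 0)"
        using finE by (simp add: sum.If_cases)
      finally show ?thesis by simp
    qed
    have Fl: "ind F \<in> l2 cA" using l2_ind(1)[OF F(1) Fc] .
    have TF: "T (ind F) \<in> l2 cA" using bounded_opD(2)[OF group_alg_bounded[OF TG] Fl] .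
    have "L2_set (\<lambda>x. cmod (\<Sum>s\<in>E. if inv s \<otimes> x \<in> F then cf T s else 0)) X = L2_set (\<lambda>x. cmod (T (ind F) x)) X"
      using eq by (simp cong: L2_set_cong)
    also have "\<dots> \<le> l2norm cA (T (ind F))" by (rule L2_set_le_l2norm[OF TF X(1) Xc])
    also have "\<dots> \<le> opnorm cA T * l2norm cA (ind F)" by (rule le_opnorm[OF group_alg_bounded[OF TG] Fl])
    also have "\<dots> \<le> 1 / 2 * sqrt (card F)" 
      unfolding l2_ind(2)[OF F(1) Fc] using Tn by (intro mult_right_mono) auto
    finally show ?thesis by simp
  qed
  have "\<not> amenable (G\<lparr>carrier := L n\<rparr>)"
  proof
    assume "amenable (G\<lparr>carrier := L n\<rparr>)"
    then obtain \<mu> :: "'a set \<Rightarrow> real" where \<mu>: "\<mu> (L n) = 1" "\<forall>A\<subseteq>L n. 0 \<le> \<mu> A"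
      "\<forall>A B. A \<subseteq> L n \<and> B \<subseteq> L n \<and> A \<inter> B = {} \<longrightarrow> \<mu> (A \<union> B) = \<mu> A + \<mu> B"
      "\<forall>g\<in>L n. \<forall>A\<subseteq>L n. \<mu> (g <#\<^bsub>G\<lparr>carrier := L n\<rparr>\<^esub> A) = \<mu> A"
      unfolding amenable_def by auto
    have lc: "g <#\<^bsub>G\<lparr>carrier := L n\<rparr>\<^esub> A = (\<lambda>x. g \<otimes> x) ` A" for g A by (auto simp: l_coset_def)
    show False
    proof (rule M.contraction_not_amenable[of E "cf T" \<mu>])
      show "finite E" by (rule finE)
      show "E \<subseteq> carrier (G\<lparr>carrier := L n\<rparr>)" using n by simp
      show "(\<Sum>s\<in>E. cf T s) = 1" by (rule sum1)
      fix F X assume "finite F" "F \<subseteq> carrier (G\<lparr>carrier := L n\<rparr>)" "finite X" "X \<subseteq> carrier (G\<lparr>carrier := L n\<rparr>)"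
      then have "L2_set (\<lambda>x. cmod (\<Sum>s\<in>E. if inv s \<otimes> x \<in> F then cf T s else 0)) X \<le> sqrt (card F) / 2"
        using contr by simp
      moreover have "(\<Sum>s\<in>E. if inv\<^bsub>G\<lparr>carrier := L n\<rparr>\<^esub> s \<otimes>\<^bsub>G\<lparr>carrier := L n\<rparr>\<^esub> x \<in> F then cf T s else 0) =
          (\<Sum>s\<in>E. if inv s \<otimes> x \<in> F then cf T s else 0)" for x
        using n invM by (intro sum.cong) auto
      ultimately show "L2_set (\<lambda>x. cmod (\<Sum>s\<in>E. if inv\<^bsub>G\<lparr>carrier := L n\<rparr>\<^esub> s \<otimes>\<^bsub>G\<lparr>carrier := L n\<rparr>\<^esub> x \<in> F then cf T s else 0)) X
          \<le> sqrt (card F) / 2" by simp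
    qed (use \<mu> lc in auto)
  qed
  then show ?thesis by blast
qed

text \<open>The operator is (1 - a)(1 - b). At the coset of \<open>y\<close> it vanishes if
  \<open>b\<close> fixes that coset, and also if \<open>a\<close> fixes both this coset and its
  image under \<open>b\<close>, which explains the form of the second alternative.\<close>

lemma disjoint_support_kqr:
  assumes L: "subgroup L G" and a: "a \<in> carrier G" "a \<noteq> \<one>" and b: "b \<in> carrier G" "b \<noteq> \<one>"
    and fix_or: "\<And>g. g \<in> carrier G \<Longrightarrow> inv g \<otimes> b \<otimes> g \<in> L \<or>
      (inv g \<otimes> a \<otimes> g \<in> L \<and> inv (b \<otimes> g) \<otimes> a \<otimes> (b \<otimes> g) \<in> L)"
  shows "\<exists>z\<in>ker_quasi_regular L. z \<noteq> (\<lambda>f x. 0)"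
proof -
  define z where "z = (\<lambda>f x. lreg G \<one> f x + ((-1) * lreg G a f x + ((-1) * lreg G b f x + lreg G (a \<otimes> b) f x)))"
  have zG: "z \<in> group_alg G" unfolding z_def
    using a b by (intro group_alg_add group_alg_scale group_alg_lreg) auto
  note lG = group_alg_lreg
  have ab: "a \<otimes> b \<in> carrier G" using a b by simp
  have ksz: "ks L z k y = ks L (lreg G \<one>) k y + ((-1) * ks L (lreg G a) k y +
      ((-1) * ks L (lreg G b) k y + ks L (lreg G (a \<otimes> b)) k y))" for k y
    unfolding z_def
      ks_add[OF lG[OF one_closed] group_alg_add[OF group_alg_scale[OF lG[OF a(1)]]
          group_alg_add[OF group_alg_scale[OF lG[OF b(1)]] lG[OF ab]]]]
      ks_add[OF group_alg_scale[OF lG[OF a(1)]] group_alg_add[OF group_alg_scale[OF lG[OF b(1)]] lG[OF ab]]]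
      ks_add[OF group_alg_scale[OF lG[OF b(1)]] lG[OF ab]] ks_scale[OF lG[OF a(1)]] ks_scale[OF lG[OF b(1)]] ..
  have trans: "inv k \<otimes> g \<in> L \<longleftrightarrow> inv k \<otimes> h \<otimes> g \<in> L"
    if "inv g \<otimes> h \<otimes> g \<in> L" "k \<in> carrier G" "g \<in> carrier G" "h \<in> carrier G" for k g h
  proof -
    have e: "inv k \<otimes> h \<otimes> g = (inv k \<otimes> g) \<otimes> (inv g \<otimes> h \<otimes> g)"
    proof -
      have "(inv k \<otimes> g) \<otimes> (inv g \<otimes> h \<otimes> g) = inv k \<otimes> ((g \<otimes> inv g) \<otimes> (h \<otimes> g))"
        using that by (simp only: m_assoc m_closed inv_closed)
      then show ?thesis using that by (simp add: m_assoc)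
    qed
    have "inv k \<otimes> g \<in> L" if l: "inv k \<otimes> h \<otimes> g \<in> L"
    proof -
      have "(inv k \<otimes> h \<otimes> g) \<otimes> inv (inv g \<otimes> h \<otimes> g) \<in> L"
        using l \<open>inv g \<otimes> h \<otimes> g \<in> L\<close> subgroup.m_closed[OF L] subgroup.m_inv_closed[OF L] by blast
      moreover have "(inv k \<otimes> h \<otimes> g) \<otimes> inv (inv g \<otimes> h \<otimes> g) = inv k \<otimes> g"
        unfolding e using \<open>k \<in> carrier G\<close> \<open>g \<in> carrier G\<close> \<open>h \<in> carrier G\<close> by (simp add: m_assoc del: inv_mult_group)
      ultimately show ?thesis by simp
    qed
    moreover have "inv k \<otimes> h \<otimes> g \<in> L" if "inv k \<otimes> g \<in> L"
      unfolding e using that \<open>inv g \<otimes> h \<otimes> g \<in> L\<close> subgroup.m_closed[OF L] by blast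
    ultimately show ?thesis by blast
  qed
  have "ks L z k y = 0" if k: "k \<in> carrier G" and y: "y \<in> carrier G" for k y
  proof -
    have aa: "inv k \<otimes> (a \<otimes> b) \<otimes> y = inv (inv a \<otimes> k) \<otimes> b \<otimes> y" "inv k \<otimes> a \<otimes> y = inv (inv a \<otimes> k) \<otimes> y"
      "inv k \<otimes> (a \<otimes> b) \<otimes> y = inv k \<otimes> a \<otimes> (b \<otimes> y)" "inv k \<otimes> b \<otimes> y = inv k \<otimes> (b \<otimes> y)"
      using k y a b by (simp_all add: inv_mult_group m_assoc)
    from fix_or[OF y] show ?thesis
    proof
      assume B: "inv y \<otimes> b \<otimes> y \<in> L"
      have "inv k \<otimes> y \<in> L \<longleftrightarrow> inv k \<otimes> b \<otimes> y \<in> L" by (rule trans[OF B k y b(1)])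
      moreover have "inv k \<otimes> a \<otimes> y \<in> L \<longleftrightarrow> inv k \<otimes> (a \<otimes> b) \<otimes> y \<in> L"
        unfolding aa(1,2) by (rule trans[OF B _ y b(1)]) (use a k in simp)
      ultimately show ?thesis unfolding ksz using a b k y by (simp add: ks_lreg)
    next
      assume A: "inv y \<otimes> a \<otimes> y \<in> L \<and> inv (b \<otimes> y) \<otimes> a \<otimes> (b \<otimes> y) \<in> L"
      have "inv k \<otimes> y \<in> L \<longleftrightarrow> inv k \<otimes> a \<otimes> y \<in> L" by (rule trans) (use A k y a in auto)
      moreover have "inv k \<otimes> b \<otimes> y \<in> L \<longleftrightarrow> inv k \<otimes> (a \<otimes> b) \<otimes> y \<in> L"
        unfolding aa(3,4) by (rule trans) (use A k y a b in auto)
      ultimately show ?thesis unfolding ksz using a b k y by (simp add: ks_lreg)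
    qed
  qed
  then have "z \<in> ker_quasi_regular L" using zG by (simp add: ker_quasi_regular_def)
  \<comment> \<open>The coefficient is 1, or 2 if \<open>a\<close> and \<open>b\<close> are mutually
    inverse.\<close>
  moreover have "cf z \<one> \<noteq> 0"
  proof -
    have "cf z = (\<lambda>x. ind {\<one>} x + ((-1) * ind {a} x + ((-1) * ind {b} x + ind {a \<otimes> b} x)))"
      using a b cf_lreg unfolding z_def cf_def by (simp add: lreg_ind)
    then show ?thesis using a b by (simp add: ind_def)
  qed
  then have "z \<noteq> (\<lambda>f x. 0)" by (auto simp: cf_def)
  ultimately show ?thesis by blast
qed

end

section \<open>Simplicity by averaging\<close>

lemma l2_sum_list:
  assumes "\<And>s. s \<in> set P \<Longrightarrow> h s \<in> l2 A"
  shows "(\<lambda>x. \<Sum>s\<leftarrow>P. h s x) \<in> l2 A \<and> l2norm A (\<lambda>x. \<Sum>s\<leftarrow>P. h s x) \<le> (\<Sum>s\<leftarrow>P. l2norm A (h s))"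
  using assms
proof (induction P)
  case (Cons s P)
  then have IH: "(\<lambda>x. \<Sum>s\<leftarrow>P. h s x) \<in> l2 A" "l2norm A (\<lambda>x. \<Sum>s\<leftarrow>P. h s x) \<le> (\<Sum>s\<leftarrow>P. l2norm A (h s))"
    by simp_all
  have s: "h s \<in> l2 A" using Cons.prems by simp
  show ?case using l2_add[OF s IH(1)] IH(2) by simp
qed simp

lemma l2_sum:
  assumes "finite F" "\<And>s. s \<in> F \<Longrightarrow> h s \<in> l2 A"
  shows "(\<lambda>x. \<Sum>s\<in>F. h s x) \<in> l2 A \<and> l2norm A (\<lambda>x. \<Sum>s\<in>F. h s x) \<le> (\<Sum>s\<in>F. l2norm A (h s))"
  using assms
proof (induction F)
  case (insert s F)
  then have IH: "(\<lambda>x. \<Sum>s\<in>F. h s x) \<in> l2 A" "l2norm A (\<lambda>x. \<Sum>s\<in>F. h s x) \<le> (\<Sum>s\<in>F. l2norm A (h s))"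
    by simp_all
  have s: "h s \<in> l2 A" using insert.prems by simp
  show ?case using l2_add[OF s IH(1)] IH(2) insert by simp
qed simp

lemma sum_list_le_const:
  fixes h :: "'s \<Rightarrow> real"
  assumes "\<And>s. s \<in> set P \<Longrightarrow> h s \<le> c" shows "(\<Sum>s\<leftarrow>P. h s) \<le> c * length P"
  using assms by (induction P) (auto simp: algebra_simps add_mono)

lemma L2_set_sum_list_le:
  "L2_set (\<lambda>x. cmod (\<Sum>s\<leftarrow>S. h s x)) X \<le> (\<Sum>s\<leftarrow>S. L2_set (\<lambda>x. cmod (h s x)) X)"
proof (induction S)
  case Nil
  then show ?case by (simp add: L2_set_def)
next
  case (Cons s S)
  have "L2_set (\<lambda>x. cmod (\<Sum>s\<leftarrow>s # S. h s x)) X \<le> L2_set (\<lambda>x. cmod (h s x) + cmod (\<Sum>s\<leftarrow>S. h s x)) X"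
    by (intro L2_set_mono) (auto intro: norm_triangle_ineq)
  also have "\<dots> \<le> L2_set (\<lambda>x. cmod (h s x)) X + L2_set (\<lambda>x. cmod (\<Sum>s\<leftarrow>S. h s x)) X"
    by (rule L2_set_triangle_ineq)
  finally show ?case using Cons by simp
qed

section \<open>Powers averaging implies simplicity\<close>

context plain_group begin

definition conj_sum :: "'a list \<Rightarrow> 'a \<Rightarrow> 'a op" where
  "conj_sum S t = (\<lambda>f x. \<Sum>s\<leftarrow>S. lreg G (s \<otimes> t \<otimes> inv s) f x)"

definition small :: "real \<Rightarrow> 'a list \<Rightarrow> 'a \<Rightarrow> bool" where
  "small e S t \<longleftrightarrow> (\<forall>f\<in>l2 cA. l2norm cA (conj_sum S t f) \<le> e * length S * l2norm cA f)"

text \<open>One list must serve all of \<open>F\<close>, since an element of an ideal is averaged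
  with all its coefficients at once.\<close>

definition powers :: bool where
  "powers \<longleftrightarrow> (\<forall>F e. finite F \<longrightarrow> F \<subseteq> carrier G - {\<one>} \<longrightarrow> 0 < e \<longrightarrow>
    (\<exists>S. S \<noteq> [] \<and> set S \<subseteq> carrier G \<and> (\<forall>t\<in>F. small e S t)))"

lemma conj_sum_l2:
  assumes "set S \<subseteq> carrier G" "t \<in> carrier G" "f \<in> l2 cA" shows "conj_sum S t f \<in> l2 cA"
  unfolding conj_sum_def using assms by (intro l2_sum_list[THEN conjunct1] lreg_in) auto

text \<open>Invariance of the matrix entries under right translation passes from the group algebra
  to norm limits.\<close>

lemma reduced_Cstar_ind:
  assumes T: "T \<in> reduced_Cstar G" and x: "x \<in> carrier G" and y: "y \<in> carrier G"
  shows "T (ind {y}) x = T (ind {\<one>}) (x \<otimes> inv y)"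
proof -
  have b: "bounded_op cA T" using T by (simp add: reduced_Cstar_def)
  have est: "cmod (T (ind {y}) x - S (ind {y}) x) \<le> opnorm cA (op_diff T S)"
    if "S \<in> group_alg G" "x \<in> carrier G" "y \<in> carrier G" for S x y
  proof -
    have d: "bounded_op cA (op_diff T S)" by (intro bounded_op_diff b group_alg_bounded that)
    have "cmod (op_diff T S (ind {y}) x) \<le> l2norm cA (op_diff T S (ind {y}))"
      by (rule l2norm_ge[OF bounded_opD(2)[OF d ind_l2] that(2)]) (rule that)
    also have "\<dots> \<le> opnorm cA (op_diff T S) * l2norm cA (ind {y})"
      by (rule le_opnorm[OF d ind_l2]) (rule that)
    also have "l2norm cA (ind {y}) = 1" using l2_ind(2)[of "{y}" cA] that by simp
    finally show ?thesis by (simp add: op_diff_def)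
  qed
  have "cmod (T (ind {y}) x - T (ind {\<one>}) (x \<otimes> inv y)) \<le> e" if e: "0 < e" for e
  proof -
    have "0 < e / 2" using e by simp
    then obtain S where S: "S \<in> group_alg G" "opnorm cA (op_diff T S) < e / 2"
      using reduced_CstarD(2)[OF T] by blast
    have "S (ind {y}) x = S (ind {\<one>}) (x \<otimes> inv y)" using group_alg_ind[OF S(1) y x] by (simp add: cf_def)
    then have "T (ind {y}) x - T (ind {\<one>}) (x \<otimes> inv y) =
        (T (ind {y}) x - S (ind {y}) x) - (T (ind {\<one>}) (x \<otimes> inv y) - S (ind {\<one>}) (x \<otimes> inv y))" by simp
    also have "cmod \<dots> \<le> cmod (T (ind {y}) x - S (ind {y}) x) + cmod (T (ind {\<one>}) (x \<otimes> inv y) - S (ind {\<one>}) (x \<otimes> inv y))"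
      by (rule norm_triangle_ineq4)
    also have "\<dots> \<le> opnorm cA (op_diff T S) + opnorm cA (op_diff T S)"
      using est[OF S(1) x y] est[OF S(1), of "x \<otimes> inv y" \<one>] x y by (intro add_mono) auto
    finally show ?thesis using S(2) by simp
  qed
  then have "cmod (T (ind {y}) x - T (ind {\<one>}) (x \<otimes> inv y)) \<le> 0" by (rule field_le_epsilon) simp
  then show ?thesis by simp
qed

text \<open>The indicator of the unit is a separating vector: by right translation all columns
  vanish with the first one, so \<open>T\<close> kills finitely supported functions and, by density,
  everything.\<close>

lemma reduced_Cstar_separating:
  assumes T: "T \<in> reduced_Cstar G" and 0: "\<And>x. x \<in> carrier G \<Longrightarrow> T (ind {\<one>}) x = 0"
  shows "T = (\<lambda>f x. 0)"
proof
  have b: "bounded_op cA T" using T by (simp add: reduced_Cstar_def)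
  have ind0: "T (ind {y}) = (\<lambda>_. 0)" if y: "y \<in> carrier G" for y
  proof
    fix x show "T (ind {y}) x = 0"
      using reduced_Cstar_ind[OF T _ y, of x] 0[of "x \<otimes> inv y"] y l2_outside[OF bounded_opD(2)[OF b ind_l2[OF y]], of x]
      by (cases "x \<in> carrier G") auto
  qed
  have fin0: "T f = (\<lambda>_. 0)" if "finite F" "F \<subseteq> carrier G" "\<And>x. x \<notin> F \<Longrightarrow> f x = 0" for F f
    using that
  proof (induction F arbitrary: f)
    case empty
    then have "f = (\<lambda>_. 0)" by auto
    then show ?case using bounded_op_zero[OF b] by simp
  next
    case (insert y F)
    let ?g = "\<lambda>x. if x = y then 0 else f x"
    have y: "y \<in> carrier G" using insert by simp
    have g: "?g \<in> l2 cA" by (rule l2_finite_support(1)[of F]) (use insert in auto)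
    have "f = (\<lambda>x. f y * ind {y} x + ?g x)" by (auto simp: ind_def)
    moreover have "T (\<lambda>x. f y * ind {y} x + ?g x) = (\<lambda>x. T (\<lambda>x. f y * ind {y} x) x + T ?g x)"
      by (rule bounded_opD(3)[OF b l2_scale_le(1)[OF ind_l2[OF y]] g])
    moreover have "T (\<lambda>x. f y * ind {y} x) = (\<lambda>x. f y * T (ind {y}) x)"
      by (rule bounded_opD(4)[OF b ind_l2[OF y]])
    moreover have "T ?g = (\<lambda>_. 0)" by (rule insert.IH) (use insert in auto)
    ultimately have "T f = (\<lambda>x. f y * T (ind {y}) x + 0)" by simp
    then show ?case using ind0[OF y] by simp
  qed
  fix f show "T f = (\<lambda>x. 0)"
  proof (cases "f \<in> l2 cA")
    case True
    obtain K where K: "0 \<le> K" "\<And>f. f \<in> l2 cA \<Longrightarrow> l2norm cA (T f) \<le> K * l2norm cA f"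
      using bounded_op_bound[OF b] by blast
    have "l2norm cA (T f) \<le> 0 + e" if e: "0 < e" for e
    proof -
      have "0 < e / (K + 1)" using e K(1) by simp
      then obtain F where F: "finite F" "F \<subseteq> cA" "l2norm cA (\<lambda>x. if x \<in> F then 0 else f x) \<le> e / (K + 1)"
        using l2_tail[OF True] by blast
      let ?g = "\<lambda>x. if x \<in> F then f x else 0" and ?h = "\<lambda>x. if x \<in> F then 0 else f x"
      have g: "?g \<in> l2 cA" by (rule l2_finite_support(1)[OF F(1,2)]) simp
      have "?h = (\<lambda>x. f x - ?g x)" by auto
      then have h: "?h \<in> l2 cA" using l2_diff(1)[OF True g] by simp
      have "f = (\<lambda>x. ?g x + ?h x)" by auto
      then have "T f = T (\<lambda>x. ?g x + ?h x)" by (rule arg_cong)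
      also have "\<dots> = (\<lambda>x. T ?g x + T ?h x)" by (rule bounded_opD(3)[OF b g h])
      also have "T ?g = (\<lambda>_. 0)" by (rule fin0[OF F(1,2)]) simp
      finally have "l2norm cA (T f) = l2norm cA (T ?h)" by simp
      also have "\<dots> \<le> K * (e / (K + 1))"
        using K(2)[OF h] mult_left_mono[OF F(3) K(1)] by linarith
      also have "\<dots> \<le> e" using K(1) e by (simp add: divide_le_eq algebra_simps)
      finally show ?thesis by simp
    qed
    then have "l2norm cA (T f) \<le> 0" by (rule field_le_epsilon)
    then show ?thesis using l2norm_eq_0[OF bounded_opD(2)[OF b True]] l2norm_nonneg[of cA "T f"] by simp
  qed (use bounded_opD(1)[OF b] in simp)
qed

text \<open>Three errors of relative size \<open>e\<close>: replacing \<open>T\<close> by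
  \<open>S\<close> (\<open>r1\<close>), the averaged terms off the unit (\<open>r2\<close>), and the
  deviation from 1 of the coefficient at the unit, which conjugation does not change
  (\<open>r3\<close>).\<close>

lemma averaging_estimate:
  assumes P: "P \<noteq> []" "set P \<subseteq> carrier G" and F: "finite F" "F \<subseteq> carrier G" "\<one> \<in> F"
    and S: "S = (\<lambda>f x. \<Sum>g\<in>F. c g * lreg G g f x)" and T: "bounded_op cA T"
    and e: "0 \<le> e" "opnorm cA (op_diff T S) \<le> e" "cmod (c \<one> - 1) \<le> e"
    and d: "\<And>g. g \<in> F - {\<one>} \<Longrightarrow> small d P g" "d * (\<Sum>g\<in>F - {\<one>}. cmod (c g)) \<le> e" and f: "f \<in> l2 cA"
  shows "l2norm cA (\<lambda>x. (\<Sum>s\<leftarrow>P. lreg G s (T (lreg G (inv s) f)) x) - of_nat (length P) * f x)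
    \<le> 3 * e * length P * l2norm cA f"
proof -
  let ?n = "of_nat (length P) :: complex"
  have SG: "S \<in> group_alg G" unfolding group_alg_def using S F by blast
  have bS: "bounded_op cA S" by (rule group_alg_bounded[OF SG])
  have bD: "bounded_op cA (op_diff T S)" by (rule bounded_op_diff[OF T bS])
  have Pc: "s \<in> carrier G" if "s \<in> set P" for s using that P by blast
  define r1 where "r1 = (\<lambda>x. \<Sum>s\<leftarrow>P. lreg G s (op_diff T S (lreg G (inv s) f)) x)"
  have fs: "lreg G (inv s) f \<in> l2 cA" if "s \<in> set P" for s using lreg_in(1)[OF inv_closed[OF Pc[OF that]] f] .
  have Df: "op_diff T S (lreg G (inv s) f) \<in> l2 cA" if "s \<in> set P" for s
    by (rule bounded_opD(2)[OF bD fs[OF that]])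
  have r1: "r1 \<in> l2 cA" "l2norm cA r1 \<le> e * length P * l2norm cA f"
  proof -
    have *: "lreg G s (op_diff T S (lreg G (inv s) f)) \<in> l2 cA" if "s \<in> set P" for s
      by (rule lreg_in(1)[OF Pc Df]) (use that in auto)
    have "l2norm cA (lreg G s (op_diff T S (lreg G (inv s) f))) \<le> e * l2norm cA f" if s: "s \<in> set P" for s
    proof -
      have "l2norm cA (lreg G s (op_diff T S (lreg G (inv s) f))) \<le> l2norm cA (op_diff T S (lreg G (inv s) f))"
        by (rule lreg_in(2)[OF Pc[OF s] Df[OF s]])
      also have "\<dots> \<le> opnorm cA (op_diff T S) * l2norm cA (lreg G (inv s) f)"
        by (rule le_opnorm[OF bD fs[OF s]])
      also have "\<dots> \<le> e * l2norm cA f"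
        using e lreg_in(2)[OF inv_closed[OF Pc[OF s]] f] by (intro mult_mono) auto
      finally show ?thesis .
    qed
    then have "(\<Sum>s\<leftarrow>P. l2norm cA (lreg G s (op_diff T S (lreg G (inv s) f)))) \<le> e * l2norm cA f * length P"
      by (rule sum_list_le_const)
    then show "r1 \<in> l2 cA" "l2norm cA r1 \<le> e * length P * l2norm cA f"
      using l2_sum_list[of P "\<lambda>s. lreg G s (op_diff T S (lreg G (inv s) f))" cA] * unfolding r1_def
      by (auto simp: mult_ac intro: order_trans)
  qed
  define r2 where "r2 = (\<lambda>x. \<Sum>g\<in>F - {\<one>}. c g * conj_sum P g f x)"
  have r2: "r2 \<in> l2 cA" "l2norm cA r2 \<le> e * length P * l2norm cA f"
  proof -
    have cs: "conj_sum P g f \<in> l2 cA" if "g \<in> F - {\<one>}" for g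
      using that F P f by (intro conj_sum_l2) auto
    then have *: "(\<lambda>x. c g * conj_sum P g f x) \<in> l2 cA" if "g \<in> F - {\<one>}" for g
      using that by (intro l2_scale_le(1)) auto
    have "l2norm cA (\<lambda>x. c g * conj_sum P g f x) \<le> cmod (c g) * (d * length P * l2norm cA f)" if g: "g \<in> F - {\<one>}" for g
      using d(1)[OF g] f l2_scale[OF cs[OF g], of "c g"] by (simp add: small_def mult_left_mono)
    then have "(\<Sum>g\<in>F - {\<one>}. l2norm cA (\<lambda>x. c g * conj_sum P g f x)) \<le> (\<Sum>g\<in>F - {\<one>}. cmod (c g) * (d * length P * l2norm cA f))"
      by (rule sum_mono)
    also have "\<dots> = (d * (\<Sum>g\<in>F - {\<one>}. cmod (c g))) * (length P * l2norm cA f)"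
      by (simp add: sum_distrib_left sum_distrib_right mult_ac)
    also have "\<dots> \<le> e * (length P * l2norm cA f)" using d(2) by (intro mult_right_mono) auto
    finally have "(\<Sum>g\<in>F - {\<one>}. l2norm cA (\<lambda>x. c g * conj_sum P g f x)) \<le> e * length P * l2norm cA f"
      by (simp add: mult.assoc)
    then show "r2 \<in> l2 cA" "l2norm cA r2 \<le> e * length P * l2norm cA f"
      using l2_sum[of "F - {\<one>}" "\<lambda>g x. c g * conj_sum P g f x" cA] * F(1) unfolding r2_def
      by (auto intro: order_trans)
  qed
  define r3 where "r3 = (\<lambda>x. (?n * (c \<one> - 1)) * f x)"
  have r3: "r3 \<in> l2 cA" "l2norm cA r3 \<le> e * length P * l2norm cA f"
  proof -
    show "r3 \<in> l2 cA" unfolding r3_def by (rule l2_scale_le(1)[OF f])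
    have "l2norm cA r3 = length P * cmod (c \<one> - 1) * l2norm cA f"
      unfolding r3_def l2_scale[OF f] by (simp add: norm_mult)
    also have "\<dots> \<le> length P * e * l2norm cA f" by (intro mult_right_mono mult_left_mono e) auto
    finally show "l2norm cA r3 \<le> e * length P * l2norm cA f" by (simp add: mult_ac)
  qed
  have eq: "(\<Sum>s\<leftarrow>P. lreg G s (T (lreg G (inv s) f)) x) - ?n * f x = r1 x + (r2 x + r3 x)" for x
  proof -
    have conjS: "lreg G s (S (lreg G (inv s) f)) x = (\<Sum>g\<in>F. c g * lreg G (s \<otimes> g \<otimes> inv s) f x)" if s: "s \<in> set P" for s
    proof (cases "x \<in> carrier G")
      case True
      have Sf: "S (lreg G (inv s) f) \<in> l2 cA" by (rule bounded_opD(2)[OF bS fs[OF s]])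
      have "lreg G s (S (lreg G (inv s) f)) x = (\<Sum>g\<in>F. c g * lreg G g (lreg G (inv s) f) (inv s \<otimes> x))"
        using lreg_apply[OF Sf True, of s] by (simp add: S)
      also have "\<dots> = (\<Sum>g\<in>F. c g * lreg G (s \<otimes> g \<otimes> inv s) f x)"
      proof (rule sum.cong[OF refl])
        fix g assume "g \<in> F"
        then have g: "g \<in> carrier G" using F by blast
        have "lreg G g (lreg G (inv s) f) (inv s \<otimes> x) = f (s \<otimes> (inv g \<otimes> (inv s \<otimes> x)))"
          using g True Pc[OF s] lreg_apply[OF fs[OF s], of "inv s \<otimes> x" g] lreg_apply[OF f, of "inv g \<otimes> (inv s \<otimes> x)" "inv s"] by simp
        also have "\<dots> = lreg G (s \<otimes> g \<otimes> inv s) f x"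
          using g True Pc[OF s] lreg_apply[OF f True] by (simp add: inv_mult_group m_assoc)
        finally show "c g * lreg G g (lreg G (inv s) f) (inv s \<otimes> x) = c g * lreg G (s \<otimes> g \<otimes> inv s) f x" by simp
      qed
      finally show ?thesis .
    next
      case False
      then have "lreg G h k x = 0" for h k by (simp add: lreg_def)
      then show ?thesis by simp
    qed
    have "(\<Sum>s\<leftarrow>P. lreg G s (S (lreg G (inv s) f)) x) = (\<Sum>s\<leftarrow>P. \<Sum>g\<in>F. c g * lreg G (s \<otimes> g \<otimes> inv s) f x)"
      using conjS by (simp cong: map_cong)
    also have "\<dots> = (\<Sum>g\<in>F. c g * conj_sum P g f x)"
      unfolding conj_sum_def by (induction P) (auto simp: sum.distrib distrib_left)
    also have "\<dots> = r2 x + c \<one> * conj_sum P \<one> f x"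
      unfolding r2_def using F by (simp add: sum.remove[of F \<one>] add.commute)
    also have "conj_sum P \<one> f x = ?n * f x"
    proof -
      have "map (\<lambda>s. lreg G (s \<otimes> \<one> \<otimes> inv s) f x) P = map (\<lambda>s. f x) P"
        using Pc lreg_one_l2[OF f] by (intro map_cong) auto
      then show ?thesis unfolding conj_sum_def by (simp only: sum_list_triv)
    qed
    finally have S1: "(\<Sum>s\<leftarrow>P. lreg G s (S (lreg G (inv s) f)) x) = r2 x + c \<one> * (?n * f x)" .
    have "lreg G s (T (lreg G (inv s) f)) x = lreg G s (op_diff T S (lreg G (inv s) f)) x + lreg G s (S (lreg G (inv s) f)) x"
      if s: "s \<in> set P" for s
    proof -
      have "T (lreg G (inv s) f) = (\<lambda>x. op_diff T S (lreg G (inv s) f) x + S (lreg G (inv s) f) x)"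
        by (simp add: op_diff_def)
      then show ?thesis
        using bounded_opD(3)[OF lreg_bounded[OF Pc[OF s]] Df[OF s] bounded_opD(2)[OF bS fs[OF s]]] by metis
    qed
    then have "map (\<lambda>s. lreg G s (T (lreg G (inv s) f)) x) P =
        map (\<lambda>s. lreg G s (op_diff T S (lreg G (inv s) f)) x + lreg G s (S (lreg G (inv s) f)) x) P" by simp
    then have "(\<Sum>s\<leftarrow>P. lreg G s (T (lreg G (inv s) f)) x) = r1 x + (\<Sum>s\<leftarrow>P. lreg G s (S (lreg G (inv s) f)) x)"
      by (simp only: sum_list_addf r1_def)
    then show ?thesis using S1 by (simp add: r3_def algebra_simps)
  qed
  have "l2norm cA (\<lambda>x. r1 x + (r2 x + r3 x)) \<le> l2norm cA r1 + (l2norm cA r2 + l2norm cA r3)"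
    using l2_add[OF r1(1) l2_add(1)[OF r2(1) r3(1)]] l2_add(2)[OF r2(1) r3(1)] by linarith
  also have "\<dots> \<le> 3 * e * length P * l2norm cA f" using r1 r2 r3 by linarith
  finally show ?thesis by (simp only: eq)
qed

text \<open>A nonzero element of the ideal has a nonzero coefficient at some \<open>g\<close>;
  translating and scaling turn it into the coefficient 1 at the unit, with no recourse to adjoints
  or a trace. The averages of the new element over conjugations stay in the ideal and approach the
  unit.\<close>

theorem powers_imp_Cstar_simple:
  assumes pw: powers shows "Cstar_simple G"
  unfolding Cstar_simple_def
proof (intro allI impI)
  fix J assume J: "closed_ideal cA (reduced_Cstar G) J"
  have Jsub: "J \<subseteq> reduced_Cstar G" and J0: "(\<lambda>f x. 0) \<in> J"
    and Jadd: "\<And>S T. S \<in> J \<Longrightarrow> T \<in> J \<Longrightarrow> (\<lambda>f x. S f x + T f x) \<in> J"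
    and Jscale: "\<And>S c. S \<in> J \<Longrightarrow> (\<lambda>f x. c * S f x) \<in> J"
    and Jmult: "\<And>S a. S \<in> J \<Longrightarrow> a \<in> reduced_Cstar G \<Longrightarrow> a \<circ> S \<in> J \<and> S \<circ> a \<in> J"
    and Jclosed: "\<And>T. T \<in> reduced_Cstar G \<Longrightarrow> \<forall>e>0. \<exists>S\<in>J. opnorm cA (op_diff T S) < e \<Longrightarrow> T \<in> J"
    using J unfolding closed_ideal_def by (blast, blast, blast, blast, blast, blast)
  have lR: "lreg G g \<in> reduced_Cstar G" if "g \<in> carrier G" for g
    using that by (intro group_alg_reduced group_alg_lreg)
  show "J = {\<lambda>f x. 0} \<or> J = reduced_Cstar G"
  proof (cases "J = {\<lambda>f x. 0}")
    case False
    then obtain T0 where T0: "T0 \<in> J" "T0 \<noteq> (\<lambda>f x. 0)" using J0 by blast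
    obtain g where g: "g \<in> carrier G" "T0 (ind {\<one>}) g \<noteq> 0"
      using reduced_Cstar_separating[of T0] T0 Jsub by blast
    define T where "T = (\<lambda>f x. inverse (T0 (ind {\<one>}) g) * (lreg G (inv g) \<circ> T0) f x)"
    have TJ: "T \<in> J" unfolding T_def
      by (rule Jscale[OF conjunct1[OF Jmult[OF T0(1) lR[OF inv_closed[OF g(1)]]]]])
    then have TR: "T \<in> reduced_Cstar G" using Jsub by blast
    have bT: "bounded_op cA T" using TR by (simp add: reduced_Cstar_def)
    have "bounded_op cA T0" using T0(1) Jsub by (auto simp: reduced_Cstar_def)
    then have "T0 (ind {\<one>}) \<in> l2 cA" by (rule bounded_opD(2)) (rule ind_l2[OF one_closed])
    then have T1: "T (ind {\<one>}) \<one> = 1" using g by (simp add: T_def lreg_apply)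
    have "lreg G \<one> \<in> J"
    proof (rule Jclosed[OF lR[OF one_closed]], intro allI impI)
      fix e0 :: real assume "0 < e0"
      \<comment> \<open>A quarter, because \<open>averaging_estimate\<close> costs a factor 3 and
        the final bound is strict.\<close>
      define e where "e = e0 / 4"
      have e: "0 < e" "3 * e < e0" using \<open>0 < e0\<close> by (auto simp: e_def)
      obtain S where S: "S \<in> group_alg G" "opnorm cA (op_diff T S) < e"
        using reduced_CstarD(2)[OF TR e(1)] by blast
      obtain F0 c0 where F0: "finite F0" "F0 \<subseteq> carrier G" "S = (\<lambda>f x. \<Sum>g\<in>F0. c0 g * lreg G g f x)"
        using S(1) by (auto simp: group_alg_def)
      define F where "F = insert \<one> F0"
      define c where "c = (\<lambda>g. if g \<in> F0 then c0 g else 0)"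
      have F: "finite F" "F \<subseteq> carrier G" "\<one> \<in> F" using F0 by (auto simp: F_def)
      have Seq: "S = (\<lambda>f x. \<Sum>g\<in>F. c g * lreg G g f x)"
        unfolding F0(3) c_def F_def using F0(1) by (intro ext sum.mono_neutral_cong_left) auto
      have "S (ind {\<one>}) \<one> = (\<Sum>g\<in>F. c g * ind {g} \<one>)"
        unfolding Seq using F(2) by (intro sum.cong refl) (simp add: lreg_ind subset_iff)
      also have "\<dots> = (\<Sum>g\<in>F. if g = \<one> then c g else 0)" by (intro sum.cong refl) (simp add: ind_def)
      also have "\<dots> = c \<one>" using F by simp
      finally have Sc: "S (ind {\<one>}) \<one> = c \<one>" .
      have bD: "bounded_op cA (op_diff T S)" by (intro bounded_op_diff bT group_alg_bounded S)
      have "cmod (op_diff T S (ind {\<one>}) \<one>) \<le> l2norm cA (op_diff T S (ind {\<one>}))"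
        by (rule l2norm_ge[OF bounded_opD(2)[OF bD ind_l2]]) auto
      also have "\<dots> \<le> opnorm cA (op_diff T S) * l2norm cA (ind {\<one>})" by (rule le_opnorm[OF bD ind_l2]) simp
      also have "l2norm cA (ind {\<one>}) = 1" using l2_ind(2)[of "{\<one>}" cA] by simp
      finally have c1: "cmod (c \<one> - 1) \<le> e" using S(2) T1 Sc by (simp add: op_diff_def norm_minus_commute)
      define M where "M = (\<Sum>g\<in>F - {\<one>}. cmod (c g))"
      have M: "0 \<le> M" unfolding M_def by (rule sum_nonneg) simp
      \<comment> \<open>The added 1 guards against \<open>M = 0\<close>.\<close>
      define d where "d = e / (M + 1)"
      have d: "0 < d" "d * M \<le> e" using e M by (auto simp: d_def divide_le_eq algebra_simps)
      have FF: "finite (F - {\<one>})" "F - {\<one>} \<subseteq> carrier G - {\<one>}" using F by auto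
      obtain P where P: "P \<noteq> []" "set P \<subseteq> carrier G" "\<forall>t\<in>F - {\<one>}. small d P t"
        using pw[unfolded powers_def, rule_format, OF FF d(1)] by blast
      define B where "B = (\<lambda>f x. inverse (of_nat (length P)) * (\<Sum>s\<leftarrow>P. (lreg G s \<circ> (T \<circ> lreg G (inv s))) f x))"
      have "(\<lambda>f x. \<Sum>s\<leftarrow>P'. (lreg G s \<circ> (T \<circ> lreg G (inv s))) f x) \<in> J" if "set P' \<subseteq> carrier G" for P'
        using that
      proof (induction P')
        case Nil
        then show ?case using J0 by simp
      next
        case (Cons s P')
        have "lreg G s \<circ> (T \<circ> lreg G (inv s)) \<in> J" using Cons.prems Jmult TJ lR by simp
        from Jadd[OF this] Cons show ?case by simp
      qed
      from Jscale[OF this[OF P(2)]] have BJ: "B \<in> J" by (simp add: B_def)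
      have "opnorm cA (op_diff (lreg G \<one>) B) \<le> 3 * e"
      proof (rule opnorm_le)
        fix f assume f: "f \<in> l2 cA"
        let ?n = "of_nat (length P) :: complex"
        let ?r = "\<lambda>x. (\<Sum>s\<leftarrow>P. lreg G s (T (lreg G (inv s) f)) x) - ?n * f x"
        have n0: "?n \<noteq> 0" using P(1) by simp
        have TG: "(\<lambda>x. \<Sum>s\<leftarrow>P. lreg G s (T (lreg G (inv s) f)) x) \<in> l2 cA"
          using P(2) f by (intro l2_sum_list[THEN conjunct1] lreg_in bounded_opD(2)[OF bT]) auto
        have r: "?r \<in> l2 cA" by (rule l2_diff(1)[OF TG l2_scale_le(1)[OF f]])
        have rn: "l2norm cA ?r \<le> 3 * e * length P * l2norm cA f"
          by (rule averaging_estimate[OF P(1,2) F Seq bT _ _ c1 _ _ f, where d = d])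
            (use e S(2) P(3) d(2) in \<open>auto simp: M_def\<close>)
        have "op_diff (lreg G \<one>) B f = (\<lambda>x. (- inverse ?n) * ?r x)"
          using n0 by (auto simp: op_diff_def lreg_one_l2[OF f] B_def field_simps)
        then have "l2norm cA (op_diff (lreg G \<one>) B f) = cmod (- inverse ?n) * l2norm cA ?r"
          using l2_scale[OF r, of "- inverse ?n"] by simp
        also have "\<dots> \<le> cmod (- inverse ?n) * (3 * e * length P * l2norm cA f)" by (intro mult_left_mono rn) simp
        also have "\<dots> = 3 * e * l2norm cA f" using n0 by (simp add: norm_inverse norm_divide)
        finally show "l2norm cA (op_diff (lreg G \<one>) B f) \<le> 3 * e * l2norm cA f" .
      qed (use e in simp)
      then show "\<exists>S\<in>J. opnorm cA (op_diff (lreg G \<one>) S) < e0" using BJ e by (intro bexI[OF _ BJ]) linarith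
    qed
    then have "a \<in> J" if "a \<in> reduced_Cstar G" for a
      using Jmult[of "lreg G \<one>" a] that comp_lreg_one[of a] by (auto simp: reduced_Cstar_def)
    then show ?thesis using Jsub by blast
  qed blast
qed

lemma smallI:
  fixes e :: real
  assumes e: "0 \<le> e" and S: "set S \<subseteq> carrier G" and t: "t \<in> carrier G"
    and le: "\<And>f X. f \<in> l2 cA \<Longrightarrow> finite X \<Longrightarrow> X \<subseteq> carrier G \<Longrightarrow>
      L2_set (\<lambda>x. cmod (\<Sum>s\<leftarrow>S. f (s \<otimes> inv t \<otimes> inv s \<otimes> x))) X \<le> e * length S * l2norm cA f"
  shows "small e S t"
  unfolding small_def
proof (intro ballI)
  fix f assume f: "f \<in> l2 cA"
  have 0: "conj_sum S t f x = 0" if "x \<notin> cA" for x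
    using l2_outside[OF conj_sum_l2[OF S t f] that] .
  have 1: "L2_set (\<lambda>x. cmod (conj_sum S t f x)) X \<le> e * length S * l2norm cA f"
    if X: "finite X" "X \<subseteq> cA" for X
  proof -
    have "conj_sum S t f x = (\<Sum>s\<leftarrow>S. f (s \<otimes> inv t \<otimes> inv s \<otimes> x))" if "x \<in> X" for x
    proof -
      have "x \<in> carrier G" using that X by blast
      then have "map (\<lambda>s. lreg G (s \<otimes> t \<otimes> inv s) f x) S = map (\<lambda>s. f (s \<otimes> inv t \<otimes> inv s \<otimes> x)) S"
        using S t by (intro map_cong refl) (simp add: lreg_apply[OF f] inv_mult_group m_assoc subset_iff)
      then show ?thesis by (simp only: conj_sum_def)
    qed
    then have "L2_set (\<lambda>x. cmod (conj_sum S t f x)) X = L2_set (\<lambda>x. cmod (\<Sum>s\<leftarrow>S. f (s \<otimes> inv t \<otimes> inv s \<otimes> x))) X"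
      by (intro L2_set_cmod_cong)
    then show ?thesis using le[OF f X] by simp
  qed
  show "l2norm cA (conj_sum S t f) \<le> e * length S * l2norm cA f"
    by (rule l2I(2)[of cA "conj_sum S t f", OF 0 1])
qed

text \<open>Powers' estimate. With \<open>D j = s j (G - C)\<close>, each \<open>s j t (s j)\<^sup>-\<^sup>1\<close> maps the complement of \<open>D j\<close>
  into \<open>D j\<close>, and the \<open>D j\<close> are disjoint; \<open>h1\<close> collects the values at points of \<open>D j\<close>.\<close>

lemma powers_estimate:
  assumes s: "\<And>j. j < N \<Longrightarrow> s j \<in> carrier G" and t: "t \<in> carrier G"
    and thin: "\<And>y. y \<in> carrier G \<Longrightarrow> y \<in> C \<Longrightarrow> t \<otimes> y \<notin> C"
    and disj: "\<And>i j x. i < N \<Longrightarrow> j < N \<Longrightarrow> i \<noteq> j \<Longrightarrow> x \<in> carrier G \<Longrightarrow> inv (s i) \<otimes> x \<in> C \<or> inv (s j) \<otimes> x \<in> C"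
    and N: "0 < N"
  shows "small (2 / sqrt N) (map s [0..<N]) t"
proof (rule smallI)
  show "set (map s [0..<N]) \<subseteq> carrier G" using s by auto
  fix f X assume f: "f \<in> l2 cA" and X: "finite X" "X \<subseteq> carrier G"
  define u where "u = (\<lambda>j x. s j \<otimes> inv t \<otimes> inv (s j) \<otimes> x)"
  define D where "D = (\<lambda>j. {x \<in> carrier G. inv (s j) \<otimes> x \<notin> C})"
  have uc: "u j x \<in> carrier G" if "j < N" "x \<in> X" for j x using that s t X by (auto simp: u_def)
  have inj: "inj_on (u j) X" if "j < N" for j
    using that s t X by (auto simp: u_def inj_on_def subset_iff)
  have move: "u j x \<in> D j" if j: "j < N" and x: "x \<in> X" "x \<notin> D j" for j x
  proof -
    have c: "x \<in> carrier G" "s j \<in> carrier G" using j x X s by auto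
    let ?z = "inv (s j) \<otimes> x"
    have "?z \<in> C" using x c by (simp add: D_def)
    moreover have "t \<otimes> (inv t \<otimes> ?z) = ?z" using c t by (simp add: m_assoc[symmetric])
    ultimately have "inv t \<otimes> ?z \<notin> C" using thin[of "inv t \<otimes> ?z"] c t by auto
    moreover have "inv (s j) \<otimes> u j x = inv t \<otimes> ?z" using c t
      by (simp add: u_def m_assoc) (simp add: m_assoc[symmetric])
    ultimately show ?thesis using uc[OF j x(1)] by (simp add: D_def)
  qed
  have Dd: "D i \<inter> D j = {}" if "i < N" "j < N" "i \<noteq> j" for i j
    using disj that unfolding D_def by blast
  define h1 where "h1 = (\<lambda>x. \<Sum>j<N. if x \<in> D j then f (u j x) else 0)"
  define h2 where "h2 = (\<lambda>j x. if x \<in> D j then 0 else f (u j x))"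
  have sum_eq: "(\<Sum>s'\<leftarrow>map s [0..<N]. f (s' \<otimes> inv t \<otimes> inv s' \<otimes> x)) = h1 x + (\<Sum>j<N. h2 j x)" for x
    by (simp add: interv_sum_list_conv_sum_set_nat h1_def h2_def sum.distrib[symmetric] u_def
        comp_def atLeast0LessThan cong: if_cong) (intro sum.cong, auto)
  have sq: "(\<Sum>x\<in>Y. (cmod (f x))\<^sup>2) \<le> (l2norm cA f)\<^sup>2" if "finite Y" "Y \<subseteq> carrier G" for Y
  proof -
    have "(L2_set (\<lambda>x. cmod (f x)) Y)\<^sup>2 \<le> (l2norm cA f)\<^sup>2"
      using L2_set_le_l2norm[OF f that] by (intro power_mono) auto
    then show ?thesis by (simp add: L2_set_def sum_nonneg)
  qed
  \<comment> \<open>At each point at most one summand of \<open>h1\<close> survives, as the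
    \<open>D j\<close> are disjoint, so its square is bounded by the sum of the squares.\<close>
  have "(\<Sum>x\<in>X. (cmod (h1 x))\<^sup>2) \<le> (\<Sum>x\<in>X. \<Sum>j<N. (cmod (f (u j x)))\<^sup>2)"
  proof (rule sum_mono)
    fix x
    show "(cmod (h1 x))\<^sup>2 \<le> (\<Sum>j<N. (cmod (f (u j x)))\<^sup>2)"
    proof (cases "\<exists>i<N. x \<in> D i")
      case True
      then obtain i where i: "i < N" "x \<in> D i" by blast
      have "h1 x = (\<Sum>j<N. if j = i then f (u i x) else 0)"
        unfolding h1_def using Dd i by (intro sum.cong refl) auto
      then have "h1 x = f (u i x)" using i by simp
      then show ?thesis using i member_le_sum[of i "{..<N}" "\<lambda>j. (cmod (f (u j x)))\<^sup>2"] by simp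
    next
      case False
      then have "h1 x = 0" unfolding h1_def by (intro sum.neutral) auto
      then show ?thesis by (simp add: sum_nonneg)
    qed
  qed
  also have "\<dots> = (\<Sum>j<N. \<Sum>x\<in>X. (cmod (f (u j x)))\<^sup>2)" by (rule sum.swap)
  also have "\<dots> \<le> (\<Sum>j<N. (l2norm cA f)\<^sup>2)"
  proof (rule sum_mono)
    fix j assume "j \<in> {..<N}"
    then have j: "j < N" by simp
    have "(\<Sum>x\<in>X. (cmod (f (u j x)))\<^sup>2) = (\<Sum>z\<in>u j ` X. (cmod (f z))\<^sup>2)"
      by (simp add: sum.reindex[OF inj[OF j]])
    also have "\<dots> \<le> (l2norm cA f)\<^sup>2" using uc[OF j] X by (intro sq) auto
    finally show "(\<Sum>x\<in>X. (cmod (f (u j x)))\<^sup>2) \<le> (l2norm cA f)\<^sup>2" .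
  qed
  finally have "(\<Sum>x\<in>X. (cmod (h1 x))\<^sup>2) \<le> N * (l2norm cA f)\<^sup>2" by simp
  then have H1: "L2_set (\<lambda>x. cmod (h1 x)) X \<le> sqrt N * l2norm cA f"
    unfolding L2_set_def using real_sqrt_le_mono by (fastforce simp: real_sqrt_mult)
  \<comment> \<open>\<open>h2 j\<close> rearranges the values of \<open>f\<close> on
    \<open>Z j\<close>, and the \<open>Z j\<close> are disjoint, so the squared norms add up to at
    most that of \<open>f\<close>. Cauchy--Schwarz over the \<open>N\<close> indices then costs a
    factor \<open>sqrt N\<close>.\<close>
  define Z where "Z = (\<lambda>j. u j ` {x \<in> X. x \<notin> D j})"
  have Zc: "Z j \<subseteq> carrier G" "finite (Z j)" "Z j \<subseteq> D j" if "j < N" for j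
    using uc[OF that] move[OF that] X by (auto simp: Z_def)
  have h2Z: "L2_set (\<lambda>x. cmod (h2 j x)) X = sqrt (\<Sum>z\<in>Z j. (cmod (f z))\<^sup>2)" if j: "j < N" for j
  proof -
    have "(\<Sum>x\<in>X. (cmod (h2 j x))\<^sup>2) = (\<Sum>x\<in>{x \<in> X. x \<notin> D j}. (cmod (f (u j x)))\<^sup>2)"
      using X by (intro sum.mono_neutral_cong_right) (auto simp: h2_def)
    also have "\<dots> = (\<Sum>z\<in>Z j. (cmod (f z))\<^sup>2)"
      unfolding Z_def using inj_on_subset[OF inj[OF j], of "{x \<in> X. x \<notin> D j}"] by (subst sum.reindex) auto
    finally show ?thesis by (simp add: L2_set_def)
  qed
  have "L2_set (\<lambda>x. cmod (\<Sum>j<N. h2 j x)) X \<le> (\<Sum>j<N. L2_set (\<lambda>x. cmod (h2 j x)) X)"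
    by (rule L2_set_sum_le) simp
  also have "\<dots> = (\<Sum>j<N. \<bar>1\<bar> * \<bar>sqrt (\<Sum>z\<in>Z j. (cmod (f z))\<^sup>2)\<bar>)"
    using h2Z by (intro sum.cong refl) (simp add: sum_nonneg)
  also have "\<dots> \<le> L2_set (\<lambda>_. 1) {..<N} * L2_set (\<lambda>j. sqrt (\<Sum>z\<in>Z j. (cmod (f z))\<^sup>2)) {..<N}"
    by (rule L2_set_mult_ineq)
  also have "L2_set (\<lambda>_. 1) {..<N} = sqrt N" by (simp add: L2_set_def)
  also have "L2_set (\<lambda>j. sqrt (\<Sum>z\<in>Z j. (cmod (f z))\<^sup>2)) {..<N} = sqrt (\<Sum>j<N. \<Sum>z\<in>Z j. (cmod (f z))\<^sup>2)"
    by (simp add: L2_set_def sum_nonneg)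
  also have "(\<Sum>j<N. \<Sum>z\<in>Z j. (cmod (f z))\<^sup>2) = (\<Sum>z\<in>(\<Union>j<N. Z j). (cmod (f z))\<^sup>2)"
  proof (rule sum.UNION_disjoint[symmetric])
    show "\<forall>i\<in>{..<N}. \<forall>j\<in>{..<N}. i \<noteq> j \<longrightarrow> Z i \<inter> Z j = {}" using Zc(3) Dd by blast
  qed (use Zc in auto)
  also have "sqrt N * sqrt (\<Sum>z\<in>(\<Union>j<N. Z j). (cmod (f z))\<^sup>2) \<le> sqrt N * sqrt ((l2norm cA f)\<^sup>2)"
  proof (intro mult_left_mono real_sqrt_le_mono sq)
    show "finite (\<Union>j<N. Z j)" "(\<Union>j<N. Z j) \<subseteq> carrier G" using Zc(1,2) by auto
  qed simp
  finally have H2: "L2_set (\<lambda>x. cmod (\<Sum>j<N. h2 j x)) X \<le> sqrt N * l2norm cA f" by simp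
  have "L2_set (\<lambda>x. cmod (h1 x + (\<Sum>j<N. h2 j x))) X \<le> L2_set (\<lambda>x. cmod (h1 x) + cmod (\<Sum>j<N. h2 j x)) X"
    by (intro L2_set_mono) (auto intro: norm_triangle_ineq)
  also have "\<dots> \<le> L2_set (\<lambda>x. cmod (h1 x)) X + L2_set (\<lambda>x. cmod (\<Sum>j<N. h2 j x)) X"
    by (rule L2_set_triangle_ineq)
  also have "\<dots> \<le> 2 * sqrt N * l2norm cA f" using H1 H2 by linarith
  also have "\<dots> = 2 / sqrt N * length (map s [0..<N]) * l2norm cA f"
    using N by (simp add: field_simps)
  finally show "L2_set (\<lambda>x. cmod (\<Sum>s'\<leftarrow>map s [0..<N]. f (s' \<otimes> inv t \<otimes> inv s' \<otimes> x))) X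
      \<le> 2 / sqrt N * length (map s [0..<N]) * l2norm cA f"
    unfolding sum_eq .
qed (use t in auto)

text \<open>For \<open>s\<close> in \<open>K\<close> write \<open>s t s\<^sup>-\<^sup>1 = t \<alpha>(s) s\<^sup>-\<^sup>1\<close> with \<open>\<alpha>(s) = t\<^sup>-\<^sup>1 s t\<close> commuting with \<open>K\<close>.
  Taking norms along the right cosets of \<open>K\<close> leaves the free action of \<open>K\<close> on them through \<open>\<alpha>\<close>. The union
  over \<open>t\<close> of these actions is used to find one list that works for all \<open>t\<close> at once.\<close>

lemma nonamenable_estimate:
  fixes e :: real
  assumes K: "subgroup K G" and na: "\<not> amenable (G\<lparr>carrier := K\<rparr>)" and U: "U \<subseteq> carrier G"
    and comm: "\<And>t s k. t \<in> U \<Longrightarrow> s \<in> K \<Longrightarrow> k \<in> K \<Longrightarrow> (inv t \<otimes> s \<otimes> t) \<otimes> k = k \<otimes> (inv t \<otimes> s \<otimes> t)"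
    and free: "\<And>t s. t \<in> U \<Longrightarrow> s \<in> K \<Longrightarrow> inv t \<otimes> s \<otimes> t \<in> K \<Longrightarrow> s = \<one>"
    and e: "0 < e"
  shows "\<exists>S. S \<noteq> [] \<and> set S \<subseteq> K \<and> (\<forall>t\<in>U. small e S t)"
proof -
  let ?K = "G\<lparr>carrier := K\<rparr>"
  interpret K: group ?K using K by (rule subgroup.subgroup_is_group) (rule group_axioms)
  have Kc: "s \<in> carrier G" if "s \<in> K" for s using subgroup.subset[OF K] that by blast
  have Uc: "t \<in> carrier G" if "t \<in> U" for t using U that by blast
  have invK: "inv\<^bsub>?K\<^esub> s = inv s" if "s \<in> K" for s using m_inv_consistent[OF K that] .
  define \<alpha> where "\<alpha> = (\<lambda>t s. inv t \<otimes> s \<otimes> t)"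
  have \<alpha>c: "\<alpha> t s \<in> carrier G" if "t \<in> U" "s \<in> K" for t s using Uc Kc that by (simp add: \<alpha>_def)
  have \<alpha>m: "\<alpha> t (s \<otimes> s') = \<alpha> t s \<otimes> \<alpha> t s'" if "t \<in> U" "s \<in> K" "s' \<in> K" for t s s'
  proof -
    have "\<alpha> t s \<otimes> \<alpha> t s' = inv t \<otimes> (s \<otimes> ((t \<otimes> inv t) \<otimes> (s' \<otimes> t)))"
      unfolding \<alpha>_def using Uc Kc that by (simp only: m_assoc m_closed inv_closed)
    then show ?thesis using Uc Kc that by (simp add: \<alpha>_def m_assoc)
  qed
  have \<alpha>i: "\<alpha> t (inv s) = inv (\<alpha> t s)" if "t \<in> U" "s \<in> K" for t s
    using Uc Kc that by (simp add: \<alpha>_def inv_mult_group m_assoc)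
  define co where "co = (\<lambda>x. (\<lambda>k. k \<otimes> x) ` K)"
  define Y where "Y = U \<times> co ` carrier G"
  \<comment> \<open>Left multiplication by \<open>\<alpha> t s\<close> takes right cosets of
    \<open>K\<close> to right cosets because it commutes with \<open>K\<close>. The first component
    keeps the actions for different \<open>t\<close> apart.\<close>
  define act where "act = (\<lambda>s (t, y). (t, (\<lambda>z. \<alpha> t s \<otimes> z) ` y))"
  have act_co: "act s (t, co x) = (t, co (\<alpha> t s \<otimes> x))" if "s \<in> K" "t \<in> U" "x \<in> carrier G" for s t x
  proof -
    have "\<alpha> t s \<otimes> (k \<otimes> x) = k \<otimes> (\<alpha> t s \<otimes> x)" if k: "k \<in> K" for k
    proof -
      have "\<alpha> t s \<otimes> (k \<otimes> x) = (\<alpha> t s \<otimes> k) \<otimes> x"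
        using \<alpha>c Kc k \<open>s \<in> K\<close> \<open>t \<in> U\<close> \<open>x \<in> carrier G\<close> by (simp add: m_assoc)
      also have "\<alpha> t s \<otimes> k = k \<otimes> \<alpha> t s" unfolding \<alpha>_def using comm \<open>s \<in> K\<close> \<open>t \<in> U\<close> k by blast
      finally show ?thesis using \<alpha>c Kc k \<open>s \<in> K\<close> \<open>t \<in> U\<close> \<open>x \<in> carrier G\<close> by (simp add: m_assoc)
    qed
    then show ?thesis by (simp add: act_def co_def image_image)
  qed
  have co_self: "x \<in> co x" if "x \<in> carrier G" for x
    unfolding co_def using that subgroup.one_closed[OF K] by (intro image_eqI[of _ _ \<one>]) auto
  have co_mult: "co (k \<otimes> x) = co x" if "k \<in> K" "x \<in> carrier G" for k x
  proof
    show "co (k \<otimes> x) \<subseteq> co x"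
      unfolding co_def using that Kc subgroup.m_closed[OF K] by (auto simp: m_assoc[symmetric])
    show "co x \<subseteq> co (k \<otimes> x)"
    proof
      fix z assume "z \<in> co x"
      then obtain l where l: "l \<in> K" "z = l \<otimes> x" by (auto simp: co_def)
      have "l \<otimes> x = (l \<otimes> inv k) \<otimes> (k \<otimes> x)"
      proof -
        have "(l \<otimes> inv k) \<otimes> (k \<otimes> x) = l \<otimes> ((inv k \<otimes> k) \<otimes> x)"
          using Kc that l by (simp only: m_assoc m_closed inv_closed)
        then show ?thesis using Kc that l by simp
      qed
      moreover have "l \<otimes> inv k \<in> K" using that l subgroup.m_closed[OF K] subgroup.m_inv_closed[OF K] by blast
      ultimately show "z \<in> co (k \<otimes> x)" using l by (auto simp: co_def)
    qed
  qed
  interpret F: free_action ?K act Y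
  proof (unfold_locales)
    fix s y assume s: "s \<in> carrier ?K" and y: "y \<in> Y"
    then obtain t x where tx: "t \<in> U" "x \<in> carrier G" "y = (t, co x)" by (auto simp: Y_def)
    show "act s y \<in> Y" using s tx act_co \<alpha>c by (auto simp: Y_def)
    show "s = \<one>\<^bsub>?K\<^esub>" if "act s y = y"
    proof -
      have sK: "s \<in> K" using s by simp
      have "co (\<alpha> t s \<otimes> x) = co x" using that act_co[OF sK tx(1,2)] tx by simp
      then have "\<alpha> t s \<otimes> x \<in> co x" using co_self[of "\<alpha> t s \<otimes> x"] \<alpha>c[OF tx(1) sK] tx by simp
      then obtain k where k: "k \<in> K" "\<alpha> t s \<otimes> x = k \<otimes> x" by (auto simp: co_def)
      then have "\<alpha> t s = k" using \<alpha>c[OF tx(1) sK] Kc tx by simp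
      then show ?thesis using free tx(1) sK k(1) by (simp add: \<alpha>_def)
    qed
  next
    fix y assume "y \<in> Y"
    then obtain t x where tx: "t \<in> U" "x \<in> carrier G" "y = (t, co x)" by (auto simp: Y_def)
    have "\<alpha> t \<one> = \<one>" using Uc[OF tx(1)] by (simp add: \<alpha>_def)
    then show "act \<one>\<^bsub>?K\<^esub> y = y" using tx act_co[of \<one> t x] subgroup.one_closed[OF K] by simp
  next
    fix s s' y assume s: "s \<in> carrier ?K" "s' \<in> carrier ?K" and y: "y \<in> Y"
    then obtain t x where tx: "t \<in> U" "x \<in> carrier G" "y = (t, co x)" by (auto simp: Y_def)
    show "act (s \<otimes>\<^bsub>?K\<^esub> s') y = act s (act s' y)"
      using s tx act_co \<alpha>c \<alpha>m subgroup.m_closed[OF K] by (simp add: m_assoc)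
  qed
  have lc: "g <#\<^bsub>?K\<^esub> A = (\<lambda>x. g \<otimes> x) ` A" for g A by (auto simp: l_coset_def)
  have na': "\<nexists>m :: 'a set \<Rightarrow> real. (\<forall>A. 0 \<le> m A) \<and> m (carrier ?K) = 1 \<and>
      (\<forall>A B. A \<inter> B = {} \<longrightarrow> m (A \<union> B) = m A + m B) \<and>
      (\<forall>s\<in>carrier ?K. \<forall>A\<subseteq>carrier ?K. m ((\<lambda>x. s \<otimes>\<^bsub>?K\<^esub> x) ` A) = m A)"
  proof
    assume "\<exists>m :: 'a set \<Rightarrow> real. (\<forall>A. 0 \<le> m A) \<and> m (carrier ?K) = 1 \<and>
      (\<forall>A B. A \<inter> B = {} \<longrightarrow> m (A \<union> B) = m A + m B) \<and>
      (\<forall>s\<in>carrier ?K. \<forall>A\<subseteq>carrier ?K. m ((\<lambda>x. s \<otimes>\<^bsub>?K\<^esub> x) ` A) = m A)"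
    then obtain m :: "'a set \<Rightarrow> real" where m: "\<forall>A. 0 \<le> m A" "m (carrier ?K) = 1"
      "\<forall>A B. A \<inter> B = {} \<longrightarrow> m (A \<union> B) = m A + m B"
      "\<forall>s\<in>carrier ?K. \<forall>A\<subseteq>carrier ?K. m ((\<lambda>x. s \<otimes>\<^bsub>?K\<^esub> x) ` A) = m A" by blast
    have "amenable ?K" unfolding amenable_def lc using m by (intro exI[of _ m]) simp
    then show False using na by simp
  qed
  obtain S c where S: "S \<noteq> []" "set S \<subseteq> carrier ?K" "0 \<le> c" "c < e" "F.contracts S c"
    using F.arbitrarily_contracting[OF na' e] by blast
  have SK: "s \<in> K" if "s \<in> set S" for s using S(2) that by auto
  have "small e S t" if t: "t \<in> U" for t
  proof (rule smallI)
    have tc: "t \<in> carrier G" using Uc[OF t] .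
    show "0 \<le> e" "set S \<subseteq> carrier G" "t \<in> carrier G" using e SK Kc tc by auto
    fix f X assume f: "f \<in> l2 cA" and X: "finite X" "X \<subseteq> carrier G"
    define b where "b = (\<lambda>s x. s \<otimes> inv (\<alpha> t s) \<otimes> x)"
    define X' where "X' = (\<lambda>x. inv t \<otimes> x) ` X"
    have X': "finite X'" "X' \<subseteq> carrier G" using X tc by (auto simp: X'_def)
    define Z where "Z = (\<Union>s\<in>set S. b s ` X')"
    have bc: "b s x \<in> carrier G" if "s \<in> set S" "x \<in> carrier G" for s x
      using that SK Kc \<alpha>c[OF t] by (simp add: b_def)
    have Z: "finite Z" "Z \<subseteq> carrier G" using X' bc by (auto simp: Z_def)
    \<comment> \<open>The norm of \<open>f\<close> on each coset, cut down to the finite set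
      \<open>Z\<close> of the points at which \<open>f\<close> gets evaluated.\<close>
    define \<eta> where "\<eta> = (\<lambda>y. L2_set (\<lambda>z. cmod (f z)) {z \<in> Z. (t, co z) = y})"
    define Q where "Q = (\<lambda>z. (t, co z)) ` Z"
    define P where "P = (\<lambda>z. (t, co z)) ` X'"
    have Q: "finite Q" "Q \<subseteq> Y" and P: "finite P" "P \<subseteq> Y"
      using Z X' t by (auto simp: Q_def P_def Y_def)
    have \<eta>0: "\<forall>y\<in>Y - Q. \<eta> y = 0"
    proof
      fix y assume "y \<in> Y - Q"
      then have "{z \<in> Z. (t, co z) = y} = {}" by (auto simp: Q_def)
      then show "\<eta> y = 0" unfolding \<eta>_def by (simp only: L2_set_empty)
    qed
    have bX: "s \<otimes> inv t \<otimes> inv s \<otimes> x = b s (inv t \<otimes> x)" if "s \<in> set S" "x \<in> carrier G" for s x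
    proof -
      have "t \<otimes> (inv t \<otimes> x) = x" using that tc by (simp add: m_assoc[symmetric])
      then show ?thesis
        unfolding b_def \<alpha>_def using that Kc[OF SK[OF that(1)]] tc by (simp add: inv_mult_group m_assoc)
    qed
    have "L2_set (\<lambda>x. cmod (\<Sum>s\<leftarrow>S. f (s \<otimes> inv t \<otimes> inv s \<otimes> x))) X = L2_set (\<lambda>x. cmod (\<Sum>s\<leftarrow>S. f (b s (inv t \<otimes> x)))) X"
    proof (rule L2_set_cmod_cong)
      fix x assume "x \<in> X"
      then have "map (\<lambda>s. f (s \<otimes> inv t \<otimes> inv s \<otimes> x)) S = map (\<lambda>s. f (b s (inv t \<otimes> x))) S"
        using bX X by (intro map_cong refl) auto
      then show "(\<Sum>s\<leftarrow>S. f (s \<otimes> inv t \<otimes> inv s \<otimes> x)) = (\<Sum>s\<leftarrow>S. f (b s (inv t \<otimes> x)))" by (simp only:)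
    qed
    also have "\<dots> = L2_set (\<lambda>x. cmod (\<Sum>s\<leftarrow>S. f (b s x))) X'"
    proof -
      have "inj_on (\<lambda>x. inv t \<otimes> x) X" using X tc by (auto simp: inj_on_def subset_iff)
      then show ?thesis unfolding X'_def L2_set_def by (simp add: sum.reindex)
    qed
    finally have 1: "L2_set (\<lambda>x. cmod (\<Sum>s\<leftarrow>S. f (s \<otimes> inv t \<otimes> inv s \<otimes> x))) X = L2_set (\<lambda>x. cmod (\<Sum>s\<leftarrow>S. f (b s x))) X'" .
    \<comment> \<open>The factor \<open>s\<close> in \<open>b s\<close> moves points only inside a
      right coset of \<open>K\<close>, so for the norms along cosets just the action by the inverse
      of \<open>\<alpha> t s\<close> is left.\<close>
    have fibre: "(\<Sum>x\<in>{x \<in> X'. (t, co x) = y}. (cmod (\<Sum>s\<leftarrow>S. f (b s x)))\<^sup>2) \<le> (\<Sum>s\<leftarrow>S. \<eta> (act (inv\<^bsub>?K\<^esub> s) y))\<^sup>2"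
      if y: "y \<in> P" for y
    proof -
      let ?X = "{x \<in> X'. (t, co x) = y}"
      have "L2_set (\<lambda>x. cmod (f (b s x))) ?X \<le> \<eta> (act (inv\<^bsub>?K\<^esub> s) y)" if s: "s \<in> set S" for s
      proof -
        have sK: "s \<in> K" "s \<in> carrier G" using s SK Kc by auto
        have inj: "inj_on (b s) ?X" using sK X' \<alpha>c[OF t sK(1)] by (auto simp: b_def inj_on_def subset_iff)
        have "L2_set (\<lambda>x. cmod (f (b s x))) ?X = L2_set (\<lambda>z. cmod (f z)) (b s ` ?X)"
          unfolding L2_set_def by (simp add: sum.reindex[OF inj])
        also have "\<dots> \<le> L2_set (\<lambda>z. cmod (f z)) {z \<in> Z. (t, co z) = act (inv\<^bsub>?K\<^esub> s) y}"
          unfolding L2_set_def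
        proof (intro real_sqrt_le_mono sum_mono2)
          show "b s ` ?X \<subseteq> {z \<in> Z. (t, co z) = act (inv\<^bsub>?K\<^esub> s) y}"
          proof
            fix z assume "z \<in> b s ` ?X"
            then obtain x where x: "x \<in> X'" "(t, co x) = y" "z = b s x" by blast
            have xc: "x \<in> carrier G" using x X' by blast
            have "act (inv s) (t, co x) = (t, co (inv (\<alpha> t s) \<otimes> x))"
              using act_co[OF subgroup.m_inv_closed[OF K sK(1)] t xc] \<alpha>i[OF t sK(1)] by simp
            also have "co (inv (\<alpha> t s) \<otimes> x) = co z"
              using co_mult[OF sK(1), of "inv (\<alpha> t s) \<otimes> x"] \<alpha>c[OF t sK(1)] xc sK x(3) by (simp add: b_def m_assoc)
            finally show "z \<in> {z \<in> Z. (t, co z) = act (inv\<^bsub>?K\<^esub> s) y}"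
              using x s invK[OF sK(1)] by (auto simp: Z_def)
          qed
        qed (use Z in auto)
        finally show ?thesis by (simp add: \<eta>_def)
      qed
      then have "(\<Sum>s\<leftarrow>S. L2_set (\<lambda>x. cmod (f (b s x))) ?X) \<le> (\<Sum>s\<leftarrow>S. \<eta> (act (inv\<^bsub>?K\<^esub> s) y))"
        by (rule sum_list_mono)
      then have "L2_set (\<lambda>x. cmod (\<Sum>s\<leftarrow>S. f (b s x))) ?X \<le> (\<Sum>s\<leftarrow>S. \<eta> (act (inv\<^bsub>?K\<^esub> s) y))"
        using L2_set_sum_list_le[where S = S and h = "\<lambda>s x. f (b s x)" and X = ?X] by linarith
      then have "(L2_set (\<lambda>x. cmod (\<Sum>s\<leftarrow>S. f (b s x))) ?X)\<^sup>2 \<le> (\<Sum>s\<leftarrow>S. \<eta> (act (inv\<^bsub>?K\<^esub> s) y))\<^sup>2"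
        by (intro power_mono) auto
      then show ?thesis by (simp add: L2_set_def sum_nonneg)
    qed
    have "(\<Sum>x\<in>X'. (cmod (\<Sum>s\<leftarrow>S. f (b s x)))\<^sup>2) = (\<Sum>y\<in>P. \<Sum>x\<in>{x \<in> X'. (t, co x) = y}. (cmod (\<Sum>s\<leftarrow>S. f (b s x)))\<^sup>2)"
      by (rule sum.group[symmetric]) (use X' P in \<open>auto simp: P_def\<close>)
    also have "\<dots> \<le> (\<Sum>y\<in>P. (\<Sum>s\<leftarrow>S. \<eta> (act (inv\<^bsub>?K\<^esub> s) y))\<^sup>2)" using fibre by (rule sum_mono)
    also have "\<dots> \<le> (c * length S)\<^sup>2 * (\<Sum>y\<in>Q. (\<eta> y)\<^sup>2)"
      using S(5) Q P \<eta>0 unfolding F.contracts_def by blast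
    also have "(\<Sum>y\<in>Q. (\<eta> y)\<^sup>2) = (\<Sum>y\<in>Q. \<Sum>z\<in>{z \<in> Z. (t, co z) = y}. (cmod (f z))\<^sup>2)"
      unfolding \<eta>_def L2_set_def by (simp add: sum_nonneg)
    also have "\<dots> = (\<Sum>z\<in>Z. (cmod (f z))\<^sup>2)" by (rule sum.group) (use Z Q in \<open>auto simp: Q_def\<close>)
    also have "\<dots> = (L2_set (\<lambda>z. cmod (f z)) Z)\<^sup>2" by (simp add: L2_set_def sum_nonneg)
    also have "(c * length S)\<^sup>2 * (L2_set (\<lambda>z. cmod (f z)) Z)\<^sup>2 \<le> (e * length S)\<^sup>2 * (l2norm cA f)\<^sup>2"
      using L2_set_le_l2norm[OF f Z] S(3,4) by (intro mult_mono power_mono mult_right_mono) auto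
    finally have "(\<Sum>x\<in>X'. (cmod (\<Sum>s\<leftarrow>S. f (b s x)))\<^sup>2) \<le> (e * length S * l2norm cA f)\<^sup>2"
      by (simp add: power_mult_distrib)
    then have "L2_set (\<lambda>x. cmod (\<Sum>s\<leftarrow>S. f (b s x))) X' \<le> e * length S * l2norm cA f"
      unfolding L2_set_def using e by (intro real_le_lsqrt) auto
    then show "L2_set (\<lambda>x. cmod (\<Sum>s\<leftarrow>S. f (s \<otimes> inv t \<otimes> inv s \<otimes> x))) X \<le> e * length S * l2norm cA f"
      using 1 by simp
  qed
  then show ?thesis using S(1) SK by (intro exI[of _ S]) auto
qed

section \<open>Iterated averaging\<close>

definition list_mult :: "'a list \<Rightarrow> 'a list \<Rightarrow> 'a list" where
  "list_mult S' S = concat (map (\<lambda>s'. map (\<lambda>s. s' \<otimes> s) S) S')"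

lemma list_mult_set: "set (list_mult S' S) = (\<Union>s'\<in>set S'. \<Union>s\<in>set S. {s' \<otimes> s})"
  by (auto simp: list_mult_def)

lemma list_mult_length: "length (list_mult S' S) = length S' * length S"
  unfolding list_mult_def by (induction S') auto

lemma list_mult_ne: "S' \<noteq> [] \<Longrightarrow> S \<noteq> [] \<Longrightarrow> list_mult S' S \<noteq> []"
  by (cases S') (auto simp: list_mult_def)

lemma conj_sum_list_mult:
  assumes S: "set S \<subseteq> carrier G" and S': "set S' \<subseteq> carrier G" and t: "t \<in> carrier G" and f: "f \<in> l2 cA"
  shows "conj_sum (list_mult S' S) t f x = (\<Sum>s'\<leftarrow>S'. \<Sum>s\<leftarrow>S. lreg G (s' \<otimes> (s \<otimes> t \<otimes> inv s) \<otimes> inv s') f x)"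
  using S'
proof (induction S')
  case Nil
  then show ?case by (simp add: conj_sum_def list_mult_def)
next
  case (Cons a S')
  have "map (\<lambda>s. lreg G ((a \<otimes> s) \<otimes> t \<otimes> inv (a \<otimes> s)) f x) S = map (\<lambda>s. lreg G (a \<otimes> (s \<otimes> t \<otimes> inv s) \<otimes> inv a) f x) S"
  proof (rule map_cong[OF refl])
    fix s assume "s \<in> set S"
    then have "s \<in> carrier G" "a \<in> carrier G" using S Cons.prems by auto
    then have "(a \<otimes> s) \<otimes> t \<otimes> inv (a \<otimes> s) = a \<otimes> (s \<otimes> t \<otimes> inv s) \<otimes> inv a"
      using t by (simp add: inv_mult_group m_assoc)
    then show "lreg G ((a \<otimes> s) \<otimes> t \<otimes> inv (a \<otimes> s)) f x = lreg G (a \<otimes> (s \<otimes> t \<otimes> inv s) \<otimes> inv a) f x" by simp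
  qed
  moreover have "conj_sum (list_mult (a # S') S) t f x =
      (\<Sum>s\<leftarrow>S. lreg G ((a \<otimes> s) \<otimes> t \<otimes> inv (a \<otimes> s)) f x) + conj_sum (list_mult S' S) t f x"
    by (simp add: conj_sum_def list_mult_def comp_def)
  ultimately show ?case using Cons by (simp only: list.map sum_list.Cons set_simps insert_subset)
qed

text \<open>Conjugations applied after the average over \<open>S\<close> do not increase norms, so
  smallness for the inner list survives any outer list.\<close>

lemma small_list_mult:
  fixes e :: real
  assumes e: "0 \<le> e" and S: "set S \<subseteq> carrier G" and S': "set S' \<subseteq> carrier G" and t: "t \<in> carrier G" and sm: "small e S t"
  shows "small e (list_mult S' S) t"
  unfolding small_def
proof (intro ballI)
  fix f assume f: "f \<in> l2 cA"
  have c: "s \<in> carrier G" if "s \<in> set S'" for s using that S' by blast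
  have gen: "inv (a \<otimes> u \<otimes> inv a) \<otimes> x = a \<otimes> (inv u \<otimes> (inv a \<otimes> x))"
    if "a \<in> carrier G" "u \<in> carrier G" "x \<in> carrier G" for a u x
    using that by (simp add: inv_mult_group m_assoc)
  have fs: "lreg G (inv s) f \<in> l2 cA" if "s \<in> set S'" for s using lreg_in(1)[OF inv_closed[OF c[OF that]] f] .
  have C: "conj_sum S t (lreg G (inv s) f) \<in> l2 cA" if "s \<in> set S'" for s
    by (rule conj_sum_l2[OF S t fs[OF that]])
  have "(\<Sum>s\<leftarrow>S. lreg G (s' \<otimes> (s \<otimes> t \<otimes> inv s) \<otimes> inv s') f x) = lreg G s' (conj_sum S t (lreg G (inv s') f)) x"
    if s': "s' \<in> set S'" for s' x
  proof (cases "x \<in> carrier G")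
    case True
    have "map (\<lambda>s. lreg G (s' \<otimes> (s \<otimes> t \<otimes> inv s) \<otimes> inv s') f x) S =
        map (\<lambda>s. lreg G (s \<otimes> t \<otimes> inv s) (lreg G (inv s') f) (inv s' \<otimes> x)) S"
    proof (rule map_cong[OF refl])
      fix s assume "s \<in> set S"
      then have s: "s \<in> carrier G" using S by blast
      let ?u = "s \<otimes> t \<otimes> inv s"
      have u: "?u \<in> carrier G" using s t by simp
      have "lreg G ?u (lreg G (inv s') f) (inv s' \<otimes> x) = f (s' \<otimes> (inv ?u \<otimes> (inv s' \<otimes> x)))"
        using u True c[OF s'] lreg_apply[OF fs[OF s'], of "inv s' \<otimes> x" ?u]
          lreg_apply[OF f, of "inv ?u \<otimes> (inv s' \<otimes> x)" "inv s'"] by simp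
      also have "\<dots> = lreg G (s' \<otimes> ?u \<otimes> inv s') f x"
        using gen[OF c[OF s'] u True] lreg_apply[OF f True, of "s' \<otimes> ?u \<otimes> inv s'"] by simp
      finally show "lreg G (s' \<otimes> ?u \<otimes> inv s') f x = lreg G ?u (lreg G (inv s') f) (inv s' \<otimes> x)" by simp
    qed
    then have "(\<Sum>s\<leftarrow>S. lreg G (s' \<otimes> (s \<otimes> t \<otimes> inv s) \<otimes> inv s') f x) = conj_sum S t (lreg G (inv s') f) (inv s' \<otimes> x)"
      by (simp only: conj_sum_def)
    then show ?thesis using lreg_apply[OF C[OF s'] True, of s'] by simp
  next
    case False
    then have "lreg G h k x = 0" for h k by (simp add: lreg_def)
    then show ?thesis by simp
  qed
  then have "map (\<lambda>s'. \<Sum>s\<leftarrow>S. lreg G (s' \<otimes> (s \<otimes> t \<otimes> inv s) \<otimes> inv s') f x) S' =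
      map (\<lambda>s'. lreg G s' (conj_sum S t (lreg G (inv s') f)) x) S'" for x by simp
  then have eq: "conj_sum (list_mult S' S) t f = (\<lambda>x. \<Sum>s'\<leftarrow>S'. lreg G s' (conj_sum S t (lreg G (inv s') f)) x)"
    by (simp only: conj_sum_list_mult[OF S S' t f] fun_eq_iff) simp
  have *: "lreg G s (conj_sum S t (lreg G (inv s) f)) \<in> l2 cA" if "s \<in> set S'" for s
    by (rule lreg_in(1)[OF c C]) (use that in auto)
  have "l2norm cA (lreg G s (conj_sum S t (lreg G (inv s) f))) \<le> e * length S * l2norm cA f" if s: "s \<in> set S'" for s
  proof -
    have "l2norm cA (lreg G s (conj_sum S t (lreg G (inv s) f))) \<le> l2norm cA (conj_sum S t (lreg G (inv s) f))"
      by (rule lreg_in(2)[OF c[OF s] C[OF s]])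
    also have "\<dots> \<le> e * length S * l2norm cA (lreg G (inv s) f)" using sm fs[OF s] by (simp add: small_def)
    also have "\<dots> \<le> e * length S * l2norm cA f"
      using e lreg_in(2)[OF inv_closed[OF c[OF s]] f] by (intro mult_left_mono) auto
    finally show ?thesis .
  qed
  then have "(\<Sum>s\<leftarrow>S'. l2norm cA (lreg G s (conj_sum S t (lreg G (inv s) f)))) \<le> e * length S * l2norm cA f * length S'"
    by (rule sum_list_le_const)
  then have "l2norm cA (\<lambda>x. \<Sum>s'\<leftarrow>S'. lreg G s' (conj_sum S t (lreg G (inv s') f)) x) \<le> e * length S * l2norm cA f * length S'"
    using l2_sum_list[of S' "\<lambda>s. lreg G s (conj_sum S t (lreg G (inv s) f))" cA, OF *] by linarith
  then show "l2norm cA (conj_sum (list_mult S' S) t f) \<le> e * length (list_mult S' S) * l2norm cA f"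
    unfolding eq list_mult_length by (simp add: mult_ac)
qed

text \<open>If all of \<open>S\<close> conjugates \<open>t\<close> to the same \<open>t'\<close>,
  the inner average changes nothing further and the outer list decides. Together with
  \<open>small_list_mult\<close> this lets one product list serve both kinds of elements.\<close>

lemma small_list_mult_const:
  assumes S: "set S \<subseteq> carrier G" and S': "set S' \<subseteq> carrier G" and t: "t \<in> carrier G" "t' \<in> carrier G"
    and const: "\<And>s. s \<in> set S \<Longrightarrow> s \<otimes> t \<otimes> inv s = t'" and sm: "small e S' t'"
  shows "small e (list_mult S' S) t"
  unfolding small_def
proof (intro ballI)
  fix f assume f: "f \<in> l2 cA"
  have "map (\<lambda>s. lreg G (s' \<otimes> (s \<otimes> t \<otimes> inv s) \<otimes> inv s') f x) S = map (\<lambda>s. lreg G (s' \<otimes> t' \<otimes> inv s') f x) S" for s' x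
    using const by simp
  then have "conj_sum (list_mult S' S) t f x = (\<Sum>s'\<leftarrow>S'. \<Sum>s\<leftarrow>S. lreg G (s' \<otimes> t' \<otimes> inv s') f x)" for x
    by (simp only: conj_sum_list_mult[OF S S' t(1) f])
  also have "(\<Sum>s'\<leftarrow>S'. \<Sum>s\<leftarrow>S. lreg G (s' \<otimes> t' \<otimes> inv s') f x) = of_nat (length S) * conj_sum S' t' f x" for x
    by (simp add: conj_sum_def sum_list_triv sum_list_const_mult)
  finally have eq: "conj_sum (list_mult S' S) t f = (\<lambda>x. of_nat (length S) * conj_sum S' t' f x)" by (rule ext)
  have "l2norm cA (conj_sum (list_mult S' S) t f) = length S * l2norm cA (conj_sum S' t' f)"
    unfolding eq using l2_scale[OF conj_sum_l2[OF S' t(2) f], of "of_nat (length S)"] by simp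
  also have "\<dots> \<le> length S * (e * length S' * l2norm cA f)"
    using sm f by (intro mult_left_mono) (auto simp: small_def)
  finally show "l2norm cA (conj_sum (list_mult S' S) t f) \<le> e * length (list_mult S' S) * l2norm cA f"
    by (simp add: list_mult_length mult_ac)
qed

lemma small_conj:
  assumes "set S \<subseteq> carrier G" "t \<in> carrier G" "q \<in> carrier G" "small e S (inv q \<otimes> t \<otimes> q)"
  shows "small e (map (\<lambda>s. s \<otimes> inv q) S) t"
proof -
  have m: "map (\<lambda>s. lreg G (s \<otimes> inv q \<otimes> t \<otimes> inv (s \<otimes> inv q)) f x) S =
      map (\<lambda>s. lreg G (s \<otimes> (inv q \<otimes> t \<otimes> q) \<otimes> inv s) f x) S" for f x
  proof (rule map_cong[OF refl])
    fix s assume "s \<in> set S"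
    then have "s \<in> carrier G" using assms by blast
    then have "s \<otimes> inv q \<otimes> t \<otimes> inv (s \<otimes> inv q) = s \<otimes> (inv q \<otimes> t \<otimes> q) \<otimes> inv s"
      using assms by (simp add: inv_mult_group m_assoc)
    then show "lreg G (s \<otimes> inv q \<otimes> t \<otimes> inv (s \<otimes> inv q)) f x = lreg G (s \<otimes> (inv q \<otimes> t \<otimes> q) \<otimes> inv s) f x" by simp
  qed
  have "conj_sum (map (\<lambda>s. s \<otimes> inv q) S) t = conj_sum S (inv q \<otimes> t \<otimes> q)"
    unfolding conj_sum_def map_map comp_def m ..
  then show ?thesis using assms(4) by (simp add: small_def)
qed

end

section \<open>The theorem\<close>

context plain_group begin

lemma small_mono: assumes "small d S t" "d \<le> e" shows "small e S t"
  unfolding small_def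
proof (intro ballI)
  fix f assume "f \<in> l2 cA"
  then have "l2norm cA (conj_sum S t f) \<le> d * length S * l2norm cA f" using assms(1) by (simp add: small_def)
  also have "\<dots> \<le> e * length S * l2norm cA f" using assms(2) by (intro mult_right_mono) auto
  finally show "l2norm cA (conj_sum S t f) \<le> e * length S * l2norm cA f" .
qed

lemma amenable_conj:
  assumes p: "p \<in> carrier G" and K: "K \<subseteq> carrier G" and M: "M \<subseteq> carrier G"
    and iff: "\<And>x. x \<in> carrier G \<Longrightarrow> x \<in> M \<longleftrightarrow> inv p \<otimes> x \<otimes> p \<in> K"
    and am: "amenable (G\<lparr>carrier := K\<rparr>)"
  shows "amenable (G\<lparr>carrier := M\<rparr>)"
proof -
  define c where "c = (\<lambda>x. inv p \<otimes> x \<otimes> p)"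
  have lc: "g <#\<^bsub>G\<lparr>carrier := X\<rparr>\<^esub> A = (\<lambda>x. g \<otimes> x) ` A" for X g A by (auto simp: l_coset_def)
  obtain \<mu> :: "'a set \<Rightarrow> real" where \<mu>: "\<mu> K = 1" "\<And>A. A \<subseteq> K \<Longrightarrow> 0 \<le> \<mu> A"
    "\<And>A B. A \<subseteq> K \<Longrightarrow> B \<subseteq> K \<Longrightarrow> A \<inter> B = {} \<Longrightarrow> \<mu> (A \<union> B) = \<mu> A + \<mu> B"
    "\<And>g A. g \<in> K \<Longrightarrow> A \<subseteq> K \<Longrightarrow> \<mu> ((\<lambda>x. g \<otimes> x) ` A) = \<mu> A"
    using am unfolding amenable_def lc by auto
  have cM: "c x \<in> K" if "x \<in> M" for x using that iff M by (auto simp: c_def)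
  have cp: "c (p \<otimes> k \<otimes> inv p) = k" if "k \<in> carrier G" for k
  proof -
    have "c (p \<otimes> k \<otimes> inv p) = inv p \<otimes> (p \<otimes> k)" using that p by (simp add: c_def m_assoc)
    then show ?thesis using that p by (simp add: m_assoc[symmetric])
  qed
  have inj: "inj_on c M"
  proof (rule inj_onI)
    fix x y assume "x \<in> M" "y \<in> M" "c x = c y"
    then show "x = y" using M p by (simp add: c_def subset_iff)
  qed
  have "c ` M = K"
  proof
    show "K \<subseteq> c ` M"
    proof
      fix k assume k: "k \<in> K"
      then have kc: "k \<in> carrier G" using K by blast
      then have "p \<otimes> k \<otimes> inv p \<in> M" using iff[of "p \<otimes> k \<otimes> inv p"] cp[OF kc] k p by (simp add: c_def)
      then show "k \<in> c ` M" using cp[OF kc] by (metis imageI)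
    qed
  qed (use cM in auto)
  have cm: "c (g \<otimes> x) = c g \<otimes> c x" if "g \<in> M" "x \<in> M" for g x
  proof -
    have gx: "g \<in> carrier G" "x \<in> carrier G" using that M by auto
    have "c g \<otimes> c x = inv p \<otimes> (g \<otimes> ((p \<otimes> inv p) \<otimes> (x \<otimes> p)))"
      unfolding c_def using gx p by (simp only: m_assoc m_closed inv_closed)
    then show ?thesis using gx p by (simp add: c_def m_assoc)
  qed
  show ?thesis
    unfolding amenable_def lc
  proof (intro exI[of _ "\<lambda>B. \<mu> (c ` B)"] conjI allI impI ballI)
    show "\<mu> (c ` carrier (G\<lparr>carrier := M\<rparr>)) = 1" using \<mu>(1) \<open>c ` M = K\<close> by simp
    show "0 \<le> \<mu> (c ` A)" if "A \<subseteq> carrier (G\<lparr>carrier := M\<rparr>)" for A using that cM by (intro \<mu>(2)) auto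
    show "\<mu> (c ` (A \<union> B)) = \<mu> (c ` A) + \<mu> (c ` B)"
      if "A \<subseteq> carrier (G\<lparr>carrier := M\<rparr>) \<and> B \<subseteq> carrier (G\<lparr>carrier := M\<rparr>) \<and> A \<inter> B = {}" for A B
    proof -
      have "c ` A \<inter> c ` B = {}" using that inj inj_on_image_Int[OF inj, of A B] by auto
      then show ?thesis using that cM unfolding image_Un by (intro \<mu>(3)) auto
    qed
    fix g A assume g: "g \<in> carrier (G\<lparr>carrier := M\<rparr>)" and A: "A \<subseteq> carrier (G\<lparr>carrier := M\<rparr>)"
    have "c ` (\<lambda>x. g \<otimes> x) ` A = (\<lambda>x. c g \<otimes> x) ` c ` A"
      unfolding image_image using cm g A by (intro image_cong refl) auto
    then show "\<mu> (c ` (\<lambda>x. g \<otimes> x) ` A) = \<mu> (c ` A)"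
      using \<mu>(4)[of "c g" "c ` A"] cM g A by (auto simp: image_subset_iff subset_iff)
  qed
qed

end

section \<open>The two implications for the HNN extension\<close>

context non_ascending_hnn begin

lemma plain_group_Gm: "plain_group Gm" by (rule plain_group.intro) (rule Gm.group_axioms)

text \<open>The quasi-kernel of type \<open>-d\<close> goes with the end in direction
  \<open>d\<close>: it fixes the complement of \<open>A (-d)\<close>, which contains neighbourhoods
  of that end. All the groups \<open>end_fix d n\<close> are conjugates of it and thus amenable,
  whereas simplicity makes one of them non-amenable.\<close>

lemma amenable_quasi_kernel_not_simple:
  assumes d: "d = 1 \<or> d = -1" and am: "amenable (Gm\<lparr>carrier := Fix (carrier Gm - A (-d))\<rparr>)"
    and nt: "Fix (carrier Gm - A (-d)) \<noteq> {\<one>\<^bsub>Gm\<^esub>}"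
  shows "\<not> Cstar_simple Gm"
proof
  assume simple: "Cstar_simple Gm"
  interpret P: plain_group Gm by (rule plain_group_Gm)
  let ?K = "Fix (carrier Gm - A (-d))"
  let ?L = "\<Union>n. end_fix d n"
  have Ks: "subgroup ?K Gm" by (rule Fix_subgroup) blast
  then obtain a where a: "a \<in> ?K" "a \<noteq> \<one>\<^bsub>Gm\<^esub>" using nt subgroup.one_closed[OF Ks] by blast
  have ac: "a \<in> carrier Gm" using a Fix_carrier by blast
  obtain b where b: "b \<in> carrier Gm" "b \<noteq> \<one>\<^bsub>Gm\<^esub>"
    "\<And>g. g \<in> carrier Gm \<Longrightarrow> inv\<^bsub>Gm\<^esub> g \<cdot> b \<cdot> g \<in> ?L \<or>
      (inv\<^bsub>Gm\<^esub> g \<cdot> a \<cdot> g \<in> ?L \<and> inv\<^bsub>Gm\<^esub> (b \<cdot> g) \<cdot> a \<cdot> (b \<cdot> g) \<in> ?L)"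
    using ex_disjoint_support_pair[OF d a] by blast
  have L: "subgroup ?L Gm"
  proof (rule Gm.subgroupI)
    show "?L \<subseteq> carrier Gm" by (auto simp: end_fix_def)
    show "?L \<noteq> {}" using subgroup.one_closed[OF end_fix_subgroup[of d 0]] by blast
    show "inv\<^bsub>Gm\<^esub> x \<in> ?L" if "x \<in> ?L" for x using that subgroup.m_inv_closed[OF end_fix_subgroup] by blast
    show "x \<cdot> y \<in> ?L" if xy: "x \<in> ?L" "y \<in> ?L" for x y
    proof -
      obtain n m where "x \<in> end_fix d n" "y \<in> end_fix d m" using xy by blast
      then have "x \<in> end_fix d (max n m)" "y \<in> end_fix d (max n m)"
        using end_fix_mono[OF d, of n "max n m"] end_fix_mono[OF d, of m "max n m"] by auto
      then show ?thesis using subgroup.m_closed[OF end_fix_subgroup] by blast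
    qed
  qed
  obtain z where z: "z \<in> P.ker_quasi_regular ?L" "z \<noteq> (\<lambda>f x. 0)"
    using P.disjoint_support_kqr[OF L ac a(2) b] by blast
  obtain n where n: "\<not> amenable (Gm\<lparr>carrier := end_fix d n\<rparr>)"
    using P.Cstar_simple_not_amenable[OF simple end_fix_subgroup end_fix_mono[OF d] z] by blast
  have "amenable (Gm\<lparr>carrier := end_fix d n\<rparr>)"
    by (rule P.amenable_conj[OF _ subgroup.subset[OF Ks] subgroup.subset[OF end_fix_subgroup]
        end_fix_conj[OF d] am]) (use td_carrier in auto)
  then show False using n by simp
qed

lemma powers_nonamenable:
  assumes e: "e = 1 \<or> e = -1" and triv: "Fix (carrier Gm) = {\<one>\<^bsub>Gm\<^esub>}"
    and na: "\<not> amenable (Gm\<lparr>carrier := Fix (carrier Gm - A e)\<rparr>)"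
  shows "plain_group.powers Gm"
proof -
  interpret P: plain_group Gm by (rule plain_group_Gm)
  let ?K = "Fix (carrier Gm - A e)"
  have K: "subgroup ?K Gm" by (rule Fix_subgroup) blast
  have Kc: "s \<in> carrier Gm" if "s \<in> ?K" for s using that by (rule Fix_carrier)
  have "\<exists>S. S \<noteq> [] \<and> set S \<subseteq> carrier Gm \<and> (\<forall>t\<in>F. P.small \<epsilon> S t)"
    if "finite F" "F \<subseteq> carrier Gm - {\<one>\<^bsub>Gm\<^esub>}" "0 < \<epsilon>" for F \<epsilon>
    using that
  \<comment> \<open>On cardinalities and not on subsets, because the hypothesis is applied to
    conjugates of the remaining elements.\<close>
  proof (induction "card F" arbitrary: F rule: less_induct)
    case less
    show ?case
    proof (cases "F = {}")
      case True
      then show ?thesis by (intro exI[of _ "[\<one>\<^bsub>Gm\<^esub>]"]) simp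
    next
      case False
      then obtain s where s: "s \<in> F" "s \<noteq> \<one>\<^bsub>Gm\<^esub>" using less.prems by blast
      have Fc: "F \<subseteq> carrier Gm" using less.prems by blast
      obtain q where q: "q \<in> carrier Gm" "thin e (inv\<^bsub>Gm\<^esub> q \<cdot> s \<cdot> q)"
        "\<And>t. t \<in> F \<Longrightarrow> inv\<^bsub>Gm\<^esub> q \<cdot> t \<cdot> q \<in> Fix (A e) \<or> thin e (inv\<^bsub>Gm\<^esub> q \<cdot> t \<cdot> q)"
        using ex_Fix_or_thin_nontrivial[OF triv e less.prems(1) Fc s] by blast
      define c where "c = (\<lambda>t. inv\<^bsub>Gm\<^esub> q \<cdot> t \<cdot> q)"
      have cc: "c t \<in> carrier Gm" if "t \<in> F" for t using that Fc q by (auto simp: c_def)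
      define F2 where "F2 = {t \<in> F. thin e (c t)}"
      define F1 where "F1 = F - F2"
      have fixF1: "c t \<in> Fix (A e)" if "t \<in> F1" for t using that q(3)[of t] by (auto simp: F1_def F2_def c_def)
      have "s \<in> F2" using s q by (simp add: F2_def c_def)
      then have "card F1 < card F" using less.prems(1) s(1) unfolding F1_def
        by (intro psubset_card_mono) (auto simp: F2_def)
      moreover have "card (c ` F1) \<le> card F1" using less.prems(1) by (intro card_image_le) (simp add: F1_def)
      ultimately have cF: "card (c ` F1) < card F" by linarith
      have cne: "c t \<noteq> \<one>\<^bsub>Gm\<^esub>" if "t \<in> F" for t
      proof
        assume "c t = \<one>\<^bsub>Gm\<^esub>"
        have tc: "t \<in> carrier Gm" using that Fc by blast
        have "t = q \<cdot> c t \<cdot> inv\<^bsub>Gm\<^esub> q" using tc q(1) by (simp add: c_def Gm.m_assoc)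
        then have "t = \<one>\<^bsub>Gm\<^esub>" using \<open>c t = \<one>\<^bsub>Gm\<^esub>\<close> q(1) by simp
        then show False using that less.prems(2) by blast
      qed
      have "finite (c ` F1)" "c ` F1 \<subseteq> carrier Gm - {\<one>\<^bsub>Gm\<^esub>}"
        using less.prems(1) cc cne by (auto simp: F1_def)
      from less.hyps[OF cF this less.prems(3)] obtain S' where S': "S' \<noteq> []" "set S' \<subseteq> carrier Gm"
        "\<And>t. t \<in> F1 \<Longrightarrow> P.small \<epsilon> S' (c t)" by blast
      \<comment> \<open>A thin \<open>t\<close> maps \<open>A e\<close> into its complement, which
        \<open>?K\<close> fixes; hence the conjugates by \<open>t\<close> of elements of
        \<open>?K\<close> fix \<open>A e\<close>. They therefore commute with \<open>?K\<close>, and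
        only the trivial one lies in \<open>?K\<close>, which is what
        \<open>nonamenable_estimate\<close> asks for.\<close>
      have thin_fix: "inv\<^bsub>Gm\<^esub> t \<cdot> k \<cdot> t \<in> Fix (A e)" if "t \<in> c ` F2" "k \<in> ?K" for t k
      proof (rule Fix_mult_set[OF _ _ A_carrier _ that(2)])
        show tc: "t \<in> carrier Gm" using that cc by (auto simp: F2_def)
        show "k \<in> carrier Gm" using Kc that by blast
        show "t \<cdot> r \<in> carrier Gm - A e" if "r \<in> A e" for r
          using that \<open>t \<in> c ` F2\<close> tc subsetD[OF A_carrier that] by (auto simp: F2_def thin_def)
      qed
      have "\<exists>S. S \<noteq> [] \<and> set S \<subseteq> ?K \<and> (\<forall>t\<in>c ` F2. P.small \<epsilon> S t)"
      proof (rule P.nonamenable_estimate[OF K na _ _ _ less.prems(3)])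
        show "c ` F2 \<subseteq> carrier Gm" using cc by (auto simp: F2_def)
        show "(inv\<^bsub>Gm\<^esub> t \<cdot> k \<cdot> t) \<cdot> l = l \<cdot> (inv\<^bsub>Gm\<^esub> t \<cdot> k \<cdot> t)" if "t \<in> c ` F2" "k \<in> ?K" "l \<in> ?K" for t k l
          using Fix_commute[OF triv saturated_A that(3) thin_fix[OF that(1,2)]] by simp
        show "k = \<one>\<^bsub>Gm\<^esub>" if t: "t \<in> c ` F2" and k: "k \<in> ?K" and i: "inv\<^bsub>Gm\<^esub> t \<cdot> k \<cdot> t \<in> ?K" for t k
        proof -
          have tc: "t \<in> carrier Gm" using t cc by (auto simp: F2_def)
          have "inv\<^bsub>Gm\<^esub> t \<cdot> k \<cdot> t \<in> Fix (carrier Gm)"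
            using thin_fix[OF t k] i unfolding Fix_def by blast
          then have "inv\<^bsub>Gm\<^esub> t \<cdot> k \<cdot> t = \<one>\<^bsub>Gm\<^esub>" using triv by simp
          moreover have "k = t \<cdot> (inv\<^bsub>Gm\<^esub> t \<cdot> k \<cdot> t) \<cdot> inv\<^bsub>Gm\<^esub> t" using tc Kc[OF k] by (simp add: Gm.m_assoc)
          ultimately show ?thesis using tc by simp
        qed
      qed
      then obtain S where S: "S \<noteq> []" "set S \<subseteq> ?K" "\<And>t. t \<in> F2 \<Longrightarrow> P.small \<epsilon> S (c t)" by blast
      have Sc: "set S \<subseteq> carrier Gm" using S(2) Kc by blast
      \<comment> \<open>The inner list \<open>S\<close> acts first. It makes the thin elements small
        and leaves the others, which commute with it, to \<open>S'\<close>.\<close>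
      define R where "R = P.list_mult S' S"
      have Rc: "set R \<subseteq> carrier Gm" using Sc S'(2) by (auto simp: R_def P.list_mult_set)
      have R: "P.small \<epsilon> R (c t)" if t: "t \<in> F" for t
      proof (cases "t \<in> F2")
        case True
        show ?thesis unfolding R_def
          by (rule P.small_list_mult[OF _ Sc S'(2) cc[OF t] S(3)[OF True]]) (use less.prems in simp)
      next
        case False
        then have t1: "t \<in> F1" using t by (simp add: F1_def)
        show ?thesis unfolding R_def
        proof (rule P.small_list_mult_const[OF Sc S'(2) cc[OF t] cc[OF t] _ S'(3)[OF t1]])
          fix k assume "k \<in> set S"
          then have k: "k \<in> ?K" using S(2) by blast
          have "k \<cdot> c t = c t \<cdot> k" by (rule Fix_commute[OF triv saturated_A k fixF1[OF t1]])
          then show "k \<cdot> c t \<cdot> inv\<^bsub>Gm\<^esub> k = c t" using Kc[OF k] cc[OF t] by (simp add: Gm.m_assoc)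
        qed
      qed
      let ?R = "map (\<lambda>s. s \<cdot> inv\<^bsub>Gm\<^esub> q) R"
      have "?R \<noteq> []" using P.list_mult_ne[OF S'(1) S(1)] by (simp add: R_def)
      moreover have "set ?R \<subseteq> carrier Gm" using Rc q(1) by auto
      moreover have "P.small \<epsilon> ?R t" if "t \<in> F" for t
        by (rule P.small_conj[OF Rc _ q(1)]) (use R[OF that] that Fc in \<open>auto simp: c_def\<close>)
      ultimately show ?thesis by blast
    qed
  qed
  then show ?thesis unfolding P.powers_def by simp
qed

text \<open>The fixator of \<open>A 1\<close> is a conjugate of the trivial quasi-kernel. So all
  elements of \<open>F\<close> become thin for one common half-tree, and disjoint translates of its
  complement feed Powers' estimate.\<close>

lemma powers_trivial:
  assumes triv: "Fix (carrier Gm - A (-1)) = {\<one>\<^bsub>Gm\<^esub>}"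
  shows "plain_group.powers Gm"
proof -
  interpret P: plain_group Gm by (rule plain_group_Gm)
  have "\<one>\<^bsub>Gm\<^esub> \<in> Fix (carrier Gm)" using subgroup.one_closed[OF Fix_subgroup] by blast
  moreover have "Fix (carrier Gm) \<subseteq> Fix (carrier Gm - A (-1))" by (rule Fix_anti) blast
  ultimately have triv': "Fix (carrier Gm) = {\<one>\<^bsub>Gm\<^esub>}" using triv by blast
  have Fix1: "x = \<one>\<^bsub>Gm\<^esub>" if "x \<in> Fix (A 1)" for x
  proof -
    have xc: "x \<in> carrier Gm" using that by (rule Fix_carrier)
    have "inv\<^bsub>Gm\<^esub> (td 1) \<cdot> x \<cdot> td 1 = \<one>\<^bsub>Gm\<^esub>" using Fix_A_conj[of 1 x] that xc triv by simp
    moreover have "x = td 1 \<cdot> (inv\<^bsub>Gm\<^esub> (td 1) \<cdot> x \<cdot> td 1) \<cdot> inv\<^bsub>Gm\<^esub> (td 1)"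
      using xc td_carrier by (simp add: Gm.m_assoc)
    ultimately show ?thesis using td_carrier by simp
  qed
  obtain Y :: "nat \<Rightarrow> 'b" where Y': "range Y \<subseteq> carrier Gm"
    "\<forall>i j y. i \<noteq> j \<longrightarrow> y \<in> A (-1) \<longrightarrow> inv\<^bsub>Gm\<^esub> (Y i) \<cdot> (Y j \<cdot> y) \<notin> A (-1)"
    using ex_disjoint_translates[of "-1"] by blast
  have Y: "Y j \<in> carrier Gm" "i \<noteq> j \<Longrightarrow> y \<in> A (-1) \<Longrightarrow> inv\<^bsub>Gm\<^esub> (Y i) \<cdot> (Y j \<cdot> y) \<notin> A (-1)" for i j y
    using Y' by auto
  have "\<exists>S. S \<noteq> [] \<and> set S \<subseteq> carrier Gm \<and> (\<forall>t\<in>F. P.small \<epsilon> S t)"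
    if F: "finite F" "F \<subseteq> carrier Gm - {\<one>\<^bsub>Gm\<^esub>}" and \<epsilon>: "0 < \<epsilon>" for F \<epsilon>
  proof (cases "F = {}")
    case True
    then show ?thesis by (intro exI[of _ "[\<one>\<^bsub>Gm\<^esub>]"]) simp
  next
    case False
    then obtain s where s: "s \<in> F" "s \<noteq> \<one>\<^bsub>Gm\<^esub>" using F by blast
    have Fc: "F \<subseteq> carrier Gm" using F by blast
    obtain q where q: "q \<in> carrier Gm"
      "\<And>t. t \<in> F \<Longrightarrow> inv\<^bsub>Gm\<^esub> q \<cdot> t \<cdot> q \<in> Fix (A 1) \<or> thin 1 (inv\<^bsub>Gm\<^esub> q \<cdot> t \<cdot> q)"
      using ex_Fix_or_thin_nontrivial[OF triv' _ F(1) Fc s, of 1] by auto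
    have thin: "thin 1 (inv\<^bsub>Gm\<^esub> q \<cdot> t \<cdot> q)" if t: "t \<in> F" for t
    proof (rule ccontr)
      assume "\<not> thin 1 (inv\<^bsub>Gm\<^esub> q \<cdot> t \<cdot> q)"
      then have "inv\<^bsub>Gm\<^esub> q \<cdot> t \<cdot> q = \<one>\<^bsub>Gm\<^esub>" using q(2)[OF t] Fix1 by blast
      moreover have "t = q \<cdot> (inv\<^bsub>Gm\<^esub> q \<cdot> t \<cdot> q) \<cdot> inv\<^bsub>Gm\<^esub> q"
        using subsetD[OF Fc t] q(1) by (simp add: Gm.m_assoc)
      ultimately have "t = \<one>\<^bsub>Gm\<^esub>" using q(1) by simp
      then show False using t F by blast
    qed
    \<comment> \<open>Makes the bound 2 / sqrt N of \<open>powers_estimate\<close> at most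
      \<epsilon>.\<close>
    obtain N :: nat where N: "(2 / \<epsilon>)\<^sup>2 < N" using reals_Archimedean2 by blast
    have N0: "0 < N" using N by (cases N) auto
    have "2 / \<epsilon> \<le> sqrt N" using N \<epsilon> by (intro real_le_rsqrt) simp
    then have Ne: "2 / sqrt N \<le> \<epsilon>" using \<epsilon> N0 by (simp add: field_simps)
    \<comment> \<open>The inverse of \<open>td 1\<close> maps the complement of \<open>A 1\<close>
      onto \<open>A (-1)\<close>, so \<open>w j\<close> takes this complement to the translate of
      \<open>A (-1)\<close> by \<open>Y j\<close>; these translates are disjoint.\<close>
    define w where "w = (\<lambda>j. Y j \<cdot> inv\<^bsub>Gm\<^esub> (td 1))"
    have w: "w j \<in> carrier Gm" for j using Y td_carrier by (simp add: w_def)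
    have small: "P.small (2 / sqrt N) (map w [0..<N]) (inv\<^bsub>Gm\<^esub> q \<cdot> t \<cdot> q)" if t: "t \<in> F" for t
    proof (rule P.powers_estimate[OF w _ _ _ N0, where C = "A 1"])
      show "inv\<^bsub>Gm\<^esub> q \<cdot> t \<cdot> q \<in> carrier Gm" using subsetD[OF Fc t] q(1) by simp
      show "inv\<^bsub>Gm\<^esub> q \<cdot> t \<cdot> q \<cdot> y \<notin> A 1" if "y \<in> A 1" for y using thin[OF t] that by (simp add: thin_def)
      fix i j :: nat and x assume ij: "i \<noteq> j" and x: "x \<in> carrier Gm"
      have eq: "inv\<^bsub>Gm\<^esub> (w k) \<cdot> x = td 1 \<cdot> (inv\<^bsub>Gm\<^esub> (Y k) \<cdot> x)" for k
        using x Y td_carrier by (simp add: w_def Gm.inv_mult_group Gm.m_assoc)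
      have iff: "inv\<^bsub>Gm\<^esub> (w k) \<cdot> x \<in> A 1 \<longleftrightarrow> inv\<^bsub>Gm\<^esub> (Y k) \<cdot> x \<notin> A (-1)" for k
        unfolding eq using td_A[of 1 "inv\<^bsub>Gm\<^esub> (Y k) \<cdot> x"] x Y by simp
      have "inv\<^bsub>Gm\<^esub> (Y i) \<cdot> x \<notin> A (-1)" if "inv\<^bsub>Gm\<^esub> (Y j) \<cdot> x \<in> A (-1)"
        using Y(2)[OF ij that] x Y(1) by simp
      then show "inv\<^bsub>Gm\<^esub> (w i) \<cdot> x \<in> A 1 \<or> inv\<^bsub>Gm\<^esub> (w j) \<cdot> x \<in> A 1" using iff by blast
    qed
    have Wc: "set (map w [0..<N]) \<subseteq> carrier Gm" using w by auto
    let ?R = "map (\<lambda>s. s \<cdot> inv\<^bsub>Gm\<^esub> q) (map w [0..<N])"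
    have "?R \<noteq> []" using N0 by simp
    moreover have "set ?R \<subseteq> carrier Gm" using w q(1) by auto
    moreover have "P.small \<epsilon> ?R t" if t: "t \<in> F" for t
      by (rule P.small_conj[OF Wc subsetD[OF Fc t] q(1) P.small_mono[OF small[OF t] Ne]])
    ultimately show ?thesis by blast
  qed
  then show ?thesis unfolding P.powers_def by simp
qed

end

theorem mainTheorem18:
  fixes G :: "'a monoid" and H :: "'a set" and \<theta> :: "'a \<Rightarrow> 'a"
    and Sm1 S1 :: "'a set"
    and Gm :: "'b monoid" and \<iota> :: "'a \<Rightarrow> 'b" and \<tau> :: 'b
  assumes "group G" and "subgroup H G"
    and "\<theta> \<in> hom (G\<lparr>carrier := H\<rparr>) G" and "inj_on \<theta> H"
    and "H \<noteq> carrier G" and "\<theta> ` H \<noteq> carrier G"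
    and "is_HNN G H \<theta> Gm \<iota> \<tau>"
    and "left_coset_reps G H Sm1" and "left_coset_reps G (\<theta> ` H) S1"
  shows "(HNN_kernel Gm \<iota> H = {\<one>\<^bsub>Gm\<^esub>} \<longrightarrow>
            (Cstar_simple Gm \<longleftrightarrow>
              (quasi_kernel G H Sm1 S1 Gm \<iota> \<tau> (-1) = {\<one>\<^bsub>Gm\<^esub>} \<or>
                 \<not> amenable (Gm\<lparr>carrier := quasi_kernel G H Sm1 S1 Gm \<iota> \<tau> (-1)\<rparr>)) \<and>
              (quasi_kernel G H Sm1 S1 Gm \<iota> \<tau> 1 = {\<one>\<^bsub>Gm\<^esub>} \<or>
                 \<not> amenable (Gm\<lparr>carrier := quasi_kernel G H Sm1 S1 Gm \<iota> \<tau> 1\<rparr>))))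
       \<and> (amenable (Gm\<lparr>carrier := quasi_kernel G H Sm1 S1 Gm \<iota> \<tau> (-1)\<rparr>) \<and>
          amenable (Gm\<lparr>carrier := quasi_kernel G H Sm1 S1 Gm \<iota> \<tau> 1\<rparr>) \<longrightarrow>
            (Cstar_simple Gm \<longleftrightarrow>
              quasi_kernel G H Sm1 S1 Gm \<iota> \<tau> (-1) = {\<one>\<^bsub>Gm\<^esub>} \<and>
              quasi_kernel G H Sm1 S1 Gm \<iota> \<tau> 1 = {\<one>\<^bsub>Gm\<^esub>}))"
proof -
  have grp: "group Gm" using assms(7) by (simp add: is_HNN_def)
  interpret N: non_ascending_hnn G Gm H \<theta> Sm1 S1 \<iota> \<tau>
    using assms grp
    by (simp add: non_ascending_hnn_def non_ascending_hnn_axioms_def hnn_def hnn_axioms_def)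
  let ?K = "\<lambda>e. quasi_kernel G H Sm1 S1 Gm \<iota> \<tau> e"
  have K: "?K e = N.Fix (carrier Gm - N.A e)" for e by (rule N.quasi_kernel_Fix)
  \<comment> \<open>The sign flips in the instantiation because the quasi-kernel of type
    \<open>e\<close> is treated with the end in direction \<open>-e\<close>.\<close>
  have ns: "?K e = {\<one>\<^bsub>Gm\<^esub>} \<or> \<not> amenable (Gm\<lparr>carrier := ?K e\<rparr>)"
    if "Cstar_simple Gm" "e = 1 \<or> e = -1" for e
    using N.amenable_quasi_kernel_not_simple[of "-e"] that unfolding K by auto
  have simple_triv: "Cstar_simple Gm" if "?K (-1) = {\<one>\<^bsub>Gm\<^esub>}"
    using plain_group.powers_imp_Cstar_simple[OF N.plain_group_Gm N.powers_trivial] that unfolding K by simp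
  have simple_na: "Cstar_simple Gm"
    if "HNN_kernel Gm \<iota> H = {\<one>\<^bsub>Gm\<^esub>}" "\<not> amenable (Gm\<lparr>carrier := ?K e\<rparr>)" "e = 1 \<or> e = -1" for e
    using plain_group.powers_imp_Cstar_simple[OF N.plain_group_Gm N.powers_nonamenable[of e]] that
    unfolding K N.HNN_kernel_Fix by blast
  show ?thesis using ns[of 1] ns[of "-1"] simple_triv simple_na[of "-1"] by blast
qed

end
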